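(* Let $s>\frac12$. Then there exist $\delta>0$ and $C>0$ such that $$\|\partial_x(uv)\|_{X^{s,-\frac12+2\delta}}\le C\,\|u\|_{X^{s,\frac12+\delta}}\|v\|_{X^{s,\frac12+\delta}}$$ for all $u,v:\mathbb R^3\to\mathbb R$ such that $u,v\in X^{s,\frac12+\delta}$.
   Context: Functions depend on $(x,y,t)\in\mathbb R^3$ with dual Fourier variables $(\xi,\mu,\tau)$. $|(\xi,\mu)|=\sqrt{3\xi^2+\mu^2}$, $\langle x\rangle=1+|x|$, $w(\xi,\mu)=\xi^3+\xi\mu^2$. For $s,b\in\mathbb R$, $X^{s,b}$ is the completion of the Schwartz space $\mathcal S(\mathbb R^3)$ under $$\|u\|_{X^{s,b}}=\Big(\int_{\mathbb R^3}\langle\tau-w(\xi,\mu)\rangle^{2b}\langle|(\xi,\mu)|\rangle^{2s}|\widehat u(\xi,\mu,\tau)|^2\,d\xi\,d\mu\,d\tau\Big)^{1/2},$$ where $\widehat u$ is the space-time Fourier transform. *)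

theory Defs
  imports "HOL-Analysis.Analysis"
begin

text \<open>Points \<open>(x, y, t)\<close> and frequencies \<open>(\<xi>, \<mu>, \<tau>)\<close>.\<close>

type_synonym R3 = "real \<times> real \<times> real"

definition dir_deriv :: "R3 \<Rightarrow> (R3 \<Rightarrow> complex) \<Rightarrow> R3 \<Rightarrow> complex" where
  "dir_deriv e f = (\<lambda>p. frechet_derivative f (at p) e)"

text \<open>
  \<open>foldr dir_deriv es f\<close> is the iterated partial derivative of \<open>f\<close> in the coordinate
  directions \<open>es\<close>. Differentiability of all of them is smoothness.
\<close>

definition schwartz :: "(R3 \<Rightarrow> complex) \<Rightarrow> bool" where
  "schwartz f \<longleftrightarrow>
     (\<forall>es. set es \<subseteq> Basis \<longrightarrow>
        (\<forall>p. foldr dir_deriv es f differentiable at p) \<and>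
        (\<forall>N::nat. \<exists>B. \<forall>p. norm p ^ N * cmod (foldr dir_deriv es f p) \<le> B))"

definition fourier :: "(R3 \<Rightarrow> complex) \<Rightarrow> R3 \<Rightarrow> complex" where
  "fourier f \<zeta> = (LINT p|lborel. exp (- \<i> * complex_of_real (p \<bullet> \<zeta>)) * f p)"

definition jbr :: "real \<Rightarrow> real" where
  "jbr x = 1 + \<bar>x\<bar>"

definition freq_norm :: "real \<Rightarrow> real \<Rightarrow> real" where
  "freq_norm \<xi> \<mu> = sqrt (3 * \<xi>\<^sup>2 + \<mu>\<^sup>2)"

definition w :: "real \<Rightarrow> real \<Rightarrow> real" where
  "w \<xi> \<mu> = \<xi> ^ 3 + \<xi> * \<mu>\<^sup>2"

text \<open>The Bourgain norm of a Schwartz function.\<close>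

definition schwartz_X_norm :: "real \<Rightarrow> real \<Rightarrow> (R3 \<Rightarrow> complex) \<Rightarrow> real" where
  "schwartz_X_norm s b f =
     sqrt (LINT (\<xi>, \<mu>, \<tau>)|lborel.
             jbr (\<tau> - w \<xi> \<mu>) powr (2 * b) * jbr (freq_norm \<xi> \<mu>) powr (2 * s)
               * (cmod (fourier f (\<xi>, \<mu>, \<tau>)))\<^sup>2)"

text \<open>
  Distributions are represented as functionals on test functions; only their values on
  Schwartz functions matter.

  The completion of the Schwartz space is realised inside the tempered distributions.
  The weights are bounded above and below by powers of \<open>1 + norm \<zeta>\<close>, so every sequence of
  Schwartz functions that is Cauchy in the norm converges in the sense of tempered
  distributions, and two such sequences have the same limit iff the norm of their difference
  tends to zero. So an element of the completion, i.e. a class of Cauchy sequences,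
  is the same thing as the distributional limit of its representatives.
\<close>

type_synonym distr = "(R3 \<Rightarrow> complex) \<Rightarrow> complex"

definition distr_of :: "(R3 \<Rightarrow> complex) \<Rightarrow> distr" where
  "distr_of f \<psi> = (LINT p|lebesgue. f p * \<psi> p)"

definition distr_dx :: "distr \<Rightarrow> distr" where
  "distr_dx T \<psi> = - T (dir_deriv (1, 0, 0) \<psi>)"

definition X_approx :: "real \<Rightarrow> real \<Rightarrow> (nat \<Rightarrow> R3 \<Rightarrow> complex) \<Rightarrow> distr \<Rightarrow> bool" where
  "X_approx s b \<phi> T \<longleftrightarrow>
     (\<forall>n. schwartz (\<phi> n)) \<and>
     (\<forall>\<epsilon>>0. \<exists>N. \<forall>m\<ge>N. \<forall>n\<ge>N. schwartz_X_norm s b (\<lambda>p. \<phi> m p - \<phi> n p) < \<epsilon>) \<and>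
     (\<forall>\<psi>. schwartz \<psi> \<longrightarrow> (\<lambda>n. distr_of (\<phi> n) \<psi>) \<longlonglongrightarrow> T \<psi>)"

definition X_space :: "real \<Rightarrow> real \<Rightarrow> distr set" where
  "X_space s b = {T. \<exists>\<phi>. X_approx s b \<phi> T}"

definition X_norm :: "real \<Rightarrow> real \<Rightarrow> distr \<Rightarrow> real" where
  "X_norm s b T =
     (THE r. \<exists>\<phi>. X_approx s b \<phi> T \<and> (\<lambda>n. schwartz_X_norm s b (\<phi> n)) \<longlonglongrightarrow> r)"

text \<open>
  Functions defining a distribution. Testing with a Gaussian shows that such a function is
  Lebesgue measurable and locally integrable.
\<close>

definition distr_function :: "(R3 \<Rightarrow> complex) \<Rightarrow> bool" where
  "distr_function f \<longleftrightarrow> (\<forall>\<psi>. schwartz \<psi> \<longrightarrow> integrable lebesgue (\<lambda>p. f p * \<psi> p))"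

definition X_functions :: "real \<Rightarrow> real \<Rightarrow> (R3 \<Rightarrow> complex) set" where
  "X_functions s b = {f. distr_function f \<and> distr_of f \<in> X_space s b}"

end

theory Submission
  imports Defs "HOL-Probability.Probability"
begin

text \<open>
  The estimate on Schwartz functions is dual to a trilinear one, which by Cauchy--Schwarz reduces to bounds,
  uniform in a fixed output or input frequency, on integrals of weights over the level sets of the phase of the
  interaction. When one input dominates the other, the group velocities of the two waves are transversal,
  which gains the missing derivative. When all three frequencies are comparable to \<open>N\<close>, the phase is a quadratic
  form of determinant \<^term>\<open>3 * \<xi>\<^sup>2 - \<mu>\<^sup>2\<close> in the free frequency: either this determinant is of size \<open>N\<^sup>2\<close>
  for one of the three frequencies, which can then be taken as the fixed one, or all of them lie near the cone where
  it vanishes. In the latter case the resonance function is of size \<open>N\<^sup>3\<close>, so one of the modulations is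
  large. The general case follows by density, since for nonnegative exponents convergence in the Bourgain norm
  implies convergence in \<open>L\<^sup>2\<close>, so that products of approximating sequences converge in \<open>L\<^sup>1\<close>.
\<close>

text \<open>The square of the derivative costs N^2 and a phase integral over the plane gains about 1
  / N, so a Sobolev weight N^(-2 s) with 2 s slightly above 1 is just enough and every further loss
  is paid by \<delta>. The modulation exponents enter as \<open>\<beta>\<close> = 1 + 2 \<delta> for
  the inputs and \<open>\<gamma>\<close> = 1 - 4 \<delta> for the output. With the output fixed, the
  two input brackets combine to the integrable exponent \<open>\<beta>\<close>. With an input fixed,
  the surviving bracket has exponent \<open>\<gamma>\<close> < 1, which is not integrable across
  level sets; up to the height N^3 it is raised to \<open>\<beta>\<close> at the cost N^(3 (\<beta>
  - \<gamma>)) = N^(18 \<delta>), and beyond that height the area of the frequency box suffices. The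
  nondegenerate quadratic form carries a logarithm, absorbed in N^(3 \<delta>). Hence the condition
  1 + 21 \<delta> <= 2 s. With one input low, nothing is lost in N: transversality pays for the
  derivative, and the remaining integral of (1 + |\<mu>|)^(-2 s) over a line converges because 2 s >
  1.\<close>

section \<open>Tonelli, translation and reflection for Lebesgue measure\<close>

lemma nn_integral_lborel_prod:
  fixes f :: "'a::euclidean_space \<times> 'b::euclidean_space \<Rightarrow> ennreal"
  assumes [measurable]: "f \<in> borel_measurable borel"
  shows "(\<integral>\<^sup>+z. f z \<partial>lborel) = (\<integral>\<^sup>+x. \<integral>\<^sup>+y. f (x, y) \<partial>lborel \<partial>lborel)"
proof -
  have "f \<in> borel_measurable (lborel \<Otimes>\<^sub>M lborel)"
    unfolding lborel_prod by simp
  from lborel.nn_integral_fst[OF this] show ?thesis by (simp add: lborel_prod)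
qed

lemma nn_integral_lborel_prod_swap:
  fixes f :: "'a::euclidean_space \<times> 'b::euclidean_space \<Rightarrow> ennreal"
  assumes [measurable]: "f \<in> borel_measurable borel"
  shows "(\<integral>\<^sup>+z. f z \<partial>lborel) = (\<integral>\<^sup>+y. \<integral>\<^sup>+x. f (x, y) \<partial>lborel \<partial>lborel)"
proof -
  have "f \<in> borel_measurable (lborel \<Otimes>\<^sub>M lborel)"
    unfolding lborel_prod by simp
  from lborel_pair.nn_integral_snd[OF this] show ?thesis
    by (simp add: lborel_prod)
qed

lemma nn_integral_lborel_shift:
  fixes f :: "'a::euclidean_space \<Rightarrow> ennreal"
  assumes [measurable]: "f \<in> borel_measurable borel"
  shows "(\<integral>\<^sup>+x. f (c + x) \<partial>lborel) = (\<integral>\<^sup>+x. f x \<partial>lborel)"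
proof -
  have "(\<integral>\<^sup>+x. f x \<partial>lborel) = (\<integral>\<^sup>+x. f x \<partial>(distr lborel borel ((+) c)))"
    by (simp only: lborel_distr_plus)
  also have "\<dots> = (\<integral>\<^sup>+x. f (c + x) \<partial>lborel)"
    by (simp add: nn_integral_distr)
  finally show ?thesis by simp
qed

lemma nn_integral_lborel_reflect:
  fixes f :: "'a::euclidean_space \<Rightarrow> ennreal"
  assumes [measurable]: "f \<in> borel_measurable borel"
  shows "(\<integral>\<^sup>+x. f (c - x) \<partial>lborel) = (\<integral>\<^sup>+x. f x \<partial>lborel)"
proof -
  have "(\<integral>\<^sup>+x. f x \<partial>lborel) = (\<integral>\<^sup>+x. f x \<partial>(density (distr lborel borel (\<lambda>x. c + (-1) *\<^sub>R x)) (\<lambda>_. \<bar>-1::real\<bar>^DIM('a))))"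
    by (subst lborel_affine[of "-1" c]) simp_all
  also have "\<dots> = (\<integral>\<^sup>+x. f (c - x) \<partial>lborel)"
    by (simp add: nn_integral_density nn_integral_distr)
  finally show ?thesis by simp
qed

section \<open>Integrals of brackets\<close>

lemma jbr_ge_1: "jbr x \<ge> 1" and jbr_pos: "jbr x > 0" and jbr_nonneg: "jbr x \<ge> 0"
  and jbr_minus: "jbr (- x) = jbr x"
  and jbr_neq_0: "jbr x \<noteq> 0"
  by (auto simp: jbr_def)

lemma jbr_continuous [continuous_intros]: "continuous_on A f \<Longrightarrow> continuous_on A (\<lambda>x. jbr (f x))"
  unfolding jbr_def by (intro continuous_intros)

lemma jbr_measurable [measurable]: "jbr \<in> borel_measurable borel"
  by (intro borel_measurable_continuous_onI continuous_intros)

text \<open>\<open>enn2real\<close> sends a divergent integral to 0, so the value carries meaning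
  for \<open>\<beta>\<close> > 1, where \<open>nn_integral_jbr\<close> recovers the integral
  itself.\<close>

definition jint :: "real \<Rightarrow> real" where
  "jint \<beta> = enn2real (\<integral>\<^sup>+u. ennreal (jbr u powr (-\<beta>)) \<partial>lborel)"

lemma jint_nonneg: "jint \<beta> \<ge> 0" by (simp add: jint_def)

lemma nn_integral_jbr:
  assumes "\<beta> > 1"
  shows "(\<integral>\<^sup>+u. ennreal (jbr u powr (-\<beta>)) \<partial>lborel) = ennreal (jint \<beta>)"
proof -
  have half: "(\<integral>\<^sup>+u. ennreal (jbr u powr (-\<beta>)) * indicator {0..} u \<partial>lborel) < \<infinity>"
  proof -
    have "(\<integral>\<^sup>+u. ennreal (jbr u powr (-\<beta>)) * indicator {0..} u \<partial>lborel)
        = (\<integral>\<^sup>+u. ennreal ((1 + u) powr (-\<beta>)) * indicator {0..} u \<partial>lborel)"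
      by (intro nn_integral_cong) (auto simp: jbr_def split: split_indicator)
    also have "\<dots> = ennreal (0 - (1 + 0) powr (1 - \<beta>) / (1 - \<beta>))"
    proof (rule nn_integral_FTC_atLeast)
      show "(\<lambda>u. (1 + u) powr (-\<beta>)) \<in> borel_measurable borel" by measurable
      show "((\<lambda>x. (1 + x) powr (1 - \<beta>) / (1 - \<beta>)) has_real_derivative (1 + x) powr (- \<beta>)) (at x)"
        if "0 \<le> x" for x
        using assms that by (auto intro!: derivative_eq_intros)
      show "((\<lambda>x. (1 + x) powr (1 - \<beta>) / (1 - \<beta>)) \<longlongrightarrow> 0) at_top"
      proof -
        have "((\<lambda>x. (1 + x) powr (1 - \<beta>)) \<longlongrightarrow> 0) at_top"
          using assms by (intro tendsto_neg_powr filterlim_tendsto_add_at_top[OF tendsto_const filterlim_ident]) auto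
        from tendsto_divide[OF this tendsto_const[of "1 - \<beta>"]] show ?thesis using assms by simp
      qed
    qed simp
    finally show ?thesis by simp
  qed
  have m: "(\<integral>\<^sup>+u. ennreal (jbr u powr (-\<beta>)) * indicator {..0} u \<partial>lborel)
         = (\<integral>\<^sup>+u. ennreal (jbr u powr (-\<beta>)) * indicator {0..} u \<partial>lborel)"
  proof -
    have "(\<integral>\<^sup>+u. ennreal (jbr u powr (-\<beta>)) * indicator {..0} u \<partial>lborel)
       = (\<integral>\<^sup>+u. ennreal (jbr (0 - u) powr (-\<beta>)) * indicator {..0} (0 - u) \<partial>lborel)"
      by (subst nn_integral_lborel_reflect[where c = 0 and f = "\<lambda>u. ennreal (jbr u powr (-\<beta>)) * indicator {..0} u"]) simp_all
    also have "\<dots> = (\<integral>\<^sup>+u. ennreal (jbr u powr (-\<beta>)) * indicator {0..} u \<partial>lborel)"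
      by (intro nn_integral_cong) (auto simp: jbr_minus split: split_indicator)
    finally show ?thesis .
  qed
  have "(\<integral>\<^sup>+u. ennreal (jbr u powr (-\<beta>)) \<partial>lborel)
     \<le> (\<integral>\<^sup>+u. ennreal (jbr u powr (-\<beta>)) * indicator {0..} u + ennreal (jbr u powr (-\<beta>)) * indicator {..0} u \<partial>lborel)"
    by (intro nn_integral_mono) (auto split: split_indicator)
  also have "\<dots> = (\<integral>\<^sup>+u. ennreal (jbr u powr (-\<beta>)) * indicator {0..} u \<partial>lborel) + (\<integral>\<^sup>+u. ennreal (jbr u powr (-\<beta>)) * indicator {..0} u \<partial>lborel)"
    by (rule nn_integral_add) auto
  also have "\<dots> < \<infinity>" using half by (simp add: m)
  finally show ?thesis by (simp add: jint_def less_top)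
qed

section \<open>Level-set integrals of quadratic polynomials in one variable\<close>

text \<open>On this set the polynomial increases with slope at least \<open>D\<close>, so taking its
  value as the new variable costs a factor 1 / \<open>D\<close> and leaves at most the full bracket
  integral. The cutoff by \<open>R\<close> makes the set compact and the affine slope makes it
  convex; it is therefore a closed interval, to which the substitution rule applies, and the bound
  is uniform in \<open>R\<close>.\<close>

lemma quadratic_substitution_half:
  assumes "\<beta> > 1" "D > 0"
  shows "(\<integral>\<^sup>+x. ennreal (jbr (a * x\<^sup>2 + b * x + c) powr (-\<beta>)) * indicator {x. \<bar>x\<bar> \<le> R \<and> D \<le> 2 * a * x + b} x \<partial>lborel)
     \<le> ennreal (jint \<beta> / D)"
proof -
  define S where "S = {x. \<bar>x\<bar> \<le> R \<and> D \<le> 2 * a * x + b}"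
  define g where "g x = a * x\<^sup>2 + b * x + c" for x
  have eq: "S = {-R..R} \<inter> {x. D \<le> 2 * a * x + b}" by (auto simp: S_def abs_le_iff)
  have "compact S" unfolding eq
    by (intro compact_Int_closed closed_Collect_le continuous_intros) auto
  moreover have "convex S"
  proof -
    have "{x. D \<le> 2 * a * x + b} = {x. inner (2 * a) x \<ge> D - b}" by (auto simp: algebra_simps)
    then show ?thesis unfolding eq by (metis convex_Int convex_real_interval(5) convex_halfspace_ge)
  qed
  ultimately obtain l u where S: "S = {l..u}"
    using connected_compact_interval_1 convex_connected by blast
  show ?thesis
  proof (cases "l < u")
    case False
    then have "S \<subseteq> {l}" unfolding S by auto
    then have "emeasure lborel S = 0" 
      by (metis emeasure_lborel_singleton emeasure_mono le_zero_eq sets_lborel borel_singleton sets.empty_sets insert_absorb)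
    then have "(\<integral>\<^sup>+x. ennreal (jbr (g x) powr (-\<beta>)) * indicator S x \<partial>lborel) = 0"
      by (intro nn_integral_null_set) (auto simp: S null_sets_def)
    then show ?thesis by (simp add: S_def g_def)
  next
    case True
    have "ennreal D * (\<integral>\<^sup>+x. ennreal (jbr (g x) powr (-\<beta>)) * indicator S x \<partial>lborel)
        = (\<integral>\<^sup>+x. ennreal D * (ennreal (jbr (g x) powr (-\<beta>)) * indicator S x) \<partial>lborel)"
      by (rule nn_integral_cmult[symmetric]) (auto simp: S g_def)
    also have "\<dots> \<le> (\<integral>\<^sup>+x. ennreal (jbr (g x) powr (-\<beta>)) * (2 * a * x + b) * indicator {l..u} x \<partial>lborel)"
    proof (intro nn_integral_mono)
      fix x
      show "ennreal D * (ennreal (jbr (g x) powr (-\<beta>)) * indicator S x)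
        \<le> ennreal (jbr (g x) powr (-\<beta>)) * (2 * a * x + b) * indicator {l..u} x"
      proof (cases "x \<in> S")
        case True
        then have "ennreal D \<le> ennreal (2 * a * x + b)" by (intro ennreal_leI) (simp add: S_def)
        then have "ennreal (jbr (g x) powr (-\<beta>)) * ennreal D \<le> ennreal (jbr (g x) powr (-\<beta>)) * ennreal (2 * a * x + b)"
          by (rule mult_left_mono) simp
        with True show ?thesis by (simp add: S[symmetric] mult.commute)
      qed simp
    qed
    also have "\<dots> = (\<integral>\<^sup>+x. ennreal (jbr x powr (-\<beta>)) * indicator {g l..g u} x \<partial>lborel)"
      using assms(2)
      by (intro nn_integral_substitution_aux[where f = "\<lambda>x. ennreal (jbr x powr (-\<beta>))", symmetric] True)
         (auto simp: g_def S[symmetric] S_def intro!: derivative_eq_intros continuous_intros)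
    also have "\<dots> \<le> (\<integral>\<^sup>+x. ennreal (jbr x powr (-\<beta>)) \<partial>lborel)"
      by (intro nn_integral_mono) (auto split: split_indicator)
    also have "\<dots> = ennreal D * ennreal (jint \<beta> / D)"
      using assms by (simp add: nn_integral_jbr ennreal_mult'[symmetric])
    finally show ?thesis using assms unfolding S_def g_def
      by (simp add: ennreal_mult_le_mult_iff)
  qed
qed

text \<open>Negative slopes reduce to positive ones by changing the sign of the polynomial, since
  the bracket is even; this doubles the constant.\<close>

lemma quadratic_substitution:
  assumes "\<beta> > 1" "D > 0"
  shows "(\<integral>\<^sup>+x. ennreal (jbr (a * x\<^sup>2 + b * x + c) powr (-\<beta>)) * indicator {x. \<bar>x\<bar> \<le> R \<and> D \<le> \<bar>2 * a * x + b\<bar>} x \<partial>lborel)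
     \<le> ennreal (2 * jint \<beta> / D)"
proof -
  have *: "jbr (- a * x\<^sup>2 + - b * x + - c) = jbr (a * x\<^sup>2 + b * x + c)" for x
    by (simp add: jbr_def)
  have "(\<integral>\<^sup>+x. ennreal (jbr (a * x\<^sup>2 + b * x + c) powr (-\<beta>)) * indicator {x. \<bar>x\<bar> \<le> R \<and> D \<le> \<bar>2 * a * x + b\<bar>} x \<partial>lborel)
    \<le> (\<integral>\<^sup>+x. ennreal (jbr (a * x\<^sup>2 + b * x + c) powr (-\<beta>)) * indicator {x. \<bar>x\<bar> \<le> R \<and> D \<le> 2 * a * x + b} x
       + ennreal (jbr (- a * x\<^sup>2 + - b * x + - c) powr (-\<beta>)) * indicator {x. \<bar>x\<bar> \<le> R \<and> D \<le> 2 * (- a) * x + (- b)} x \<partial>lborel)"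
    unfolding * by (intro nn_integral_mono) (auto split: split_indicator)
  also have "\<dots> = (\<integral>\<^sup>+x. ennreal (jbr (a * x\<^sup>2 + b * x + c) powr (-\<beta>)) * indicator {x. \<bar>x\<bar> \<le> R \<and> D \<le> 2 * a * x + b} x \<partial>lborel)
      + (\<integral>\<^sup>+x. ennreal (jbr (- a * x\<^sup>2 + - b * x + - c) powr (-\<beta>)) * indicator {x. \<bar>x\<bar> \<le> R \<and> D \<le> 2 * (- a) * x + (- b)} x \<partial>lborel)"
    by (rule nn_integral_add) measurable
  also have "\<dots> \<le> ennreal (jint \<beta> / D) + ennreal (jint \<beta> / D)"
    by (intro add_mono quadratic_substitution_half assms)
  also have "\<dots> = ennreal (2 * jint \<beta> / D)"
    using assms by (subst ennreal_plus[symmetric]) (auto simp: jint_nonneg)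
  finally show ?thesis .
qed

lemma nn_integral_abs_powr:
  assumes "0 < \<theta>" "R \<ge> 0"
  shows "(\<integral>\<^sup>+x. ennreal (\<bar>x - c\<bar> powr (\<theta> - 1)) * indicator {x. \<bar>x - c\<bar> \<le> R} x \<partial>lborel) = ennreal (2 * R powr \<theta> / \<theta>)"
proof -
  have 1: "(\<integral>\<^sup>+x. ennreal (x powr (\<theta> - 1)) * indicator {0..R} x \<partial>lborel) = ennreal (R powr \<theta> / \<theta>)"
  proof -
    have "((\<lambda>x. x powr (\<theta> - 1)) has_integral R powr (\<theta> - 1 + 1) / (\<theta> - 1 + 1)) {0..R}"
      using assms by (intro has_integral_powr_from_0) auto
    from nn_integral_has_integral_lebesgue'[OF _ this] show ?thesis using assms by simp
  qed
  have [measurable]: "(\<lambda>x. ennreal (\<bar>x\<bar> powr (\<theta> - 1)) * indicator {x. \<bar>x\<bar> \<le> R} x) \<in> borel_measurable borel"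
    by measurable
  have "(\<integral>\<^sup>+x. ennreal (\<bar>x - c\<bar> powr (\<theta> - 1)) * indicator {x. \<bar>x - c\<bar> \<le> R} x \<partial>lborel)
      = (\<integral>\<^sup>+x. ennreal (\<bar>x\<bar> powr (\<theta> - 1)) * indicator {x. \<bar>x\<bar> \<le> R} x \<partial>lborel)"
    using nn_integral_lborel_shift[of "\<lambda>x. ennreal (\<bar>x\<bar> powr (\<theta> - 1)) * indicator {x. \<bar>x\<bar> \<le> R} x" "- c"]
    by (simp add: indicator_def)
  also have "\<dots> = (\<integral>\<^sup>+x. (ennreal (x powr (\<theta> - 1)) * indicator {0..R} x) + (ennreal ((0-x) powr (\<theta> - 1)) * indicator {0..R} (0-x)) \<partial>lborel)"
    by (intro nn_integral_cong) (auto split: split_indicator)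
  also have "\<dots> = (\<integral>\<^sup>+x. (ennreal (x powr (\<theta> - 1)) * indicator {0..R} x) \<partial>lborel)
     + (\<integral>\<^sup>+x. (ennreal ((0-x) powr (\<theta> - 1)) * indicator {0..R} (0-x)) \<partial>lborel)"
    by (rule nn_integral_add) measurable
  also have "(\<integral>\<^sup>+x. (ennreal ((0-x) powr (\<theta> - 1)) * indicator {0..R} (0-x)) \<partial>lborel)
     = (\<integral>\<^sup>+x. (ennreal (x powr (\<theta> - 1)) * indicator {0..R} x) \<partial>lborel)"
    by (rule nn_integral_lborel_reflect) measurable
  finally show ?thesis using assms by (simp add: 1 ennreal_plus[symmetric] del: ennreal_plus)
qed

lemma min_le_powr_mult_powr:
  fixes A B \<theta> :: real
  assumes "0 \<le> A" "0 \<le> B" "0 < \<theta>" "\<theta> < 1"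
  shows "min A B \<le> A powr \<theta> * B powr (1 - \<theta>)"
proof -
  let ?m = "min A B"
  have "?m = ?m powr \<theta> * ?m powr (1 - \<theta>)"
    using assms by (cases "?m = 0") (auto simp: powr_add[symmetric] min_def)
  also have "\<dots> \<le> A powr \<theta> * B powr (1 - \<theta>)"
    using assms by (intro mult_mono powr_mono2) auto
  finally show ?thesis .
qed

text \<open>The minimum of \<open>A\<close> and \<open>X\<close> / |y - yc| would integrate to a
  logarithm. Interpolating the two bounds with weight \<open>\<theta>\<close> leaves the integrable
  singularity |y - yc|^(\<theta> - 1), at the price of a factor \<open>R powr \<theta>\<close>. The
  centre is excluded because division by zero gives 0, so that the second bound would force
  \<open>F\<close> to vanish there.\<close>

lemma nn_integral_log_interpolation:
  fixes F :: "real \<Rightarrow> ennreal"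
  assumes "0 \<le> A" "0 \<le> X" "0 < \<theta>" "\<theta> < 1" "0 \<le> R"
    and F: "\<And>y. \<bar>y - yc\<bar> \<le> R \<Longrightarrow> y \<noteq> yc \<Longrightarrow> F y \<le> ennreal A"
       "\<And>y. \<bar>y - yc\<bar> \<le> R \<Longrightarrow> y \<noteq> yc \<Longrightarrow> F y \<le> ennreal (X / \<bar>y - yc\<bar>)"
    and 0: "\<And>y. \<not> \<bar>y - yc\<bar> \<le> R \<Longrightarrow> F y = 0"
  shows "(\<integral>\<^sup>+y. F y \<partial>lborel) \<le> ennreal (A powr \<theta> * X powr (1 - \<theta>) * (2 * R powr \<theta> / \<theta>))"
proof -
  have "(\<integral>\<^sup>+y. F y \<partial>lborel) \<le> (\<integral>\<^sup>+y. ennreal (A powr \<theta> * X powr (1 - \<theta>)) *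
       (ennreal (\<bar>y - yc\<bar> powr (\<theta> - 1)) * indicator {y. \<bar>y - yc\<bar> \<le> R} y) \<partial>lborel)"
  proof (rule nn_integral_mono_AE)
    have "F y \<le> ennreal (A powr \<theta> * X powr (1 - \<theta>)) *
       (ennreal (\<bar>y - yc\<bar> powr (\<theta> - 1)) * indicator {y. \<bar>y - yc\<bar> \<le> R} y)" if "y \<noteq> yc" for y
    proof (cases "\<bar>y - yc\<bar> \<le> R")
      case True
      have "F y \<le> ennreal (min A (X / \<bar>y - yc\<bar>))" using F[OF True that] by (simp add: min_def)
      also have "\<dots> \<le> ennreal (A powr \<theta> * (X / \<bar>y - yc\<bar>) powr (1 - \<theta>))"
        using assms by (intro ennreal_leI min_le_powr_mult_powr) auto
      also have "(X / \<bar>y - yc\<bar>) powr (1 - \<theta>) = X powr (1 - \<theta>) * \<bar>y - yc\<bar> powr (\<theta> - 1)"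
        using assms that powr_minus_divide[of "\<bar>y - yc\<bar>" "1 - \<theta>"] by (simp add: powr_divide)
      finally show ?thesis using True assms by (simp add: ennreal_mult' mult.assoc)
    qed (use 0 in simp)
    moreover have "AE y in lborel. y \<noteq> yc" by (rule AE_lborel_singleton)
    ultimately show "AE y in lborel. F y \<le> ennreal (A powr \<theta> * X powr (1 - \<theta>)) *
       (ennreal (\<bar>y - yc\<bar> powr (\<theta> - 1)) * indicator {y. \<bar>y - yc\<bar> \<le> R} y)"
      by (auto elim!: eventually_mono)
  qed
  also have "\<dots> = ennreal (A powr \<theta> * X powr (1 - \<theta>)) * ennreal (2 * R powr \<theta> / \<theta>)"
    by (subst nn_integral_cmult) (simp_all add: nn_integral_abs_powr assms)
  also have "\<dots> = ennreal (A powr \<theta> * X powr (1 - \<theta>) * (2 * R powr \<theta> / \<theta>))"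
    using assms by (simp add: ennreal_mult'[symmetric])
  finally show ?thesis .
qed

section \<open>The phase of a pair of waves and its gradient\<close>

text \<open>Besides being the square of \<open>freq_norm\<close>, this is the derivative of
  \<open>w\<close> in \<xi>. The \<xi>-derivative of the phase is thus a difference of squared
  frequency sizes, which is large as soon as the two sizes differ by a factor.\<close>

definition fn2 :: "real \<Rightarrow> real \<Rightarrow> real" where "fn2 \<xi> \<mu> = 3 * \<xi>\<^sup>2 + \<mu>\<^sup>2"

lemma freq_norm_sq: "(freq_norm \<xi> \<mu>)\<^sup>2 = fn2 \<xi> \<mu>" and freq_norm_nonneg: "freq_norm \<xi> \<mu> \<ge> 0"
  by (simp_all add: freq_norm_def fn2_def)

lemma freq_norm_bounds: "\<bar>\<mu>\<bar> \<le> freq_norm \<xi> \<mu>" "sqrt 3 * \<bar>\<xi>\<bar> \<le> freq_norm \<xi> \<mu>" "\<bar>\<xi>\<bar> \<le> freq_norm \<xi> \<mu>"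
proof -
  show "\<bar>\<mu>\<bar> \<le> freq_norm \<xi> \<mu>" unfolding freq_norm_def by (intro real_le_rsqrt) auto
  show "sqrt 3 * \<bar>\<xi>\<bar> \<le> freq_norm \<xi> \<mu>"
    unfolding freq_norm_def by (intro real_le_rsqrt) (auto simp: power_mult_distrib)
  show "\<bar>\<xi>\<bar> \<le> freq_norm \<xi> \<mu>" unfolding freq_norm_def by (intro real_le_rsqrt) auto
qed

text \<open>For an output frequency (\<xi>0, \<mu>0) this is the time frequency of the product of
  two free waves. Since \<open>w\<close> is odd, \<open>ph (-\<xi>) (-\<mu>)\<close> is the phase
  that occurs when an input (\<xi>, \<mu>) is fixed instead, so one definition serves both
  situations.\<close>

definition ph :: "real \<Rightarrow> real \<Rightarrow> real \<Rightarrow> real \<Rightarrow> real" where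
  "ph \<xi>0 \<mu>0 \<xi> \<mu> = w \<xi> \<mu> + w (\<xi>0 - \<xi>) (\<mu>0 - \<mu>)"

text \<open>The cubes of the free variable cancel in the sum, so the phase is quadratic in \<xi>,
  and \<open>D\<close> bounds its \<xi>-derivative from below. The same holds for \<mu> in
  \<open>mu_integral\<close>.\<close>

lemma xi_integral:
  assumes "\<beta> > 1" "D > 0"
  shows "(\<integral>\<^sup>+\<xi>. ennreal (jbr (t - ph \<xi>0 \<mu>0 \<xi> \<mu>) powr (-\<beta>)) *
      indicator {\<xi>. \<bar>\<xi>\<bar> \<le> R \<and> D \<le> \<bar>fn2 \<xi> \<mu> - fn2 (\<xi>0 - \<xi>) (\<mu>0 - \<mu>)\<bar>} \<xi> \<partial>lborel) \<le> ennreal (2 * jint \<beta> / D)"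
proof -
  let ?a = "- (3 * \<xi>0)" and ?b = "3 * \<xi>0\<^sup>2 - \<mu>\<^sup>2 + (\<mu>0 - \<mu>)\<^sup>2" and ?c = "t - \<xi>0 ^ 3 - \<xi>0 * (\<mu>0 - \<mu>)\<^sup>2"
  have "t - ph \<xi>0 \<mu>0 \<xi> \<mu> = ?a * \<xi>\<^sup>2 + ?b * \<xi> + ?c" for \<xi>
    unfolding ph_def w_def by algebra
  moreover have "fn2 \<xi> \<mu> - fn2 (\<xi>0 - \<xi>) (\<mu>0 - \<mu>) = - (2 * ?a * \<xi> + ?b)" for \<xi>
    unfolding fn2_def by algebra
  ultimately show ?thesis
    using quadratic_substitution[OF assms, of ?a ?b ?c R] by (simp only: abs_minus_cancel)
qed

lemma mu_integral:
  assumes "\<beta> > 1" "D > 0"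
  shows "(\<integral>\<^sup>+\<mu>. ennreal (jbr (t - ph \<xi>0 \<mu>0 \<xi> \<mu>) powr (-\<beta>)) *
      indicator {\<mu>. \<bar>\<mu>\<bar> \<le> R \<and> D \<le> \<bar>2 * \<xi> * \<mu> - 2 * (\<xi>0 - \<xi>) * (\<mu>0 - \<mu>)\<bar>} \<mu> \<partial>lborel) \<le> ennreal (2 * jint \<beta> / D)"
proof -
  let ?a = "- \<xi>0" and ?b = "2 * (\<xi>0 - \<xi>) * \<mu>0" and ?c = "t - \<xi> ^ 3 - (\<xi>0 - \<xi>) ^ 3 - (\<xi>0 - \<xi>) * \<mu>0\<^sup>2"
  have "t - ph \<xi>0 \<mu>0 \<xi> \<mu> = ?a * \<mu>\<^sup>2 + ?b * \<mu> + ?c" for \<mu>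
    unfolding ph_def w_def by algebra
  moreover have "2 * \<xi> * \<mu> - 2 * (\<xi>0 - \<xi>) * (\<mu>0 - \<mu>) = - (2 * ?a * \<mu> + ?b)" for \<mu>
    by algebra
  ultimately show ?thesis
    using quadratic_substitution[OF assms, of ?a ?b ?c R] by (simp only: abs_minus_cancel)
qed

text \<open>The phase is a quadratic form in \<^term>\<open>(\<xi> - \<xi>0 / 2, \<mu> - \<mu>0 / 2)\<close> plus a constant; its determinant
  is \<^term>\<open>3 * \<xi>0\<^sup>2 - \<mu>0\<^sup>2\<close>.\<close>

lemma gradient_dichotomy_aux:
  fixes P Q a b x y K r c :: real
  assumes "c > 0" "r > 0" and K: "c * r\<^sup>2 \<le> \<bar>K\<bar>" and xi: "3 * \<bar>x\<bar> \<le> 2 * r" and mu: "\<bar>y\<bar> \<le> r"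
    and e1: "2 * K * a = x * P - y * Q" and e2: "2 * K * b = 3 * x * Q - y * P"
  shows "c / 2 * r * \<bar>b\<bar> \<le> \<bar>P\<bar> \<or> c / 2 * r * \<bar>a\<bar> \<le> \<bar>Q\<bar>"
\<comment> \<open>\<open>P\<close> and \<open>Q\<close> stand for the components of the gradient and
  (\<open>a\<close>, \<open>b\<close>) for the displacement from the centre; \<open>e1\<close> and
  \<open>e2\<close> are Cramer's rule for the linear system that relates them. Two small components
  would give 3 |a| <= |b| and 3 |b| <= 2 |a|, contradicting that neither displacement
  vanishes.\<close>
proof (rule ccontr)
  assume "\<not> ?thesis"
  then have P: "\<bar>P\<bar> < c / 2 * r * \<bar>b\<bar>" and Q: "\<bar>Q\<bar> < c / 2 * r * \<bar>a\<bar>" by auto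
  have Kb: "2 * (c * r\<^sup>2) * z \<le> 2 * \<bar>K\<bar> * z" if "z \<ge> 0" for z
    using K that by (intro mult_right_mono) auto
  have A: "2 * (c * r\<^sup>2) * \<bar>a\<bar> \<le> \<bar>x\<bar> * \<bar>P\<bar> + \<bar>y\<bar> * \<bar>Q\<bar>"
  proof -
    have "2 * (c * r\<^sup>2) * \<bar>a\<bar> \<le> \<bar>2 * K * a\<bar>" using Kb[of "\<bar>a\<bar>"] by (simp add: abs_mult)
    also have "\<dots> \<le> \<bar>x * P\<bar> + \<bar>y * Q\<bar>" unfolding e1 by (rule abs_triangle_ineq4)
    finally show ?thesis by (simp only: abs_mult)
  qed
  have B: "2 * (c * r\<^sup>2) * \<bar>b\<bar> \<le> 3 * \<bar>x\<bar> * \<bar>Q\<bar> + \<bar>y\<bar> * \<bar>P\<bar>"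
  proof -
    have "2 * (c * r\<^sup>2) * \<bar>b\<bar> \<le> \<bar>2 * K * b\<bar>" using Kb[of "\<bar>b\<bar>"] by (simp add: abs_mult)
    also have "\<dots> \<le> \<bar>3 * x * Q\<bar> + \<bar>y * P\<bar>" unfolding e2 by (rule abs_triangle_ineq4)
    finally show ?thesis by (simp only: abs_mult abs_numeral)
  qed
  have pos: "\<bar>a\<bar> > 0" "\<bar>b\<bar> > 0" using P Q by (auto simp: zero_less_mult_iff)
  have cr: "c * r\<^sup>2 > 0" using assms by simp
  have "\<bar>x\<bar> * \<bar>P\<bar> \<le> r * (c / 2 * r * \<bar>b\<bar>)" by (rule mult_mono) (use P xi assms in linarith)+
  moreover have "\<bar>y\<bar> * \<bar>Q\<bar> \<le> r * (c / 2 * r * \<bar>a\<bar>)" by (rule mult_mono) (use Q mu assms in linarith)+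
  moreover have "c * r\<^sup>2 * (\<bar>b\<bar> / 2 + \<bar>a\<bar> / 2) = r * (c / 2 * r * \<bar>b\<bar>) + r * (c / 2 * r * \<bar>a\<bar>)"
    by (simp add: power2_eq_square algebra_simps)
  ultimately have "c * r\<^sup>2 * (2 * \<bar>a\<bar>) \<le> c * r\<^sup>2 * (\<bar>b\<bar> / 2 + \<bar>a\<bar> / 2)"
    using A by linarith
  then have 1: "2 * \<bar>a\<bar> \<le> \<bar>b\<bar> / 2 + \<bar>a\<bar> / 2" using cr by (simp only: mult_le_cancel_left_pos)
  have "3 * \<bar>x\<bar> * \<bar>Q\<bar> \<le> 2 * r * (c / 2 * r * \<bar>a\<bar>)" by (rule mult_mono) (use Q xi assms in linarith)+
  moreover have "\<bar>y\<bar> * \<bar>P\<bar> \<le> r * (c / 2 * r * \<bar>b\<bar>)" by (rule mult_mono) (use P mu assms in linarith)+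
  moreover have "c * r\<^sup>2 * (\<bar>a\<bar> + \<bar>b\<bar> / 2) = 2 * r * (c / 2 * r * \<bar>a\<bar>) + r * (c / 2 * r * \<bar>b\<bar>)"
    by (simp add: power2_eq_square algebra_simps)
  ultimately have "c * r\<^sup>2 * (2 * \<bar>b\<bar>) \<le> c * r\<^sup>2 * (\<bar>a\<bar> + \<bar>b\<bar> / 2)"
    using B by linarith
  then have 2: "2 * \<bar>b\<bar> \<le> \<bar>a\<bar> + \<bar>b\<bar> / 2" using cr by (simp only: mult_le_cancel_left_pos)
  show False using 1 2 pos by linarith
qed

text \<open>The gradient is the displacement from (\<xi>0 / 2, \<mu>0 / 2) multiplied by a matrix
  with entries of order \<open>r\<close> and determinant of order \<open>r\<close> squared, so it
  cannot be much smaller than \<open>r\<close> times the displacement. The pairing is crosswise, the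
  \<xi>-derivative against the displacement in \<mu> and conversely: the lower bound then stays
  constant while the variable of differentiation is integrated.\<close>

lemma gradient_dichotomy:
  assumes "c > 0" and r: "r = freq_norm \<xi>0 \<mu>0" "r > 0" and K: "c * r\<^sup>2 \<le> \<bar>3 * \<xi>0\<^sup>2 - \<mu>0\<^sup>2\<bar>"
  shows "c / 2 * r * \<bar>\<mu> - \<mu>0 / 2\<bar> \<le> \<bar>fn2 \<xi> \<mu> - fn2 (\<xi>0 - \<xi>) (\<mu>0 - \<mu>)\<bar> \<or>
         c / 2 * r * \<bar>\<xi> - \<xi>0 / 2\<bar> \<le> \<bar>2 * \<xi> * \<mu> - 2 * (\<xi>0 - \<xi>) * (\<mu>0 - \<mu>)\<bar>"
proof (rule gradient_dichotomy_aux[OF assms(1) r(2) K])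
  have "(3 * \<bar>\<xi>0\<bar>)\<^sup>2 \<le> (2 * r)\<^sup>2" by (simp add: r(1) freq_norm_sq fn2_def power_mult_distrib)
  then show "3 * \<bar>\<xi>0\<bar> \<le> 2 * r" by (rule power2_le_imp_le) (use r(2) in simp)
  show "\<bar>\<mu>0\<bar> \<le> r" using freq_norm_bounds[of \<mu>0 \<xi>0] r by simp
  let ?P = "fn2 \<xi> \<mu> - fn2 (\<xi>0 - \<xi>) (\<mu>0 - \<mu>)" and ?Q = "2 * \<xi> * \<mu> - 2 * (\<xi>0 - \<xi>) * (\<mu>0 - \<mu>)"
  let ?a = "\<xi> - \<xi>0 / 2" and ?b = "\<mu> - \<mu>0 / 2" and ?K = "3 * \<xi>0\<^sup>2 - \<mu>0\<^sup>2"
  have "2 * ?a = 2 * \<xi> - \<xi>0" by simp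
  moreover have "?K * (2 * \<xi> - \<xi>0) = \<xi>0 * ?P - \<mu>0 * ?Q" unfolding fn2_def by algebra
  ultimately show "2 * ?K * ?a = \<xi>0 * ?P - \<mu>0 * ?Q" by (metis mult.assoc mult.left_commute)
  have "2 * ?b = 2 * \<mu> - \<mu>0" by simp
  moreover have "?K * (2 * \<mu> - \<mu>0) = 3 * \<xi>0 * ?Q - \<mu>0 * ?P" unfolding fn2_def by algebra
  ultimately show "2 * ?K * ?b = 3 * \<xi>0 * ?Q - \<mu>0 * ?P" by (metis mult.assoc mult.left_commute)
qed

text \<open>On each half of the dichotomy the variable with a large derivative is integrated by
  substitution. A slice contributes at most its length, of order r, and at most a constant over r
  times the distance to the centre. Interpolation in the other variable gives r^\<theta> r^(\<theta>
  - 1) r^\<theta> = r^(3 \<theta> - 1): the decay 1 / r, up to a logarithm that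
  \<open>\<theta>\<close> pays for.\<close>

lemma quadratic_form_integral:
  assumes "\<beta> > 1" "0 < \<theta>" "\<theta> < 1" "c > 0"
  shows "\<exists>C\<ge>0. \<forall>\<xi>0 \<mu>0 t. freq_norm \<xi>0 \<mu>0 > 0 \<longrightarrow> c * (freq_norm \<xi>0 \<mu>0)\<^sup>2 \<le> \<bar>3 * \<xi>0\<^sup>2 - \<mu>0\<^sup>2\<bar> \<longrightarrow>
    (\<integral>\<^sup>+z. ennreal (jbr (t - ph \<xi>0 \<mu>0 (fst z) (snd z)) powr (-\<beta>)) *
       indicator {z. \<bar>fst z\<bar> \<le> 5 * freq_norm \<xi>0 \<mu>0 \<and> \<bar>snd z\<bar> \<le> 5 * freq_norm \<xi>0 \<mu>0} z \<partial>lborel)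
      \<le> ennreal (C * freq_norm \<xi>0 \<mu>0 powr (3 * \<theta> - 1))"
proof -
  \<comment> \<open>\<open>?X\<close> collects the constant of the slice bound at slope
    \<open>c / 2 * r\<close> times the distance to the centre. In \<open>?C\<close> the 10 is the
    length of a slice of the box in units of r, and the 6 bounds the distance 5 + 1/2 from a point
    of the box to the centre.\<close>
  let ?X = "2 * jint \<beta> * 2 / c"
  let ?C = "10 powr \<theta> * ?X powr (1 - \<theta>) * (2 * 6 powr \<theta> / \<theta>)"
  have C: "?C \<ge> 0" using assms by simp
  show ?thesis
  proof (intro exI[of _ "2 * ?C"] conjI allI impI)
    show "0 \<le> 2 * ?C" using C by simp
    fix \<xi>0 \<mu>0 t assume r0: "freq_norm \<xi>0 \<mu>0 > 0" and K: "c * (freq_norm \<xi>0 \<mu>0)\<^sup>2 \<le> \<bar>3 * \<xi>0\<^sup>2 - \<mu>0\<^sup>2\<bar>"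
    define r where "r = freq_norm \<xi>0 \<mu>0"
    have rp: "r > 0" using r0 by (simp add: r_def)
    define J where "J \<xi> \<mu> = ennreal (jbr (t - ph \<xi>0 \<mu>0 \<xi> \<mu>) powr (-\<beta>))" for \<xi> \<mu>
    have [measurable]: "(\<lambda>z. J (fst z) (snd z)) \<in> borel_measurable borel"
    proof -
      have [measurable]: "(\<lambda>z. ph \<xi>0 \<mu>0 (fst z) (snd z)) \<in> borel_measurable borel"
        unfolding ph_def w_def by (intro borel_measurable_continuous_onI continuous_intros)
      show ?thesis unfolding J_def by measurable
    qed
    have J1: "J \<xi> \<mu> \<le> 1" for \<xi> \<mu>
      unfolding J_def using powr_mono[of "-\<beta>" 0 "jbr (t - ph \<xi>0 \<mu>0 \<xi> \<mu>)"] assms jbr_ge_1[of "t - ph \<xi>0 \<mu>0 \<xi> \<mu>"]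
      by (simp add: jbr_neq_0)
    \<comment> \<open>The \<xi>-derivative is large on \<open>S1\<close> and the \<mu>-derivative on
      \<open>S2\<close>. By the dichotomy the two sets cover the box; their overlap only counts some
      mass twice.\<close>
    define S1 where "S1 = {z::real\<times>real. (\<bar>fst z\<bar> \<le> 5 * r \<and> \<bar>snd z\<bar> \<le> 5 * r) \<and> c / 2 * r * \<bar>snd z - \<mu>0 / 2\<bar> \<le> \<bar>fn2 (fst z) (snd z) - fn2 (\<xi>0 - fst z) (\<mu>0 - snd z)\<bar>}"
    define S2 where "S2 = {z::real\<times>real. (\<bar>fst z\<bar> \<le> 5 * r \<and> \<bar>snd z\<bar> \<le> 5 * r) \<and> c / 2 * r * \<bar>fst z - \<xi>0 / 2\<bar> \<le> \<bar>2 * fst z * snd z - 2 * (\<xi>0 - fst z) * (\<mu>0 - snd z)\<bar>}"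
    have "closed S1" "closed S2" unfolding S1_def S2_def fn2_def
      by (intro closed_Collect_conj closed_Collect_le continuous_intros)+
    then have [measurable]: "S1 \<in> sets borel" "S2 \<in> sets borel" by auto
    have half: "\<bar>\<xi>0\<bar> \<le> r" "\<bar>\<mu>0\<bar> \<le> r" using freq_norm_bounds[of \<mu>0 \<xi>0] freq_norm_bounds(3)[of \<xi>0 \<mu>0] by (auto simp: r_def)
    have Cr: "(10 * r) powr \<theta> * (?X / r) powr (1 - \<theta>) * (2 * (6 * r) powr \<theta> / \<theta>) = ?C * r powr (3 * \<theta> - 1)"
    proof -
      have "(10 * r) powr \<theta> * (?X / r) powr (1 - \<theta>) * (2 * (6 * r) powr \<theta> / \<theta>)
         = ?C * (r powr \<theta> * r powr (-(1 - \<theta>)) * r powr \<theta>)"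
      proof -
        have "(?X / r) powr (1 - \<theta>) = ?X powr (1 - \<theta>) * r powr (-(1 - \<theta>))"
          using rp assms jint_nonneg[of \<beta>] by (subst powr_divide) (auto simp: powr_minus[of r "1 - \<theta>"] divide_inverse simp del: minus_diff_eq)
        moreover have "(10 * r) powr \<theta> = 10 powr \<theta> * r powr \<theta>" "(6 * r) powr \<theta> = 6 powr \<theta> * r powr \<theta>"
          using rp by (simp_all add: powr_mult)
        ultimately show ?thesis by (simp only: times_divide_eq_right times_divide_eq_left mult_ac)
      qed
      also have "r powr \<theta> * r powr (-(1 - \<theta>)) * r powr \<theta> = r powr (3 * \<theta> - 1)"
        by (simp add: powr_add[symmetric])
      finally show ?thesis .
    qed
    have triv: "(\<integral>\<^sup>+x. indicator {x::real. \<bar>x\<bar> \<le> 5 * r} x \<partial>lborel) = ennreal (10 * r)"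
    proof -
      have *: "{x::real. \<bar>x\<bar> \<le> 5 * r} = {-(5*r)..5*r}" by auto
      show ?thesis unfolding * using rp by (simp add: nn_integral_indicator)
    qed
    have I1: "(\<integral>\<^sup>+z. J (fst z) (snd z) * indicator S1 z \<partial>lborel) \<le> ennreal (?C * r powr (3 * \<theta> - 1))"
    proof -
      have "(\<integral>\<^sup>+z. J (fst z) (snd z) * indicator S1 z \<partial>lborel) = (\<integral>\<^sup>+\<mu>. \<integral>\<^sup>+\<xi>. J \<xi> \<mu> * indicator S1 (\<xi>, \<mu>) \<partial>lborel \<partial>lborel)"
        by (subst nn_integral_lborel_prod_swap) simp_all
      also have "\<dots> \<le> ennreal ((10 * r) powr \<theta> * (?X / r) powr (1 - \<theta>) * (2 * (6 * r) powr \<theta> / \<theta>))"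
      proof (rule nn_integral_log_interpolation[where yc = "\<mu>0 / 2"])
        fix \<mu> assume mu: "\<mu> \<noteq> \<mu>0 / 2"
        have "(\<integral>\<^sup>+\<xi>. J \<xi> \<mu> * indicator S1 (\<xi>, \<mu>) \<partial>lborel) \<le> (\<integral>\<^sup>+\<xi>. indicator {\<xi>. \<bar>\<xi>\<bar> \<le> 5 * r} \<xi> \<partial>lborel)"
          using J1 by (intro nn_integral_mono) (auto simp: S1_def S2_def split: split_indicator)
        then show "(\<integral>\<^sup>+\<xi>. J \<xi> \<mu> * indicator S1 (\<xi>, \<mu>) \<partial>lborel) \<le> ennreal (10 * r)" by (simp add: triv)
        have D: "c / 2 * r * \<bar>\<mu> - \<mu>0 / 2\<bar> > 0" using assms rp mu by simp
        have "(\<integral>\<^sup>+\<xi>. J \<xi> \<mu> * indicator S1 (\<xi>, \<mu>) \<partial>lborel) 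
          \<le> (\<integral>\<^sup>+\<xi>. J \<xi> \<mu> * indicator {\<xi>. \<bar>\<xi>\<bar> \<le> 5 * r \<and> c / 2 * r * \<bar>\<mu> - \<mu>0 / 2\<bar> \<le> \<bar>fn2 \<xi> \<mu> - fn2 (\<xi>0 - \<xi>) (\<mu>0 - \<mu>)\<bar>} \<xi> \<partial>lborel)"
          by (intro nn_integral_mono) (auto simp: S1_def S2_def split: split_indicator)
        also have "\<dots> \<le> ennreal (2 * jint \<beta> / (c / 2 * r * \<bar>\<mu> - \<mu>0 / 2\<bar>))"
          unfolding J_def by (rule xi_integral[OF assms(1) D])
        finally show "(\<integral>\<^sup>+\<xi>. J \<xi> \<mu> * indicator S1 (\<xi>, \<mu>) \<partial>lborel) \<le> ennreal (?X / r / \<bar>\<mu> - \<mu>0 / 2\<bar>)"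
          by (simp add: field_simps)
      next
        fix \<mu> assume "\<not> \<bar>\<mu> - \<mu>0 / 2\<bar> \<le> 6 * r"
        then have "\<not> \<bar>\<mu>\<bar> \<le> 5 * r" using half by auto
        then show "(\<integral>\<^sup>+\<xi>. J \<xi> \<mu> * indicator S1 (\<xi>, \<mu>) \<partial>lborel) = 0" by (simp add: S1_def)
      qed (use assms rp jint_nonneg[of \<beta>] in auto)
      finally show ?thesis unfolding Cr .
    qed
    have I2: "(\<integral>\<^sup>+z. J (fst z) (snd z) * indicator S2 z \<partial>lborel) \<le> ennreal (?C * r powr (3 * \<theta> - 1))"
    proof -
      have "(\<integral>\<^sup>+z. J (fst z) (snd z) * indicator S2 z \<partial>lborel) = (\<integral>\<^sup>+\<xi>. \<integral>\<^sup>+\<mu>. J \<xi> \<mu> * indicator S2 (\<xi>, \<mu>) \<partial>lborel \<partial>lborel)"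
        by (subst nn_integral_lborel_prod) simp_all
      also have "\<dots> \<le> ennreal ((10 * r) powr \<theta> * (?X / r) powr (1 - \<theta>) * (2 * (6 * r) powr \<theta> / \<theta>))"
      proof (rule nn_integral_log_interpolation[where yc = "\<xi>0 / 2"])
        fix \<xi> assume mu: "\<xi> \<noteq> \<xi>0 / 2"
        have "(\<integral>\<^sup>+\<mu>. J \<xi> \<mu> * indicator S2 (\<xi>, \<mu>) \<partial>lborel) \<le> (\<integral>\<^sup>+\<xi>. indicator {\<xi>. \<bar>\<xi>\<bar> \<le> 5 * r} \<xi> \<partial>lborel)"
          using J1 by (intro nn_integral_mono) (auto simp: S1_def S2_def split: split_indicator)
        then show "(\<integral>\<^sup>+\<mu>. J \<xi> \<mu> * indicator S2 (\<xi>, \<mu>) \<partial>lborel) \<le> ennreal (10 * r)" by (simp add: triv)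
        have D: "c / 2 * r * \<bar>\<xi> - \<xi>0 / 2\<bar> > 0" using assms rp mu by simp
        have "(\<integral>\<^sup>+\<mu>. J \<xi> \<mu> * indicator S2 (\<xi>, \<mu>) \<partial>lborel) 
          \<le> (\<integral>\<^sup>+\<mu>. J \<xi> \<mu> * indicator {\<mu>. \<bar>\<mu>\<bar> \<le> 5 * r \<and> c / 2 * r * \<bar>\<xi> - \<xi>0 / 2\<bar> \<le> \<bar>2 * \<xi> * \<mu> - 2 * (\<xi>0 - \<xi>) * (\<mu>0 - \<mu>)\<bar>} \<mu> \<partial>lborel)"
          by (intro nn_integral_mono) (auto simp: S1_def S2_def split: split_indicator)
        also have "\<dots> \<le> ennreal (2 * jint \<beta> / (c / 2 * r * \<bar>\<xi> - \<xi>0 / 2\<bar>))"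
          unfolding J_def by (rule mu_integral[OF assms(1) D])
        finally show "(\<integral>\<^sup>+\<mu>. J \<xi> \<mu> * indicator S2 (\<xi>, \<mu>) \<partial>lborel) \<le> ennreal (?X / r / \<bar>\<xi> - \<xi>0 / 2\<bar>)"
          by (simp add: field_simps)
      next
        fix \<xi> assume "\<not> \<bar>\<xi> - \<xi>0 / 2\<bar> \<le> 6 * r"
        then have "\<not> \<bar>\<xi>\<bar> \<le> 5 * r" using half by auto
        then show "(\<integral>\<^sup>+\<mu>. J \<xi> \<mu> * indicator S2 (\<xi>, \<mu>) \<partial>lborel) = 0" by (simp add: S2_def)
      qed (use assms rp jint_nonneg[of \<beta>] in auto)
      finally show ?thesis unfolding Cr .
    qed
    have "(\<integral>\<^sup>+z. J (fst z) (snd z) * indicator {z. \<bar>fst z\<bar> \<le> 5 * r \<and> \<bar>snd z\<bar> \<le> 5 * r} z \<partial>lborel)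
      \<le> (\<integral>\<^sup>+z. J (fst z) (snd z) * indicator S1 z + J (fst z) (snd z) * indicator S2 z \<partial>lborel)"
    proof (rule nn_integral_mono)
      fix z
      show "J (fst z) (snd z) * indicator {z. \<bar>fst z\<bar> \<le> 5 * r \<and> \<bar>snd z\<bar> \<le> 5 * r} z
         \<le> J (fst z) (snd z) * indicator S1 z + J (fst z) (snd z) * indicator S2 z"
        using gradient_dichotomy[OF assms(4) r_def rp, of "snd z" "fst z"] K
        by (auto simp: r_def[symmetric] S1_def S2_def split: split_indicator)
    qed
    also have "\<dots> = (\<integral>\<^sup>+z. J (fst z) (snd z) * indicator S1 z \<partial>lborel) + (\<integral>\<^sup>+z. J (fst z) (snd z) * indicator S2 z \<partial>lborel)"
      by (rule nn_integral_add) measurable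
    also have "\<dots> \<le> ennreal (?C * r powr (3 * \<theta> - 1)) + ennreal (?C * r powr (3 * \<theta> - 1))"
      by (intro add_mono I1 I2)
    also have "\<dots> = ennreal (2 * ?C * r powr (3 * \<theta> - 1))"
    proof -
      have ge: "0 \<le> ?C * r powr (3 * \<theta> - 1)" by (rule mult_nonneg_nonneg[OF C]) simp
      have "2 * ?C * r powr (3 * \<theta> - 1) = ?C * r powr (3 * \<theta> - 1) + ?C * r powr (3 * \<theta> - 1)"
        by (simp only: mult_2 distrib_right)
      then show ?thesis by (simp only: ennreal_plus[symmetric, OF ge ge])
    qed
    finally show "(\<integral>\<^sup>+z. ennreal (jbr (t - ph \<xi>0 \<mu>0 (fst z) (snd z)) powr (-\<beta>)) *
       indicator {z. \<bar>fst z\<bar> \<le> 5 * freq_norm \<xi>0 \<mu>0 \<and> \<bar>snd z\<bar> \<le> 5 * freq_norm \<xi>0 \<mu>0} z \<partial>lborel)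
      \<le> ennreal (2 * ?C * freq_norm \<xi>0 \<mu>0 powr (3 * \<theta> - 1))" by (simp add: J_def r_def)
  qed
qed

section \<open>Weighted bilinear convolution bounds\<close>

text \<open>Nonnegative extended functions, standing for the moduli of Fourier transforms, make the
  convolution defined everywhere and monotone in the set \<open>A\<close> of admissible pairs of
  input frequencies.\<close>

definition bilin :: "('a::euclidean_space \<times> 'a) set \<Rightarrow> ('a \<Rightarrow> ennreal) \<Rightarrow> ('a \<Rightarrow> ennreal) \<Rightarrow> 'a \<Rightarrow> ennreal" where
  "bilin A F G z = (\<integral>\<^sup>+z1. indicator A (z1, z - z1) * (F z1 * G (z - z1)) \<partial>lborel)"

text \<open>The estimate is stated in squared form to stay free of roots in \<open>ennreal\<close>.
  Measurability of \<open>A\<close> belongs to the predicate so that unions and exchanges of the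
  inputs carry it along.\<close>

definition bilin_bounded :: "('a::euclidean_space \<Rightarrow> real) \<Rightarrow> ('a \<Rightarrow> real) \<Rightarrow> ('a \<times> 'a) set \<Rightarrow> bool" where
  "bilin_bounded m \<omega> A \<longleftrightarrow> A \<in> sets borel \<and> (\<exists>C\<ge>0. \<forall>F\<in>borel_measurable borel. \<forall>G\<in>borel_measurable borel.
     (\<integral>\<^sup>+z. ennreal (m z) * (bilin A F G z)\<^sup>2 \<partial>lborel)
      \<le> ennreal C * (\<integral>\<^sup>+z. ennreal (\<omega> z) * (F z)\<^sup>2 \<partial>lborel) * (\<integral>\<^sup>+z. ennreal (\<omega> z) * (G z)\<^sup>2 \<partial>lborel))"

lemma borel_pair_maps [measurable]:
  "(\<lambda>p::'a::euclidean_space \<times> 'a. (snd p, fst p - snd p)) \<in> borel_measurable borel"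
  "(\<lambda>p::'a \<times> 'a. (snd p, fst p)) \<in> borel_measurable borel"
  "(\<lambda>p::'a \<times> 'a. fst p - snd p) \<in> borel_measurable borel"
  "(\<lambda>p::'a \<times> 'a. fst p + snd p) \<in> borel_measurable borel"
  "(\<lambda>p::'a \<times> 'a. fst p) \<in> borel_measurable borel"
  "(\<lambda>p::'a \<times> 'a. snd p) \<in> borel_measurable borel"
  "(\<lambda>x::'a. (x, z - x)) \<in> borel_measurable borel"
  "(\<lambda>x::'a. (x, z)) \<in> borel_measurable borel"
  by (intro borel_measurable_continuous_onI continuous_intros)+

lemma borel_pair_compose:
  fixes f :: "'a::euclidean_space \<Rightarrow> 'b::topological_space"
  assumes [measurable]: "f \<in> borel_measurable borel"
  shows "(\<lambda>p::'a \<times> 'a. f (fst p)) \<in> borel_measurable borel" "(\<lambda>p::'a \<times> 'a. f (snd p)) \<in> borel_measurable borel"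
    "(\<lambda>p::'a \<times> 'a. f (fst p - snd p)) \<in> borel_measurable borel" "(\<lambda>p::'a \<times> 'a. f (fst p + snd p)) \<in> borel_measurable borel"
    "(\<lambda>x::'a. f (c - x)) \<in> borel_measurable borel"
  by measurable

lemma borel_indicator_compose:
  fixes A :: "('a::euclidean_space \<times> 'a) set"
  assumes [measurable]: "A \<in> sets borel"
  shows "(\<lambda>p. indicator A (snd p, fst p - snd p) :: ennreal) \<in> borel_measurable borel"
    "(\<lambda>x. indicator A (x, z - x) :: ennreal) \<in> borel_measurable borel"
    "(\<lambda>x. indicator A (x, z) :: ennreal) \<in> borel_measurable borel"
    "(\<lambda>p. indicator A p :: ennreal) \<in> borel_measurable borel"
proof -
  have i: "(indicator A :: _ \<Rightarrow> ennreal) \<in> borel_measurable borel" by simp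
  show "(\<lambda>p. indicator A (snd p, fst p - snd p) :: ennreal) \<in> borel_measurable borel"
    "(\<lambda>x. indicator A (x, z - x) :: ennreal) \<in> borel_measurable borel"
    "(\<lambda>x. indicator A (x, z) :: ennreal) \<in> borel_measurable borel"
    "(\<lambda>p. indicator A p :: ennreal) \<in> borel_measurable borel"
    using measurable_compose[OF borel_pair_maps(1) i] measurable_compose[OF borel_pair_maps(7) i]
      measurable_compose[OF borel_pair_maps(8) i] i by simp_all
qed

lemma borel_bilin_integrand:
  fixes A :: "('a::euclidean_space \<times> 'a) set" and F G :: "'a \<Rightarrow> ennreal"
  assumes A: "A \<in> sets borel" and [measurable]: "F \<in> borel_measurable borel" and G: "G \<in> borel_measurable borel"
  shows "(\<lambda>x. indicator A (x, z - x) * (F x * G (z - x))) \<in> borel_measurable borel"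
    "(\<lambda>p. indicator A (snd p, fst p - snd p) * (F (snd p) * G (fst p - snd p))) \<in> borel_measurable borel"
proof -
  note [measurable] = borel_pair_compose[OF G] borel_pair_compose[of F]
  define i :: "'a \<Rightarrow> ennreal" where "i x = indicator A (x, z - x)" for x
  have [measurable]: "i \<in> borel_measurable borel"
    unfolding i_def[abs_def] by (rule borel_indicator_compose[OF A])
  have "(\<lambda>x. i x * (F x * G (z - x))) \<in> borel_measurable borel" by measurable
  then show "(\<lambda>x. indicator A (x, z - x) * (F x * G (z - x))) \<in> borel_measurable borel" by (simp add: i_def)
  define j :: "'a \<times> 'a \<Rightarrow> ennreal" where "j p = indicator A (snd p, fst p - snd p)" for p
  have [measurable]: "j \<in> borel_measurable borel"
    unfolding j_def[abs_def] by (rule borel_indicator_compose[OF A])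
  have "(\<lambda>p. j p * (F (snd p) * G (fst p - snd p))) \<in> borel_measurable borel" by measurable
  then show "(\<lambda>p. indicator A (snd p, fst p - snd p) * (F (snd p) * G (fst p - snd p))) \<in> borel_measurable borel"
    by (simp add: j_def)
qed

lemma nn_integral_lborel_swap:
  fixes h :: "'a::euclidean_space \<times> 'b::euclidean_space \<Rightarrow> ennreal"
  assumes "h \<in> borel_measurable borel"
  shows "(\<integral>\<^sup>+x. \<integral>\<^sup>+y. h (x, y) \<partial>lborel \<partial>lborel) = (\<integral>\<^sup>+y. \<integral>\<^sup>+x. h (x, y) \<partial>lborel \<partial>lborel)"
  using nn_integral_lborel_prod[OF assms] nn_integral_lborel_prod_swap[OF assms] by simp

lemma borel_measurable_nn_integral_lborel:
  fixes h :: "'a::euclidean_space \<times> 'b::euclidean_space \<Rightarrow> ennreal"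
  assumes "h \<in> borel_measurable borel"
  shows "(\<lambda>x. \<integral>\<^sup>+y. h (x, y) \<partial>lborel) \<in> borel_measurable borel"
proof -
  have "h \<in> borel_measurable (borel \<Otimes>\<^sub>M borel)" using assms by (simp add: borel_prod)
  then have "h \<in> borel_measurable (borel \<Otimes>\<^sub>M lborel)"
    by (simp cong: measurable_cong_sets sets_pair_measure_cong)
  then show ?thesis by (rule lborel.borel_measurable_nn_integral_fst)
qed

text \<open>Cauchy-Schwarz in the free input, with the reciprocal weights in one factor and the
  weights in the other. The first factor is controlled by \<open>bd\<close>; the second is the
  convolution of the two weighted squares, whose integral is the product of the norms.\<close>

lemma bilin_bounded_fixed_output:
  fixes m \<omega> :: "'a::euclidean_space \<Rightarrow> real"
  assumes m [measurable]: "m \<in> borel_measurable borel" and \<omega> [measurable]: "\<omega> \<in> borel_measurable borel"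
    and A [measurable]: "A \<in> sets borel"
    and mpos: "\<And>z. m z \<ge> 0" and wpos: "\<And>z. \<omega> z > 0" and C: "C \<ge> 0"
    and bd: "\<And>z. (\<integral>\<^sup>+z1. ennreal (m z / (\<omega> z1 * \<omega> (z - z1))) * indicator A (z1, z - z1) \<partial>lborel) \<le> ennreal C"
  shows "bilin_bounded m \<omega> A"
  unfolding bilin_bounded_def
proof (intro conjI A exI[of _ C] C ballI)
  fix F G :: "'a \<Rightarrow> ennreal" assume F [measurable]: "F \<in> borel_measurable borel" and G [measurable]: "G \<in> borel_measurable borel"
  note [measurable] = borel_pair_compose[OF m] borel_pair_compose[OF \<omega>] borel_pair_compose[OF F] borel_pair_compose[OF G] borel_indicator_compose[OF A]
  let ?k = "\<lambda>z z1. \<omega> z1 * \<omega> (z - z1)"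
  have k: "?k z z1 > 0" for z z1 using wpos by simp
  have k0: "?k z z1 \<ge> 0" for z z1 using k[of z1 z] by (rule less_imp_le)
  have pt: "ennreal (m z) * (bilin A F G z)\<^sup>2
      \<le> ennreal C * (\<integral>\<^sup>+z1. (ennreal (\<omega> z1) * (F z1)\<^sup>2) * (ennreal (\<omega> (z - z1)) * (G (z - z1))\<^sup>2) \<partial>lborel)" for z
  proof -
    have "(bilin A F G z)\<^sup>2 = (\<integral>\<^sup>+z1. (ennreal (1 / sqrt (?k z z1)) * indicator A (z1, z - z1)) * (ennreal (sqrt (?k z z1)) * (F z1 * G (z - z1))) \<partial>lborel)\<^sup>2"
    proof -
      have e: "ennreal (1 / sqrt (?k z z1)) * ennreal (sqrt (?k z z1)) = 1" for z1
        using k[of z1 z] by (subst ennreal_mult'[symmetric]) (auto simp del: real_sqrt_mult)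
      have "(ennreal (1 / sqrt (?k z z1)) * indicator A (z1, z - z1)) * (ennreal (sqrt (?k z z1)) * (F z1 * G (z - z1)))
        = (ennreal (1 / sqrt (?k z z1)) * ennreal (sqrt (?k z z1))) * (indicator A (z1, z - z1) * (F z1 * G (z - z1)))" for z1
        by (simp only: mult_ac)
      then show ?thesis unfolding bilin_def e by simp
    qed
    also have "\<dots> \<le> (\<integral>\<^sup>+z1. (ennreal (1 / sqrt (?k z z1)) * indicator A (z1, z - z1))\<^sup>2 \<partial>lborel) *
        (\<integral>\<^sup>+z1. (ennreal (sqrt (?k z z1)) * (F z1 * G (z - z1)))\<^sup>2 \<partial>lborel)"
      by (rule Cauchy_Schwarz_nn_integral) measurable
    also have "(\<integral>\<^sup>+z1. (ennreal (1 / sqrt (?k z z1)) * indicator A (z1, z - z1))\<^sup>2 \<partial>lborel)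
       = (\<integral>\<^sup>+z1. ennreal (1 / ?k z z1) * indicator A (z1, z - z1) \<partial>lborel)"
      using k0 by (intro nn_integral_cong)
        (auto simp: power_mult_distrib ennreal_power power_divide split: split_indicator simp del: real_sqrt_mult)
    also have "(\<integral>\<^sup>+z1. (ennreal (sqrt (?k z z1)) * (F z1 * G (z - z1)))\<^sup>2 \<partial>lborel)
       = (\<integral>\<^sup>+z1. (ennreal (\<omega> z1) * (F z1)\<^sup>2) * (ennreal (\<omega> (z - z1)) * (G (z - z1))\<^sup>2) \<partial>lborel)"
    proof (rule nn_integral_cong)
      fix z1
      have "(ennreal (sqrt (?k z z1)))\<^sup>2 = ennreal (\<omega> z1) * ennreal (\<omega> (z - z1))"
        using k0 wpos[of z1] wpos[of "z - z1"] by (simp add: ennreal_power less_imp_le ennreal_mult del: real_sqrt_mult)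
      then show "(ennreal (sqrt (?k z z1)) * (F z1 * G (z - z1)))\<^sup>2 = (ennreal (\<omega> z1) * (F z1)\<^sup>2) * (ennreal (\<omega> (z - z1)) * (G (z - z1))\<^sup>2)"
        by (simp add: power_mult_distrib mult_ac)
    qed
    finally have "ennreal (m z) * (bilin A F G z)\<^sup>2 \<le> (ennreal (m z) * (\<integral>\<^sup>+z1. ennreal (1 / ?k z z1) * indicator A (z1, z - z1) \<partial>lborel)) *
       (\<integral>\<^sup>+z1. (ennreal (\<omega> z1) * (F z1)\<^sup>2) * (ennreal (\<omega> (z - z1)) * (G (z - z1))\<^sup>2) \<partial>lborel)"
      by (simp add: mult_left_mono mult.assoc)
    also have "ennreal (m z) * (\<integral>\<^sup>+z1. ennreal (1 / ?k z z1) * indicator A (z1, z - z1) \<partial>lborel)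
      = (\<integral>\<^sup>+z1. ennreal (m z / (\<omega> z1 * \<omega> (z - z1))) * indicator A (z1, z - z1) \<partial>lborel)"
      using mpos[of z] k0
      by (subst nn_integral_cmult[symmetric]) (auto intro!: nn_integral_cong simp: ennreal_mult'[symmetric] mult.assoc[symmetric])
    also have "\<dots> \<le> ennreal C" by (rule bd)
    finally show ?thesis by (simp add: mult_right_mono)
  qed
  have [measurable]: "(\<lambda>z. \<integral>\<^sup>+z1. (ennreal (\<omega> z1) * (F z1)\<^sup>2) * (ennreal (\<omega> (z - z1)) * (G (z - z1))\<^sup>2) \<partial>lborel) \<in> borel_measurable borel"
    using borel_measurable_nn_integral_lborel[of "\<lambda>p. (ennreal (\<omega> (snd p)) * (F (snd p))\<^sup>2) * (ennreal (\<omega> (fst p - snd p)) * (G (fst p - snd p))\<^sup>2)"]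
    by simp
  have "(\<integral>\<^sup>+z. ennreal (m z) * (bilin A F G z)\<^sup>2 \<partial>lborel)
     \<le> (\<integral>\<^sup>+z. ennreal C * (\<integral>\<^sup>+z1. (ennreal (\<omega> z1) * (F z1)\<^sup>2) * (ennreal (\<omega> (z - z1)) * (G (z - z1))\<^sup>2) \<partial>lborel) \<partial>lborel)"
    by (intro nn_integral_mono pt)
  also have "\<dots> = ennreal C * (\<integral>\<^sup>+z. \<integral>\<^sup>+z1. (ennreal (\<omega> z1) * (F z1)\<^sup>2) * (ennreal (\<omega> (z - z1)) * (G (z - z1))\<^sup>2) \<partial>lborel \<partial>lborel)"
    by (rule nn_integral_cmult) measurable
  also have "(\<integral>\<^sup>+z. \<integral>\<^sup>+z1. (ennreal (\<omega> z1) * (F z1)\<^sup>2) * (ennreal (\<omega> (z - z1)) * (G (z - z1))\<^sup>2) \<partial>lborel \<partial>lborel)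
     = (\<integral>\<^sup>+z1. \<integral>\<^sup>+z. (ennreal (\<omega> z1) * (F z1)\<^sup>2) * (ennreal (\<omega> (z - z1)) * (G (z - z1))\<^sup>2) \<partial>lborel \<partial>lborel)"
    using nn_integral_lborel_swap[of "\<lambda>p. (ennreal (\<omega> (snd p)) * (F (snd p))\<^sup>2) * (ennreal (\<omega> (fst p - snd p)) * (G (fst p - snd p))\<^sup>2)"]
    by simp
  also have "\<dots> = (\<integral>\<^sup>+z1. (ennreal (\<omega> z1) * (F z1)\<^sup>2) * (\<integral>\<^sup>+z. ennreal (\<omega> z) * (G z)\<^sup>2 \<partial>lborel) \<partial>lborel)"
  proof (rule nn_integral_cong)
    fix z1
    have "(\<integral>\<^sup>+z. ennreal (\<omega> (z - z1)) * (G (z - z1))\<^sup>2 \<partial>lborel) = (\<integral>\<^sup>+z. ennreal (\<omega> z) * (G z)\<^sup>2 \<partial>lborel)"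
      using nn_integral_lborel_shift[of "\<lambda>z. ennreal (\<omega> z) * (G z)\<^sup>2" "- z1"] by simp
    moreover have "(\<integral>\<^sup>+z. (ennreal (\<omega> z1) * (F z1)\<^sup>2) * (ennreal (\<omega> (z - z1)) * (G (z - z1))\<^sup>2) \<partial>lborel)
      = (ennreal (\<omega> z1) * (F z1)\<^sup>2) * (\<integral>\<^sup>+z. ennreal (\<omega> (z - z1)) * (G (z - z1))\<^sup>2 \<partial>lborel)"
      by (rule nn_integral_cmult) measurable
    ultimately show "(\<integral>\<^sup>+z. (ennreal (\<omega> z1) * (F z1)\<^sup>2) * (ennreal (\<omega> (z - z1)) * (G (z - z1))\<^sup>2) \<partial>lborel)
      = (ennreal (\<omega> z1) * (F z1)\<^sup>2) * (\<integral>\<^sup>+z. ennreal (\<omega> z) * (G z)\<^sup>2 \<partial>lborel)" by simp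
  qed
  also have "\<dots> = (\<integral>\<^sup>+z. ennreal (\<omega> z) * (F z)\<^sup>2 \<partial>lborel) * (\<integral>\<^sup>+z. ennreal (\<omega> z) * (G z)\<^sup>2 \<partial>lborel)"
    by (rule nn_integral_multc) measurable
  finally show "(\<integral>\<^sup>+z. ennreal (m z) * (bilin A F G z)\<^sup>2 \<partial>lborel)
      \<le> ennreal C * (\<integral>\<^sup>+z. ennreal (\<omega> z) * (F z)\<^sup>2 \<partial>lborel) * (\<integral>\<^sup>+z. ennreal (\<omega> z) * (G z)\<^sup>2 \<partial>lborel)"
    by (simp add: mult.assoc)
qed

text \<open>In Cauchy-Schwarz only the weight of the first input is split off, so its whole norm
  comes out at once. What remains is integrated over the output; in the variables given by the two
  inputs, the second is frozen and the kernel is integrated over the first, which is what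
  \<open>bd\<close> bounds.\<close>

lemma bilin_bounded_fixed_input:
  fixes m \<omega> :: "'a::euclidean_space \<Rightarrow> real"
  assumes m [measurable]: "m \<in> borel_measurable borel" and \<omega> [measurable]: "\<omega> \<in> borel_measurable borel"
    and A [measurable]: "A \<in> sets borel"
    and mpos: "\<And>z. m z \<ge> 0" and wpos: "\<And>z. \<omega> z > 0" and C: "C \<ge> 0"
    and bd: "\<And>z2. (\<integral>\<^sup>+z1. ennreal (m (z1 + z2) / (\<omega> z1 * \<omega> z2)) * indicator A (z1, z2) \<partial>lborel) \<le> ennreal C"
  shows "bilin_bounded m \<omega> A"
  unfolding bilin_bounded_def
proof (intro conjI A exI[of _ C] C ballI)
  fix F G :: "'a \<Rightarrow> ennreal" assume F [measurable]: "F \<in> borel_measurable borel" and G [measurable]: "G \<in> borel_measurable borel"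
  note [measurable] = borel_pair_compose[OF m] borel_pair_compose[OF \<omega>] borel_pair_compose[OF F] borel_pair_compose[OF G] borel_indicator_compose[OF A]
  let ?NF = "(\<integral>\<^sup>+z. ennreal (\<omega> z) * (F z)\<^sup>2 \<partial>lborel)"
  have pt: "ennreal (m z) * (bilin A F G z)\<^sup>2
      \<le> ?NF * (\<integral>\<^sup>+z1. ennreal (m z / \<omega> z1) * (G (z - z1))\<^sup>2 * indicator A (z1, z - z1) \<partial>lborel)" for z
  proof -
    have "(bilin A F G z)\<^sup>2 = (\<integral>\<^sup>+z1. (ennreal (sqrt (\<omega> z1)) * F z1) * (ennreal (1 / sqrt (\<omega> z1)) * G (z - z1) * indicator A (z1, z - z1)) \<partial>lborel)\<^sup>2"
    proof -
      have e: "ennreal (sqrt (\<omega> z1)) * ennreal (1 / sqrt (\<omega> z1)) = 1" for z1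
        using wpos[of z1] by (subst ennreal_mult'[symmetric]) auto
      have "(ennreal (sqrt (\<omega> z1)) * F z1) * (ennreal (1 / sqrt (\<omega> z1)) * G (z - z1) * indicator A (z1, z - z1))
         = (ennreal (sqrt (\<omega> z1)) * ennreal (1 / sqrt (\<omega> z1))) * (indicator A (z1, z - z1) * (F z1 * G (z - z1)))" for z1
        by (simp only: mult_ac)
      then show ?thesis unfolding bilin_def e by simp
    qed
    also have "\<dots> \<le> (\<integral>\<^sup>+z1. (ennreal (sqrt (\<omega> z1)) * F z1)\<^sup>2 \<partial>lborel) *
        (\<integral>\<^sup>+z1. (ennreal (1 / sqrt (\<omega> z1)) * G (z - z1) * indicator A (z1, z - z1))\<^sup>2 \<partial>lborel)"
      by (rule Cauchy_Schwarz_nn_integral) measurable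
    also have "(\<integral>\<^sup>+z1. (ennreal (sqrt (\<omega> z1)) * F z1)\<^sup>2 \<partial>lborel) = ?NF"
      by (intro nn_integral_cong) (auto simp: power_mult_distrib ennreal_power wpos less_imp_le)
    also have "(\<integral>\<^sup>+z1. (ennreal (1 / sqrt (\<omega> z1)) * G (z - z1) * indicator A (z1, z - z1))\<^sup>2 \<partial>lborel)
       = (\<integral>\<^sup>+z1. ennreal (1 / \<omega> z1) * ((G (z - z1))\<^sup>2 * indicator A (z1, z - z1)) \<partial>lborel)"
      by (intro nn_integral_cong)
        (auto simp: power_mult_distrib ennreal_power power_divide wpos less_imp_le split: split_indicator)
    finally have "ennreal (m z) * (bilin A F G z)\<^sup>2 \<le> ?NF * (ennreal (m z) * (\<integral>\<^sup>+z1. ennreal (1 / \<omega> z1) * ((G (z - z1))\<^sup>2 * indicator A (z1, z - z1)) \<partial>lborel))"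
      by (simp add: mult_left_mono mult.left_commute)
    also have "ennreal (m z) * (\<integral>\<^sup>+z1. ennreal (1 / \<omega> z1) * ((G (z - z1))\<^sup>2 * indicator A (z1, z - z1)) \<partial>lborel)
      = (\<integral>\<^sup>+z1. ennreal (m z / \<omega> z1) * (G (z - z1))\<^sup>2 * indicator A (z1, z - z1) \<partial>lborel)"
      using mpos[of z] wpos
      by (subst nn_integral_cmult[symmetric]) (auto intro!: nn_integral_cong simp: ennreal_mult'[symmetric] mult.assoc[symmetric])
    finally show ?thesis .
  qed
  let ?h = "\<lambda>p. ennreal (m (fst p) / \<omega> (snd p)) * (G (fst p - snd p))\<^sup>2 * indicator A (snd p, fst p - snd p)"
  have h: "?h \<in> borel_measurable borel" by measurable
  let ?h' = "\<lambda>p. ennreal (m (fst p + snd p) / \<omega> (fst p)) * (G (snd p))\<^sup>2 * indicator A p"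
  have h': "?h' \<in> borel_measurable borel" by measurable
  have [measurable]: "(\<lambda>z. \<integral>\<^sup>+z1. ennreal (m z / \<omega> z1) * (G (z - z1))\<^sup>2 * indicator A (z1, z - z1) \<partial>lborel) \<in> borel_measurable borel"
    using borel_measurable_nn_integral_lborel[OF h] by simp
  have "(\<integral>\<^sup>+z. ennreal (m z) * (bilin A F G z)\<^sup>2 \<partial>lborel)
     \<le> (\<integral>\<^sup>+z. ?NF * (\<integral>\<^sup>+z1. ennreal (m z / \<omega> z1) * (G (z - z1))\<^sup>2 * indicator A (z1, z - z1) \<partial>lborel) \<partial>lborel)"
    by (intro nn_integral_mono pt)
  also have "\<dots> = ?NF * (\<integral>\<^sup>+z. \<integral>\<^sup>+z1. ?h (z, z1) \<partial>lborel \<partial>lborel)"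
    by (subst nn_integral_cmult) simp_all
  also have "(\<integral>\<^sup>+z. \<integral>\<^sup>+z1. ?h (z, z1) \<partial>lborel \<partial>lborel) = (\<integral>\<^sup>+z1. \<integral>\<^sup>+z. ?h (z, z1) \<partial>lborel \<partial>lborel)"
    by (rule nn_integral_lborel_swap[OF h])
  \<comment> \<open>For fixed \<open>z1\<close> the output is written as \<open>z1 + z2\<close>,
    which makes the second input an independent variable.\<close>
  also have "\<dots> = (\<integral>\<^sup>+z1. \<integral>\<^sup>+z2. ?h' (z1, z2) \<partial>lborel \<partial>lborel)"
  proof (rule nn_integral_cong)
    fix z1 :: 'a
    have "(\<lambda>z::'a. (z, z1)) \<in> borel_measurable borel" by (rule borel_pair_maps(8))
    from measurable_compose[OF this h] have "(\<lambda>z. ?h (z, z1)) \<in> borel_measurable borel" .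
    from nn_integral_lborel_shift[OF this, of z1]
    show "(\<integral>\<^sup>+z. ?h (z, z1) \<partial>lborel) = (\<integral>\<^sup>+z2. ?h' (z1, z2) \<partial>lborel)" by simp
  qed
  also have "\<dots> = (\<integral>\<^sup>+z2. \<integral>\<^sup>+z1. ?h' (z1, z2) \<partial>lborel \<partial>lborel)"
    by (rule nn_integral_lborel_swap[OF h'])
  also have "\<dots> \<le> (\<integral>\<^sup>+z2. ennreal C * (ennreal (\<omega> z2) * (G z2)\<^sup>2) \<partial>lborel)"
  proof (rule nn_integral_mono)
    fix z2
    have [measurable]: "(\<lambda>z1. m (z1 + z2)) \<in> borel_measurable borel"
      using measurable_compose[OF borel_measurable_continuous_onI m, of "\<lambda>z1. z1 + z2"] by (auto intro: continuous_intros)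
    \<comment> \<open>The weight of the second input, absent so far, is inserted and removed: one
      copy completes its norm, the other completes the kernel of \<open>bd\<close>.\<close>
    have e: "ennreal (m (z1 + z2) / \<omega> z1) = ennreal (\<omega> z2) * ennreal (m (z1 + z2) / (\<omega> z1 * \<omega> z2))" for z1
      using wpos[of z1] wpos[of z2] mpos[of "z1 + z2"] by (subst ennreal_mult[symmetric]) auto
    have "(\<integral>\<^sup>+z1. ?h' (z1, z2) \<partial>lborel) = (\<integral>\<^sup>+z1. (ennreal (\<omega> z2) * (G z2)\<^sup>2) * (ennreal (m (z1 + z2) / (\<omega> z1 * \<omega> z2)) * indicator A (z1, z2)) \<partial>lborel)"
      by (intro nn_integral_cong) (simp add: e mult_ac)
    also have "\<dots> = (ennreal (\<omega> z2) * (G z2)\<^sup>2) * (\<integral>\<^sup>+z1. ennreal (m (z1 + z2) / (\<omega> z1 * \<omega> z2)) * indicator A (z1, z2) \<partial>lborel)"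
      by (rule nn_integral_cmult) measurable
    also have "\<dots> \<le> (ennreal (\<omega> z2) * (G z2)\<^sup>2) * ennreal C" by (intro mult_left_mono bd) simp
    finally show "(\<integral>\<^sup>+z1. ?h' (z1, z2) \<partial>lborel) \<le> ennreal C * (ennreal (\<omega> z2) * (G z2)\<^sup>2)" by (simp add: mult.commute)
  qed
  also have "\<dots> = ennreal C * (\<integral>\<^sup>+z. ennreal (\<omega> z) * (G z)\<^sup>2 \<partial>lborel)"
    by (rule nn_integral_cmult) measurable
  finally show "(\<integral>\<^sup>+z. ennreal (m z) * (bilin A F G z)\<^sup>2 \<partial>lborel)
      \<le> ennreal C * ?NF * (\<integral>\<^sup>+z. ennreal (\<omega> z) * (G z)\<^sup>2 \<partial>lborel)"
    by (simp add: mult_left_mono mult_right_mono mult_ac)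
qed

lemma bilin_swap:
  assumes [measurable]: "A \<in> sets borel" "F \<in> borel_measurable borel" "G \<in> borel_measurable borel"
  shows "bilin {p. (snd p, fst p) \<in> A} F G z = bilin A G F z"
proof -
  have [measurable]: "(\<lambda>x. indicator A (x, z - x) * (G x * F (z - x))) \<in> borel_measurable borel"
    by (intro borel_bilin_integrand) measurable
  show ?thesis unfolding bilin_def
    by (subst nn_integral_lborel_reflect[symmetric, where c = z])
       (auto intro!: nn_integral_cong simp: indicator_def mult.commute)
qed

text \<open>Convolution is commutative, so a region and its mirror image are bounded together. Hence
  any region that singles out one input need be treated only for one choice of that input.\<close>

lemma bilin_bounded_swap:
  assumes "bilin_bounded m \<omega> A"
  shows "bilin_bounded m \<omega> {p. (snd p, fst p) \<in> A}"
proof -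
  have A: "A \<in> sets borel" using assms by (simp add: bilin_bounded_def)
  have "{p. (snd p, fst p) \<in> A} \<in> sets borel"
    using measurable_sets[OF borel_pair_maps(2) A] by (simp add: vimage_def)
  then show ?thesis using assms
    unfolding bilin_bounded_def by (fastforce simp: bilin_swap mult_ac)
qed

text \<open>The convolution restricted to a union is at most the sum of the two restricted ones, and
  (a + b)^2 <= 2 (a^2 + b^2). The frequency regions may therefore overlap, and each can be described
  by closed conditions.\<close>

lemma bilin_bounded_Un:
  assumes m [measurable]: "m \<in> borel_measurable borel"
    and "bilin_bounded m \<omega> A" "bilin_bounded m \<omega> B"
  shows "bilin_bounded m \<omega> (A \<union> B)"
proof -
  have sets [measurable]: "A \<in> sets borel" "B \<in> sets borel" using assms by (auto simp: bilin_bounded_def)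
  from assms obtain C D where CD: "C \<ge> 0" "D \<ge> 0" and
    C: "\<And>F G. F \<in> borel_measurable borel \<Longrightarrow> G \<in> borel_measurable borel \<Longrightarrow> (\<integral>\<^sup>+z. ennreal (m z) * (bilin A F G z)\<^sup>2 \<partial>lborel)
      \<le> ennreal C * (\<integral>\<^sup>+z. ennreal (\<omega> z) * (F z)\<^sup>2 \<partial>lborel) * (\<integral>\<^sup>+z. ennreal (\<omega> z) * (G z)\<^sup>2 \<partial>lborel)" and
    D: "\<And>F G. F \<in> borel_measurable borel \<Longrightarrow> G \<in> borel_measurable borel \<Longrightarrow> (\<integral>\<^sup>+z. ennreal (m z) * (bilin B F G z)\<^sup>2 \<partial>lborel)
      \<le> ennreal D * (\<integral>\<^sup>+z. ennreal (\<omega> z) * (F z)\<^sup>2 \<partial>lborel) * (\<integral>\<^sup>+z. ennreal (\<omega> z) * (G z)\<^sup>2 \<partial>lborel)"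
    unfolding bilin_bounded_def by blast
  show ?thesis unfolding bilin_bounded_def
  proof (intro conjI exI[of _ "2 * (C + D)"] ballI)
    fix F G :: "'a \<Rightarrow> ennreal" assume F [measurable]: "F \<in> borel_measurable borel" and G [measurable]: "G \<in> borel_measurable borel"
    note [measurable] = borel_pair_compose[OF m] borel_pair_compose[OF F] borel_pair_compose[OF G] borel_indicator_compose
    have [measurable]: "bilin E F G \<in> borel_measurable borel" if "E \<in> sets borel" for E
    proof -
      have "(\<lambda>p. indicator E (snd p, fst p - snd p) * (F (snd p) * G (fst p - snd p))) \<in> borel_measurable borel"
        by (rule borel_bilin_integrand[OF that F G])
      from borel_measurable_nn_integral_lborel[OF this] show ?thesis by (simp add: bilin_def[abs_def])
    qed
    have "ennreal (m z) * (bilin (A \<union> B) F G z)\<^sup>2 \<le> ennreal 2 * (ennreal (m z) * (bilin A F G z)\<^sup>2 + ennreal (m z) * (bilin B F G z)\<^sup>2)" for z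
    proof -
      have "bilin (A \<union> B) F G z \<le> (\<integral>\<^sup>+z1. indicator A (z1, z - z1) * (F z1 * G (z - z1)) + indicator B (z1, z - z1) * (F z1 * G (z - z1)) \<partial>lborel)"
        unfolding bilin_def by (intro nn_integral_mono) (auto split: split_indicator)
      also have "\<dots> = bilin A F G z + bilin B F G z" unfolding bilin_def
        using borel_bilin_integrand(1)[OF _ F G] sets by (intro nn_integral_add) auto
      finally have "(bilin (A \<union> B) F G z)\<^sup>2 \<le> (bilin A F G z + bilin B F G z)\<^sup>2" by (rule power_mono) simp
      also have "\<dots> \<le> 2 * ((bilin A F G z)\<^sup>2 + (bilin B F G z)\<^sup>2)"
      proof -
        note sum_of_squares_ge_ennreal[of "bilin A F G z" "bilin B F G z"]
        from add_left_mono[OF this, of "(bilin A F G z)\<^sup>2 + (bilin B F G z)\<^sup>2"]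
        show ?thesis by (simp add: power2_sum mult_2 add_ac)
      qed
      finally have "(bilin (A \<union> B) F G z)\<^sup>2 \<le> 2 * ((bilin A F G z)\<^sup>2 + (bilin B F G z)\<^sup>2)" .
      from mult_left_mono[OF this, of "ennreal (m z)"] show ?thesis by (simp add: distrib_left mult_ac)
    qed
    then have "(\<integral>\<^sup>+z. ennreal (m z) * (bilin (A \<union> B) F G z)\<^sup>2 \<partial>lborel)
      \<le> (\<integral>\<^sup>+z. ennreal 2 * (ennreal (m z) * (bilin A F G z)\<^sup>2 + ennreal (m z) * (bilin B F G z)\<^sup>2) \<partial>lborel)"
      by (intro nn_integral_mono)
    also have "\<dots> = ennreal 2 * ((\<integral>\<^sup>+z. ennreal (m z) * (bilin A F G z)\<^sup>2 \<partial>lborel) + (\<integral>\<^sup>+z. ennreal (m z) * (bilin B F G z)\<^sup>2 \<partial>lborel))"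
      by (simp add: nn_integral_cmult nn_integral_add sets)
    also have "\<dots> \<le> ennreal 2 * (ennreal C * (\<integral>\<^sup>+z. ennreal (\<omega> z) * (F z)\<^sup>2 \<partial>lborel) * (\<integral>\<^sup>+z. ennreal (\<omega> z) * (G z)\<^sup>2 \<partial>lborel) +
       ennreal D * (\<integral>\<^sup>+z. ennreal (\<omega> z) * (F z)\<^sup>2 \<partial>lborel) * (\<integral>\<^sup>+z. ennreal (\<omega> z) * (G z)\<^sup>2 \<partial>lborel))"
      by (intro mult_left_mono add_mono C D) auto
    also have "\<dots> = ennreal (2 * (C + D)) * (\<integral>\<^sup>+z. ennreal (\<omega> z) * (F z)\<^sup>2 \<partial>lborel) * (\<integral>\<^sup>+z. ennreal (\<omega> z) * (G z)\<^sup>2 \<partial>lborel)"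
      using CD by (simp add: ennreal_mult ennreal_plus distrib_right distrib_left mult_ac)
    finally show "(\<integral>\<^sup>+z. ennreal (m z) * (bilin (A \<union> B) F G z)\<^sup>2 \<partial>lborel) \<le> ennreal (2 * (C + D)) * (\<integral>\<^sup>+z. ennreal (\<omega> z) * (F z)\<^sup>2 \<partial>lborel) * (\<integral>\<^sup>+z. ennreal (\<omega> z) * (G z)\<^sup>2 \<partial>lborel)" .
  qed (use CD sets in auto)
qed

section \<open>Reduction to level-set integrals\<close>

lemma jbr_powr_le_1: "a \<ge> 0 \<Longrightarrow> jbr x powr (- a) \<le> 1"
  using powr_mono[of "-a" 0 "jbr x"] jbr_ge_1[of x] by (simp add: jbr_neq_0)

lemma jbr_mono: "\<bar>x\<bar> \<le> \<bar>y\<bar> \<Longrightarrow> jbr x \<le> jbr y" by (simp add: jbr_def)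

lemma jbr_powr_antimono: "0 \<le> a \<Longrightarrow> jbr x \<le> jbr y \<Longrightarrow> jbr y powr (- a) \<le> jbr x powr (- a)"
  using jbr_pos[of x] by (intro powr_mono2') auto

text \<open>The larger bracket is at least half the bracket of the sum and can take over the
  exponent \<gamma>. If the larger one is the one with exponent \<beta>, its surplus \<beta> -
  \<gamma> is handed to the smaller one, so a full power \<beta> remains in either case.\<close>

lemma jbr_product_le:
  assumes "0 \<le> \<gamma>" "\<gamma> \<le> \<beta>"
  shows "jbr x powr (-\<gamma>) * jbr y powr (-\<beta>) \<le> 2 powr \<gamma> * jbr (x + y) powr (-\<gamma>) * (jbr x powr (-\<beta>) + jbr y powr (-\<beta>))"
proof -
  have half: "jbr u powr (-\<gamma>) \<le> 2 powr \<gamma> * jbr (x + y) powr (-\<gamma>)" if "jbr (x + y) \<le> 2 * jbr u" for u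
  proof -
    have "jbr u powr (-\<gamma>) \<le> (jbr (x + y) / 2) powr (-\<gamma>)"
      using that assms jbr_pos[of "x + y"] by (intro powr_mono2') auto
    also have "\<dots> = 2 powr \<gamma> * jbr (x + y) powr (-\<gamma>)"
      using jbr_pos[of "x + y"] by (simp add: powr_divide powr_minus field_simps)
    finally show ?thesis .
  qed
  have sum: "jbr (x + y) \<le> jbr x + jbr y" by (simp add: jbr_def)
  show ?thesis
  proof (cases "jbr x \<ge> jbr y")
    case True
    then have "jbr x powr (-\<gamma>) * jbr y powr (-\<beta>) \<le> (2 powr \<gamma> * jbr (x + y) powr (-\<gamma>)) * jbr y powr (-\<beta>)"
      using sum by (intro mult_right_mono half) auto
    also have "\<dots> \<le> (2 powr \<gamma> * jbr (x + y) powr (-\<gamma>)) * (jbr x powr (-\<beta>) + jbr y powr (-\<beta>))"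
      by (intro mult_left_mono) auto
    finally show ?thesis .
  next
    case False
    have "jbr x powr (-\<gamma>) * jbr y powr (-\<beta>) = jbr y powr (-\<gamma>) * (jbr x powr (-\<gamma>) * jbr y powr (-(\<beta> - \<gamma>)))"
      by (simp add: powr_add[symmetric] mult.left_commute)
    also have "\<dots> \<le> (2 powr \<gamma> * jbr (x + y) powr (-\<gamma>)) * (jbr x powr (-\<gamma>) * jbr x powr (-(\<beta> - \<gamma>)))"
      using False sum assms by (intro mult_mono half jbr_powr_antimono mult_nonneg_nonneg) auto
    also have "jbr x powr (-\<gamma>) * jbr x powr (-(\<beta> - \<gamma>)) = jbr x powr (-\<beta>)"
      by (simp add: powr_add[symmetric])
    also have "(2 powr \<gamma> * jbr (x + y) powr (-\<gamma>)) * jbr x powr (-\<beta>) \<le> (2 powr \<gamma> * jbr (x + y) powr (-\<gamma>)) * (jbr x powr (-\<beta>) + jbr y powr (-\<beta>))"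
      by (intro mult_left_mono) auto
    finally show ?thesis .
  qed
qed

text \<open>Convolving two brackets keeps the weaker decay, provided the stronger one is integrable.
  It serves with \<open>\<gamma>\<close> equal to \<open>\<beta>\<close> when the output is fixed
  and with \<open>\<gamma>\<close> < \<open>\<beta>\<close> when an input is fixed.\<close>

lemma tau_integral:
  assumes "0 \<le> \<gamma>" "\<gamma> \<le> \<beta>" "\<beta> > 1"
  shows "(\<integral>\<^sup>+t. ennreal (jbr (c - t) powr (-\<gamma>) * jbr (t - a) powr (-\<beta>)) \<partial>lborel)
     \<le> ennreal (2 powr \<gamma> * 2 * jint \<beta> * jbr (c - a) powr (-\<gamma>))"
proof -
  let ?k = "2 powr \<gamma> * jbr (c - a) powr (-\<gamma>)"
  have m: "(\<lambda>t. ennreal (jbr t powr (-\<beta>))) \<in> borel_measurable borel" by measurable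
  have [measurable]: "(\<lambda>t. jbr (c - t)) \<in> borel_measurable borel" "(\<lambda>t. jbr (t - a)) \<in> borel_measurable borel" by measurable
  have "(\<integral>\<^sup>+t. ennreal (jbr (c - t) powr (-\<gamma>) * jbr (t - a) powr (-\<beta>)) \<partial>lborel)
     \<le> (\<integral>\<^sup>+t. ennreal ?k * (ennreal (jbr (c - t) powr (-\<beta>)) + ennreal (jbr (t - a) powr (-\<beta>))) \<partial>lborel)"
  proof (rule nn_integral_mono)
    fix t
    show "ennreal (jbr (c - t) powr (-\<gamma>) * jbr (t - a) powr (-\<beta>))
       \<le> ennreal ?k * (ennreal (jbr (c - t) powr (-\<beta>)) + ennreal (jbr (t - a) powr (-\<beta>)))"
      using jbr_product_le[OF assms(1,2), of "c - t" "t - a"]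
      by (simp add: ennreal_plus[symmetric] ennreal_mult[symmetric] ennreal_leI del: ennreal_plus)
  qed
  also have "\<dots> = ennreal ?k * ((\<integral>\<^sup>+t. ennreal (jbr (c - t) powr (-\<beta>)) \<partial>lborel) + (\<integral>\<^sup>+t. ennreal (jbr (t - a) powr (-\<beta>)) \<partial>lborel))"
    by (subst nn_integral_cmult, measurable, subst nn_integral_add) simp_all
  also have "(\<integral>\<^sup>+t. ennreal (jbr (c - t) powr (-\<beta>)) \<partial>lborel) = ennreal (jint \<beta>)"
    using nn_integral_lborel_reflect[OF m, of c] by (simp add: nn_integral_jbr assms)
  also have "(\<integral>\<^sup>+t. ennreal (jbr (t - a) powr (-\<beta>)) \<partial>lborel) = ennreal (jint \<beta>)"
    using nn_integral_lborel_shift[OF m, of "-a"] by (simp add: nn_integral_jbr assms)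
  also have "ennreal ?k * (ennreal (jint \<beta>) + ennreal (jint \<beta>)) = ennreal (2 powr \<gamma> * 2 * jint \<beta> * jbr (c - a) powr (-\<gamma>))"
    using jint_nonneg[of \<beta>] by (simp add: ennreal_plus[symmetric] ennreal_mult[symmetric] mult_ac del: ennreal_plus)
  finally show ?thesis .
qed

lemma freq_norm_triangle: "freq_norm (a + c) (b + d) \<le> freq_norm a b + freq_norm c d"
proof -
  have "freq_norm x y = sqrt ((sqrt 3 * x)\<^sup>2 + y\<^sup>2)" for x y
    by (simp add: freq_norm_def power_mult_distrib)
  then show ?thesis
    using real_sqrt_sum_squares_triangle_ineq[of "sqrt 3 * a" "sqrt 3 * c" b d] by (simp add: distrib_left)
qed

lemma freq_norm_minus: "freq_norm (- a) (- b) = freq_norm a b" by (simp add: freq_norm_def)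

lemma freq_norm_diff: "freq_norm (a - c) (b - d) = freq_norm (c - a) (d - b)"
  using freq_norm_minus[of "a - c" "b - d"] by simp

text \<open>\<open>rr\<close> is the size of the spatial frequency. \<open>sg\<close> is the
  modulation, the signed distance in \<tau> from the characteristic surface of the equation.\<close>

definition rr :: "R3 \<Rightarrow> real" where "rr z = freq_norm (fst z) (fst (snd z))"
definition sg :: "R3 \<Rightarrow> real" where "sg z = snd (snd z) - w (fst z) (fst (snd z))"
definition wt :: "real \<Rightarrow> real \<Rightarrow> R3 \<Rightarrow> real" where
  "wt s b z = jbr (sg z) powr (2 * b) * jbr (rr z) powr (2 * s)"

lemma freq_norm_continuous [continuous_intros]:
  "continuous_on A f \<Longrightarrow> continuous_on A g \<Longrightarrow> continuous_on A (\<lambda>x. freq_norm (f x) (g x))"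
  unfolding freq_norm_def by (intro continuous_intros)

lemma w_continuous [continuous_intros]:
  "continuous_on A f \<Longrightarrow> continuous_on A g \<Longrightarrow> continuous_on A (\<lambda>x. w (f x) (g x))"
  unfolding w_def by (intro continuous_intros)

lemma jbr_powr_continuous [continuous_intros]:
  "continuous_on A f \<Longrightarrow> continuous_on A (\<lambda>x. jbr (f x) powr a)"
  by (intro continuous_intros) (simp_all add: jbr_neq_0)

lemma wt_continuous: "continuous_on A (wt s b)"
  unfolding wt_def[abs_def] rr_def sg_def by (intro continuous_intros)

lemma wt_measurable [measurable]: "wt s b \<in> borel_measurable borel"
  by (intro borel_measurable_continuous_onI wt_continuous)

lemma wt_pos: "wt s b z > 0" by (simp add: wt_def jbr_neq_0)

lemma ennreal_regroup:
  assumes "a \<ge> 0" "k \<ge> 0" "x \<ge> 0"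
  shows "(ennreal a * i) * ennreal (k * x) = ennreal k * (ennreal (a * x) * i)"
  using assms by (simp add: ennreal_mult mult_ac)

lemma nn_integral_R3_le:
  fixes f :: "R3 \<Rightarrow> ennreal" and g :: "real \<times> real \<Rightarrow> ennreal"
  assumes [measurable]: "f \<in> borel_measurable borel" "g \<in> borel_measurable borel"
    and le: "\<And>\<xi> \<mu>. (\<integral>\<^sup>+\<tau>. f (\<xi>, \<mu>, \<tau>) \<partial>lborel) \<le> K * g (\<xi>, \<mu>)"
  shows "(\<integral>\<^sup>+z. f z \<partial>lborel) \<le> K * (\<integral>\<^sup>+x. g x \<partial>lborel)"
proof -
  have s: "(\<lambda>y. f (\<xi>, y)) \<in> borel_measurable borel" for \<xi>
    by (rule measurable_compose[OF borel_measurable_continuous_onI]) (auto intro: continuous_intros)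
  have g2: "(\<lambda>y. g (\<xi>, y)) \<in> borel_measurable borel" for \<xi>
    by (rule measurable_compose[OF borel_measurable_continuous_onI]) (auto intro: continuous_intros)
  have "(\<integral>\<^sup>+z. f z \<partial>lborel) = (\<integral>\<^sup>+\<xi>. \<integral>\<^sup>+\<mu>. \<integral>\<^sup>+\<tau>. f (\<xi>, \<mu>, \<tau>) \<partial>lborel \<partial>lborel \<partial>lborel)"
    by (simp add: nn_integral_lborel_prod s)
  also have "\<dots> \<le> (\<integral>\<^sup>+\<xi>. \<integral>\<^sup>+\<mu>. K * g (\<xi>, \<mu>) \<partial>lborel \<partial>lborel)"
    by (intro nn_integral_mono le)
  also have "\<dots> = (\<integral>\<^sup>+\<xi>. K * (\<integral>\<^sup>+\<mu>. g (\<xi>, \<mu>) \<partial>lborel) \<partial>lborel)"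
    using g2 by (simp add: nn_integral_cmult)
  also have "\<dots> = K * (\<integral>\<^sup>+\<xi>. (\<integral>\<^sup>+\<mu>. g (\<xi>, \<mu>) \<partial>lborel) \<partial>lborel)"
    by (rule nn_integral_cmult) (use borel_measurable_nn_integral_lborel[OF assms(2)] in simp)
  also have "(\<integral>\<^sup>+\<xi>. (\<integral>\<^sup>+\<mu>. g (\<xi>, \<mu>) \<partial>lborel) \<partial>lborel) = (\<integral>\<^sup>+x. g x \<partial>lborel)"
    by (simp add: nn_integral_lborel_prod)
  finally show ?thesis .
qed

text \<open>The squared symbol of the x-derivative times the squared weight of the output norm; the
  modulation thus carries the power -\<gamma>.\<close>

definition mult_weight :: "real \<Rightarrow> real \<Rightarrow> R3 \<Rightarrow> real" where
  "mult_weight s \<gamma> z = (fst z)\<^sup>2 * wt s (-\<gamma>/2) z"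

definition zk_bounded :: "real \<Rightarrow> real \<Rightarrow> real \<Rightarrow> (R3 \<times> R3) set \<Rightarrow> bool" where
  "zk_bounded s \<beta> \<gamma> = bilin_bounded (mult_weight s \<gamma>) (wt s (\<beta> / 2))"

text \<open>This is the part of the kernel that depends on the spatial frequencies alone. The rest
  consists of brackets of modulations, one of whose variables can be integrated out.\<close>

definition freq3 :: "real \<Rightarrow> real \<times> real \<Rightarrow> real \<times> real \<Rightarrow> real" where
  "freq3 s x y = (fst x + fst y)\<^sup>2 * jbr (freq_norm (fst x + fst y) (snd x + snd y)) powr (2 * s) *
     jbr (freq_norm (fst x) (snd x)) powr (- 2 * s) * jbr (freq_norm (fst y) (snd y)) powr (- 2 * s)"

context
  fixes s \<delta> \<beta> \<gamma> :: real
  assumes s: "s > 1 / 2" and \<delta>: "\<delta> > 0" "21 * \<delta> \<le> 2 * s - 1" "8 * \<delta> \<le> 1"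
    and \<beta>: "\<beta> = 1 + 2 * \<delta>" and \<gamma>: "\<gamma> = 1 - 4 * \<delta>"
begin

lemma mult_weight_measurable: "mult_weight s \<gamma> \<in> borel_measurable borel"
  unfolding mult_weight_def[abs_def] by (intro borel_measurable_continuous_onI continuous_intros wt_continuous)

lemma mult_weight_nonneg: "mult_weight s \<gamma> z \<ge> 0"
  using wt_pos[of s "-\<gamma>/2" z] by (simp add: mult_weight_def)

lemma kernel_eq:
  "mult_weight s \<gamma> ((\<xi>1, \<mu>1, \<tau>1) + (\<xi>2, \<mu>2, \<tau>2)) / (wt s (\<beta> / 2) (\<xi>1, \<mu>1, \<tau>1) * wt s (\<beta> / 2) (\<xi>2, \<mu>2, \<tau>2)) =
    freq3 s (\<xi>1, \<mu>1) (\<xi>2, \<mu>2) * jbr (\<tau>1 + \<tau>2 - w (\<xi>1 + \<xi>2) (\<mu>1 + \<mu>2)) powr (-\<gamma>) * jbr (\<tau>1 - w \<xi>1 \<mu>1) powr (-\<beta>) * jbr (\<tau>2 - w \<xi>2 \<mu>2) powr (-\<beta>)"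
proof -
  have e: "2 * (\<beta> / 2) = \<beta>" "2 * (- \<gamma> / 2) = - \<gamma>" "- 2 * s = - (2 * s)" by simp_all
  show ?thesis
    unfolding mult_weight_def wt_def freq3_def rr_def sg_def e add_Pair fst_conv snd_conv unfolding powr_minus divide_inverse inverse_mult_distrib
    by (simp only: mult_ac)
qed

lemma freq3_nonneg: "freq3 s x y \<ge> 0" by (simp add: freq3_def)

lemma freq3_continuous: "continuous_on A f \<Longrightarrow> continuous_on A g \<Longrightarrow> continuous_on A (\<lambda>x. freq3 s (f x) (g x))"
  unfolding freq3_def by (intro continuous_intros)

lemma zk_fixed_output:
  fixes P :: "R3 \<Rightarrow> real \<times> real \<Rightarrow> bool"
  assumes A: "A = {p. P (fst p + snd p) (fst (fst p), fst (snd (fst p)))}" "closed A"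
    and P: "\<And>z. closed {x. P z x}" and C: "C \<ge> 0"
    and bd: "\<And>\<xi> \<mu> \<tau>. (\<integral>\<^sup>+x. ennreal (freq3 s x (\<xi> - fst x, \<mu> - snd x) * jbr (\<tau> - w \<xi> \<mu>) powr (-\<gamma>) *
        jbr (\<tau> - ph \<xi> \<mu> (fst x) (snd x)) powr (-\<beta>)) * indicator {x. P (\<xi>, \<mu>, \<tau>) x} x \<partial>lborel) \<le> ennreal C"
  shows "zk_bounded s \<beta> \<gamma> A"
  unfolding zk_bounded_def
proof (rule bilin_bounded_fixed_output[OF mult_weight_measurable wt_measurable _ mult_weight_nonneg wt_pos])
  let ?K = "2 powr \<beta> * 2 * jint \<beta>"
  show A': "A \<in> sets borel" using A(2) by auto
  show "0 \<le> ?K * C" using C jint_nonneg[of \<beta>] by simp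
  fix z :: R3
  obtain \<xi> \<mu> \<tau> where z: "z = (\<xi>, \<mu>, \<tau>)" by (cases z)
  have [measurable]: "(\<lambda>z1. ennreal (mult_weight s \<gamma> z / (wt s (\<beta> / 2) z1 * wt s (\<beta> / 2) (z - z1))) * indicator A (z1, z - z1)) \<in> borel_measurable borel"
    using borel_pair_compose(5)[OF wt_measurable] mult_weight_measurable borel_indicator_compose(2)[OF A']
    by (intro borel_measurable_times_ennreal) auto
  let ?g = "\<lambda>x. ennreal (freq3 s x (\<xi> - fst x, \<mu> - snd x) * jbr (\<tau> - w \<xi> \<mu>) powr (-\<gamma>) *
        jbr (\<tau> - ph \<xi> \<mu> (fst x) (snd x)) powr (-\<beta>)) * indicator {x. P (\<xi>, \<mu>, \<tau>) x} x"
  have "(\<lambda>x. freq3 s x (\<xi> - fst x, \<mu> - snd x) * jbr (\<tau> - w \<xi> \<mu>) powr (-\<gamma>) *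
        jbr (\<tau> - ph \<xi> \<mu> (fst x) (snd x)) powr (-\<beta>)) \<in> borel_measurable borel"
    unfolding ph_def by (intro borel_measurable_continuous_onI continuous_intros freq3_continuous)
  then have g: "?g \<in> borel_measurable borel" using P[of "(\<xi>, \<mu>, \<tau>)"]
    by (intro borel_measurable_times_ennreal) auto
  have "(\<integral>\<^sup>+z1. ennreal (mult_weight s \<gamma> z / (wt s (\<beta> / 2) z1 * wt s (\<beta> / 2) (z - z1))) * indicator A (z1, z - z1) \<partial>lborel)
      \<le> ennreal ?K * (\<integral>\<^sup>+x. ?g x \<partial>lborel)"
  proof (rule nn_integral_R3_le[OF _ g])
    fix \<xi>1 \<mu>1
    let ?f = "freq3 s (\<xi>1, \<mu>1) (\<xi> - \<xi>1, \<mu> - \<mu>1) * jbr (\<tau> - w \<xi> \<mu>) powr (-\<gamma>)"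
    have f0: "?f \<ge> 0" by (simp add: freq3_nonneg)
    have "(\<integral>\<^sup>+\<tau>1. ennreal (mult_weight s \<gamma> z / (wt s (\<beta> / 2) (\<xi>1, \<mu>1, \<tau>1) * wt s (\<beta> / 2) (z - (\<xi>1, \<mu>1, \<tau>1)))) * indicator A ((\<xi>1, \<mu>1, \<tau>1), z - (\<xi>1, \<mu>1, \<tau>1)) \<partial>lborel)
      = (\<integral>\<^sup>+\<tau>1. (ennreal ?f * indicator {x. P (\<xi>, \<mu>, \<tau>) x} (\<xi>1, \<mu>1)) * ennreal (jbr ((\<tau> - w (\<xi> - \<xi>1) (\<mu> - \<mu>1)) - \<tau>1) powr (-\<beta>) * jbr (\<tau>1 - w \<xi>1 \<mu>1) powr (-\<beta>)) \<partial>lborel)"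
    proof (rule nn_integral_cong)
      fix \<tau>1
      have e: "mult_weight s \<gamma> z / (wt s (\<beta> / 2) (\<xi>1, \<mu>1, \<tau>1) * wt s (\<beta> / 2) (z - (\<xi>1, \<mu>1, \<tau>1))) =
          ?f * (jbr ((\<tau> - w (\<xi> - \<xi>1) (\<mu> - \<mu>1)) - \<tau>1) powr (-\<beta>) * jbr (\<tau>1 - w \<xi>1 \<mu>1) powr (-\<beta>))"
        using kernel_eq[of \<xi>1 \<mu>1 \<tau>1 "\<xi> - \<xi>1" "\<mu> - \<mu>1" "\<tau> - \<tau>1"] by (simp add: z algebra_simps)
      show "ennreal (mult_weight s \<gamma> z / (wt s (\<beta> / 2) (\<xi>1, \<mu>1, \<tau>1) * wt s (\<beta> / 2) (z - (\<xi>1, \<mu>1, \<tau>1)))) * indicator A ((\<xi>1, \<mu>1, \<tau>1), z - (\<xi>1, \<mu>1, \<tau>1))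
        = (ennreal ?f * indicator {x. P (\<xi>, \<mu>, \<tau>) x} (\<xi>1, \<mu>1)) * ennreal (jbr ((\<tau> - w (\<xi> - \<xi>1) (\<mu> - \<mu>1)) - \<tau>1) powr (-\<beta>) * jbr (\<tau>1 - w \<xi>1 \<mu>1) powr (-\<beta>))"
        unfolding e using f0 by (subst ennreal_mult) (auto simp: A(1) z indicator_def)
    qed
    also have "\<dots> = (ennreal ?f * indicator {x. P (\<xi>, \<mu>, \<tau>) x} (\<xi>1, \<mu>1)) * (\<integral>\<^sup>+\<tau>1. ennreal (jbr ((\<tau> - w (\<xi> - \<xi>1) (\<mu> - \<mu>1)) - \<tau>1) powr (-\<beta>) * jbr (\<tau>1 - w \<xi>1 \<mu>1) powr (-\<beta>)) \<partial>lborel)"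
      by (rule nn_integral_cmult) measurable
    also have "\<dots> \<le> (ennreal ?f * indicator {x. P (\<xi>, \<mu>, \<tau>) x} (\<xi>1, \<mu>1)) * ennreal (?K * jbr (\<tau> - w (\<xi> - \<xi>1) (\<mu> - \<mu>1) - w \<xi>1 \<mu>1) powr (-\<beta>))"
      using \<delta> \<beta> by (intro mult_left_mono tau_integral) auto
    also have "\<tau> - w (\<xi> - \<xi>1) (\<mu> - \<mu>1) - w \<xi>1 \<mu>1 = \<tau> - ph \<xi> \<mu> \<xi>1 \<mu>1" by (simp add: ph_def)
    also have "(ennreal ?f * indicator {x. P (\<xi>, \<mu>, \<tau>) x} (\<xi>1, \<mu>1)) * ennreal (?K * jbr (\<tau> - ph \<xi> \<mu> \<xi>1 \<mu>1) powr (-\<beta>)) = ennreal ?K * ?g (\<xi>1, \<mu>1)"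
    proof -
      have K: "?K \<ge> 0" using jint_nonneg[of \<beta>] by simp
      show ?thesis unfolding fst_conv snd_conv by (rule ennreal_regroup[OF f0 K powr_ge_zero])
    qed
    finally show "(\<integral>\<^sup>+\<tau>1. ennreal (mult_weight s \<gamma> z / (wt s (\<beta> / 2) (\<xi>1, \<mu>1, \<tau>1) * wt s (\<beta> / 2) (z - (\<xi>1, \<mu>1, \<tau>1)))) * indicator A ((\<xi>1, \<mu>1, \<tau>1), z - (\<xi>1, \<mu>1, \<tau>1)) \<partial>lborel) \<le> ennreal ?K * ?g (\<xi>1, \<mu>1)" .
  qed measurable
  also have "\<dots> \<le> ennreal ?K * ennreal C" by (intro mult_left_mono bd) simp
  also have "\<dots> = ennreal (?K * C)" using C jint_nonneg[of \<beta>] by (simp add: ennreal_mult)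
  finally show "(\<integral>\<^sup>+z1. ennreal (mult_weight s \<gamma> z / (wt s (\<beta> / 2) z1 * wt s (\<beta> / 2) (z - z1))) * indicator A (z1, z - z1) \<partial>lborel) \<le> ennreal (?K * C)" .
qed

text \<open>Here the free time frequency couples the output bracket, of exponent
  \<open>\<gamma>\<close>, with that of the free input, of exponent \<open>\<beta>\<close>; only the
  weaker exponent survives the integration. The bracket of the fixed input stays as a
  factor.\<close>

lemma zk_fixed_input:
  fixes P :: "R3 \<Rightarrow> real \<times> real \<Rightarrow> bool"
  assumes A: "A = {p. P (snd p) (fst (fst p), fst (snd (fst p)))}" "closed A"
    and P: "\<And>z. closed {x. P z x}" and C: "C \<ge> 0"
    and bd: "\<And>\<xi> \<mu> \<tau>. (\<integral>\<^sup>+x. ennreal (freq3 s x (\<xi>, \<mu>) * jbr (\<tau> - w \<xi> \<mu>) powr (-\<beta>) *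
        jbr (- \<tau> - ph (-\<xi>) (-\<mu>) (fst x) (snd x)) powr (-\<gamma>)) * indicator {x. P (\<xi>, \<mu>, \<tau>) x} x \<partial>lborel) \<le> ennreal C"
  shows "zk_bounded s \<beta> \<gamma> A"
  unfolding zk_bounded_def
proof (rule bilin_bounded_fixed_input[OF mult_weight_measurable wt_measurable _ mult_weight_nonneg wt_pos])
  let ?K = "2 powr \<gamma> * 2 * jint \<beta>"
  show A': "A \<in> sets borel" using A(2) by auto
  show "0 \<le> ?K * C" using C jint_nonneg[of \<beta>] by simp
  fix z :: R3
  obtain \<xi> \<mu> \<tau> where z: "z = (\<xi>, \<mu>, \<tau>)" by (cases z)
  have "(\<lambda>z1. mult_weight s \<gamma> (z1 + z) / (wt s (\<beta> / 2) z1 * wt s (\<beta> / 2) z)) \<in> borel_measurable borel"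
    unfolding mult_weight_def wt_def rr_def sg_def
    by (intro borel_measurable_continuous_onI continuous_intros) (auto simp: jbr_neq_0)
  then have [measurable]: "(\<lambda>z1. ennreal (mult_weight s \<gamma> (z1 + z) / (wt s (\<beta> / 2) z1 * wt s (\<beta> / 2) z)) * indicator A (z1, z)) \<in> borel_measurable borel"
    using borel_indicator_compose(3)[OF A']
    by (intro borel_measurable_times_ennreal) auto
  let ?g = "\<lambda>x. ennreal (freq3 s x (\<xi>, \<mu>) * jbr (\<tau> - w \<xi> \<mu>) powr (-\<beta>) *
        jbr (- \<tau> - ph (-\<xi>) (-\<mu>) (fst x) (snd x)) powr (-\<gamma>)) * indicator {x. P (\<xi>, \<mu>, \<tau>) x} x"
  have "(\<lambda>x. freq3 s x (\<xi>, \<mu>) * jbr (\<tau> - w \<xi> \<mu>) powr (-\<beta>) *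
        jbr (- \<tau> - ph (-\<xi>) (-\<mu>) (fst x) (snd x)) powr (-\<gamma>)) \<in> borel_measurable borel"
    unfolding ph_def by (intro borel_measurable_continuous_onI continuous_intros freq3_continuous)
  then have g: "?g \<in> borel_measurable borel" using P[of "(\<xi>, \<mu>, \<tau>)"]
    by (intro borel_measurable_times_ennreal) auto
  have "(\<integral>\<^sup>+z1. ennreal (mult_weight s \<gamma> (z1 + z) / (wt s (\<beta> / 2) z1 * wt s (\<beta> / 2) z)) * indicator A (z1, z) \<partial>lborel)
      \<le> ennreal ?K * (\<integral>\<^sup>+x. ?g x \<partial>lborel)"
  proof (rule nn_integral_R3_le[OF _ g])
    fix \<xi>1 \<mu>1
    let ?f = "freq3 s (\<xi>1, \<mu>1) (\<xi>, \<mu>) * jbr (\<tau> - w \<xi> \<mu>) powr (-\<beta>)"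
    have f0: "?f \<ge> 0" by (simp add: freq3_nonneg)
    have "(\<integral>\<^sup>+\<tau>1. ennreal (mult_weight s \<gamma> ((\<xi>1, \<mu>1, \<tau>1) + z) / (wt s (\<beta> / 2) (\<xi>1, \<mu>1, \<tau>1) * wt s (\<beta> / 2) z)) * indicator A ((\<xi>1, \<mu>1, \<tau>1), z) \<partial>lborel)
      = (\<integral>\<^sup>+\<tau>1. (ennreal ?f * indicator {x. P (\<xi>, \<mu>, \<tau>) x} (\<xi>1, \<mu>1)) * ennreal (jbr ((w (\<xi>1 + \<xi>) (\<mu>1 + \<mu>) - \<tau>) - \<tau>1) powr (-\<gamma>) * jbr (\<tau>1 - w \<xi>1 \<mu>1) powr (-\<beta>)) \<partial>lborel)"
    proof (rule nn_integral_cong)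
      fix \<tau>1
      have "jbr ((w (\<xi>1 + \<xi>) (\<mu>1 + \<mu>) - \<tau>) - \<tau>1) = jbr (\<tau>1 + \<tau> - w (\<xi>1 + \<xi>) (\<mu>1 + \<mu>))"
        using jbr_minus[of "\<tau>1 + \<tau> - w (\<xi>1 + \<xi>) (\<mu>1 + \<mu>)"] by (simp add: algebra_simps)
      then have e: "mult_weight s \<gamma> ((\<xi>1, \<mu>1, \<tau>1) + z) / (wt s (\<beta> / 2) (\<xi>1, \<mu>1, \<tau>1) * wt s (\<beta> / 2) z) =
          ?f * (jbr ((w (\<xi>1 + \<xi>) (\<mu>1 + \<mu>) - \<tau>) - \<tau>1) powr (-\<gamma>) * jbr (\<tau>1 - w \<xi>1 \<mu>1) powr (-\<beta>))"
        using kernel_eq[of \<xi>1 \<mu>1 \<tau>1 \<xi> \<mu> \<tau>] by (simp only: z mult_ac)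
      show "ennreal (mult_weight s \<gamma> ((\<xi>1, \<mu>1, \<tau>1) + z) / (wt s (\<beta> / 2) (\<xi>1, \<mu>1, \<tau>1) * wt s (\<beta> / 2) z)) * indicator A ((\<xi>1, \<mu>1, \<tau>1), z)
        = (ennreal ?f * indicator {x. P (\<xi>, \<mu>, \<tau>) x} (\<xi>1, \<mu>1)) * ennreal (jbr ((w (\<xi>1 + \<xi>) (\<mu>1 + \<mu>) - \<tau>) - \<tau>1) powr (-\<gamma>) * jbr (\<tau>1 - w \<xi>1 \<mu>1) powr (-\<beta>))"
        unfolding e using f0 by (subst ennreal_mult) (auto simp: A(1) z indicator_def)
    qed
    also have "\<dots> = (ennreal ?f * indicator {x. P (\<xi>, \<mu>, \<tau>) x} (\<xi>1, \<mu>1)) * (\<integral>\<^sup>+\<tau>1. ennreal (jbr ((w (\<xi>1 + \<xi>) (\<mu>1 + \<mu>) - \<tau>) - \<tau>1) powr (-\<gamma>) * jbr (\<tau>1 - w \<xi>1 \<mu>1) powr (-\<beta>)) \<partial>lborel)"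
      by (rule nn_integral_cmult) measurable
    also have "\<dots> \<le> (ennreal ?f * indicator {x. P (\<xi>, \<mu>, \<tau>) x} (\<xi>1, \<mu>1)) * ennreal (?K * jbr (w (\<xi>1 + \<xi>) (\<mu>1 + \<mu>) - \<tau> - w \<xi>1 \<mu>1) powr (-\<gamma>))"
      using \<delta> \<beta> \<gamma> by (intro mult_left_mono tau_integral) auto
    \<comment> \<open>Oddness of \<open>w\<close> turns the difference of an output and an input
      into the phase at the negated fixed frequency.\<close>
    also have "w (\<xi>1 + \<xi>) (\<mu>1 + \<mu>) - \<tau> - w \<xi>1 \<mu>1 = - \<tau> - ph (-\<xi>) (-\<mu>) \<xi>1 \<mu>1"
      by (simp add: ph_def w_def power3_eq_cube power2_eq_square algebra_simps)
    also have "(ennreal ?f * indicator {x. P (\<xi>, \<mu>, \<tau>) x} (\<xi>1, \<mu>1)) * ennreal (?K * jbr (- \<tau> - ph (-\<xi>) (-\<mu>) \<xi>1 \<mu>1) powr (-\<gamma>)) = ennreal ?K * ?g (\<xi>1, \<mu>1)"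
    proof -
      have K: "?K \<ge> 0" using jint_nonneg[of \<beta>] by simp
      show ?thesis unfolding fst_conv snd_conv by (rule ennreal_regroup[OF f0 K powr_ge_zero])
    qed
    finally show "(\<integral>\<^sup>+\<tau>1. ennreal (mult_weight s \<gamma> ((\<xi>1, \<mu>1, \<tau>1) + z) / (wt s (\<beta> / 2) (\<xi>1, \<mu>1, \<tau>1) * wt s (\<beta> / 2) z)) * indicator A ((\<xi>1, \<mu>1, \<tau>1), z) \<partial>lborel) \<le> ennreal ?K * ?g (\<xi>1, \<mu>1)" .
  qed measurable
  also have "\<dots> \<le> ennreal ?K * ennreal C" by (intro mult_left_mono bd) simp
  also have "\<dots> = ennreal (?K * C)" using C jint_nonneg[of \<beta>] by (simp add: ennreal_mult)
  finally show "(\<integral>\<^sup>+z1. ennreal (mult_weight s \<gamma> (z1 + z) / (wt s (\<beta> / 2) z1 * wt s (\<beta> / 2) z)) * indicator A (z1, z) \<partial>lborel) \<le> ennreal (?K * C)" .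
qed

end

section \<open>From phase integrals with exponent \<beta> to bounds on frequency regions\<close>

lemma nn_integral_box:
  assumes "r \<ge> 0"
  shows "(\<integral>\<^sup>+x. indicator {x::real\<times>real. \<bar>fst x\<bar> \<le> r \<and> \<bar>snd x\<bar> \<le> r} x \<partial>lborel) = ennreal (4 * r\<^sup>2)"
proof -
  have e: "{x::real\<times>real. \<bar>fst x\<bar> \<le> r \<and> \<bar>snd x\<bar> \<le> r} = {-r..r} \<times> {-r..r}" by auto
  have "emeasure lborel ({-r..r} \<times> {-r..r}) = emeasure (lborel :: real measure) {-r..r} * emeasure (lborel :: real measure) {-r..r}"
    unfolding lborel_prod[symmetric] by (intro lborel.emeasure_pair_measure_Times) auto
  then show ?thesis unfolding e using assms
    by (subst nn_integral_indicator) (auto simp: ennreal_mult[symmetric] power2_eq_square lborel_prod[symmetric] intro!: pair_measureI)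
qed

lemma closed_box_pair: "closed {x::real\<times>real. \<bar>fst x\<bar> \<le> r \<and> \<bar>snd x\<bar> \<le> r}"
  by (intro closed_Collect_conj closed_Collect_le continuous_intros)

lemma jbr_cube: "jbr (r ^ 3) \<le> jbr r ^ 3" "jbr r ^ 3 \<le> 4 * jbr (r ^ 3)" if "r \<ge> 0"
proof -
  have r3: "r ^ 3 \<ge> 0" using that by simp
  show "jbr (r ^ 3) \<le> jbr r ^ 3" using that by (simp add: jbr_def power3_eq_cube algebra_simps)
  \<comment> \<open>This product equals 4 (1 + r^3) - (1 + r)^3.\<close>
  have "0 \<le> 3 * (1 + r) * (1 - r)\<^sup>2" using that by simp
  then show "jbr r ^ 3 \<le> 4 * jbr (r ^ 3)" using that r3
    by (simp add: jbr_def power3_eq_cube power2_eq_square algebra_simps)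
qed

lemma jbr_powr_le_const: "a \<le> 0 \<Longrightarrow> jbr x powr a \<le> 1"
  using jbr_powr_le_1[of "-a" x] by simp

lemma jbr_scale: "k \<ge> 1 \<Longrightarrow> 0 \<le> x \<Longrightarrow> x \<le> k * y \<Longrightarrow> jbr x \<le> k * jbr y"
proof -
  assume "k \<ge> 1" "0 \<le> x" "x \<le> k * y"
  moreover from this have "k * y \<le> k * \<bar>y\<bar>" by (intro mult_left_mono) auto
  ultimately show ?thesis unfolding jbr_def distrib_left by linarith
qed

context
  fixes s \<delta> \<beta> \<gamma> :: real
  assumes s: "s > 1 / 2" and \<delta>: "\<delta> > 0" "21 * \<delta> \<le> 2 * s - 1" "8 * \<delta> \<le> 1"
    and \<beta>: "\<beta> = 1 + 2 * \<delta>" and \<gamma>: "\<gamma> = 1 - 4 * \<delta>"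
begin

lemma freq3_commute: "freq3 s x y = freq3 s y x"
  by (simp add: freq3_def add.commute mult_ac)

text \<open>The output frequency is controlled by that of the second input, so these two weights
  cancel up to a constant. The weight of the first input is what remains, and the derivative is
  bounded by the full output frequency.\<close>

lemma freq3_le:
  assumes k: "k \<ge> 1" and le: "freq_norm (fst x + fst y) (snd x + snd y) \<le> k * freq_norm (fst y) (snd y)"
  shows "freq3 s x y \<le> k powr (2 * s) * (freq_norm (fst x + fst y) (snd x + snd y))\<^sup>2 * jbr (freq_norm (fst x) (snd x)) powr (- 2 * s)"
proof -
  let ?r = "freq_norm (fst x + fst y) (snd x + snd y)" and ?r1 = "freq_norm (fst x) (snd x)" and ?r2 = "freq_norm (fst y) (snd y)"
  have 1: "(fst x + fst y)\<^sup>2 \<le> ?r\<^sup>2" by (simp add: freq_norm_sq fn2_def)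
  have "jbr ?r \<le> k * jbr ?r2" by (rule jbr_scale[OF k freq_norm_nonneg le])
  then have "jbr ?r powr (2 * s) \<le> (k * jbr ?r2) powr (2 * s)"
    using s jbr_pos[of ?r] by (intro powr_mono2) auto
  also have "\<dots> = k powr (2 * s) * jbr ?r2 powr (2 * s)"
    using k by (simp add: powr_mult jbr_nonneg)
  finally have 2: "jbr ?r powr (2 * s) * jbr ?r2 powr (- 2 * s) \<le> k powr (2 * s) * (jbr ?r2 powr (2 * s) * jbr ?r2 powr (- 2 * s))"
    by (simp add: mult_right_mono mult.assoc[symmetric])
  also have "jbr ?r2 powr (2 * s) * jbr ?r2 powr (- 2 * s) = 1" by (simp add: powr_add[symmetric] jbr_neq_0)
  finally have 2: "jbr ?r powr (2 * s) * jbr ?r2 powr (- 2 * s) \<le> k powr (2 * s)" by simp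
  have "freq3 s x y = (fst x + fst y)\<^sup>2 * (jbr ?r powr (2 * s) * jbr ?r2 powr (- 2 * s)) * jbr ?r1 powr (- 2 * s)"
    by (simp add: freq3_def mult_ac)
  also have "\<dots> \<le> ?r\<^sup>2 * k powr (2 * s) * jbr ?r1 powr (- 2 * s)"
    using 1 2 by (intro mult_mono mult_nonneg_nonneg) auto
  finally show ?thesis by (simp add: mult_ac)
qed

text \<open>A power \<open>\<gamma>\<close> < 1 is not integrable over the line. Up to the height
  \<open>l\<close> it is raised to \<open>\<beta>\<close> at the cost of the surplus power of
  \<open>l\<close>; beyond that height the bracket is uniformly small.\<close>

lemma jbr_powr_gamma_le:
  "jbr u powr (-\<gamma>) \<le> jbr l powr (\<beta> - \<gamma>) * jbr u powr (-\<beta>) + jbr l powr (-\<gamma>)"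
proof (cases "\<bar>u\<bar> \<le> \<bar>l\<bar>")
  case True
  have "jbr u powr (-\<gamma>) = jbr u powr (\<beta> - \<gamma>) * jbr u powr (-\<beta>)" by (simp add: powr_add[symmetric])
  also have "\<dots> \<le> jbr l powr (\<beta> - \<gamma>) * jbr u powr (-\<beta>)"
    using jbr_mono[OF True] jbr_pos[of u] \<beta> \<gamma> \<delta> by (intro mult_right_mono powr_mono2) auto
  finally show ?thesis by (simp add: add_increasing2)
next
  case False
  then have "jbr u powr (-\<gamma>) \<le> jbr l powr (-\<gamma>)" using \<delta> \<gamma> by (intro jbr_powr_antimono jbr_mono) auto
  then show ?thesis by (simp add: add_increasing)
qed

lemma powr_exponent_le: "2 * s \<ge> a \<Longrightarrow> jbr x powr (- 2 * s) * jbr x powr a \<le> 1"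
  by (simp add: powr_add[symmetric] jbr_powr_le_const)

text \<open>With the height r^3 both parts are affordable. The part below loses r^(3 (\<beta> -
  \<gamma>)) = r^(18 \<delta>), which makes 1 + 21 \<delta> in total. The part above is r^2 times
  the area of the box times r^(-3 \<gamma>), which makes 1 + 12 \<delta>. Both exponents are at most
  2 s. The 400 is the area 100 r^2 of the box, in units of r^2, times the factor 4 of
  \<open>jbr_cube\<close>.\<close>

lemma gamma_integral_le:
  fixes \<phi> :: "real \<times> real \<Rightarrow> real"
  assumes [measurable]: "\<phi> \<in> borel_measurable borel" and S: "closed S" "S \<subseteq> {x. \<bar>fst x\<bar> \<le> 5 * r \<and> \<bar>snd x\<bar> \<le> 5 * r}"
    and r: "r \<ge> 0" and Cb: "Cb \<ge> 0"
    and bd: "ennreal (r\<^sup>2) * (\<integral>\<^sup>+x. ennreal (jbr (\<phi> x) powr (-\<beta>)) * indicator S x \<partial>lborel) \<le> ennreal (Cb * jbr r powr (1 + 3 * \<delta>))"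
  shows "ennreal (r\<^sup>2) * (\<integral>\<^sup>+x. ennreal (jbr (\<phi> x) powr (-\<gamma>)) * indicator S x \<partial>lborel) \<le> ennreal ((Cb + 400) * jbr r powr (2 * s))"
proof -
  let ?l = "jbr (r ^ 3)" and ?j = "jbr r"
  have [measurable]: "S \<in> sets borel" using S by auto
  have j: "?j \<ge> 1" "?j \<ge> r" "?j > 0" using r by (auto simp: jbr_def)
  have l: "?l \<ge> 1" "?l > 0" by (auto simp: jbr_def)
  have j3: "?j powr 3 = ?j ^ 3" using j by (simp add: powr_numeral)
  have e1: "?l powr (\<beta> - \<gamma>) \<le> ?j powr (18 * \<delta>)"
  proof -
    have "?l powr (\<beta> - \<gamma>) \<le> (?j powr 3) powr (\<beta> - \<gamma>)"
      using jbr_cube(1)[OF r] l \<beta> \<gamma> \<delta> j3 by (intro powr_mono2) auto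
    also have "\<dots> = ?j powr (18 * \<delta>)" by (simp add: powr_powr \<beta> \<gamma>)
    finally show ?thesis .
  qed
  have e2: "?l powr (-\<gamma>) \<le> 4 * ?j powr (12 * \<delta> - 3)"
  proof -
    have "?l powr (-\<gamma>) \<le> (?j powr 3 / 4) powr (-\<gamma>)"
      using jbr_cube(2)[OF r] j j3 \<gamma> \<delta> by (intro powr_mono2') auto
    also have "\<dots> = 4 powr \<gamma> * (?j powr 3) powr (-\<gamma>)" by (simp add: powr_divide powr_minus field_simps)
    also have "(?j powr 3) powr (-\<gamma>) = ?j powr (12 * \<delta> - 3)" by (simp add: powr_powr \<gamma> algebra_simps)
    also have "4 powr \<gamma> * ?j powr (12 * \<delta> - 3) \<le> 4 powr 1 * ?j powr (12 * \<delta> - 3)" using \<gamma> \<delta> by (intro mult_right_mono powr_mono) auto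
    finally show ?thesis by simp
  qed
  have "(\<integral>\<^sup>+x. ennreal (jbr (\<phi> x) powr (-\<gamma>)) * indicator S x \<partial>lborel)
     \<le> (\<integral>\<^sup>+x. ennreal (?l powr (\<beta> - \<gamma>)) * (ennreal (jbr (\<phi> x) powr (-\<beta>)) * indicator S x) + ennreal (?l powr (-\<gamma>)) * indicator {x. \<bar>fst x\<bar> \<le> 5 * r \<and> \<bar>snd x\<bar> \<le> 5 * r} x \<partial>lborel)"
  proof (rule nn_integral_mono)
    fix x
    have "ennreal (jbr (\<phi> x) powr (-\<gamma>)) \<le> ennreal (?l powr (\<beta> - \<gamma>)) * ennreal (jbr (\<phi> x) powr (-\<beta>)) + ennreal (?l powr (-\<gamma>))"
      using jbr_powr_gamma_le[of "\<phi> x" "r ^ 3"] by (simp add: ennreal_mult[symmetric] ennreal_plus[symmetric] ennreal_leI del: ennreal_plus)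
    then show "ennreal (jbr (\<phi> x) powr (-\<gamma>)) * indicator S x \<le> ennreal (?l powr (\<beta> - \<gamma>)) * (ennreal (jbr (\<phi> x) powr (-\<beta>)) * indicator S x) + ennreal (?l powr (-\<gamma>)) * indicator {x. \<bar>fst x\<bar> \<le> 5 * r \<and> \<bar>snd x\<bar> \<le> 5 * r} x"
      using S(2) by (cases "x \<in> S") auto
  qed
  also have "\<dots> = ennreal (?l powr (\<beta> - \<gamma>)) * (\<integral>\<^sup>+x. ennreal (jbr (\<phi> x) powr (-\<beta>)) * indicator S x \<partial>lborel) + ennreal (?l powr (-\<gamma>)) * ennreal (100 * r\<^sup>2)"
  proof -
    have [measurable]: "{x::real\<times>real. \<bar>fst x\<bar> \<le> 5 * r \<and> \<bar>snd x\<bar> \<le> 5 * r} \<in> sets borel" using closed_box_pair by auto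
    show ?thesis
      using nn_integral_box[of "5 * r"] r
      by (subst nn_integral_add) (simp_all add: nn_integral_cmult power_mult_distrib)
  qed
  finally have "ennreal (r\<^sup>2) * (\<integral>\<^sup>+x. ennreal (jbr (\<phi> x) powr (-\<gamma>)) * indicator S x \<partial>lborel)
    \<le> ennreal (r\<^sup>2) * (ennreal (?l powr (\<beta> - \<gamma>)) * (\<integral>\<^sup>+x. ennreal (jbr (\<phi> x) powr (-\<beta>)) * indicator S x \<partial>lborel) + ennreal (?l powr (-\<gamma>)) * ennreal (100 * r\<^sup>2))"
    by (rule mult_left_mono) simp
  also have "\<dots> = ennreal (?l powr (\<beta> - \<gamma>)) * (ennreal (r\<^sup>2) * (\<integral>\<^sup>+x. ennreal (jbr (\<phi> x) powr (-\<beta>)) * indicator S x \<partial>lborel)) + ennreal (r\<^sup>2 * (?l powr (-\<gamma>) * (100 * r\<^sup>2)))"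
  proof -
    have "ennreal (r\<^sup>2 * (?l powr (-\<gamma>) * (100 * r\<^sup>2))) = ennreal (r\<^sup>2) * (ennreal (?l powr (-\<gamma>)) * ennreal (100 * r\<^sup>2))"
      by (subst ennreal_mult, simp, simp, subst ennreal_mult) simp_all
    then show ?thesis by (simp only: distrib_left mult_ac)
  qed
  also have "\<dots> \<le> ennreal (?l powr (\<beta> - \<gamma>)) * ennreal (Cb * ?j powr (1 + 3 * \<delta>)) + ennreal (r\<^sup>2 * (?l powr (-\<gamma>) * (100 * r\<^sup>2)))"
    by (intro add_right_mono mult_left_mono bd) simp
  also have "\<dots> = ennreal (?l powr (\<beta> - \<gamma>) * (Cb * ?j powr (1 + 3 * \<delta>)) + r\<^sup>2 * (?l powr (-\<gamma>) * (100 * r\<^sup>2)))"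
    using Cb by (simp add: ennreal_mult[symmetric] ennreal_plus[symmetric] del: ennreal_plus)
  also have "\<dots> \<le> ennreal ((Cb + 400) * ?j powr (2 * s))"
  proof (rule ennreal_leI)
    have "?l powr (\<beta> - \<gamma>) * (Cb * ?j powr (1 + 3 * \<delta>)) \<le> ?j powr (18 * \<delta>) * (Cb * ?j powr (1 + 3 * \<delta>))"
      using Cb by (intro mult_right_mono e1) auto
    also have "\<dots> = Cb * ?j powr (1 + 21 * \<delta>)" by (simp add: powr_add[symmetric] add.commute)
    also have "\<dots> \<le> Cb * ?j powr (2 * s)" using Cb j \<delta> by (intro mult_left_mono powr_mono) auto
    finally have 1: "?l powr (\<beta> - \<gamma>) * (Cb * ?j powr (1 + 3 * \<delta>)) \<le> Cb * ?j powr (2 * s)" .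
    have "r\<^sup>2 * (?l powr (-\<gamma>) * (100 * r\<^sup>2)) = 100 * (r ^ 4 * ?l powr (-\<gamma>))" by (simp add: power4_eq_xxxx power2_eq_square)
    also have "\<dots> \<le> 100 * (?j powr 4 * (4 * ?j powr (12 * \<delta> - 3)))"
      using j r by (intro mult_left_mono mult_mono e2) (auto simp: powr_numeral power_mono)
    also have "\<dots> = 400 * ?j powr (1 + 12 * \<delta>)" by (simp add: powr_add[symmetric])
    also have "\<dots> \<le> 400 * ?j powr (2 * s)" using j \<delta> by (intro mult_left_mono powr_mono) auto
    finally show "?l powr (\<beta> - \<gamma>) * (Cb * ?j powr (1 + 3 * \<delta>)) + r\<^sup>2 * (?l powr (-\<gamma>) * (100 * r\<^sup>2)) \<le> (Cb + 400) * ?j powr (2 * s)"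
      using 1 unfolding distrib_right by linarith
  qed
  finally show ?thesis .
qed

lemma ph_measurable: "(\<lambda>x. c - ph a b (fst x) (snd x)) \<in> borel_measurable borel"
  unfolding ph_def by (intro borel_measurable_continuous_onI continuous_intros)

lemma jbr_ph_measurable: "(\<lambda>x. ennreal (jbr (c - ph a b (fst x) (snd x)) powr p)) \<in> borel_measurable borel"
proof -
  note [measurable] = ph_measurable[of c a b]
  show ?thesis by measurable
qed

text \<open>Bookkeeping shared by the regions: \<open>q\<close> is the decay provided by the weights
  and \<open>p\<close> the growth of the integral, and the estimate closes when they cancel. Keeping
  the factor \<open>r\<^sup>2\<close> next to the integral avoids dividing by a frequency that may
  vanish.\<close>

lemma nn_integral_weighted_le:
  assumes "closed S" and M: "M \<ge> 0" and J: "J \<in> borel_measurable borel" 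
    and pt: "\<And>x. x \<in> S \<Longrightarrow> f x \<le> ennreal (M * (r\<^sup>2 * q)) * J x" and q: "q \<ge> 0"
    and bd: "ennreal (r\<^sup>2) * (\<integral>\<^sup>+x. J x * indicator S x \<partial>lborel) \<le> ennreal (C * p)" and "C \<ge> 0" "p \<ge> 0" and pq: "q * p \<le> 1"
  shows "(\<integral>\<^sup>+x. f x * indicator S x \<partial>lborel) \<le> ennreal (M * C)"
proof -
  have [measurable]: "S \<in> sets borel" using assms by auto
  note [measurable] = J
  have "(\<integral>\<^sup>+x. f x * indicator S x \<partial>lborel) \<le> (\<integral>\<^sup>+x. ennreal (M * (r\<^sup>2 * q)) * (J x * indicator S x) \<partial>lborel)"
    using pt by (intro nn_integral_mono) (auto split: split_indicator)
  also have "\<dots> = ennreal (M * (r\<^sup>2 * q)) * (\<integral>\<^sup>+x. J x * indicator S x \<partial>lborel)"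
    by (rule nn_integral_cmult) measurable
  also have "\<dots> = ennreal (M * q) * (ennreal (r\<^sup>2) * (\<integral>\<^sup>+x. J x * indicator S x \<partial>lborel))"
    using M q by (simp add: ennreal_mult mult_ac)
  also have "\<dots> \<le> ennreal (M * q) * ennreal (C * p)" by (intro mult_left_mono bd) simp
  also have "\<dots> = ennreal (M * C * (q * p))" using assms by (simp add: ennreal_mult[symmetric] mult_ac)
  also have "\<dots> \<le> ennreal (M * C * 1)" using assms by (intro ennreal_leI mult_left_mono) auto
  finally show ?thesis by simp
qed

text \<open>With the output fixed the surviving bracket already has the exponent
  \<open>\<beta>\<close> of the hypothesis, and the bracket of the output is bounded by 1. The
  growth 1 + 3 \<delta> stays below 2 s.\<close>

lemma zk_output_from_beta:
  fixes P :: "R3 \<Rightarrow> real \<times> real \<Rightarrow> bool"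
  assumes A: "A = {p. P (fst p + snd p) (fst (fst p), fst (snd (fst p)))}" "closed A"
    and P: "\<And>z. closed {x. P z x}" and M: "M \<ge> 0" and Cb: "Cb \<ge> 0"
    and pt: "\<And>\<xi> \<mu> \<tau> x. P (\<xi>, \<mu>, \<tau>) x \<Longrightarrow> freq3 s x (\<xi> - fst x, \<mu> - snd x) \<le> M * ((freq_norm \<xi> \<mu>)\<^sup>2 * jbr (freq_norm \<xi> \<mu>) powr (- 2 * s))"
    and bd: "\<And>\<xi> \<mu> \<tau> t. ennreal ((freq_norm \<xi> \<mu>)\<^sup>2) * (\<integral>\<^sup>+x. ennreal (jbr (t - ph \<xi> \<mu> (fst x) (snd x)) powr (-\<beta>)) * indicator {x. P (\<xi>, \<mu>, \<tau>) x} x \<partial>lborel)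
        \<le> ennreal (Cb * jbr (freq_norm \<xi> \<mu>) powr (1 + 3 * \<delta>))"
  shows "zk_bounded s \<beta> \<gamma> A"
proof (rule zk_fixed_output[OF s \<delta> \<beta> \<gamma> A P])
  show "0 \<le> M * Cb" using M Cb by simp
  fix \<xi> \<mu> \<tau>
  show "(\<integral>\<^sup>+x. ennreal (freq3 s x (\<xi> - fst x, \<mu> - snd x) * jbr (\<tau> - w \<xi> \<mu>) powr (-\<gamma>) *
        jbr (\<tau> - ph \<xi> \<mu> (fst x) (snd x)) powr (-\<beta>)) * indicator {x. P (\<xi>, \<mu>, \<tau>) x} x \<partial>lborel) \<le> ennreal (M * Cb)"
  proof (rule nn_integral_weighted_le[where S = "{x. P (\<xi>, \<mu>, \<tau>) x}" and J = "\<lambda>x. ennreal (jbr (\<tau> - ph \<xi> \<mu> (fst x) (snd x)) powr (-\<beta>))" and r = "freq_norm \<xi> \<mu>" and q = "jbr (freq_norm \<xi> \<mu>) powr (- 2 * s)" and p = "jbr (freq_norm \<xi> \<mu>) powr (1 + 3 * \<delta>)", OF P M jbr_ph_measurable _ _ bd Cb])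
    fix x assume "x \<in> {x. P (\<xi>, \<mu>, \<tau>) x}"
    then have "freq3 s x (\<xi> - fst x, \<mu> - snd x) * jbr (\<tau> - w \<xi> \<mu>) powr (-\<gamma>) \<le> (M * ((freq_norm \<xi> \<mu>)\<^sup>2 * jbr (freq_norm \<xi> \<mu>) powr (- 2 * s))) * 1"
      using M \<gamma> \<delta> by (intro mult_mono pt jbr_powr_le_1) auto
    then have "freq3 s x (\<xi> - fst x, \<mu> - snd x) * jbr (\<tau> - w \<xi> \<mu>) powr (-\<gamma>) * jbr (\<tau> - ph \<xi> \<mu> (fst x) (snd x)) powr (-\<beta>)
      \<le> (M * ((freq_norm \<xi> \<mu>)\<^sup>2 * jbr (freq_norm \<xi> \<mu>) powr (- 2 * s))) * jbr (\<tau> - ph \<xi> \<mu> (fst x) (snd x)) powr (-\<beta>)"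
      by (intro mult_right_mono) auto
    then show "ennreal (freq3 s x (\<xi> - fst x, \<mu> - snd x) * jbr (\<tau> - w \<xi> \<mu>) powr (-\<gamma>) * jbr (\<tau> - ph \<xi> \<mu> (fst x) (snd x)) powr (-\<beta>))
      \<le> ennreal (M * ((freq_norm \<xi> \<mu>)\<^sup>2 * jbr (freq_norm \<xi> \<mu>) powr (- 2 * s))) * ennreal (jbr (\<tau> - ph \<xi> \<mu> (fst x) (snd x)) powr (-\<beta>))"
      using M by (subst ennreal_mult[symmetric]) (auto intro: ennreal_leI)
  next
    show "jbr (freq_norm \<xi> \<mu>) powr (- 2 * s) * jbr (freq_norm \<xi> \<mu>) powr (1 + 3 * \<delta>) \<le> 1"
      using \<delta> by (intro powr_exponent_le) auto
  qed auto
qed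

text \<open>With an input fixed the surviving bracket has only the exponent \<open>\<gamma>\<close>.
  The hypothesis, which concerns \<open>\<beta>\<close>, is transferred by
  \<open>gamma_integral_le\<close>, and the confinement to a box is there for its part above the
  height r^3.\<close>

lemma zk_input_from_beta:
  fixes P :: "R3 \<Rightarrow> real \<times> real \<Rightarrow> bool"
  assumes A: "A = {p. P (snd p) (fst (fst p), fst (snd (fst p)))}" "closed A"
    and P: "\<And>z. closed {x. P z x}" and M: "M \<ge> 0" and Cb: "Cb \<ge> 0"
    and box: "\<And>\<xi> \<mu> \<tau> x. P (\<xi>, \<mu>, \<tau>) x \<Longrightarrow> \<bar>fst x\<bar> \<le> 5 * freq_norm \<xi> \<mu> \<and> \<bar>snd x\<bar> \<le> 5 * freq_norm \<xi> \<mu>"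
    and pt: "\<And>\<xi> \<mu> \<tau> x. P (\<xi>, \<mu>, \<tau>) x \<Longrightarrow> freq3 s x (\<xi>, \<mu>) \<le> M * ((freq_norm \<xi> \<mu>)\<^sup>2 * jbr (freq_norm \<xi> \<mu>) powr (- 2 * s))"
    and bd: "\<And>\<xi> \<mu> \<tau> t. ennreal ((freq_norm \<xi> \<mu>)\<^sup>2) * (\<integral>\<^sup>+x. ennreal (jbr (t - ph (-\<xi>) (-\<mu>) (fst x) (snd x)) powr (-\<beta>)) * indicator {x. P (\<xi>, \<mu>, \<tau>) x} x \<partial>lborel)
        \<le> ennreal (Cb * jbr (freq_norm \<xi> \<mu>) powr (1 + 3 * \<delta>))"
  shows "zk_bounded s \<beta> \<gamma> A"
proof (rule zk_fixed_input[OF s \<delta> \<beta> \<gamma> A P])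
  show "0 \<le> M * (Cb + 400)" using M Cb by simp
  fix \<xi> \<mu> \<tau>
  let ?r = "freq_norm \<xi> \<mu>"
  have S: "{x. P (\<xi>, \<mu>, \<tau>) x} \<subseteq> {x. \<bar>fst x\<bar> \<le> 5 * ?r \<and> \<bar>snd x\<bar> \<le> 5 * ?r}" using box by auto
  note g = gamma_integral_le[OF ph_measurable P S freq_norm_nonneg Cb bd]
  show "(\<integral>\<^sup>+x. ennreal (freq3 s x (\<xi>, \<mu>) * jbr (\<tau> - w \<xi> \<mu>) powr (-\<beta>) *
        jbr (- \<tau> - ph (-\<xi>) (-\<mu>) (fst x) (snd x)) powr (-\<gamma>)) * indicator {x. P (\<xi>, \<mu>, \<tau>) x} x \<partial>lborel) \<le> ennreal (M * (Cb + 400))"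
  proof (rule nn_integral_weighted_le[where S = "{x. P (\<xi>, \<mu>, \<tau>) x}" and J = "\<lambda>x. ennreal (jbr (- \<tau> - ph (-\<xi>) (-\<mu>) (fst x) (snd x)) powr (-\<gamma>))" and r = ?r and q = "jbr ?r powr (- 2 * s)" and p = "jbr ?r powr (2 * s)", OF P M jbr_ph_measurable _ _ g])
    fix x assume "x \<in> {x. P (\<xi>, \<mu>, \<tau>) x}"
    then have "freq3 s x (\<xi>, \<mu>) * jbr (\<tau> - w \<xi> \<mu>) powr (-\<beta>) \<le> (M * (?r\<^sup>2 * jbr ?r powr (- 2 * s))) * 1"
      using M \<beta> \<delta> by (intro mult_mono pt jbr_powr_le_1) auto
    then have "freq3 s x (\<xi>, \<mu>) * jbr (\<tau> - w \<xi> \<mu>) powr (-\<beta>) * jbr (- \<tau> - ph (-\<xi>) (-\<mu>) (fst x) (snd x)) powr (-\<gamma>)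
      \<le> (M * (?r\<^sup>2 * jbr ?r powr (- 2 * s))) * jbr (- \<tau> - ph (-\<xi>) (-\<mu>) (fst x) (snd x)) powr (-\<gamma>)"
      by (intro mult_right_mono) auto
    then show "ennreal (freq3 s x (\<xi>, \<mu>) * jbr (\<tau> - w \<xi> \<mu>) powr (-\<beta>) * jbr (- \<tau> - ph (-\<xi>) (-\<mu>) (fst x) (snd x)) powr (-\<gamma>))
      \<le> ennreal (M * (?r\<^sup>2 * jbr ?r powr (- 2 * s))) * ennreal (jbr (- \<tau> - ph (-\<xi>) (-\<mu>) (fst x) (snd x)) powr (-\<gamma>))"
      using M by (subst ennreal_mult[symmetric]) (auto intro: ennreal_leI)
  next
    show "jbr ?r powr (- 2 * s) * jbr ?r powr (2 * s) \<le> 1"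
      by (intro powr_exponent_le) auto
  qed (use Cb in auto)
qed

end

section \<open>The resonance function and the frequency regions\<close>

text \<open>It is used with r^2 = (p^2 + q^2) / 2: when q is negligible, |p| is close to sqrt 2
  times r, and 14/10 and 3/2 enclose sqrt 2. Such a frequency lies near one of the two lines on
  which the determinant p q vanishes.\<close>

definition dominates :: "real \<Rightarrow> real \<Rightarrow> real \<Rightarrow> bool" where
  "dominates p q r \<longleftrightarrow> \<bar>q\<bar> \<le> \<bar>p\<bar> / 40 \<and> 14 / 10 * r \<le> \<bar>p\<bar> \<and> \<bar>p\<bar> \<le> 3 / 2 * r"

text \<open>Here r^2 <= p^2, so smallness of p q relative to r^2 becomes |q| <= |p| / 40. The size
  of |p| then follows from the formula for r^2, in which q^2 is at most p^2 / 1600.\<close>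

lemma dominates_half:
  assumes le: "\<bar>q\<bar> \<le> \<bar>p\<bar>" and r: "r \<ge> 0" "r\<^sup>2 = (p\<^sup>2 + q\<^sup>2) / 2" and K: "\<bar>p * q\<bar> \<le> r\<^sup>2 / 40"
  shows "dominates p q r"
proof -
  have q2: "q\<^sup>2 \<le> p\<^sup>2" using le by (simp add: abs_le_square_iff)
  have 1: "\<bar>q\<bar> \<le> \<bar>p\<bar> / 40"
  proof (cases "p = 0")
    case False
    have "\<bar>p\<bar> * \<bar>q\<bar> \<le> \<bar>p\<bar> * (\<bar>p\<bar> / 40)"
      using K q2 r(2) by (simp add: abs_mult power2_eq_square)
    then show ?thesis by (rule mult_left_le_imp_le) (use False in simp)
  qed (use le in simp)
  have "q\<^sup>2 \<le> (\<bar>p\<bar> / 40)\<^sup>2" using 1 by (metis abs_ge_zero power_mono power2_abs)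
  then have q3: "q\<^sup>2 \<le> p\<^sup>2 / 1600" by (simp add: power_divide)
  have "(14 / 10 * r)\<^sup>2 \<le> \<bar>p\<bar>\<^sup>2" 
  proof -
    have "(14 / 10 * r)\<^sup>2 = 196 / 100 * r\<^sup>2" by (simp add: power2_eq_square)
    moreover have "196 / 100 * r\<^sup>2 \<le> p\<^sup>2"
    proof -
      have "49 * q\<^sup>2 \<le> 1600 * q\<^sup>2" by (intro mult_right_mono) auto
      also have "1600 * q\<^sup>2 \<le> p\<^sup>2" using q3 by simp
      finally show ?thesis unfolding r(2) by (simp add: field_simps)
    qed
    ultimately show ?thesis by (simp only: power2_abs)
  qed
  then have 2: "14 / 10 * r \<le> \<bar>p\<bar>" by (rule power2_le_imp_le) simp
  have "\<bar>p\<bar>\<^sup>2 \<le> 2 * r\<^sup>2" by (simp add: r(2))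
  also have "\<dots> \<le> (3 / 2 * r)\<^sup>2" by (simp add: power_mult_distrib power_divide)
  finally have "\<bar>p\<bar>\<^sup>2 \<le> (3 / 2 * r)\<^sup>2" .
  then have 3: "\<bar>p\<bar> \<le> 3 / 2 * r" by (rule power2_le_imp_le) (use r in simp)
  show ?thesis using 1 2 3 by (simp add: dominates_def)
qed

lemma dominates_cases:
  assumes r: "r \<ge> 0" "r\<^sup>2 = (p\<^sup>2 + q\<^sup>2) / 2" and K: "\<bar>p * q\<bar> \<le> r\<^sup>2 / 40"
  shows "dominates p q r \<or> dominates q p r"
  using dominates_half[of q p r] dominates_half[of p q r] assms
  by (cases "\<bar>q\<bar> \<le> \<bar>p\<bar>") (auto simp: mult.commute add.commute)

text \<open>If p dominates in both inputs, then q1 + q2 is small and p dominates in the output as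
  well. Of the two products forming the resonance function the first has full size, 14/10 cubed
  being 2.744, and the second is smaller by 40^3 = 64000, so they cannot cancel.\<close>

lemma resonance_parallel:
  assumes d: "dominates p1 q1 r1" "dominates p2 q2 r2" "dominates (p1 + p2) (q1 + q2) r \<or> dominates (q1 + q2) (p1 + p2) r"
    and r: "r > 0" "r1 \<ge> 0" "r2 \<ge> 0" "r1 \<le> 4 * r" "r2 \<le> 4 * r"
  shows "2 * (r * r1 * r2) \<le> \<bar>(p1 + p2) * p1 * p2 + (q1 + q2) * q1 * q2\<bar>"
proof -
  let ?p = "p1 + p2" and ?q = "q1 + q2"
  \<comment> \<open>Otherwise 14/10 r <= |q1 + q2| <= 3/80 (r1 + r2) <= 3/10 r.\<close>
  have "\<not> dominates ?q ?p r" using d(1,2) r unfolding dominates_def by linarith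
  then have d3: "dominates ?p ?q r" using d by blast
  let ?A = "\<bar>?p\<bar> * \<bar>p1\<bar> * \<bar>p2\<bar>" and ?B = "\<bar>?q\<bar> * \<bar>q1\<bar> * \<bar>q2\<bar>"
  have A: "(14 / 10 * r) * (14 / 10 * r1) * (14 / 10 * r2) \<le> ?A"
    using d3 d(1,2) r unfolding dominates_def by (intro mult_mono mult_nonneg_nonneg) auto
  have B: "?B \<le> (\<bar>?p\<bar> / 40) * (\<bar>p1\<bar> / 40) * (\<bar>p2\<bar> / 40)"
    using d3 d(1,2) unfolding dominates_def by (intro mult_mono mult_nonneg_nonneg) auto
  have "?A - ?B \<le> \<bar>?p * p1 * p2 + ?q * q1 * q2\<bar>"
    using abs_triangle_ineq2[of "?p * p1 * p2" "- (?q * q1 * q2)"] by (simp add: abs_mult)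
  moreover have "(\<bar>?p\<bar> / 40) * (\<bar>p1\<bar> / 40) * (\<bar>p2\<bar> / 40) = ?A / 64000" by simp
  moreover have "(14 / 10 * r) * (14 / 10 * r1) * (14 / 10 * r2) = 2744 / 1000 * (r * r1 * r2)" by simp
  moreover have "r * r1 * r2 \<ge> 0" using r by simp
  ultimately show ?thesis using A B by linarith
qed

text \<open>With p dominating in one input and q in the other, both p1 + p2 and q1 + q2 are large,
  so the output cannot lie near the cone. For comparable sizes this configuration does not
  occur.\<close>

lemma resonance_transversal:
  assumes d: "dominates p1 q1 r1" "dominates q2 p2 r2" "dominates (p1 + p2) (q1 + q2) r \<or> dominates (q1 + q2) (p1 + p2) r"
    and r: "r > 0" "r1 \<le> 4 * r2" "r2 \<le> 4 * r1" "r \<le> 5 * r1" "r \<le> 5 * r2"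
  shows False
proof -
  have a: "\<bar>q2\<bar> \<le> \<bar>q1 + q2\<bar> + \<bar>q1\<bar>" "\<bar>p1\<bar> \<le> \<bar>p1 + p2\<bar> + \<bar>p2\<bar>" by simp_all
  have b: "\<bar>q1\<bar> \<le> 3 / 80 * r1" "14 / 10 * r1 \<le> \<bar>p1\<bar>" using d(1) unfolding dominates_def by auto
  have c: "\<bar>p2\<bar> \<le> 3 / 80 * r2" "14 / 10 * r2 \<le> \<bar>q2\<bar>" using d(2) unfolding dominates_def by auto
  have "\<bar>q1 + q2\<bar> \<le> 3 / 80 * r \<or> \<bar>p1 + p2\<bar> \<le> 3 / 80 * r" using d(3) unfolding dominates_def by auto
  then show False
  proof
    assume "\<bar>q1 + q2\<bar> \<le> 3 / 80 * r"
    then have "14 / 10 * r2 \<le> 3 / 80 * r + 3 / 80 * r1" using a(1) b(1) c(2) by linarith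
    then show False using r by linarith
  next
    assume "\<bar>p1 + p2\<bar> \<le> 3 / 80 * r"
    then have "14 / 10 * r1 \<le> 3 / 80 * r + 3 / 80 * r2" using a(2) c(1) b(2) by linarith
    then show False using r by linarith
  qed
qed

text \<open>The bounds by 4 are what remains once the regions are removed in which some frequency is
  at most a quarter of an input frequency. The bounds by 5 then follow from the triangle inequality
  for the output.\<close>

definition comparable :: "real \<Rightarrow> real \<Rightarrow> real \<Rightarrow> bool" where
  "comparable r r1 r2 \<longleftrightarrow> r1 \<le> 4 * r2 \<and> r2 \<le> 4 * r1 \<and> r1 \<le> 4 * r \<and> r2 \<le> 4 * r \<and> r \<le> 5 * r1 \<and> r \<le> 5 * r2"

definition Kdet :: "real \<Rightarrow> real \<Rightarrow> real" where "Kdet \<xi> \<mu> = 3 * \<xi>\<^sup>2 - \<mu>\<^sup>2"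

text \<open>In the variables \<^term>\<open>p = sqrt 3 * \<xi> + \<mu>\<close> and \<^term>\<open>q = sqrt 3 * \<xi> - \<mu>\<close> the dispersion relation decouples:
  \<^term>\<open>w \<xi> \<mu>\<close> is a multiple of \<^term>\<open>p ^ 3 + q ^ 3\<close>, and \<^term>\<open>Kdet \<xi> \<mu> = p * q\<close>.\<close>

lemma resonance:
  assumes cmp: "comparable (freq_norm (x1 + x2) (m1 + m2)) (freq_norm x1 m1) (freq_norm x2 m2)"
    and K: "\<bar>Kdet (x1 + x2) (m1 + m2)\<bar> \<le> (freq_norm (x1 + x2) (m1 + m2))\<^sup>2 / 40"
      "\<bar>Kdet x1 m1\<bar> \<le> (freq_norm x1 m1)\<^sup>2 / 40" "\<bar>Kdet x2 m2\<bar> \<le> (freq_norm x2 m2)\<^sup>2 / 40"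
  shows "freq_norm (x1 + x2) (m1 + m2) * freq_norm x1 m1 * freq_norm x2 m2 \<le> 2 * \<bar>w (x1 + x2) (m1 + m2) - w x1 m1 - w x2 m2\<bar>"
proof -
  define t where "t = sqrt (3::real)"
  have t2: "t\<^sup>2 = 3" and t0: "t \<ge> 0" by (simp_all add: t_def)
  have "t\<^sup>2 \<le> 2\<^sup>2" by (simp add: t2)
  then have tle: "t \<le> 2" by (rule power2_le_imp_le) simp
  define p1 q1 p2 q2 where "p1 = t * x1 + m1" and "q1 = t * x1 - m1" and "p2 = t * x2 + m2" and "q2 = t * x2 - m2"
  note pq = p1_def q1_def p2_def q2_def
  let ?r = "freq_norm (x1 + x2) (m1 + m2)" and ?r1 = "freq_norm x1 m1" and ?r2 = "freq_norm x2 m2"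
  have sq: "(freq_norm x m)\<^sup>2 = ((t * x + m)\<^sup>2 + (t * x - m)\<^sup>2) / 2" "Kdet x m = (t * x + m) * (t * x - m)" for x m
  proof -
    have "(t * x + m)\<^sup>2 + (t * x - m)\<^sup>2 = 2 * (t\<^sup>2 * x\<^sup>2 + m\<^sup>2)" by algebra
    then show "(freq_norm x m)\<^sup>2 = ((t * x + m)\<^sup>2 + (t * x - m)\<^sup>2) / 2" by (simp add: freq_norm_sq fn2_def t2)
    have "(t * x + m) * (t * x - m) = t\<^sup>2 * x\<^sup>2 - m\<^sup>2" by algebra
    then show "Kdet x m = (t * x + m) * (t * x - m)" by (simp add: Kdet_def t2)
  qed
  have d: "dominates (t * x + m) (t * x - m) (freq_norm x m) \<or> dominates (t * x - m) (t * x + m) (freq_norm x m)"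
    if "\<bar>Kdet x m\<bar> \<le> (freq_norm x m)\<^sup>2 / 40" for x m
    using that sq[of x m] by (intro dominates_cases freq_norm_nonneg) simp_all
  have e: "t * (x1 + x2) + (m1 + m2) = p1 + p2" "t * (x1 + x2) - (m1 + m2) = q1 + q2" by (simp_all add: pq algebra_simps)
  have d0: "dominates (p1 + p2) (q1 + q2) ?r \<or> dominates (q1 + q2) (p1 + p2) ?r" using d[OF K(1)] unfolding e .
  have d1: "dominates p1 q1 ?r1 \<or> dominates q1 p1 ?r1" using d[OF K(2)] by (simp add: pq)
  have d2: "dominates p2 q2 ?r2 \<or> dominates q2 p2 ?r2" using d[OF K(3)] by (simp add: pq)
  \<comment> \<open>With w = (p^3 + q^3) / (6 t) this is the identity (a + b)^3 - a^3 - b^3 = 3 a b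
    (a + b), applied in p and in q.\<close>
  have id: "(p1 + p2) * p1 * p2 + (q1 + q2) * q1 * q2 = 2 * t * (w (x1 + x2) (m1 + m2) - w x1 m1 - w x2 m2)"
  proof -
    let ?x = "x1 + x2" and ?m = "m1 + m2"
    have "(p1 + p2) * p1 * p2 + (q1 + q2) * q1 * q2 = 2 * t * (t\<^sup>2 * (?x * x1 * x2) + ?x * m1 * m2 + ?m * (x1 * m2 + x2 * m1))"
      unfolding pq by algebra
    moreover have "w ?x ?m - w x1 m1 - w x2 m2 = 3 * (?x * x1 * x2) + ?x * m1 * m2 + ?m * (x1 * m2 + x2 * m1)"
      unfolding w_def by algebra
    ultimately show ?thesis by (simp add: t2)
  qed
  show ?thesis
  proof (cases "?r = 0")
    case False
    then have r: "?r > 0" using freq_norm_nonneg[of "x1 + x2" "m1 + m2"] by simp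
    have "2 * (?r * ?r1 * ?r2) \<le> \<bar>(p1 + p2) * p1 * p2 + (q1 + q2) * q1 * q2\<bar>"
    proof -
      consider "dominates p1 q1 ?r1" "dominates p2 q2 ?r2" | "dominates p1 q1 ?r1" "dominates q2 p2 ?r2"
        | "dominates q1 p1 ?r1" "dominates p2 q2 ?r2" | "dominates q1 p1 ?r1" "dominates q2 p2 ?r2"
        using d1 d2 by blast
      then show ?thesis
      proof cases
        case 1
        with d0 r cmp show ?thesis by (intro resonance_parallel) (auto simp: comparable_def freq_norm_nonneg)
      next
        case 2
        with d0 r cmp have False by (intro resonance_transversal[of p1 q1 ?r1 q2 p2 ?r2 ?r]) (auto simp: comparable_def)
        then show ?thesis ..
      next
        case 3
        with d0 r cmp have False by (intro resonance_transversal[of q1 p1 ?r1 p2 q2 ?r2 ?r]) (auto simp: comparable_def)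
        then show ?thesis ..
      next
        case 4
        with d0 r cmp have "2 * (?r * ?r1 * ?r2) \<le> \<bar>(q1 + q2) * q1 * q2 + (p1 + p2) * p1 * p2\<bar>"
          by (intro resonance_parallel) (auto simp: comparable_def freq_norm_nonneg)
        then show ?thesis by (simp add: add.commute)
      qed
    qed
    also have "\<dots> = 2 * t * \<bar>w (x1 + x2) (m1 + m2) - w x1 m1 - w x2 m2\<bar>"
      unfolding id using t0 by (simp add: abs_mult)
    also have "\<dots> \<le> 2 * 2 * \<bar>w (x1 + x2) (m1 + m2) - w x1 m1 - w x2 m2\<bar>"
      using tle by (intro mult_right_mono) auto
    finally show ?thesis by linarith
  qed simp
qed

text \<open>A modulation of order r^3 turns its bracket into a gain of r^(-3 \<gamma>). The 800
  combines the 200 of the hypothesis with the 4 of \<open>jbr_cube\<close>.\<close>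

lemma jbr_sigma_le:
  assumes "r \<ge> 0" "r ^ 3 / 200 \<le> \<bar>\<sigma>\<bar>" "0 \<le> \<gamma>"
  shows "jbr \<sigma> powr (-\<gamma>) \<le> 800 powr \<gamma> * jbr r powr (- 3 * \<gamma>)"
proof -
  have "jbr r ^ 3 \<le> 4 * jbr (r ^ 3)" by (rule jbr_cube(2)[OF assms(1)])
  also have "jbr (r ^ 3) \<le> 200 * jbr \<sigma>" using assms by (simp add: jbr_def)
  finally have "jbr r ^ 3 / 800 \<le> jbr \<sigma>" by simp
  then have "jbr \<sigma> powr (-\<gamma>) \<le> (jbr r powr 3 / 800) powr (-\<gamma>)"
    using assms(3) jbr_pos[of r] by (intro powr_mono2') (auto simp: powr_numeral)
  also have "\<dots> = 800 powr \<gamma> * (jbr r powr 3) powr (-\<gamma>)" by (simp add: powr_divide powr_minus field_simps)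
  also have "(jbr r powr 3) powr (-\<gamma>) = jbr r powr (- 3 * \<gamma>)" by (simp add: powr_powr)
  finally show ?thesis .
qed

lemma freq_norm_sum_bounds:
  "freq_norm a b \<le> freq_norm c d + freq_norm (a - c) (b - d)"
  "freq_norm (a - c) (b - d) \<le> freq_norm a b + freq_norm c d"
  "freq_norm c d \<le> freq_norm a b + freq_norm (a - c) (b - d)"
  using freq_norm_triangle[of c "a - c" d "b - d"] freq_norm_triangle[of a "- c" b "- d"]
    freq_norm_triangle[of a "c - a" b "d - b"] freq_norm_minus[of c d] freq_norm_diff[of a c b d]
  by (simp_all add: freq_norm_minus)

section \<open>Bounds on the individual frequency regions\<close>

context
  fixes s \<delta> \<beta> \<gamma> :: real
  assumes s: "s > 1 / 2" and \<delta>: "\<delta> > 0" "21 * \<delta> \<le> 2 * s - 1" "8 * \<delta> \<le> 1"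
    and \<beta>: "\<beta> = 1 + 2 * \<delta>" and \<gamma>: "\<gamma> = 1 - 4 * \<delta>"
begin

lemma beta1: "\<beta> > 1" using \<beta> \<delta> by simp

text \<open>The \<xi>-derivative of the phase is a difference of squared sizes and is at least r^2 /
  2. Integration in \<xi> therefore gains r^(-2), which absorbs the squared derivative. The integral
  in \<mu> is left to the weight of the low frequency, integrable because 2 s > 1, and no power of r
  is lost.\<close>

lemma region_low_high:
  "zk_bounded s \<beta> \<gamma> {p. 4 * rr (fst p) \<le> rr (snd p)}"
proof (rule zk_fixed_output[OF s \<delta> \<beta> \<gamma>, where P = "\<lambda>z x. 4 * freq_norm (fst x) (snd x) \<le> freq_norm (fst z - fst x) (fst (snd z) - snd x)" and C = "2 powr (2 * s) * (4 * jint \<beta>) * jint (2 * s)"])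
  show "{p. 4 * rr (fst p) \<le> rr (snd p)} = {p. 4 * freq_norm (fst (fst (fst p), fst (snd (fst p)))) (snd (fst (fst p), fst (snd (fst p))))
     \<le> freq_norm (fst (fst p + snd p) - fst (fst (fst p), fst (snd (fst p)))) (fst (snd (fst p + snd p)) - snd (fst (fst p), fst (snd (fst p))))}"
    by (simp add: rr_def)
  show "closed {p. 4 * rr (fst p) \<le> rr (snd p)}"
    unfolding rr_def by (intro closed_Collect_le continuous_intros)
  show "closed {x. 4 * freq_norm (fst x) (snd x) \<le> freq_norm (fst z - fst x) (fst (snd z) - snd x)}" for z :: R3
    by (intro closed_Collect_le continuous_intros)
  show "0 \<le> 2 powr (2 * s) * (4 * jint \<beta>) * jint (2 * s)" using jint_nonneg by simp
  fix \<xi> \<mu> \<tau> :: real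
  let ?S = "{x. 4 * freq_norm (fst x) (snd x) \<le> freq_norm (fst (\<xi>, \<mu>, \<tau>) - fst x) (fst (snd (\<xi>, \<mu>, \<tau>)) - snd x)}"
  let ?r = "freq_norm \<xi> \<mu>"
  let ?J = "\<lambda>x. jbr (\<tau> - ph \<xi> \<mu> (fst x) (snd x)) powr (-\<beta>)"
  let ?D = "?r\<^sup>2 / 2"
  show "(\<integral>\<^sup>+x. ennreal (freq3 s x (\<xi> - fst x, \<mu> - snd x) * jbr (\<tau> - w \<xi> \<mu>) powr (-\<gamma>) * ?J x) * indicator ?S x \<partial>lborel)
    \<le> ennreal (2 powr (2 * s) * (4 * jint \<beta>) * jint (2 * s))"
  proof (cases "?r = 0")
    case True
    then have "\<xi> = 0" using freq_norm_bounds(3)[of \<xi> \<mu>] by simp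
    then show ?thesis using jint_nonneg by (simp add: freq3_def)
  next
    case False
    then have r: "?r > 0" using freq_norm_nonneg[of \<xi> \<mu>] by simp
    define T where "T = {x. \<bar>fst x\<bar> \<le> ?r \<and> ?D \<le> \<bar>fn2 (fst x) (snd x) - fn2 (\<xi> - fst x) (\<mu> - snd x)\<bar>}"
    have T: "closed T" unfolding T_def fn2_def by (intro closed_Collect_conj closed_Collect_le continuous_intros)
    then have [measurable]: "T \<in> sets borel" by auto
    have ST: "x \<in> T" if "x \<in> ?S" for x
    proof -
      let ?r1 = "freq_norm (fst x) (snd x)" and ?r2 = "freq_norm (\<xi> - fst x) (\<mu> - snd x)"
      have a: "4 * ?r1 \<le> ?r2" using that by simp
      have b: "?r \<le> ?r1 + ?r2" "?r2 \<le> ?r + ?r1" using freq_norm_sum_bounds by auto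
      have "\<bar>fst x\<bar> \<le> ?r1" by (rule freq_norm_bounds)
      then have 1: "\<bar>fst x\<bar> \<le> ?r" using a b freq_norm_nonneg[of "fst x" "snd x"] by linarith
      have "(4 / 5 * ?r)\<^sup>2 \<le> ?r2\<^sup>2" by (intro power_mono) (use a b r in linarith)+
      have sqs: "(4 / 5 * y)\<^sup>2 = 16 / 25 * y\<^sup>2" "(y / 4)\<^sup>2 = 1 / 16 * y\<^sup>2" for y :: real by (simp_all add: power2_eq_square)
      have e1: "(4 / 5 * ?r)\<^sup>2 \<le> ?r2\<^sup>2" by fact
      have e2: "?r1\<^sup>2 \<le> (?r2 / 4)\<^sup>2" using a freq_norm_nonneg by (intro power_mono) auto
      \<comment> \<open>From \<open>e1\<close> and \<open>e2\<close> the difference is at least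
        15/16 * 16/25 = 3/5 of the squared output size.\<close>
      have "?D \<le> ?r2\<^sup>2 - ?r1\<^sup>2" using e1 e2 zero_le_power2[of ?r] unfolding sqs by linarith
      then have "?D \<le> \<bar>fn2 (fst x) (snd x) - fn2 (\<xi> - fst x) (\<mu> - snd x)\<bar>" unfolding freq_norm_sq by linarith
      with 1 show ?thesis by (simp add: T_def)
    qed
    have pt: "freq3 s x (\<xi> - fst x, \<mu> - snd x) * jbr (\<tau> - w \<xi> \<mu>) powr (-\<gamma>) * ?J x
       \<le> 2 powr (2 * s) * ?r\<^sup>2 * jbr (snd x) powr (- (2 * s)) * ?J x" if "x \<in> ?S" for x
    proof -
      have "freq3 s x (\<xi> - fst x, \<mu> - snd x) \<le> 2 powr (2 * s) * ?r\<^sup>2 * jbr (freq_norm (fst x) (snd x)) powr (- 2 * s)"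
        using freq3_le[OF s \<delta> \<beta> \<gamma>, of 2 x "(\<xi> - fst x, \<mu> - snd x)"] that freq_norm_sum_bounds(1)[of \<xi> \<mu> "fst x" "snd x"]
          freq_norm_nonneg[of "\<xi> - fst x" "\<mu> - snd x"] by simp
      \<comment> \<open>The weight of the low frequency is weakened to one in \<mu> alone, so that
        it can be taken out of the \<xi>-integral.\<close>
      also have "\<dots> \<le> 2 powr (2 * s) * ?r\<^sup>2 * jbr (snd x) powr (- (2 * s))"
      proof -
        have "jbr (freq_norm (fst x) (snd x)) powr (- (2 * s)) \<le> jbr (snd x) powr (- (2 * s))"
          using s freq_norm_bounds(1)[of "snd x" "fst x"] freq_norm_nonneg[of "fst x" "snd x"] by (intro jbr_powr_antimono jbr_mono) auto
        then show ?thesis by (intro mult_left_mono) auto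
      qed
      finally have "freq3 s x (\<xi> - fst x, \<mu> - snd x) * jbr (\<tau> - w \<xi> \<mu>) powr (-\<gamma>) \<le> (2 powr (2 * s) * ?r\<^sup>2 * jbr (snd x) powr (- (2 * s))) * 1"
        using \<gamma> \<delta> by (intro mult_mono jbr_powr_le_1) auto
      then show ?thesis by (intro mult_right_mono) auto
    qed
    have [measurable]: "(\<lambda>x. ennreal (?J x)) \<in> borel_measurable borel" by (rule jbr_ph_measurable[OF s \<delta> \<beta> \<gamma>])
    let ?h = "\<lambda>x. ennreal (2 powr (2 * s) * ?r\<^sup>2) * (ennreal (jbr (snd x) powr (- (2 * s))) * (ennreal (?J x) * indicator T x))"
    have [measurable]: "(\<lambda>x::real\<times>real. ennreal (jbr (snd x) powr (- (2 * s)))) \<in> borel_measurable borel"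
      by (intro measurable_compose[OF _ measurable_ennreal] borel_measurable_continuous_onI continuous_intros)
    have "(\<integral>\<^sup>+x. ennreal (freq3 s x (\<xi> - fst x, \<mu> - snd x) * jbr (\<tau> - w \<xi> \<mu>) powr (-\<gamma>) * ?J x) * indicator ?S x \<partial>lborel)
       \<le> (\<integral>\<^sup>+x. ?h x \<partial>lborel)"
    proof (rule nn_integral_mono)
      fix x
      show "ennreal (freq3 s x (\<xi> - fst x, \<mu> - snd x) * jbr (\<tau> - w \<xi> \<mu>) powr (-\<gamma>) * ?J x) * indicator ?S x \<le> ?h x"
      proof (cases "x \<in> ?S")
        case True
        have "ennreal (freq3 s x (\<xi> - fst x, \<mu> - snd x) * jbr (\<tau> - w \<xi> \<mu>) powr (-\<gamma>) * ?J x) \<le> ennreal (2 powr (2 * s) * ?r\<^sup>2 * jbr (snd x) powr (- (2 * s)) * ?J x)"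
          by (rule ennreal_leI[OF pt[OF True]])
        also have "\<dots> = ?h x" using ST[OF True] by (simp add: ennreal_mult mult_ac)
        finally show ?thesis using True by simp
      qed simp
    qed
    also have "\<dots> = ennreal (2 powr (2 * s) * ?r\<^sup>2) * (\<integral>\<^sup>+x. ennreal (jbr (snd x) powr (- (2 * s))) * (ennreal (?J x) * indicator T x) \<partial>lborel)"
      by (rule nn_integral_cmult) measurable
    also have "(\<integral>\<^sup>+x. ennreal (jbr (snd x) powr (- (2 * s))) * (ennreal (?J x) * indicator T x) \<partial>lborel)
      = (\<integral>\<^sup>+m. \<integral>\<^sup>+x. ennreal (jbr m powr (- (2 * s))) * (ennreal (?J (x, m)) * indicator T (x, m)) \<partial>lborel \<partial>lborel)"
      by (subst nn_integral_lborel_prod_swap) simp_all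
    also have "\<dots> \<le> (\<integral>\<^sup>+m. ennreal (jbr m powr (- (2 * s))) * ennreal (2 * jint \<beta> / ?D) \<partial>lborel)"
    proof (rule nn_integral_mono)
      fix m :: real
      have m1: "(\<lambda>x. (x::real, m)) \<in> borel_measurable borel" by (intro borel_measurable_continuous_onI continuous_intros)
      have [measurable]: "(\<lambda>x. ennreal (?J (x, m)) * indicator T (x, m)) \<in> borel_measurable borel"
        by (rule measurable_compose[OF m1]) measurable
      have "(\<integral>\<^sup>+x. ennreal (jbr m powr (- (2 * s))) * (ennreal (?J (x, m)) * indicator T (x, m)) \<partial>lborel)
        = ennreal (jbr m powr (- (2 * s))) * (\<integral>\<^sup>+x. ennreal (?J (x, m)) * indicator T (x, m) \<partial>lborel)"
        by (rule nn_integral_cmult) measurable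
      also have "(\<integral>\<^sup>+x. ennreal (?J (x, m)) * indicator T (x, m) \<partial>lborel) \<le> ennreal (2 * jint \<beta> / ?D)"
        using xi_integral[OF beta1, of ?D \<tau> \<xi> \<mu> m ?r] r by (simp add: T_def indicator_def)
      finally show "(\<integral>\<^sup>+x. ennreal (jbr m powr (- (2 * s))) * (ennreal (?J (x, m)) * indicator T (x, m)) \<partial>lborel)
         \<le> ennreal (jbr m powr (- (2 * s))) * ennreal (2 * jint \<beta> / ?D)" by (simp add: mult_left_mono)
    qed
    also have "\<dots> = ennreal (jint (2 * s)) * ennreal (2 * jint \<beta> / ?D)"
      using s by (subst nn_integral_multc) (simp_all add: nn_integral_jbr)
    finally have "(\<integral>\<^sup>+x. ennreal (freq3 s x (\<xi> - fst x, \<mu> - snd x) * jbr (\<tau> - w \<xi> \<mu>) powr (-\<gamma>) * ?J x) * indicator ?S x \<partial>lborel)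
      \<le> ennreal (2 powr (2 * s) * ?r\<^sup>2) * (ennreal (jint (2 * s)) * ennreal (2 * jint \<beta> / ?D))"
      by (simp add: mult_left_mono)
    also have "\<dots> = ennreal (2 powr (2 * s) * ?r\<^sup>2 * (jint (2 * s) * (2 * jint \<beta> / ?D)))"
      using jint_nonneg by (simp add: ennreal_mult[symmetric])
    also have "2 powr (2 * s) * ?r\<^sup>2 * (jint (2 * s) * (2 * jint \<beta> / ?D)) = 2 powr (2 * s) * (4 * jint \<beta>) * jint (2 * s)"
      using r by (simp add: field_simps)
    finally show ?thesis .
  qed
qed

text \<open>With a high input fixed, the \<xi>-derivative of the phase compares the free input with
  the low output and is again at least r^2 / 2. The other variable ranges over an interval of length
  10 r, so r^2 times the phase integral is only of order r. The output weight cancels against that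
  of the free input.\<close>

lemma region_high_high_low:
  "zk_bounded s \<beta> \<gamma> {p. 4 * rr (fst p + snd p) \<le> rr (snd p)}"
proof (rule zk_input_from_beta[OF s \<delta> \<beta> \<gamma>, where P = "\<lambda>z x. 4 * freq_norm (fst x + fst z) (snd x + fst (snd z)) \<le> freq_norm (fst z) (fst (snd z))" and M = 1 and Cb = "40 * jint \<beta>"])
  show "{p. 4 * rr (fst p + snd p) \<le> rr (snd p)} = {p. 4 * freq_norm (fst (fst (fst p), fst (snd (fst p))) + fst (snd p)) (snd (fst (fst p), fst (snd (fst p))) + fst (snd (snd p))) \<le> freq_norm (fst (snd p)) (fst (snd (snd p)))}"
    by (simp add: rr_def)
  show "closed {p. 4 * rr (fst p + snd p) \<le> rr (snd p)}"
    unfolding rr_def by (intro closed_Collect_le continuous_intros)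
  show "closed {x. 4 * freq_norm (fst x + fst z) (snd x + fst (snd z)) \<le> freq_norm (fst z) (fst (snd z))}" for z :: R3
    by (intro closed_Collect_le continuous_intros)
  show "0 \<le> 40 * jint \<beta>" using jint_nonneg by simp
  {
    fix \<xi> \<mu> \<tau> :: real and x assume "4 * freq_norm (fst x + fst (\<xi>, \<mu>, \<tau>)) (snd x + fst (snd (\<xi>, \<mu>, \<tau>))) \<le> freq_norm (fst (\<xi>, \<mu>, \<tau>)) (fst (snd (\<xi>, \<mu>, \<tau>)))"
    then have a: "4 * freq_norm (fst x + \<xi>) (snd x + \<mu>) \<le> freq_norm \<xi> \<mu>" by simp
    let ?r = "freq_norm (fst x + \<xi>) (snd x + \<mu>)" and ?r1 = "freq_norm (fst x) (snd x)" and ?r2 = "freq_norm \<xi> \<mu>"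
    have b: "?r1 \<le> ?r + ?r2" "?r2 \<le> ?r + ?r1"
      using freq_norm_sum_bounds[where a = "fst x + \<xi>" and b = "snd x + \<mu>" and c = \<xi> and d = \<mu>] by auto
    have bb: "\<bar>fst x\<bar> \<le> ?r1" "\<bar>snd x\<bar> \<le> ?r1" by (rule freq_norm_bounds)+
    show "\<bar>fst x\<bar> \<le> 5 * ?r2 \<and> \<bar>snd x\<bar> \<le> 5 * ?r2" using a b bb freq_norm_nonneg[of \<xi> \<mu>] by linarith
    \<comment> \<open>The inputs are exchanged so that the weight left over by
      \<open>freq3_le\<close> belongs to the fixed input.\<close>
    have "freq3 s x (\<xi>, \<mu>) = freq3 s (\<xi>, \<mu>) x" by (rule freq3_commute[OF s \<delta> \<beta> \<gamma>])
    also have "\<dots> \<le> 1 powr (2 * s) * (freq_norm (fst (\<xi>, \<mu>) + fst x) (snd (\<xi>, \<mu>) + snd x))\<^sup>2 * jbr (freq_norm (fst (\<xi>, \<mu>)) (snd (\<xi>, \<mu>))) powr (- 2 * s)"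
      using a b freq_norm_nonneg[of \<xi> \<mu>] by (intro freq3_le[OF s \<delta> \<beta> \<gamma>]) (auto simp: add.commute)
    also have "\<dots> = ?r\<^sup>2 * jbr ?r2 powr (- 2 * s)" by (simp add: add.commute)
    also have "\<dots> \<le> ?r2\<^sup>2 * jbr ?r2 powr (- 2 * s)"
      using a freq_norm_nonneg[of "fst x + \<xi>" "snd x + \<mu>"] by (intro mult_right_mono power_mono) auto
    finally show "freq3 s x (\<xi>, \<mu>) \<le> 1 * (?r2\<^sup>2 * jbr ?r2 powr (- 2 * s))" by simp
  }
  fix \<xi> \<mu> \<tau> t :: real
  let ?r = "freq_norm \<xi> \<mu>"
  let ?D = "?r\<^sup>2 / 2"
  let ?J = "\<lambda>x. jbr (t - ph (-\<xi>) (-\<mu>) (fst x) (snd x)) powr (-\<beta>)"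
  let ?S = "{x. 4 * freq_norm (fst x + fst (\<xi>, \<mu>, \<tau>)) (snd x + fst (snd (\<xi>, \<mu>, \<tau>))) \<le> freq_norm (fst (\<xi>, \<mu>, \<tau>)) (fst (snd (\<xi>, \<mu>, \<tau>)))}"
  show "ennreal (?r\<^sup>2) * (\<integral>\<^sup>+x. ennreal (?J x) * indicator ?S x \<partial>lborel) \<le> ennreal (40 * jint \<beta> * jbr ?r powr (1 + 3 * \<delta>))"
  proof (cases "?r = 0")
    case False
    then have r: "?r > 0" using freq_norm_nonneg[of \<xi> \<mu>] by simp
    define T where "T = {x. \<bar>snd x\<bar> \<le> 5 * ?r \<and> \<bar>fst x\<bar> \<le> 5 * ?r \<and> ?D \<le> \<bar>fn2 (fst x) (snd x) - fn2 (-\<xi> - fst x) (-\<mu> - snd x)\<bar>}"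
    have T: "closed T" unfolding T_def fn2_def by (intro closed_Collect_conj closed_Collect_le continuous_intros)
    then have [measurable]: "T \<in> sets borel" by auto
    have ST: "x \<in> T" if "x \<in> ?S" for x
    proof -
      have a: "4 * freq_norm (fst x + \<xi>) (snd x + \<mu>) \<le> freq_norm \<xi> \<mu>" using that by simp
      let ?ro = "freq_norm (fst x + \<xi>) (snd x + \<mu>)" and ?r1 = "freq_norm (fst x) (snd x)"
      have b: "?r1 \<le> ?ro + ?r" "?r \<le> ?ro + ?r1"
        using freq_norm_sum_bounds[where a = "fst x + \<xi>" and b = "snd x + \<mu>" and c = \<xi> and d = \<mu>] by auto
      have bb: "\<bar>fst x\<bar> \<le> ?r1" "\<bar>snd x\<bar> \<le> ?r1" by (rule freq_norm_bounds)+
      have 1: "\<bar>fst x\<bar> \<le> 5 * ?r" "\<bar>snd x\<bar> \<le> 5 * ?r" using a b bb r by linarith+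
      have "(3 / 4 * ?r)\<^sup>2 \<le> ?r1\<^sup>2" by (intro power_mono) (use a b r in linarith)+
      have sqs: "(3 / 4 * y)\<^sup>2 = 9 / 16 * y\<^sup>2" "(y / 4)\<^sup>2 = 1 / 16 * y\<^sup>2" for y :: real by (simp_all add: power2_eq_square)
      have e1: "(3 / 4 * ?r)\<^sup>2 \<le> ?r1\<^sup>2" by fact
      have e2: "?ro\<^sup>2 \<le> (?r / 4)\<^sup>2" using a freq_norm_nonneg by (intro power_mono) auto
      have "?D \<le> ?r1\<^sup>2 - ?ro\<^sup>2" using e1 e2 unfolding sqs by linarith
      moreover have "fn2 (-\<xi> - fst x) (-\<mu> - snd x) = ?ro\<^sup>2"
        unfolding freq_norm_sq fn2_def by (simp add: power2_eq_square algebra_simps)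
      ultimately have "?D \<le> \<bar>fn2 (fst x) (snd x) - fn2 (-\<xi> - fst x) (-\<mu> - snd x)\<bar>" unfolding freq_norm_sq by linarith
      with 1 show ?thesis by (simp add: T_def)
    qed
    have [measurable]: "(\<lambda>x. ennreal (?J x)) \<in> borel_measurable borel" by (rule jbr_ph_measurable[OF s \<delta> \<beta> \<gamma>])
    have "(\<integral>\<^sup>+x. ennreal (?J x) * indicator ?S x \<partial>lborel) \<le> (\<integral>\<^sup>+x. ennreal (?J x) * indicator T x \<partial>lborel)"
      using ST by (intro nn_integral_mono) (auto split: split_indicator)
    also have "\<dots> = (\<integral>\<^sup>+m. \<integral>\<^sup>+x. ennreal (?J (x, m)) * indicator T (x, m) \<partial>lborel \<partial>lborel)"
      by (subst nn_integral_lborel_prod_swap) simp_all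
    also have "\<dots> \<le> (\<integral>\<^sup>+m. ennreal (2 * jint \<beta> / ?D) * indicator {-(5 * ?r)..5 * ?r} m \<partial>lborel)"
    proof (rule nn_integral_mono)
      fix m :: real
      show "(\<integral>\<^sup>+x. ennreal (?J (x, m)) * indicator T (x, m) \<partial>lborel) \<le> ennreal (2 * jint \<beta> / ?D) * indicator {-(5 * ?r)..5 * ?r} m"
      proof (cases "\<bar>m\<bar> \<le> 5 * ?r")
        case True
        have "(\<integral>\<^sup>+x. ennreal (?J (x, m)) * indicator T (x, m) \<partial>lborel) \<le> ennreal (2 * jint \<beta> / ?D)"
          using xi_integral[OF beta1, of ?D t "-\<xi>" "-\<mu>" m "5 * ?r"] r True by (simp add: T_def indicator_def)
        then show ?thesis using True by (simp add: abs_le_iff)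
      qed (simp add: T_def)
    qed
    also have "\<dots> = ennreal (2 * jint \<beta> / ?D) * ennreal (10 * ?r)"
      using r by (subst nn_integral_cmult_indicator) simp_all
    finally have "ennreal (?r\<^sup>2) * (\<integral>\<^sup>+x. ennreal (?J x) * indicator ?S x \<partial>lborel) \<le> ennreal (?r\<^sup>2) * (ennreal (2 * jint \<beta> / ?D) * ennreal (10 * ?r))"
      by (rule mult_left_mono) simp
    \<comment> \<open>The 40 is the factor 4 from \<open>2 * jint \<beta> / ?D\<close> times the
      length 10 in units of r.\<close>
    also have "\<dots> = ennreal (40 * jint \<beta> * ?r)"
      using jint_nonneg[of \<beta>] r by (simp add: ennreal_mult[symmetric] field_simps)
    also have "\<dots> \<le> ennreal (40 * jint \<beta> * jbr ?r powr (1 + 3 * \<delta>))"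
    proof -
      have "?r \<le> jbr ?r powr 1" by (simp add: jbr_def)
      also have "\<dots> \<le> jbr ?r powr (1 + 3 * \<delta>)" using \<delta> jbr_ge_1 by (intro powr_mono) auto
      finally show ?thesis using jint_nonneg[of \<beta>] by (intro ennreal_leI mult_left_mono) auto
    qed
    finally show ?thesis .
  qed simp
qed simp

end

context
  fixes s \<delta> \<beta> \<gamma> :: real
  assumes s: "s > 1 / 2" and \<delta>: "\<delta> > 0" "21 * \<delta> \<le> 2 * s - 1" "8 * \<delta> \<le> 1"
    and \<beta>: "\<beta> = 1 + 2 * \<delta>" and \<gamma>: "\<gamma> = 1 - 4 * \<delta>"
begin

text \<open>The weights of the output and of the second input cancel up to 5^(2 s). The weight of
  the first input, of comparable size, is rewritten in terms of the fixed output at the cost of a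
  second such factor.\<close>

lemma freq3_comparable_output:
  assumes "comparable (freq_norm \<xi> \<mu>) (freq_norm (fst x) (snd x)) (freq_norm (\<xi> - fst x) (\<mu> - snd x))"
  shows "freq3 s x (\<xi> - fst x, \<mu> - snd x) \<le> 5 powr (2 * s) * 5 powr (2 * s) * ((freq_norm \<xi> \<mu>)\<^sup>2 * jbr (freq_norm \<xi> \<mu>) powr (- 2 * s))"
proof -
  let ?r = "freq_norm \<xi> \<mu>" and ?u = "freq_norm (fst x) (snd x)"
  have "freq3 s x (\<xi> - fst x, \<mu> - snd x) \<le> 5 powr (2 * s) * ?r\<^sup>2 * jbr ?u powr (- 2 * s)"
    using freq3_le[OF s \<delta> \<beta> \<gamma>, of 5 x "(\<xi> - fst x, \<mu> - snd x)"] assms by (simp add: comparable_def)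
  also have "jbr ?u powr (- 2 * s) \<le> 5 powr (2 * s) * jbr ?r powr (- 2 * s)"
  proof -
    have "jbr ?r \<le> 5 * jbr ?u" using assms by (intro jbr_scale freq_norm_nonneg) (auto simp: comparable_def)
    then have "jbr ?u powr (- 2 * s) \<le> (jbr ?r / 5) powr (- 2 * s)"
      using s jbr_pos[of ?r] by (intro powr_mono2') auto
    also have "\<dots> = 5 powr (2 * s) * jbr ?r powr (- 2 * s)"
      by (simp add: powr_divide powr_minus jbr_nonneg field_simps)
    finally show ?thesis .
  qed
  finally show ?thesis by (simp add: mult_left_mono mult_right_mono mult_ac)
qed

lemma freq3_comparable_input:
  assumes "comparable (freq_norm (fst x + \<xi>) (snd x + \<mu>)) (freq_norm (fst x) (snd x)) (freq_norm \<xi> \<mu>)"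
  shows "freq3 s x (\<xi>, \<mu>) \<le> 25 * 5 powr (2 * s) * ((freq_norm \<xi> \<mu>)\<^sup>2 * jbr (freq_norm \<xi> \<mu>) powr (- 2 * s))"
proof -
  let ?r = "freq_norm \<xi> \<mu>" and ?u = "freq_norm (fst x + \<xi>) (snd x + \<mu>)"
  have "freq3 s x (\<xi>, \<mu>) = freq3 s (\<xi>, \<mu>) x" by (rule freq3_commute[OF s \<delta> \<beta> \<gamma>])
  also have "\<dots> \<le> 5 powr (2 * s) * ?u\<^sup>2 * jbr ?r powr (- 2 * s)"
    using freq3_le[OF s \<delta> \<beta> \<gamma>, of 5 "(\<xi>, \<mu>)" x] assms by (simp add: comparable_def add.commute)
  also have "\<dots> \<le> 5 powr (2 * s) * (5 * ?r)\<^sup>2 * jbr ?r powr (- 2 * s)"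
    using assms by (intro mult_right_mono mult_left_mono power_mono freq_norm_nonneg) (auto simp: comparable_def)
  finally show ?thesis by (simp add: power_mult_distrib mult_ac)
qed

lemma Kdet_continuous: "continuous_on A f \<Longrightarrow> continuous_on A g \<Longrightarrow> continuous_on A (\<lambda>x. Kdet (f x) (g x))"
  unfolding Kdet_def by (intro continuous_intros)

lemma closed_comparable:
  assumes "continuous_on UNIV f" "continuous_on UNIV g" "continuous_on UNIV h"
  shows "closed {x. comparable (f x) (g x) (h x)}"
  unfolding comparable_def using assms
  by (intro closed_Collect_conj closed_Collect_le continuous_intros)

text \<open>The planar bound is used with c = 1/40 and interpolation exponent \<delta>, and r^2 r^(3
  \<delta> - 1) = r^(1 + 3 \<delta>). The determinant condition concerns only the fixed frequency,
  so it either leaves a slice untouched or empties it; this is the form of the two conditions on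
  \<open>S\<close>.\<close>

lemma quadratic_region:
  obtains Cb where "Cb \<ge> 0" "\<And>\<xi> \<mu> t S. ((freq_norm \<xi> \<mu>)\<^sup>2 / 40 \<le> \<bar>Kdet \<xi> \<mu>\<bar> \<Longrightarrow> S \<subseteq> {x. \<bar>fst x\<bar> \<le> 5 * freq_norm \<xi> \<mu> \<and> \<bar>snd x\<bar> \<le> 5 * freq_norm \<xi> \<mu>}) \<Longrightarrow>
     (\<not> (freq_norm \<xi> \<mu>)\<^sup>2 / 40 \<le> \<bar>Kdet \<xi> \<mu>\<bar> \<Longrightarrow> S = {}) \<Longrightarrow>
     ennreal ((freq_norm \<xi> \<mu>)\<^sup>2) * (\<integral>\<^sup>+x. ennreal (jbr (t - ph \<xi> \<mu> (fst x) (snd x)) powr (-\<beta>)) * indicator S x \<partial>lborel)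
        \<le> ennreal (Cb * jbr (freq_norm \<xi> \<mu>) powr (1 + 3 * \<delta>))"
proof -
  have b: "\<beta> > 1" and d: "\<delta> < 1" using \<beta> \<delta> by auto
  obtain C where C: "C \<ge> 0" and Q: "\<And>\<xi> \<mu> t. freq_norm \<xi> \<mu> > 0 \<Longrightarrow> 1 / 40 * (freq_norm \<xi> \<mu>)\<^sup>2 \<le> \<bar>3 * \<xi>\<^sup>2 - \<mu>\<^sup>2\<bar> \<Longrightarrow>
    (\<integral>\<^sup>+z. ennreal (jbr (t - ph \<xi> \<mu> (fst z) (snd z)) powr (-\<beta>)) *
       indicator {z. \<bar>fst z\<bar> \<le> 5 * freq_norm \<xi> \<mu> \<and> \<bar>snd z\<bar> \<le> 5 * freq_norm \<xi> \<mu>} z \<partial>lborel)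
      \<le> ennreal (C * freq_norm \<xi> \<mu> powr (3 * \<delta> - 1))"
    using quadratic_form_integral[OF b \<delta>(1) d, of "1/40"] by auto
  show ?thesis
  proof (rule that[OF C])
    fix \<xi> \<mu> t :: real and S
    let ?r = "freq_norm \<xi> \<mu>"
    assume S: "?r\<^sup>2 / 40 \<le> \<bar>Kdet \<xi> \<mu>\<bar> \<Longrightarrow> S \<subseteq> {x. \<bar>fst x\<bar> \<le> 5 * ?r \<and> \<bar>snd x\<bar> \<le> 5 * ?r}" "\<not> ?r\<^sup>2 / 40 \<le> \<bar>Kdet \<xi> \<mu>\<bar> \<Longrightarrow> S = {}"
    let ?I = "(\<integral>\<^sup>+x. ennreal (jbr (t - ph \<xi> \<mu> (fst x) (snd x)) powr (-\<beta>)) * indicator S x \<partial>lborel)"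
    show "ennreal (?r\<^sup>2) * ?I \<le> ennreal (C * jbr ?r powr (1 + 3 * \<delta>))"
    proof (cases "?r = 0 \<or> \<not> ?r\<^sup>2 / 40 \<le> \<bar>Kdet \<xi> \<mu>\<bar>")
      case True then show ?thesis using S(2) by auto
    next
      case False
      then have r: "?r > 0" and K: "?r\<^sup>2 / 40 \<le> \<bar>Kdet \<xi> \<mu>\<bar>" using freq_norm_nonneg[of \<xi> \<mu>] by auto
      have "?I \<le> (\<integral>\<^sup>+z. ennreal (jbr (t - ph \<xi> \<mu> (fst z) (snd z)) powr (-\<beta>)) *
       indicator {z. \<bar>fst z\<bar> \<le> 5 * ?r \<and> \<bar>snd z\<bar> \<le> 5 * ?r} z \<partial>lborel)"
        using S(1)[OF K] by (intro nn_integral_mono) (auto split: split_indicator)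
      also have "\<dots> \<le> ennreal (C * ?r powr (3 * \<delta> - 1))" using K by (intro Q[OF r]) (simp add: Kdet_def)
      finally have "ennreal (?r\<^sup>2) * ?I \<le> ennreal (?r\<^sup>2) * ennreal (C * ?r powr (3 * \<delta> - 1))"
        by (rule mult_left_mono) simp
      also have "\<dots> = ennreal (C * (?r powr 2 * ?r powr (3 * \<delta> - 1)))"
        using C r by (simp add: ennreal_mult[symmetric] mult_ac powr_numeral)
      also have "\<dots> = ennreal (C * ?r powr (1 + 3 * \<delta>))" by (simp add: powr_add[symmetric] add.commute)
      also have "\<dots> \<le> ennreal (C * jbr ?r powr (1 + 3 * \<delta>))"
        using C r \<delta> by (intro ennreal_leI mult_left_mono powr_mono2) (auto simp: jbr_def)
      finally show ?thesis .
    qed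
  qed
qed

lemma box_of_freq_norm: "freq_norm (fst x) (snd x) \<le> 5 * r \<Longrightarrow> \<bar>fst x\<bar> \<le> 5 * r \<and> \<bar>snd x\<bar> \<le> 5 * r"
  using freq_norm_bounds(1)[of "snd x" "fst x"] freq_norm_bounds(3)[of "fst x" "snd x"] by simp

lemma region_K_output:
  "zk_bounded s \<beta> \<gamma> {p. comparable (rr (fst p + snd p)) (rr (fst p)) (rr (snd p)) \<and>
     (rr (fst p + snd p))\<^sup>2 / 40 \<le> \<bar>Kdet (fst (fst p + snd p)) (fst (snd (fst p + snd p)))\<bar>}"
proof -
  obtain Cb where Cb: "Cb \<ge> 0" and bd: "\<And>\<xi> \<mu> t S. ((freq_norm \<xi> \<mu>)\<^sup>2 / 40 \<le> \<bar>Kdet \<xi> \<mu>\<bar> \<Longrightarrow> S \<subseteq> {x. \<bar>fst x\<bar> \<le> 5 * freq_norm \<xi> \<mu> \<and> \<bar>snd x\<bar> \<le> 5 * freq_norm \<xi> \<mu>}) \<Longrightarrow>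
     (\<not> (freq_norm \<xi> \<mu>)\<^sup>2 / 40 \<le> \<bar>Kdet \<xi> \<mu>\<bar> \<Longrightarrow> S = {}) \<Longrightarrow>
     ennreal ((freq_norm \<xi> \<mu>)\<^sup>2) * (\<integral>\<^sup>+x. ennreal (jbr (t - ph \<xi> \<mu> (fst x) (snd x)) powr (-\<beta>)) * indicator S x \<partial>lborel)
        \<le> ennreal (Cb * jbr (freq_norm \<xi> \<mu>) powr (1 + 3 * \<delta>))" using quadratic_region by blast
  show ?thesis
  proof (rule zk_output_from_beta[OF s \<delta> \<beta> \<gamma>, where P = "\<lambda>z x. comparable (freq_norm (fst z) (fst (snd z))) (freq_norm (fst x) (snd x)) (freq_norm (fst z - fst x) (fst (snd z) - snd x)) \<and>
       (freq_norm (fst z) (fst (snd z)))\<^sup>2 / 40 \<le> \<bar>Kdet (fst z) (fst (snd z))\<bar>" and M = "5 powr (2 * s) * 5 powr (2 * s)", OF _ _ _ _ Cb], goal_cases)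
    case 1 show ?case by (simp add: rr_def)
  next
    case 2 show ?case unfolding rr_def
      by (intro closed_Collect_conj closed_comparable closed_Collect_le continuous_intros Kdet_continuous) auto
  next
    case (3 z) show ?case
      by (intro closed_Collect_conj closed_comparable closed_Collect_const continuous_intros)
  next
    case 4 show ?case by simp
  next
    case (5 \<xi> \<mu> \<tau> x) then show ?case by (intro freq3_comparable_output) simp
  next
    case (6 \<xi> \<mu> \<tau> t) show ?case
      by (rule bd) (auto simp: comparable_def dest!: box_of_freq_norm[rotated] intro: box_of_freq_norm[THEN conjunct1] box_of_freq_norm[THEN conjunct2] )
  qed
qed

lemma region_K_input:
  "zk_bounded s \<beta> \<gamma> {p. comparable (rr (fst p + snd p)) (rr (fst p)) (rr (snd p)) \<and>
     (rr (snd p))\<^sup>2 / 40 \<le> \<bar>Kdet (fst (snd p)) (fst (snd (snd p)))\<bar>}"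
proof -
  obtain Cb where Cb: "Cb \<ge> 0" and bd: "\<And>\<xi> \<mu> t S. ((freq_norm \<xi> \<mu>)\<^sup>2 / 40 \<le> \<bar>Kdet \<xi> \<mu>\<bar> \<Longrightarrow> S \<subseteq> {x. \<bar>fst x\<bar> \<le> 5 * freq_norm \<xi> \<mu> \<and> \<bar>snd x\<bar> \<le> 5 * freq_norm \<xi> \<mu>}) \<Longrightarrow>
     (\<not> (freq_norm \<xi> \<mu>)\<^sup>2 / 40 \<le> \<bar>Kdet \<xi> \<mu>\<bar> \<Longrightarrow> S = {}) \<Longrightarrow>
     ennreal ((freq_norm \<xi> \<mu>)\<^sup>2) * (\<integral>\<^sup>+x. ennreal (jbr (t - ph \<xi> \<mu> (fst x) (snd x)) powr (-\<beta>)) * indicator S x \<partial>lborel)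
        \<le> ennreal (Cb * jbr (freq_norm \<xi> \<mu>) powr (1 + 3 * \<delta>))" using quadratic_region by blast
  show ?thesis
  proof (rule zk_input_from_beta[OF s \<delta> \<beta> \<gamma>, where P = "\<lambda>z x. comparable (freq_norm (fst x + fst z) (snd x + fst (snd z))) (freq_norm (fst x) (snd x)) (freq_norm (fst z) (fst (snd z))) \<and>
       (freq_norm (fst z) (fst (snd z)))\<^sup>2 / 40 \<le> \<bar>Kdet (fst z) (fst (snd z))\<bar>" and M = "25 * 5 powr (2 * s)", OF _ _ _ _ Cb], goal_cases)
    case 1 show ?case by (simp add: rr_def)
  next
    case 2 show ?case unfolding rr_def
      by (intro closed_Collect_conj closed_comparable closed_Collect_le continuous_intros Kdet_continuous) auto
  next
    case (3 z) show ?case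
      by (intro closed_Collect_conj closed_comparable closed_Collect_const continuous_intros)
  next
    case 4 show ?case by simp
  next
    case (5 \<xi> \<mu> \<tau> x) then show ?case
      using freq_norm_nonneg[of \<xi> \<mu>] by (intro box_of_freq_norm) (auto simp: comparable_def)
  next
    case (6 \<xi> \<mu> \<tau> x) then show ?case by (intro freq3_comparable_input) simp
  next
    case (7 \<xi> \<mu> \<tau> t) 
    \<comment> \<open>The phase for a fixed input belongs to the negated frequency, and the
      determinant is even.\<close>
    have e: "Kdet (-\<xi>) (-\<mu>) = Kdet \<xi> \<mu>" by (simp add: Kdet_def)
    show ?case
      by (rule bd[of "-\<xi>" "-\<mu>", unfolded freq_norm_minus e])
        (use freq_norm_nonneg[of \<xi> \<mu>] in \<open>auto simp: comparable_def intro: box_of_freq_norm[THEN conjunct1] box_of_freq_norm[THEN conjunct2]\<close>)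
  qed
qed

lemma sigma_region:
  assumes "closed S" "S \<subseteq> {x. \<bar>fst x\<bar> \<le> 5 * r \<and> \<bar>snd x\<bar> \<le> 5 * r}" "r \<ge> 0" "M \<ge> 0"
    and pt: "\<And>x. x \<in> S \<Longrightarrow> f x \<le> M * (r\<^sup>2 * (jbr r powr (- 2 * s) * jbr r powr (- 3 * \<gamma>)))"
  shows "(\<integral>\<^sup>+x. ennreal (f x) * indicator S x \<partial>lborel) \<le> ennreal (M * 100)"
proof (rule nn_integral_weighted_le[where J = "\<lambda>_. 1" and r = r and q = "jbr r powr (- 2 * s) * jbr r powr (- 3 * \<gamma>)" and p = "jbr r powr 4", OF s \<delta> \<beta> \<gamma> assms(1) assms(4)])
  show "ennreal (f x) \<le> ennreal (M * (r\<^sup>2 * (jbr r powr (- 2 * s) * jbr r powr (- 3 * \<gamma>)))) * 1" if "x \<in> S" for x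
    using pt[OF that] by (simp add: ennreal_leI)
  have "(\<integral>\<^sup>+x. 1 * indicator S x \<partial>lborel) \<le> (\<integral>\<^sup>+x. indicator {x::real\<times>real. \<bar>fst x\<bar> \<le> 5 * r \<and> \<bar>snd x\<bar> \<le> 5 * r} x \<partial>lborel)"
    using assms(2) by (intro nn_integral_mono) (auto split: split_indicator)
  also have "\<dots> = ennreal (4 * (5 * r)\<^sup>2)" using assms(3) by (intro nn_integral_box) simp
  finally have "ennreal (r\<^sup>2) * (\<integral>\<^sup>+x. 1 * indicator S x \<partial>lborel) \<le> ennreal (r\<^sup>2) * ennreal (4 * (5 * r)\<^sup>2)"
    by (rule mult_left_mono) simp
  also have "\<dots> = ennreal (100 * r ^ 4)" by (simp add: ennreal_mult[symmetric] power2_eq_square power4_eq_xxxx mult_ac)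
  also have "\<dots> \<le> ennreal (100 * jbr r powr 4)"
    using assms(3) by (intro ennreal_leI mult_left_mono) (auto simp: powr_numeral jbr_nonneg jbr_def intro!: power_mono)
  finally show "ennreal (r\<^sup>2) * (\<integral>\<^sup>+x. 1 * indicator S x \<partial>lborel) \<le> ennreal (100 * jbr r powr 4)" .
  have "jbr r powr (- 2 * s) * jbr r powr (- 3 * \<gamma>) * jbr r powr 4 = jbr r powr (- 2 * s - 3 * \<gamma> + 4)"
    by (simp add: powr_add[symmetric])
  also have "\<dots> \<le> 1" using \<delta> \<gamma> by (intro jbr_powr_le_const) auto
  finally show "jbr r powr (- 2 * s) * jbr r powr (- 3 * \<gamma>) * jbr r powr 4 \<le> 1" .
qed auto

lemma region_sigma_output:
  "zk_bounded s \<beta> \<gamma> {p. comparable (rr (fst p + snd p)) (rr (fst p)) (rr (snd p)) \<and> (rr (fst p + snd p)) ^ 3 / 200 \<le> \<bar>sg (fst p + snd p)\<bar>}"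
proof (rule zk_fixed_output[OF s \<delta> \<beta> \<gamma>, where P = "\<lambda>z x. comparable (freq_norm (fst z) (fst (snd z))) (freq_norm (fst x) (snd x)) (freq_norm (fst z - fst x) (fst (snd z) - snd x)) \<and>
       (freq_norm (fst z) (fst (snd z))) ^ 3 / 200 \<le> \<bar>sg z\<bar>" and C = "(5 powr (2 * s) * 5 powr (2 * s) * 800 powr \<gamma>) * 100"], goal_cases)
  case 1 show ?case by (simp add: rr_def)
next
  case 2 show ?case unfolding rr_def sg_def
    by (intro closed_Collect_conj closed_comparable closed_Collect_le continuous_intros) auto
next
  case (3 z) show ?case
    by (intro closed_Collect_conj closed_comparable closed_Collect_const continuous_intros)
next
  case 4 show ?case by simp
next
  case (5 \<xi> \<mu> \<tau>)
  show ?case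
  proof (rule sigma_region[where r = "freq_norm \<xi> \<mu>"])
    show "closed {x. comparable (freq_norm (fst (\<xi>, \<mu>, \<tau>)) (fst (snd (\<xi>, \<mu>, \<tau>)))) (freq_norm (fst x) (snd x)) (freq_norm (fst (\<xi>, \<mu>, \<tau>) - fst x) (fst (snd (\<xi>, \<mu>, \<tau>)) - snd x)) \<and>
       (freq_norm (fst (\<xi>, \<mu>, \<tau>)) (fst (snd (\<xi>, \<mu>, \<tau>)))) ^ 3 / 200 \<le> \<bar>sg (\<xi>, \<mu>, \<tau>)\<bar>}"
      by (intro closed_Collect_conj closed_comparable closed_Collect_const continuous_intros)
    show "{x. comparable (freq_norm (fst (\<xi>, \<mu>, \<tau>)) (fst (snd (\<xi>, \<mu>, \<tau>)))) (freq_norm (fst x) (snd x)) (freq_norm (fst (\<xi>, \<mu>, \<tau>) - fst x) (fst (snd (\<xi>, \<mu>, \<tau>)) - snd x)) \<and>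
       (freq_norm (fst (\<xi>, \<mu>, \<tau>)) (fst (snd (\<xi>, \<mu>, \<tau>)))) ^ 3 / 200 \<le> \<bar>sg (\<xi>, \<mu>, \<tau>)\<bar>} \<subseteq> {x. \<bar>fst x\<bar> \<le> 5 * freq_norm \<xi> \<mu> \<and> \<bar>snd x\<bar> \<le> 5 * freq_norm \<xi> \<mu>}"
      using freq_norm_nonneg[of \<xi> \<mu>] by (intro subsetI CollectI box_of_freq_norm) (auto simp: comparable_def)
    fix x assume "x \<in> {x. comparable (freq_norm (fst (\<xi>, \<mu>, \<tau>)) (fst (snd (\<xi>, \<mu>, \<tau>)))) (freq_norm (fst x) (snd x)) (freq_norm (fst (\<xi>, \<mu>, \<tau>) - fst x) (fst (snd (\<xi>, \<mu>, \<tau>)) - snd x)) \<and>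
       (freq_norm (fst (\<xi>, \<mu>, \<tau>)) (fst (snd (\<xi>, \<mu>, \<tau>)))) ^ 3 / 200 \<le> \<bar>sg (\<xi>, \<mu>, \<tau>)\<bar>}"
    then have c: "comparable (freq_norm \<xi> \<mu>) (freq_norm (fst x) (snd x)) (freq_norm (\<xi> - fst x) (\<mu> - snd x))"
      and sg: "(freq_norm \<xi> \<mu>) ^ 3 / 200 \<le> \<bar>\<tau> - w \<xi> \<mu>\<bar>" by (auto simp: sg_def)
    have "freq3 s x (\<xi> - fst x, \<mu> - snd x) * jbr (\<tau> - w \<xi> \<mu>) powr (-\<gamma>) * jbr (\<tau> - ph \<xi> \<mu> (fst x) (snd x)) powr (-\<beta>)
      \<le> (5 powr (2 * s) * 5 powr (2 * s) * ((freq_norm \<xi> \<mu>)\<^sup>2 * jbr (freq_norm \<xi> \<mu>) powr (- 2 * s))) * (800 powr \<gamma> * jbr (freq_norm \<xi> \<mu>) powr (- 3 * \<gamma>)) * 1"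
      using \<gamma> \<beta> \<delta> by (intro mult_mono freq3_comparable_output[OF c] jbr_sigma_le[OF freq_norm_nonneg sg] jbr_powr_le_1 mult_nonneg_nonneg freq3_nonneg) auto
    then show "freq3 s x (\<xi> - fst x, \<mu> - snd x) * jbr (\<tau> - w \<xi> \<mu>) powr (-\<gamma>) * jbr (\<tau> - ph \<xi> \<mu> (fst x) (snd x)) powr (-\<beta>)
      \<le> (5 powr (2 * s) * 5 powr (2 * s) * 800 powr \<gamma>) * ((freq_norm \<xi> \<mu>)\<^sup>2 * (jbr (freq_norm \<xi> \<mu>) powr (- 2 * s) * jbr (freq_norm \<xi> \<mu>) powr (- 3 * \<gamma>)))"
      by (simp only: mult_ac mult_1_right)
  qed (auto simp: freq_norm_nonneg)
qed

lemma region_sigma_input: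
  "zk_bounded s \<beta> \<gamma> {p. comparable (rr (fst p + snd p)) (rr (fst p)) (rr (snd p)) \<and> (rr (snd p)) ^ 3 / 200 \<le> \<bar>sg (snd p)\<bar>}"
proof (rule zk_fixed_input[OF s \<delta> \<beta> \<gamma>, where P = "\<lambda>z x. comparable (freq_norm (fst x + fst z) (snd x + fst (snd z))) (freq_norm (fst x) (snd x)) (freq_norm (fst z) (fst (snd z))) \<and>
       (freq_norm (fst z) (fst (snd z))) ^ 3 / 200 \<le> \<bar>sg z\<bar>" and C = "(25 * 5 powr (2 * s) * 800 powr \<gamma>) * 100"], goal_cases)
  case 1 show ?case by (simp add: rr_def)
next
  case 2 show ?case unfolding rr_def sg_def
    by (intro closed_Collect_conj closed_comparable closed_Collect_le continuous_intros) auto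
next
  case (3 z) show ?case
    by (intro closed_Collect_conj closed_comparable closed_Collect_const continuous_intros)
next
  case 4 show ?case by simp
next
  case (5 \<xi> \<mu> \<tau>)
  let ?S = "{x. comparable (freq_norm (fst x + fst (\<xi>, \<mu>, \<tau>)) (snd x + fst (snd (\<xi>, \<mu>, \<tau>)))) (freq_norm (fst x) (snd x)) (freq_norm (fst (\<xi>, \<mu>, \<tau>)) (fst (snd (\<xi>, \<mu>, \<tau>)))) \<and>
       (freq_norm (fst (\<xi>, \<mu>, \<tau>)) (fst (snd (\<xi>, \<mu>, \<tau>)))) ^ 3 / 200 \<le> \<bar>sg (\<xi>, \<mu>, \<tau>)\<bar>}"
  show ?case
  proof (rule sigma_region[where r = "freq_norm \<xi> \<mu>"])
    show "closed ?S"
      by (intro closed_Collect_conj closed_comparable closed_Collect_const continuous_intros)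
    show "?S \<subseteq> {x. \<bar>fst x\<bar> \<le> 5 * freq_norm \<xi> \<mu> \<and> \<bar>snd x\<bar> \<le> 5 * freq_norm \<xi> \<mu>}"
      using freq_norm_nonneg[of \<xi> \<mu>] by (intro subsetI CollectI box_of_freq_norm) (auto simp: comparable_def)
    fix x assume "x \<in> ?S"
    then have c: "comparable (freq_norm (fst x + \<xi>) (snd x + \<mu>)) (freq_norm (fst x) (snd x)) (freq_norm \<xi> \<mu>)"
      and sg: "(freq_norm \<xi> \<mu>) ^ 3 / 200 \<le> \<bar>\<tau> - w \<xi> \<mu>\<bar>" by (auto simp: sg_def)
    \<comment> \<open>An input modulation has the better exponent \<open>\<beta>\<close>; weakening
      it to \<open>\<gamma>\<close> allows the same area bound as for the output.\<close>
    have "jbr (\<tau> - w \<xi> \<mu>) powr (-\<beta>) \<le> jbr (\<tau> - w \<xi> \<mu>) powr (-\<gamma>)"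
      using \<beta> \<gamma> \<delta> jbr_ge_1 by (intro powr_mono) auto
    also have "\<dots> \<le> 800 powr \<gamma> * jbr (freq_norm \<xi> \<mu>) powr (- 3 * \<gamma>)"
      using \<gamma> \<delta> by (intro jbr_sigma_le[OF freq_norm_nonneg sg]) auto
    finally have sb: "jbr (\<tau> - w \<xi> \<mu>) powr (-\<beta>) \<le> 800 powr \<gamma> * jbr (freq_norm \<xi> \<mu>) powr (- 3 * \<gamma>)" .
    have "freq3 s x (\<xi>, \<mu>) * jbr (\<tau> - w \<xi> \<mu>) powr (-\<beta>) * jbr (- \<tau> - ph (-\<xi>) (-\<mu>) (fst x) (snd x)) powr (-\<gamma>)
      \<le> (25 * 5 powr (2 * s) * ((freq_norm \<xi> \<mu>)\<^sup>2 * jbr (freq_norm \<xi> \<mu>) powr (- 2 * s))) * (800 powr \<gamma> * jbr (freq_norm \<xi> \<mu>) powr (- 3 * \<gamma>)) * 1"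
      using \<gamma> \<beta> \<delta> by (intro mult_mono freq3_comparable_input[OF c] sb jbr_powr_le_1 mult_nonneg_nonneg freq3_nonneg) auto
    then show "freq3 s x (\<xi>, \<mu>) * jbr (\<tau> - w \<xi> \<mu>) powr (-\<beta>) * jbr (- \<tau> - ph (-\<xi>) (-\<mu>) (fst x) (snd x)) powr (-\<gamma>)
      \<le> (25 * 5 powr (2 * s) * 800 powr \<gamma>) * ((freq_norm \<xi> \<mu>)\<^sup>2 * (jbr (freq_norm \<xi> \<mu>) powr (- 2 * s) * jbr (freq_norm \<xi> \<mu>) powr (- 3 * \<gamma>)))"
      by (simp only: mult_ac mult_1_right)
  qed (auto simp: freq_norm_nonneg)
qed

text \<open>The time frequencies cancel in the combination of the three modulations, which leaves
  the resonance function. The cubes are at most 25, 16 and 16 times the product of the three sizes.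
  If all modulations were below 1/200 of their cubes, they would add up to less than 57/200 of the
  product, whereas at least half of it is required.\<close>

lemma sigma_dichotomy:
  assumes cmp: "comparable (rr (z1 + z2)) (rr z1) (rr z2)"
    and K: "\<bar>Kdet (fst (z1 + z2)) (fst (snd (z1 + z2)))\<bar> \<le> (rr (z1 + z2))\<^sup>2 / 40" 
      "\<bar>Kdet (fst z1) (fst (snd z1))\<bar> \<le> (rr z1)\<^sup>2 / 40" "\<bar>Kdet (fst z2) (fst (snd z2))\<bar> \<le> (rr z2)\<^sup>2 / 40"
  shows "rr (z1 + z2) ^ 3 / 200 \<le> \<bar>sg (z1 + z2)\<bar> \<or> rr z1 ^ 3 / 200 \<le> \<bar>sg z1\<bar> \<or> rr z2 ^ 3 / 200 \<le> \<bar>sg z2\<bar>"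
proof -
  define R U V where "R = rr (z1 + z2)" and "U = rr z1" and "V = rr z2"
  have pos: "R \<ge> 0" "U \<ge> 0" "V \<ge> 0" by (simp_all add: R_def U_def V_def rr_def freq_norm_nonneg)
  have c: "U \<le> 4 * V" "V \<le> 4 * U" "U \<le> 4 * R" "V \<le> 4 * R" "R \<le> 5 * U" "R \<le> 5 * V"
    using cmp by (auto simp: comparable_def R_def U_def V_def)
  have "R * U * V \<le> 2 * \<bar>w (fst z1 + fst z2) (fst (snd z1) + fst (snd z2)) - w (fst z1) (fst (snd z1)) - w (fst z2) (fst (snd z2))\<bar>"
    using resonance[of "fst z1" "fst z2" "fst (snd z1)" "fst (snd z2)"] assms by (simp add: R_def U_def V_def rr_def)
  moreover have "w (fst z1 + fst z2) (fst (snd z1) + fst (snd z2)) - w (fst z1) (fst (snd z1)) - w (fst z2) (fst (snd z2)) = sg z1 + sg z2 - sg (z1 + z2)"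
    by (simp add: sg_def)
  ultimately have "R * U * V \<le> 2 * \<bar>sg z1 + sg z2 - sg (z1 + z2)\<bar>" by simp
  also have "\<dots> \<le> 2 * (\<bar>sg z1\<bar> + \<bar>sg z2\<bar> + \<bar>sg (z1 + z2)\<bar>)" by (intro mult_left_mono) linarith+
  finally have H: "R * U * V \<le> 2 * (\<bar>sg z1\<bar> + \<bar>sg z2\<bar> + \<bar>sg (z1 + z2)\<bar>)" .
  have "R * R * R \<le> R * (5 * U) * (5 * V)" using pos c by (intro mult_mono mult_nonneg_nonneg) auto
  then have 1: "R ^ 3 \<le> 25 * (R * U * V)" by (simp add: power3_eq_cube)
  have "U * U * U \<le> (4 * R) * U * (4 * V)" using pos c by (intro mult_mono mult_nonneg_nonneg) auto
  then have 2: "U ^ 3 \<le> 16 * (R * U * V)" by (simp add: power3_eq_cube)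
  have "V * V * V \<le> (4 * R) * (4 * U) * V" using pos c by (intro mult_mono mult_nonneg_nonneg) auto
  then have 3: "V ^ 3 \<le> 16 * (R * U * V)" by (simp add: power3_eq_cube)
  have "R ^ 3 / 200 \<le> \<bar>sg (z1 + z2)\<bar> \<or> U ^ 3 / 200 \<le> \<bar>sg z1\<bar> \<or> V ^ 3 / 200 \<le> \<bar>sg z2\<bar>"
    using H 1 2 3 by argo
  then show ?thesis by (simp add: R_def U_def V_def)
qed

lemma rr_triangle: "rr (z1 + z2) \<le> rr z1 + rr z2" by (simp add: rr_def freq_norm_triangle)

text \<open>Four regions dispose of the pairs in which some frequency is at most a quarter of an
  input frequency. In the rest the sizes are comparable, and six regions cover it according to which
  determinant or, failing that, which modulation is large. Regions that single out the first input
  are mirror images of those for the second, except for \<open>region_low_high\<close>, whose mirror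
  image has the second input low.\<close>

theorem zk_bounded_UNIV: "zk_bounded s \<beta> \<gamma> UNIV"
proof -
  note sw = bilin_bounded_swap[of "mult_weight s \<gamma>" "wt s (\<beta> / 2)", folded zk_bounded_def]
  note un = bilin_bounded_Un[OF mult_weight_measurable[OF s \<delta> \<beta> \<gamma>], of "wt s (\<beta> / 2)", folded zk_bounded_def]
  let ?c = "\<lambda>p::R3\<times>R3. comparable (rr (fst p + snd p)) (rr (fst p)) (rr (snd p))"
  let ?k = "\<lambda>z::R3. (rr z)\<^sup>2 / 40 \<le> \<bar>Kdet (fst z) (fst (snd z))\<bar>"
  let ?g = "\<lambda>z::R3. rr z ^ 3 / 200 \<le> \<bar>sg z\<bar>"
  have cs: "?c (snd p, fst p) = ?c p" for p by (auto simp: comparable_def add.commute)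
  have "zk_bounded s \<beta> \<gamma> ({p. 4 * rr (fst p) \<le> rr (snd p)} \<union> {p. 4 * rr (snd p) \<le> rr (fst p)}
     \<union> {p. 4 * rr (fst p + snd p) \<le> rr (snd p)} \<union> {p. 4 * rr (snd p + fst p) \<le> rr (fst p)}
     \<union> {p. ?c p \<and> ?k (fst p + snd p)} \<union> {p. ?c p \<and> ?k (snd p)} \<union> {p. ?c (snd p, fst p) \<and> ?k (fst p)}
     \<union> {p. ?c p \<and> ?g (fst p + snd p)} \<union> {p. ?c p \<and> ?g (snd p)} \<union> {p. ?c (snd p, fst p) \<and> ?g (fst p)})" (is "zk_bounded _ _ _ ?U")
    using region_low_high[OF s \<delta> \<beta> \<gamma>] sw[OF region_low_high[OF s \<delta> \<beta> \<gamma>]]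
      region_high_high_low[OF s \<delta> \<beta> \<gamma>] sw[OF region_high_high_low[OF s \<delta> \<beta> \<gamma>]]
      region_K_output region_K_input sw[OF region_K_input] region_sigma_output region_sigma_input sw[OF region_sigma_input]
    by (intro un) simp_all
  moreover have "?U = UNIV"
  proof (intro equalityI subsetI UNIV_I)
    fix p :: "R3 \<times> R3"
    have t: "rr (fst p + snd p) \<le> rr (fst p) + rr (snd p)" by (rule rr_triangle)
    show "p \<in> ?U"
    proof (cases "4 * rr (fst p) \<le> rr (snd p) \<or> 4 * rr (snd p) \<le> rr (fst p) \<or> 4 * rr (fst p + snd p) \<le> rr (snd p) \<or> 4 * rr (fst p + snd p) \<le> rr (fst p)")
      case True then show ?thesis by (auto simp: add.commute)
    next
      case False
      then have c: "?c p" using t by (auto simp: comparable_def)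
      then have c': "?c (snd p, fst p)" by (simp only: cs)
      show ?thesis
      proof (cases "?k (fst p + snd p) \<or> ?k (fst p) \<or> ?k (snd p)")
        case True with c c' show ?thesis by (auto simp del: fst_add snd_add)
      next
        case False
        then have "?g (fst p + snd p) \<or> ?g (fst p) \<or> ?g (snd p)"
          by (intro sigma_dichotomy c) (simp_all only: not_le de_Morgan_disj less_imp_le)
        with c c' show ?thesis by (auto simp del: fst_add snd_add)
      qed
    qed
  qed
  ultimately show ?thesis by simp
qed

end

section \<open>Schwartz functions and their Fourier transforms\<close>

text \<open>All iterated derivatives are controlled at once by placing the function in a class
  \<open>S\<close> that is closed under differentiation and whose members are differentiable and
  decay: \<open>S\<close> is the invariant of an induction on the list of directions.\<close>

lemma schwartz_coinduct:
  assumes f: "f \<in> S"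
    and diff: "\<And>f p. f \<in> S \<Longrightarrow> f differentiable at p"
    and decay: "\<And>f N. f \<in> S \<Longrightarrow> \<exists>B. \<forall>p. norm p ^ N * cmod (f p) \<le> B"
    and deriv: "\<And>f e. f \<in> S \<Longrightarrow> e \<in> Basis \<Longrightarrow> dir_deriv e f \<in> S"
  shows "schwartz f"
proof -
  have "foldr dir_deriv es f \<in> S" if "set es \<subseteq> Basis" for es
    using that by (induction es) (auto simp: f deriv)
  then show ?thesis unfolding schwartz_def using diff decay by blast
qed

lemma schwartz_differentiable: "schwartz f \<Longrightarrow> f differentiable at p"
  unfolding schwartz_def by (metis empty_subsetI foldr.simps(1) id_apply list.set(1))

lemma schwartz_decay: "schwartz f \<Longrightarrow> \<exists>B. \<forall>p. norm p ^ N * cmod (f p) \<le> B"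
  unfolding schwartz_def by (metis empty_subsetI foldr.simps(1) id_apply list.set(1))

lemma schwartz_dir_deriv: 
  assumes "schwartz f" "e \<in> Basis" shows "schwartz (dir_deriv e f)"
proof -
  have "foldr dir_deriv es (dir_deriv e f) = foldr dir_deriv (es @ [e]) f" for es by simp
  then show ?thesis using assms unfolding schwartz_def
    by (metis (no_types, lifting) Un_subset_iff empty_subsetI insert_subset list.set(1) list.set(2) set_append)
qed

lemma schwartz_has_derivative:
  "schwartz f \<Longrightarrow> (f has_derivative frechet_derivative f (at p)) (at p)"
  using schwartz_differentiable frechet_derivative_works by blast

lemma dir_deriv_eqI:
  assumes "\<And>p. (f has_derivative f' p) (at p)"
  shows "dir_deriv e f = (\<lambda>p. f' p e)"
  unfolding dir_deriv_def using frechet_derivative_at[OF assms] by (intro ext) simp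

text \<open>The Leibniz rule turns a product into a sum of products, so sums are included to obtain
  a class closed under differentiation, as \<open>schwartz_coinduct\<close> requires.\<close>

inductive_set schwartz_product :: "(R3 \<Rightarrow> complex) set" where
  mult: "schwartz f \<Longrightarrow> schwartz g \<Longrightarrow> (\<lambda>p. f p * g p) \<in> schwartz_product"
| add: "f \<in> schwartz_product \<Longrightarrow> g \<in> schwartz_product \<Longrightarrow> (\<lambda>p. f p + g p) \<in> schwartz_product"

lemma schwartz_product:
  assumes "schwartz f" "schwartz g"
  shows "schwartz (\<lambda>p. f p * g p)"
proof (rule schwartz_coinduct[of _ schwartz_product])
  show "(\<lambda>p. f p * g p) \<in> schwartz_product" using assms by (rule schwartz_product.mult)
  show D: "h differentiable at p" if "h \<in> schwartz_product" for h p
    using that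
  proof induction
    case (mult f g)
    then show ?case by (intro differentiable_mult[of f p UNIV g] schwartz_differentiable)
  next
    case (add f g)
    then show ?case by (intro differentiable_add[of f "at p" g])
  qed
  show "\<exists>B. \<forall>p. norm p ^ N * cmod (h p) \<le> B" if "h \<in> schwartz_product" for h N
    using that
  proof induction
    case (mult f g)
    obtain A where A: "\<And>p. norm p ^ N * cmod (f p) \<le> A" using schwartz_decay[OF mult(1)] by blast
    obtain B where B: "\<And>p. norm p ^ 0 * cmod (g p) \<le> B" using schwartz_decay[OF mult(2)] by blast
    have "norm p ^ N * cmod (f p * g p) \<le> A * B" for p
      using mult_mono[OF A[of p] B[of p]] A[of p] by (simp add: norm_mult mult.assoc order_trans[rotated])
    then show ?case by blast
  next
    case (add f g)
    then obtain A B where A: "\<And>p. norm p ^ N * cmod (f p) \<le> A" and B: "\<And>p. norm p ^ N * cmod (g p) \<le> B" by blast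
    have "norm p ^ N * cmod (f p + g p) \<le> A + B" for p
    proof -
      have "norm p ^ N * cmod (f p + g p) \<le> norm p ^ N * (cmod (f p) + cmod (g p))"
        by (intro mult_left_mono norm_triangle_ineq) simp
      then show ?thesis using A[of p] B[of p] by (simp add: distrib_left)
    qed
    then show ?case by blast
  qed
  show "dir_deriv e h \<in> schwartz_product" if "h \<in> schwartz_product" "e \<in> Basis" for h e
    using that
  proof induction
    case (mult f g)
    have "dir_deriv e (\<lambda>p. f p * g p) = (\<lambda>p. f p * dir_deriv e g p + dir_deriv e f p * g p)"
      using has_derivative_mult[OF schwartz_has_derivative[OF mult(1)] schwartz_has_derivative[OF mult(2)]]
      by (subst dir_deriv_eqI) (auto simp: dir_deriv_def)
    also have "\<dots> \<in> schwartz_product"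
      using mult by (intro schwartz_product.intros schwartz_dir_deriv)
    finally show ?case .
  next
    case (add f g)
    have "dir_deriv e (\<lambda>p. f p + g p) = (\<lambda>p. dir_deriv e f p + dir_deriv e g p)"
      using has_derivative_add[of f "frechet_derivative f (at p)" "at p" g "frechet_derivative g (at p)" for p] D[OF add(1)] D[OF add(2)]
      by (subst dir_deriv_eqI) (auto simp: dir_deriv_def frechet_derivative_works)
    also have "\<dots> \<in> schwartz_product" using add by (intro schwartz_product.add) auto
    finally show ?case .
  qed
qed

lemma dir_deriv_linear:
  assumes "schwartz f" "schwartz g"
  shows "dir_deriv e (\<lambda>p. a * f p + b * g p) = (\<lambda>p. a * dir_deriv e f p + b * dir_deriv e g p)"
proof -
  have "((\<lambda>p. a * f p + b * g p) has_derivative (\<lambda>h. a * frechet_derivative f (at p) h + b * frechet_derivative g (at p) h)) (at p)" for p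
    by (intro has_derivative_add has_derivative_mult_right schwartz_has_derivative assms)
  from dir_deriv_eqI[OF this] show ?thesis by (simp add: dir_deriv_def)
qed

lemma schwartz_linear:
  assumes "schwartz f" "schwartz g"
  shows "schwartz (\<lambda>p. a * f p + b * g p)"
proof (rule schwartz_coinduct[of _ "{h. \<exists>f g. schwartz f \<and> schwartz g \<and> h = (\<lambda>p. a * f p + b * g p)}"])
  show "(\<lambda>p. a * f p + b * g p) \<in> {h. \<exists>f g. schwartz f \<and> schwartz g \<and> h = (\<lambda>p. a * f p + b * g p)}" using assms by blast
next
  fix h p assume "h \<in> {h. \<exists>f g. schwartz f \<and> schwartz g \<and> h = (\<lambda>p. a * f p + b * g p)}"
  then obtain f g where fg: "schwartz f" "schwartz g" and h: "h = (\<lambda>p. a * f p + b * g p)" by blast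
  note d = schwartz_differentiable[OF fg(1), of p] schwartz_differentiable[OF fg(2), of p]
  show "h differentiable at p" unfolding h
    by (rule differentiable_add; rule differentiable_mult[OF differentiable_const]; rule d)
next
  fix h N assume "h \<in> {h. \<exists>f g. schwartz f \<and> schwartz g \<and> h = (\<lambda>p. a * f p + b * g p)}"
  then obtain f g where fg: "schwartz f" "schwartz g" and h: "h = (\<lambda>p. a * f p + b * g p)" by blast
  obtain A B where A: "\<And>p. norm p ^ N * cmod (f p) \<le> A" and B: "\<And>p. norm p ^ N * cmod (g p) \<le> B"
    using schwartz_decay[OF fg(1)] schwartz_decay[OF fg(2)] by metis
  have "norm p ^ N * cmod (h p) \<le> cmod a * A + cmod b * B" for p
  proof -
    have "norm p ^ N * cmod (h p) \<le> norm p ^ N * (cmod (a * f p) + cmod (b * g p))"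
      unfolding h by (intro mult_left_mono norm_triangle_ineq) simp
    also have "\<dots> = cmod a * (norm p ^ N * cmod (f p)) + cmod b * (norm p ^ N * cmod (g p))"
      by (simp add: norm_mult algebra_simps)
    also have "\<dots> \<le> cmod a * A + cmod b * B" using A B by (intro add_mono mult_left_mono) auto
    finally show ?thesis .
  qed
  then show "\<exists>B. \<forall>p. norm p ^ N * cmod (h p) \<le> B" by blast
next
  fix h and e :: R3 assume "h \<in> {h. \<exists>f g. schwartz f \<and> schwartz g \<and> h = (\<lambda>p. a * f p + b * g p)}" and e: "e \<in> Basis"
  then obtain f g where fg: "schwartz f" "schwartz g" and h: "h = (\<lambda>p. a * f p + b * g p)" by blast
  then show "dir_deriv e h \<in> {h. \<exists>f g. schwartz f \<and> schwartz g \<and> h = (\<lambda>p. a * f p + b * g p)}"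
    using dir_deriv_linear[OF fg] schwartz_dir_deriv[OF _ e] by blast
qed

lemma schwartz_diff: "schwartz f \<Longrightarrow> schwartz g \<Longrightarrow> schwartz (\<lambda>p. f p - g p)"
  using schwartz_linear[of f g 1 "-1"] by simp

lemma schwartz_scale: "schwartz f \<Longrightarrow> schwartz (\<lambda>p. c * f p)"
  using schwartz_linear[of f f c 0] by simp

lemma schwartz_add: "schwartz f \<Longrightarrow> schwartz g \<Longrightarrow> schwartz (\<lambda>p. f p + g p)"
  using schwartz_linear[of f g 1 1] by simp

section \<open>Gaussians as Schwartz functions\<close>

text \<open>The modulation \<open>v\<close> provides test functions whose pairings with a function
  are values of a Fourier transform. The transform of \<open>gauss 0 c\<close> is a translated
  Gaussian, which is a multiple of \<open>gauss c 0\<close>; the real tilt \<open>u\<close> covers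
  it with the same definition.\<close>

definition gauss :: "R3 \<Rightarrow> R3 \<Rightarrow> R3 \<Rightarrow> complex" where
  "gauss u v p = exp (of_real (- (p \<bullet> p) / 2 + p \<bullet> u) + \<i> * of_real (p \<bullet> v))"

text \<open>Derivatives of a Gaussian are polynomial multiples of it. Multiplication by linear forms
  and addition generate a class of such multiples that is closed under differentiation.\<close>

inductive_set poly_gauss :: "R3 \<Rightarrow> R3 \<Rightarrow> (R3 \<Rightarrow> complex) set" for u v where
  const: "(\<lambda>p. c * gauss u v p) \<in> poly_gauss u v"
| mult: "f \<in> poly_gauss u v \<Longrightarrow> (\<lambda>p. of_real (p \<bullet> a) * f p) \<in> poly_gauss u v"
| add: "f \<in> poly_gauss u v \<Longrightarrow> g \<in> poly_gauss u v \<Longrightarrow> (\<lambda>p. f p + g p) \<in> poly_gauss u v"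

lemma poly_gauss_scale:
  "f \<in> poly_gauss u v \<Longrightarrow> (\<lambda>p. c * f p) \<in> poly_gauss u v"
proof (induction rule: poly_gauss.induct)
  case (const d)
  then show ?case using poly_gauss.const[of "c * d" u v] by (simp add: mult.assoc)
next
  case (mult f a)
  then show ?case using poly_gauss.mult[OF mult.IH, of a] by (simp add: mult.left_commute)
next
  case (add f g)
  then show ?case using poly_gauss.add[OF add.IH] by (simp add: distrib_left)
qed

lemma gauss_has_derivative:
  "(gauss u v has_derivative (\<lambda>h. (of_real (- (p \<bullet> h) + h \<bullet> u) + \<i> * of_real (h \<bullet> v)) * gauss u v p)) (at p)"
proof -
  have "((\<lambda>p. of_real (- (p \<bullet> p) / 2 + p \<bullet> u) + \<i> * of_real (p \<bullet> v)) has_derivative (\<lambda>h. of_real (- (p \<bullet> h) + h \<bullet> u) + \<i> * of_real (h \<bullet> v) :: complex)) (at p)"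
    by (auto intro!: derivative_eq_intros simp: inner_commute field_simps)
  from has_derivative_compose[OF this DERIV_exp[THEN has_field_derivative_imp_has_derivative]] show ?thesis unfolding gauss_def[abs_def] by (simp add: mult.commute)
qed

lemma norm_gauss: "cmod (gauss u v p) = exp (- (p \<bullet> p) / 2 + p \<bullet> u)"
  by (simp add: gauss_def norm_exp_eq_Re)

lemma gauss_decay: "norm p ^ N * cmod (gauss u v p) \<le> fact N * exp ((norm u + 1)\<^sup>2 / 2)"
proof -
  let ?r = "norm p" and ?a = "norm u"
  \<comment> \<open>Completing the square trades the Gaussian for exp(-r), against which r^N is
    bounded by N!.\<close>
  have "0 \<le> (?r - (?a + 1))\<^sup>2" by simp
  then have "- ?r\<^sup>2 / 2 + ?r * ?a \<le> - ?r + (?a + 1)\<^sup>2 / 2" by (simp add: power2_eq_square algebra_simps)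
  moreover have "p \<bullet> u \<le> ?r * ?a" by (rule norm_cauchy_schwarz)
  ultimately have "- (p \<bullet> p) / 2 + p \<bullet> u \<le> - ?r + (?a + 1)\<^sup>2 / 2" by (simp add: power2_norm_eq_inner[symmetric])
  then have 1: "cmod (gauss u v p) \<le> exp (- ?r) * exp ((?a + 1)\<^sup>2 / 2)"
    by (simp add: norm_gauss exp_add[symmetric])
  have "?r ^ N / fact N \<le> exp ?r"
    using sum_le_suminf[OF summable_exp[of ?r], of "{N}"] by (simp add: exp_def divide_inverse mult.commute)
  then have 2: "?r ^ N * exp (- ?r) \<le> fact N" by (simp add: exp_minus field_simps)
  have "?r ^ N * cmod (gauss u v p) \<le> ?r ^ N * (exp (- ?r) * exp ((?a + 1)\<^sup>2 / 2))" by (intro mult_left_mono 1) simp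
  also have "\<dots> = (?r ^ N * exp (- ?r)) * exp ((?a + 1)\<^sup>2 / 2)" by simp
  also have "\<dots> \<le> fact N * exp ((?a + 1)\<^sup>2 / 2)" by (intro mult_right_mono 2) simp
  finally show ?thesis .
qed

lemma schwartz_gauss: "schwartz (gauss u v)"
proof (rule schwartz_coinduct[of _ "poly_gauss u v"])
  show "gauss u v \<in> poly_gauss u v" using poly_gauss.const[of 1 u v] by simp
  show D: "f differentiable at p" if "f \<in> poly_gauss u v" for f p
    using that
  proof induction
    case (const c)
    have "gauss u v differentiable at p" using gauss_has_derivative differentiable_def by blast
    then show ?case by (rule differentiable_mult[OF differentiable_const])
  next
    case (mult f a)
    have "(\<lambda>p. of_real (p \<bullet> a) :: complex) differentiable at p"
      unfolding differentiable_def by (rule exI) (auto intro!: derivative_eq_intros)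
    then show ?case using mult by (intro differentiable_mult)
  qed (auto intro: differentiable_add)
  show "\<exists>B. \<forall>p. norm p ^ N * cmod (f p) \<le> B" if "f \<in> poly_gauss u v" for f N
    using that
  proof (induction arbitrary: N)
    case (const c)
    have "norm p ^ N * cmod (c * gauss u v p) \<le> cmod c * (fact N * exp ((norm u + 1)\<^sup>2 / 2))" for p
      using mult_left_mono[OF gauss_decay[of p N u v], of "cmod c"] by (simp add: norm_mult mult_ac)
    then show ?case by blast
  next
    case (mult f a)
    obtain B where B: "\<And>p. norm p ^ Suc N * cmod (f p) \<le> B" using mult.IH[of "Suc N"] by blast
    have "norm p ^ N * cmod (of_real (p \<bullet> a) * f p) \<le> norm a * B" for p
    proof -
      have "norm p ^ N * cmod (of_real (p \<bullet> a) * f p) = norm p ^ N * (\<bar>p \<bullet> a\<bar> * cmod (f p))" by (simp add: norm_mult)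
      also have "\<dots> \<le> norm p ^ N * ((norm p * norm a) * cmod (f p))"
        by (intro mult_left_mono mult_right_mono Cauchy_Schwarz_ineq2) auto
      also have "\<dots> = norm a * (norm p ^ Suc N * cmod (f p))" by simp
      also have "\<dots> \<le> norm a * B" by (intro mult_left_mono B) simp
      finally show ?thesis .
    qed
    then show ?case by blast
  next
    case (add f g)
    obtain A B where A: "\<And>p. norm p ^ N * cmod (f p) \<le> A" and B: "\<And>p. norm p ^ N * cmod (g p) \<le> B" using add.IH by metis
    have "norm p ^ N * cmod (f p + g p) \<le> A + B" for p
    proof -
      have "norm p ^ N * cmod (f p + g p) \<le> norm p ^ N * (cmod (f p) + cmod (g p))"
        by (intro mult_left_mono norm_triangle_ineq) simp
      then show ?thesis using A[of p] B[of p] by (simp add: distrib_left)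
    qed
    then show ?case by blast
  qed
  show "dir_deriv e f \<in> poly_gauss u v" if "f \<in> poly_gauss u v" "e \<in> Basis" for f e
    using that(1)
  proof induction
    case (const c)
    have "dir_deriv e (\<lambda>p. c * gauss u v p) = (\<lambda>p. (c * (of_real (e \<bullet> u) + \<i> * of_real (e \<bullet> v))) * gauss u v p + of_real (p \<bullet> (- e)) * (c * gauss u v p))"
      unfolding dir_deriv_eqI[OF has_derivative_mult_right[OF gauss_has_derivative]] by (rule ext) (simp add: algebra_simps)
    also have "\<dots> \<in> poly_gauss u v" by (intro poly_gauss.intros)
    finally show ?case .
  next
    case (mult f a)
    have d: "((\<lambda>p. of_real (p \<bullet> a) * f p) has_derivative (\<lambda>h. of_real (p \<bullet> a) * frechet_derivative f (at p) h + of_real (h \<bullet> a) * f p)) (at p)" for p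
    proof (rule has_derivative_mult)
      show "((\<lambda>p. of_real (p \<bullet> a) :: complex) has_derivative (\<lambda>h. of_real (h \<bullet> a))) (at p)" by (auto intro!: derivative_eq_intros)
      show "(f has_derivative frechet_derivative f (at p)) (at p)" using D[OF mult(1)] frechet_derivative_works by blast
    qed
    have "dir_deriv e (\<lambda>p. of_real (p \<bullet> a) * f p) = (\<lambda>p. of_real (p \<bullet> a) * dir_deriv e f p + of_real (e \<bullet> a) * f p)"
      using dir_deriv_eqI[OF d] by (simp add: dir_deriv_def)
    also have "\<dots> \<in> poly_gauss u v" using mult by (intro poly_gauss.add poly_gauss.mult poly_gauss_scale)
    finally show ?case .
  next
    case (add f g)
    have "((\<lambda>p. f p + g p) has_derivative (\<lambda>h. frechet_derivative f (at p) h + frechet_derivative g (at p) h)) (at p)" for p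
      using D[OF add(1)] D[OF add(2)] frechet_derivative_works by (intro has_derivative_add) blast+
    from dir_deriv_eqI[OF this] have "dir_deriv e (\<lambda>p. f p + g p) = (\<lambda>p. dir_deriv e f p + dir_deriv e g p)" by (simp add: dir_deriv_def)
    also have "\<dots> \<in> poly_gauss u v" using add by (intro poly_gauss.add)
    finally show ?case .
  qed
qed

section \<open>Rapidly decreasing functions and integrals of derivatives\<close>

text \<open>Decay without smoothness, so that Schwartz functions and their Fourier transforms can be
  treated by the same integrability lemmas.\<close>

definition rapid :: "(R3 \<Rightarrow> complex) \<Rightarrow> bool" where
  "rapid f \<longleftrightarrow> f \<in> borel_measurable borel \<and> (\<forall>N::nat. \<exists>B. \<forall>p. norm p ^ N * cmod (f p) \<le> B)"

lemma schwartz_continuous: "schwartz f \<Longrightarrow> continuous_on A f"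
  by (meson continuous_at_imp_continuous_on differentiable_imp_continuous_within schwartz_differentiable)

lemma schwartz_measurable: "schwartz f \<Longrightarrow> f \<in> borel_measurable borel"
  by (intro borel_measurable_continuous_onI schwartz_continuous)

lemma schwartz_rapid: "schwartz f \<Longrightarrow> rapid f"
  unfolding rapid_def using schwartz_measurable schwartz_decay by blast

lemma rapid_bound:
  assumes "rapid f"
  obtains B where "B \<ge> 0" "\<And>p. (1 + norm p) ^ N * cmod (f p) \<le> B"
proof -
  obtain A where A: "\<And>p. norm p ^ 0 * cmod (f p) \<le> A" using assms unfolding rapid_def by blast
  obtain B where B: "\<And>p. norm p ^ N * cmod (f p) \<le> B" using assms unfolding rapid_def by blast
  have A0: "A \<ge> 0" and B0: "B \<ge> 0" using A[of 0] B[of 0] by (auto intro: order_trans[rotated])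
  have "(1 + norm p) ^ N * cmod (f p) \<le> 2 ^ N * (A + B)" for p
  proof -
    have "(1 + norm p) ^ N \<le> 2 ^ N * (1 + norm p ^ N)"
    proof (cases "norm p \<le> 1")
      case True
      then have "(1 + norm p) ^ N \<le> 2 ^ N" by (intro power_mono) auto
      also have "\<dots> \<le> 2 ^ N * (1 + norm p ^ N)" by simp
      finally show ?thesis .
    next
      case False
      then have "(1 + norm p) ^ N \<le> (2 * norm p) ^ N" by (intro power_mono) auto
      then show ?thesis by (simp add: power_mult_distrib distrib_left add_increasing)
    qed
    then have "(1 + norm p) ^ N * cmod (f p) \<le> 2 ^ N * (1 + norm p ^ N) * cmod (f p)" by (intro mult_right_mono) auto
    also have "\<dots> = 2 ^ N * (norm p ^ 0 * cmod (f p) + norm p ^ N * cmod (f p))" by (simp add: algebra_simps)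
    also have "\<dots> \<le> 2 ^ N * (A + B)" by (intro mult_left_mono add_mono A B) auto
    finally show ?thesis .
  qed
  then show ?thesis using A0 B0 by (intro that[of "2 ^ N * (A + B)"]) auto
qed

text \<open>An integrable majorant in product form, whose integral factors into one-dimensional
  bracket integrals. Quadratic decay in each of three coordinates accounts for the power 6 in
  \<open>dmaj_ge\<close>.\<close>

definition dmaj :: "R3 \<Rightarrow> real" where
  "dmaj p = jbr (fst p) powr (-2) * jbr (fst (snd p)) powr (-2) * jbr (snd (snd p)) powr (-2)"

lemma dmaj_pos: "dmaj p > 0" by (simp add: dmaj_def jbr_neq_0)

lemma dmaj_measurable [measurable]: "dmaj \<in> borel_measurable borel"
  unfolding dmaj_def[abs_def] by (intro borel_measurable_continuous_onI continuous_intros)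

lemma dmaj_integrable: "integrable lborel dmaj"
proof (rule integrableI_nonneg)
  have "(\<integral>\<^sup>+p. ennreal (dmaj p) \<partial>lborel) \<le> ennreal (jint 2) * (\<integral>\<^sup>+x. ennreal (jbr (fst x) powr (-2) * jbr (snd x) powr (-2)) \<partial>(lborel :: (real \<times> real) measure))"
  proof (rule nn_integral_R3_le)
    show "(\<lambda>x. ennreal (dmaj x)) \<in> borel_measurable borel" by measurable
    show "(\<lambda>x::real\<times>real. ennreal (jbr (fst x) powr (-2) * jbr (snd x) powr (-2))) \<in> borel_measurable borel"
      by (intro measurable_compose[OF _ measurable_ennreal] borel_measurable_continuous_onI continuous_intros)
    fix a b :: real
    have "(\<integral>\<^sup>+t. ennreal (dmaj (a, b, t)) \<partial>lborel) = (\<integral>\<^sup>+t. ennreal (jbr a powr (-2) * jbr b powr (-2)) * ennreal (jbr t powr (-2)) \<partial>lborel)"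
      by (simp add: dmaj_def ennreal_mult[symmetric])
    also have "\<dots> = ennreal (jbr a powr (-2) * jbr b powr (-2)) * ennreal (jint 2)"
      by (subst nn_integral_cmult) (simp_all add: nn_integral_jbr)
    finally show "(\<integral>\<^sup>+t. ennreal (dmaj (a, b, t)) \<partial>lborel) \<le> ennreal (jint 2) * ennreal (jbr (fst (a, b)) powr (-2) * jbr (snd (a, b)) powr (-2))"
      by (simp add: mult.commute)
  qed
  also have "(\<integral>\<^sup>+x. ennreal (jbr (fst x) powr (-2) * jbr (snd x) powr (-2)) \<partial>(lborel :: (real \<times> real) measure)) = ennreal (jint 2) * ennreal (jint 2)"
  proof -
    have "(\<lambda>x::real\<times>real. ennreal (jbr (fst x) powr (-2) * jbr (snd x) powr (-2))) \<in> borel_measurable borel"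
      by (intro measurable_compose[OF _ measurable_ennreal] borel_measurable_continuous_onI continuous_intros)
    then have "(\<integral>\<^sup>+x. ennreal (jbr (fst x) powr (-2) * jbr (snd x) powr (-2)) \<partial>(lborel :: (real \<times> real) measure))
      = (\<integral>\<^sup>+a. \<integral>\<^sup>+b. ennreal (jbr a powr (-2)) * ennreal (jbr b powr (-2)) \<partial>lborel \<partial>lborel)"
      by (simp add: nn_integral_lborel_prod ennreal_mult)
    also have "\<dots> = (\<integral>\<^sup>+a. ennreal (jbr a powr (-2)) * ennreal (jint 2) \<partial>lborel)"
      by (intro nn_integral_cong, subst nn_integral_cmult) (simp_all add: nn_integral_jbr)
    also have "\<dots> = ennreal (jint 2) * ennreal (jint 2)"
      by (subst nn_integral_multc) (simp_all add: nn_integral_jbr)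
    finally show ?thesis .
  qed
  also have "ennreal (jint 2) * (ennreal (jint 2) * ennreal (jint 2)) < \<infinity>" by (simp add: ennreal_mult_less_top)
  finally show "(\<integral>\<^sup>+p. ennreal (dmaj p) \<partial>lborel) < \<infinity>" .
qed (auto intro: less_imp_le dmaj_pos)

lemma dmaj_ge: "1 \<le> (1 + norm p) ^ 6 * dmaj p"
proof -
  obtain a b t where p: "p = (a, b, t)" by (cases p)
  have n: "\<bar>a\<bar> \<le> norm p" "\<bar>b\<bar> \<le> norm p" "\<bar>t\<bar> \<le> norm p"
    using norm_fst_le[of a "(b, t)"] norm_snd_le[of "(b, t)" a] norm_fst_le[of b t] norm_snd_le[of t b] by (auto simp: p)
  have j: "(jbr x)\<^sup>2 \<le> (1 + norm p)\<^sup>2" if "\<bar>x\<bar> \<le> norm p" for x using that by (intro power_mono) (auto simp: jbr_def)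
  have e: "jbr x powr (-2) = 1 / (jbr x)\<^sup>2" for x by (simp add: powr_minus_divide powr_numeral jbr_nonneg)
  have "(jbr a)\<^sup>2 * (jbr b)\<^sup>2 * (jbr t)\<^sup>2 \<le> (1 + norm p)\<^sup>2 * (1 + norm p)\<^sup>2 * (1 + norm p)\<^sup>2"
    using n by (intro mult_mono j) auto
  also have "\<dots> = (1 + norm p) ^ 6" by (simp add: power_add[symmetric])
  finally have *: "(jbr a)\<^sup>2 * (jbr b)\<^sup>2 * (jbr t)\<^sup>2 \<le> (1 + norm p) ^ 6" .
  have pos: "(jbr a)\<^sup>2 * (jbr b)\<^sup>2 * (jbr t)\<^sup>2 > 0" by (simp add: jbr_neq_0)
  have "dmaj p = 1 / ((jbr a)\<^sup>2 * (jbr b)\<^sup>2 * (jbr t)\<^sup>2)" by (simp add: dmaj_def p e)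
  then show ?thesis using * pos by (simp add: field_simps)
qed

lemma rapid_majorant:
  assumes "rapid f"
  obtains B where "B \<ge> 0" "\<And>p. cmod (f p) \<le> B * dmaj p"
proof -
  obtain B where B: "B \<ge> 0" "\<And>p. (1 + norm p) ^ 6 * cmod (f p) \<le> B" using rapid_bound[OF assms] by blast
  have "cmod (f p) \<le> B * dmaj p" for p
  proof -
    have "1 * cmod (f p) \<le> ((1 + norm p) ^ 6 * dmaj p) * cmod (f p)" by (intro mult_right_mono dmaj_ge) simp
    also have "\<dots> = ((1 + norm p) ^ 6 * cmod (f p)) * dmaj p" by simp
    also have "\<dots> \<le> B * dmaj p" using less_imp_le[OF dmaj_pos] by (intro mult_right_mono B) auto
    finally show ?thesis by simp
  qed
  with B(1) that show ?thesis by blast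
qed

lemma rapid_integrable: "rapid f \<Longrightarrow> integrable lborel f"
proof -
  assume r: "rapid f"
  obtain B where B: "B \<ge> 0" "\<And>p. cmod (f p) \<le> B * dmaj p" using rapid_majorant[OF r] by blast
  show ?thesis
    by (rule Bochner_Integration.integrable_bound[of _ "\<lambda>p. B * dmaj p"])
       (use r B dmaj_integrable order_trans[OF B(2) abs_ge_self] in \<open>auto simp: rapid_def\<close>)
qed

lemma schwartz_integrable: "schwartz f \<Longrightarrow> integrable lborel f"
  by (intro rapid_integrable schwartz_rapid)

lemma lborel_integral_affine:
  fixes f :: "R3 \<Rightarrow> complex"
  assumes [measurable]: "f \<in> borel_measurable borel" and k: "k \<noteq> 0"
  shows "(\<integral>x. f x \<partial>lborel) = of_real (\<bar>k\<bar> ^ 3) * (\<integral>x. f (t + k *\<^sub>R x) \<partial>lborel)"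
proof -
  have "(\<integral>x. f x \<partial>lborel) = (\<integral>x. f x \<partial>density (distr lborel borel (\<lambda>x. t + k *\<^sub>R x)) (\<lambda>_. \<bar>k\<bar> ^ DIM(R3)))"
    using lborel_affine[OF k, of t] by simp
  also have "\<dots> = (\<integral>x. (\<bar>k\<bar> ^ 3) *\<^sub>R f x \<partial>distr lborel borel (\<lambda>x. t + k *\<^sub>R x))"
    by (subst integral_density) (simp_all add: power3_eq_cube mult.assoc)
  also have "\<dots> = (\<integral>x. (\<bar>k\<bar> ^ 3) *\<^sub>R f (t + k *\<^sub>R x) \<partial>lborel)"
    by (subst integral_distr) simp_all
  finally show ?thesis by (simp add: scaleR_conv_of_real)
qed

lemma lborel_integral_shift:
  fixes f :: "R3 \<Rightarrow> complex"
  assumes "f \<in> borel_measurable borel"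
  shows "(\<integral>x. f (t + x) \<partial>lborel) = (\<integral>x. f x \<partial>lborel)"
  using lborel_integral_affine[OF assms, of 1 t] by simp

lemma lborel_integrable_shift:
  fixes f :: "R3 \<Rightarrow> complex"
  assumes f: "integrable lborel f"
  shows "integrable lborel (\<lambda>x. f (t + x))"
proof -
  have [measurable]: "f \<in> borel_measurable borel" using f by simp
  have "integrable (distr lborel borel ((+) t)) f" using f by (simp add: lborel_distr_plus)
  then show ?thesis by (subst (asm) integrable_distr_eq) simp_all
qed

text \<open>A shift by at most 1 costs a factor 4 in each of the three coordinates. This makes
  \<open>dmaj\<close> a common majorant for difference quotients with step at most 1.\<close>

lemma dmaj_shift: "norm h \<le> 1 \<Longrightarrow> dmaj (p + h) \<le> 64 * dmaj p"
proof -
  assume h: "norm h \<le> 1"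
  obtain a b t where p: "p = (a, b, t)" by (cases p)
  obtain x y z where hh: "h = (x, y, z)" by (cases h)
  have n: "\<bar>x\<bar> \<le> 1" "\<bar>y\<bar> \<le> 1" "\<bar>z\<bar> \<le> 1"
    using h norm_fst_le[of x "(y, z)"] norm_snd_le[of "(y, z)" x] norm_fst_le[of y z] norm_snd_le[of z y] by (auto simp: hh)
  \<comment> \<open>A shift by at most 1 at most halves the bracket, whose exponent is -2.\<close>
  have j: "jbr (u + v) powr (-2) \<le> 4 * jbr u powr (-2)" if "\<bar>v\<bar> \<le> 1" for u v
  proof -
    have "jbr (u + v) powr (-2) \<le> (jbr u / 2) powr (-2)"
    proof (rule powr_mono2')
      show "jbr u / 2 \<le> jbr (u + v)" 
      proof -
        have "\<bar>u\<bar> \<le> \<bar>u + v\<bar> + \<bar>v\<bar>" using abs_triangle_ineq4[of "u + v" v] by simp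
        also have "\<dots> \<le> \<bar>u + v\<bar> + 1" using that by simp
        also have "\<dots> \<le> 2 * \<bar>u + v\<bar> + 1" by simp
        finally show ?thesis by (simp add: jbr_def)
      qed
    qed (use jbr_pos[of u] in auto)
    also have "\<dots> = 4 * jbr u powr (-2)" by (simp add: powr_divide jbr_nonneg powr_minus_divide powr_numeral)
    finally show ?thesis .
  qed
  have "dmaj (p + h) \<le> (4 * jbr a powr (-2)) * (4 * jbr b powr (-2)) * (4 * jbr t powr (-2))"
    unfolding dmaj_def p hh add_Pair fst_conv snd_conv using n by (intro mult_mono j mult_nonneg_nonneg) simp_all
  then show ?thesis by (simp add: dmaj_def p)
qed

text \<open>Every difference quotient has integral 0 by translation invariance. The mean value
  inequality bounds it by the derivative at a nearby point, hence by a fixed multiple of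
  \<open>dmaj\<close>, and dominated convergence passes to the derivative.\<close>

lemma integral_dir_deriv_eq_0:
  assumes diff: "\<And>p. g differentiable at p" and int: "integrable lborel g"
    and meas: "dir_deriv e g \<in> borel_measurable borel"
    and B: "\<And>p. cmod (dir_deriv e g p) \<le> B * dmaj p" and e: "norm e = 1"
  shows "(\<integral>p. dir_deriv e g p \<partial>lborel) = 0"
proof -
  have [measurable]: "g \<in> borel_measurable borel" using int by simp
  have B0: "B \<ge> 0" using order_trans[OF norm_ge_zero B[of 0]] dmaj_pos[of 0] by (simp add: zero_le_mult_iff)
  \<comment> \<open>The step 1 / (n + 1) never exceeds 1, as \<open>dmaj_shift\<close>
    demands.\<close>
  define h where "h n p = of_nat (Suc n) * (g (p + (1 / real (Suc n)) *\<^sub>R e) - g p)" for n p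
  have line: "((\<lambda>t. g (p + t *\<^sub>R e)) has_derivative (\<lambda>t. t *\<^sub>R dir_deriv e g (p + s *\<^sub>R e))) (at s)" for p s
  proof -
    have "(g has_derivative frechet_derivative g (at (p + s *\<^sub>R e))) (at (p + s *\<^sub>R e))"
      using diff frechet_derivative_works by blast
    moreover have "((\<lambda>t. p + t *\<^sub>R e) has_derivative (\<lambda>t. t *\<^sub>R e)) (at s)" by (auto intro!: derivative_eq_intros)
    ultimately have "((\<lambda>t. g (p + t *\<^sub>R e)) has_derivative (\<lambda>t. frechet_derivative g (at (p + s *\<^sub>R e)) (t *\<^sub>R e))) (at s)"
      using has_derivative_compose by blast
    moreover have "frechet_derivative g (at (p + s *\<^sub>R e)) (t *\<^sub>R e) = t *\<^sub>R dir_deriv e g (p + s *\<^sub>R e)" for t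
      using linear_frechet_derivative[OF diff] by (simp add: dir_deriv_def linear_cmul)
    ultimately show ?thesis by simp
  qed
  have lim: "(\<lambda>n. h n p) \<longlonglongrightarrow> dir_deriv e g p" for p
  proof -
    have "((\<lambda>y. norm ((g (p + y *\<^sub>R e) - g (p + 0 *\<^sub>R e)) - (y - 0) *\<^sub>R dir_deriv e g (p + 0 *\<^sub>R e)) / norm (y - 0)) \<longlongrightarrow> 0) (at 0)"
      using line[of p 0] unfolding has_derivative_iff_norm by blast
    then have "((\<lambda>y. norm ((g (p + y *\<^sub>R e) - g p) - y *\<^sub>R dir_deriv e g p) / norm y) \<longlongrightarrow> 0) (at (0::real))" by simp
    moreover have "filterlim (\<lambda>n. 1 / real (Suc n)) (at 0) sequentially"
      unfolding filterlim_at using LIMSEQ_inverse_real_of_nat by (auto simp: inverse_eq_divide)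
    ultimately have "(\<lambda>n. norm ((g (p + (1 / real (Suc n)) *\<^sub>R e) - g p) - (1 / real (Suc n)) *\<^sub>R dir_deriv e g p) / norm (1 / real (Suc n))) \<longlonglongrightarrow> 0"
      by (rule filterlim_compose)
    moreover have "norm ((g (p + (1 / real (Suc n)) *\<^sub>R e) - g p) - (1 / real (Suc n)) *\<^sub>R dir_deriv e g p) / norm (1 / real (Suc n))
        = norm (h n p - dir_deriv e g p)" for n
    proof -
      have "h n p - dir_deriv e g p = real (Suc n) *\<^sub>R ((g (p + (1 / real (Suc n)) *\<^sub>R e) - g p) - (1 / real (Suc n)) *\<^sub>R dir_deriv e g p)"
        unfolding h_def scaleR_conv_of_real by (simp add: right_diff_distrib del: of_nat_Suc)
      then show ?thesis by (simp add: norm_mult del: of_nat_Suc)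
    qed
    ultimately have "(\<lambda>n. norm (h n p - dir_deriv e g p)) \<longlonglongrightarrow> 0" by simp
    then show ?thesis using Lim_null tendsto_norm_zero_iff by blast
  qed
  have bound: "norm (h n p) \<le> 64 * B * dmaj p" for n p
  proof -
    let ?s = "1 / real (Suc n)"
    have s: "0 < ?s" "?s \<le> 1" by auto
    have "\<exists>x\<in>{0<..<?s}. norm (g (p + ?s *\<^sub>R e) - g (p + 0 *\<^sub>R e)) \<le> norm ((?s - 0) *\<^sub>R dir_deriv e g (p + x *\<^sub>R e))"
    proof (rule mvt_general[OF s(1)])
      show "continuous_on {0..?s} (\<lambda>t. g (p + t *\<^sub>R e))"
        by (intro continuous_at_imp_continuous_on ballI has_derivative_continuous[OF line])
    qed (rule line)
    then obtain x where x: "0 < x" "x < ?s" and le: "norm (g (p + ?s *\<^sub>R e) - g p) \<le> ?s * norm (dir_deriv e g (p + x *\<^sub>R e))"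
      by auto
    have "norm (h n p) = real (Suc n) * norm (g (p + ?s *\<^sub>R e) - g p)" unfolding h_def norm_mult by (simp del: of_nat_Suc)
    also have "\<dots> \<le> real (Suc n) * (?s * norm (dir_deriv e g (p + x *\<^sub>R e)))" by (intro mult_left_mono le) simp
    also have "\<dots> = norm (dir_deriv e g (p + x *\<^sub>R e))" by (simp del: of_nat_Suc)
    also have "\<dots> \<le> B * dmaj (p + x *\<^sub>R e)" by (rule B)
    also have "\<dots> \<le> B * (64 * dmaj p)" 
    proof -
      have "x \<le> 1" using x(2) s(2) by linarith
      then show ?thesis using x(1) e B0 by (intro mult_left_mono dmaj_shift) auto
    qed
    finally show ?thesis by simp
  qed
  have zero: "(\<integral>p. h n p \<partial>lborel) = 0" for n
  proof -
    have sh: "integrable lborel (\<lambda>p. g (p + (1 / real (Suc n)) *\<^sub>R e))"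
      using lborel_integrable_shift[OF int, of "(1 / real (Suc n)) *\<^sub>R e"] by (simp add: add.commute)
    have "(\<integral>p. h n p \<partial>lborel) = of_nat (Suc n) * ((\<integral>p. g (p + (1 / real (Suc n)) *\<^sub>R e) \<partial>lborel) - (\<integral>p. g p \<partial>lborel))"
      unfolding h_def using sh int by simp
    also have "(\<integral>p. g (p + (1 / real (Suc n)) *\<^sub>R e) \<partial>lborel) = (\<integral>p. g p \<partial>lborel)"
      using lborel_integral_shift[of g "(1 / real (Suc n)) *\<^sub>R e"] by (simp add: add.commute)
    finally show ?thesis by simp
  qed
  have "(\<lambda>n. \<integral>p. h n p \<partial>lborel) \<longlonglongrightarrow> (\<integral>p. dir_deriv e g p \<partial>lborel)"
  proof (rule integral_dominated_convergence[where w = "\<lambda>p. 64 * B * dmaj p"])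
    show "integrable lborel (\<lambda>p. 64 * B * dmaj p)" using dmaj_integrable by simp
    show "h n \<in> borel_measurable lborel" for n unfolding h_def[abs_def] by measurable
  qed (use meas lim bound in auto)
  then show ?thesis by (simp add: zero LIMSEQ_const_iff)
qed

lemma norm_Basis_R3: "(e::R3) \<in> Basis \<Longrightarrow> norm e = 1" by (rule norm_Basis)

lemma dir_deriv_mult:
  assumes "\<And>p. f differentiable at p" "\<And>p. g differentiable at p"
  shows "dir_deriv e (\<lambda>p. f p * g p) = (\<lambda>p. f p * dir_deriv e g p + dir_deriv e f p * g p)"
proof -
  have "((\<lambda>p. f p * g p) has_derivative (\<lambda>h. f p * frechet_derivative g (at p) h + frechet_derivative f (at p) h * g p)) (at p)" for p
    using assms frechet_derivative_works by (intro has_derivative_mult) blast+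
  from dir_deriv_eqI[OF this] show ?thesis by (simp add: dir_deriv_def)
qed

lemma integration_by_parts:
  assumes f: "schwartz f" and g: "schwartz g" and e: "e \<in> Basis"
  shows "(\<integral>p. f p * dir_deriv e g p \<partial>lborel) = - (\<integral>p. dir_deriv e f p * g p \<partial>lborel)"
proof -
  have fg: "schwartz (\<lambda>p. f p * g p)" by (rule schwartz_product[OF f g])
  obtain B where B: "\<And>p. cmod (dir_deriv e (\<lambda>p. f p * g p) p) \<le> B * dmaj p"
    using rapid_majorant[OF schwartz_rapid[OF schwartz_dir_deriv[OF fg e]]] by blast
  have "(\<integral>p. dir_deriv e (\<lambda>p. f p * g p) p \<partial>lborel) = 0"
    by (rule integral_dir_deriv_eq_0[OF schwartz_differentiable[OF fg] schwartz_integrable[OF fg]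
          schwartz_measurable[OF schwartz_dir_deriv[OF fg e]] B norm_Basis_R3[OF e]])
  moreover have "dir_deriv e (\<lambda>p. f p * g p) = (\<lambda>p. f p * dir_deriv e g p + dir_deriv e f p * g p)"
    by (intro dir_deriv_mult schwartz_differentiable f g)
  ultimately have "(\<integral>p. f p * dir_deriv e g p + dir_deriv e f p * g p \<partial>lborel) = 0" by simp
  moreover have "integrable lborel (\<lambda>p. f p * dir_deriv e g p)" "integrable lborel (\<lambda>p. dir_deriv e f p * g p)"
    by (intro schwartz_integrable schwartz_product schwartz_dir_deriv f g e)+
  ultimately show ?thesis by (simp add: add_eq_0_iff)
qed

section \<open>The Fourier transform: derivatives, decay and exchange of integrals\<close>

definition ech :: "R3 \<Rightarrow> R3 \<Rightarrow> complex" where "ech \<zeta> p = exp (\<i> * of_real (p \<bullet> \<zeta>))"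

lemma norm_ech [simp]: "cmod (ech \<zeta> p) = 1" by (simp add: ech_def norm_exp_eq_Re)

lemma ech_commute: "ech \<zeta> p = ech p \<zeta>" by (simp add: ech_def inner_commute)

lemma ech_add: "ech \<zeta> (p + q) = ech \<zeta> p * ech \<zeta> q"
  by (simp add: ech_def inner_add_left distrib_left exp_add)

lemma ech_minus: "ech \<zeta> (- p) = cnj (ech \<zeta> p)" "ech (- \<zeta>) p = cnj (ech \<zeta> p)"
  by (simp_all add: ech_def exp_cnj)

lemma ech_diff: "ech \<zeta> (p - q) = ech \<zeta> p * ech (- q) \<zeta>"
  using ech_add[of \<zeta> p "- q"] by (simp add: ech_commute[of \<zeta> "- q"])

lemma fourier_ech: "fourier f \<zeta> = (\<integral>p. f p * ech (- \<zeta>) p \<partial>lborel)"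
  by (simp add: fourier_def ech_def mult.commute)

lemma ech_continuous: "continuous_on A f \<Longrightarrow> continuous_on A g \<Longrightarrow> continuous_on A (\<lambda>x. ech (f x) (g x))"
  unfolding ech_def by (intro continuous_intros)

lemma ech_has_derivative: "(ech \<zeta> has_derivative (\<lambda>h. (\<i> * of_real (h \<bullet> \<zeta>)) * ech \<zeta> p)) (at p)"
proof -
  have "((\<lambda>p. \<i> * of_real (p \<bullet> \<zeta>)) has_derivative (\<lambda>h. \<i> * of_real (h \<bullet> \<zeta>) :: complex)) (at p)"
    by (auto intro!: derivative_eq_intros)
  from has_derivative_compose[OF this DERIV_exp[THEN has_field_derivative_imp_has_derivative]]
  show ?thesis unfolding ech_def[abs_def] by (simp add: mult.commute)
qed

text \<open>The derivative of \<open>f\<close> times a character has integral 0. A character is not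
  a Schwartz function, so this rests on \<open>integral_dir_deriv_eq_0\<close> and not on
  \<open>integration_by_parts\<close>.\<close>

lemma fourier_dir_deriv:
  assumes f: "schwartz f" and e: "e \<in> Basis"
  shows "fourier (dir_deriv e f) \<zeta> = \<i> * of_real (e \<bullet> \<zeta>) * fourier f \<zeta>"
proof -
  let ?E = "ech (- \<zeta>)"
  have dE: "?E differentiable at p" for p using ech_has_derivative differentiable_def by blast
  have d: "dir_deriv e (\<lambda>p. f p * ?E p) = (\<lambda>p. f p * ((\<i> * of_real (e \<bullet> (- \<zeta>))) * ?E p) + dir_deriv e f p * ?E p)"
    using dir_deriv_mult[OF schwartz_differentiable[OF f] dE] dir_deriv_eqI[OF ech_has_derivative, of e "- \<zeta>"] by simp
  have [measurable]: "?E \<in> borel_measurable borel" by (intro borel_measurable_continuous_onI ech_continuous continuous_intros)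
  note [measurable] = schwartz_measurable[OF f] schwartz_measurable[OF schwartz_dir_deriv[OF f e]]
  obtain A where A: "A \<ge> 0" "\<And>p. cmod (f p) \<le> A * dmaj p" using rapid_majorant[OF schwartz_rapid[OF f]] by blast
  obtain B where B: "B \<ge> 0" "\<And>p. cmod (dir_deriv e f p) \<le> B * dmaj p" using rapid_majorant[OF schwartz_rapid[OF schwartz_dir_deriv[OF f e]]] by blast
  have bounded: "integrable lborel (\<lambda>p. h p * ?E p)" if "integrable lborel h" for h :: "R3 \<Rightarrow> complex"
    by (rule Bochner_Integration.integrable_bound[OF that]) (use that in \<open>auto simp: norm_mult\<close>)
  have i1: "integrable lborel (\<lambda>p. f p * ?E p)" by (intro bounded schwartz_integrable f)
  have i2: "integrable lborel (\<lambda>p. dir_deriv e f p * ?E p)" by (intro bounded schwartz_integrable schwartz_dir_deriv f e)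
  have "(\<integral>p. dir_deriv e (\<lambda>p. f p * ?E p) p \<partial>lborel) = 0"
  proof (rule integral_dir_deriv_eq_0[where B = "\<bar>e \<bullet> \<zeta>\<bar> * A + B", OF _ i1 _ _ norm_Basis_R3[OF e]])
    show "(\<lambda>p. f p * ?E p) differentiable at p" for p
      using schwartz_differentiable[OF f] dE by (intro differentiable_mult[of f p UNIV ?E]) auto
    show "dir_deriv e (\<lambda>p. f p * ?E p) \<in> borel_measurable borel" unfolding d by measurable
    show "cmod (dir_deriv e (\<lambda>p. f p * ?E p) p) \<le> (\<bar>e \<bullet> \<zeta>\<bar> * A + B) * dmaj p" for p
    proof -
      have "cmod (dir_deriv e (\<lambda>p. f p * ?E p) p) \<le> cmod (f p * ((\<i> * of_real (e \<bullet> (- \<zeta>))) * ?E p)) + cmod (dir_deriv e f p * ?E p)"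
        unfolding d by (rule norm_triangle_ineq)
      also have "\<dots> = \<bar>e \<bullet> \<zeta>\<bar> * cmod (f p) + cmod (dir_deriv e f p)" by (simp add: norm_mult)
      also have "\<dots> \<le> \<bar>e \<bullet> \<zeta>\<bar> * (A * dmaj p) + B * dmaj p" by (intro add_mono mult_left_mono A B) simp
      finally show ?thesis by (simp add: algebra_simps)
    qed
  qed
  then have "(\<integral>p. - (\<i> * of_real (e \<bullet> \<zeta>)) * (f p * ?E p) + dir_deriv e f p * ?E p \<partial>lborel) = 0"
    unfolding d by (simp add: mult_ac)
  then have "- (\<i> * of_real (e \<bullet> \<zeta>)) * fourier f \<zeta> + fourier (dir_deriv e f) \<zeta> = 0"
    unfolding fourier_ech using i1 i2 by (subst (asm) Bochner_Integration.integral_add) (simp_all del: mult_minus_left)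
  then show ?thesis by (simp add: add_eq_0_iff)
qed

lemma fourier_measurable:
  assumes [measurable]: "f \<in> borel_measurable borel"
  shows "fourier f \<in> borel_measurable borel"
proof -
  have "(\<lambda>(\<zeta>, p). f p * ech (- \<zeta>) p) \<in> borel_measurable (borel \<Otimes>\<^sub>M lborel)"
  proof -
    have "(\<lambda>p::R3\<times>R3. ech (- fst p) (snd p)) \<in> borel_measurable borel"
      by (intro borel_measurable_continuous_onI ech_continuous continuous_intros)
    then have [measurable]: "(\<lambda>p::R3\<times>R3. ech (- fst p) (snd p)) \<in> borel_measurable (borel \<Otimes>\<^sub>M lborel)"
      by (simp add: borel_prod[symmetric] cong: measurable_cong_sets sets_pair_measure_cong)
    show ?thesis by (simp add: case_prod_beta')
  qed
  from lborel.borel_measurable_lebesgue_integral[OF this] show ?thesis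
    unfolding fourier_ech[abs_def] by simp
qed

lemma norm_fourier_le:
  assumes "integrable lborel f"
  shows "cmod (fourier f \<zeta>) \<le> (\<integral>p. cmod (f p) \<partial>lborel)"
proof -
  have "cmod (fourier f \<zeta>) \<le> (\<integral>p. cmod (f p * ech (- \<zeta>) p) \<partial>lborel)"
    unfolding fourier_ech by (rule integral_norm_bound)
  then show ?thesis by (simp add: norm_mult)
qed

text \<open>Induction on the power of the norm: one factor is distributed over the coordinates and
  each coordinate is absorbed as a derivative of the function. The claim is therefore carried for
  all Schwartz functions at once.\<close>

lemma fourier_rapid:
  assumes "schwartz f" shows "rapid (fourier f)"
proof -
  have "\<forall>f. schwartz f \<longrightarrow> (\<exists>B. \<forall>\<zeta>. norm \<zeta> ^ N * cmod (fourier f \<zeta>) \<le> B)" for N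
  proof (induction N)
    case 0 then show ?case using norm_fourier_le schwartz_integrable by (metis mult_1 power_0)
  next
    case (Suc N)
    show ?case
    proof (intro allI impI)
      fix f assume f: "schwartz f"
      have "\<forall>e\<in>Basis. \<exists>B. \<forall>\<zeta>. norm \<zeta> ^ N * cmod (fourier (dir_deriv e f) \<zeta>) \<le> B"
        using Suc schwartz_dir_deriv[OF f] by blast
      then obtain B where B: "\<And>e \<zeta>. e \<in> Basis \<Longrightarrow> norm \<zeta> ^ N * cmod (fourier (dir_deriv e f) \<zeta>) \<le> B e" by metis
      have "norm \<zeta> ^ Suc N * cmod (fourier f \<zeta>) \<le> (\<Sum>e\<in>Basis. B e)" for \<zeta>
      proof -
        have "norm \<zeta> \<le> (\<Sum>e\<in>Basis. \<bar>e \<bullet> \<zeta>\<bar>)" using norm_le_l1[of \<zeta>] by (simp add: inner_commute)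
        then have "norm \<zeta> ^ Suc N * cmod (fourier f \<zeta>) \<le> (\<Sum>e\<in>Basis. \<bar>e \<bullet> \<zeta>\<bar>) * (norm \<zeta> ^ N * cmod (fourier f \<zeta>))"
          by (simp add: mult.assoc mult_right_mono)
        also have "\<dots> = (\<Sum>e\<in>Basis. norm \<zeta> ^ N * cmod (fourier (dir_deriv e f) \<zeta>))"
          unfolding sum_distrib_right by (intro sum.cong refl) (simp add: fourier_dir_deriv[OF f] norm_mult)
        also have "\<dots> \<le> (\<Sum>e\<in>Basis. B e)" by (intro sum_mono B)
        finally show ?thesis .
      qed
      then show "\<exists>B. \<forall>\<zeta>. norm \<zeta> ^ Suc N * cmod (fourier f \<zeta>) \<le> B" by blast
    qed
  qed
  then show ?thesis using assms fourier_measurable schwartz_measurable unfolding rapid_def by blast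
qed

lemma integrable_lborel_product:
  fixes a :: "'a::euclidean_space \<Rightarrow> complex" and b :: "'b::euclidean_space \<Rightarrow> complex"
  assumes a: "integrable lborel a" and b: "integrable lborel b"
  shows "integrable (lborel \<Otimes>\<^sub>M lborel) (\<lambda>(x, y). a x * b y)"
proof (rule lborel_pair.Fubini_integrable)
  have [measurable]: "a \<in> borel_measurable lborel" "b \<in> borel_measurable lborel" using a b by auto
  show "(\<lambda>(x, y). a x * b y) \<in> borel_measurable (lborel \<Otimes>\<^sub>M lborel)" by measurable
  show "integrable lborel (\<lambda>x. \<integral>y. cmod (case (x, y) of (x, y) \<Rightarrow> a x * b y) \<partial>lborel)"
    using a by (simp add: norm_mult)
  show "AE x in lborel. integrable lborel (\<lambda>y. case (x, y) of (x, y) \<Rightarrow> a x * b y)" using b by simp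
qed

text \<open>The exchanges of integrals behind inversion, the convolution theorem and Plancherel are
  all of this type: two integrable functions of separate variables, coupled by a bounded kernel that
  is exponential or Gaussian.\<close>

lemma fubini_kernel:
  fixes a :: "'a::euclidean_space \<Rightarrow> complex" and b :: "'b::euclidean_space \<Rightarrow> complex"
  assumes a: "integrable lborel a" and b: "integrable lborel b"
    and K: "K \<in> borel_measurable borel" and K1: "\<And>z. cmod (K z) \<le> 1"
  shows "(\<integral>x. a x * (\<integral>y. b y * K (x, y) \<partial>lborel) \<partial>lborel) = (\<integral>y. b y * (\<integral>x. a x * K (x, y) \<partial>lborel) \<partial>lborel)"
proof -
  have [measurable]: "a \<in> borel_measurable lborel" "b \<in> borel_measurable lborel" using a b by auto
  have [measurable]: "K \<in> borel_measurable (lborel \<Otimes>\<^sub>M lborel)" using K by (simp add: lborel_prod)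
  have "integrable (lborel \<Otimes>\<^sub>M lborel) (case_prod (\<lambda>x y. a x * b y * K (x, y)))"
    by (rule Bochner_Integration.integrable_bound[OF integrable_lborel_product[OF a b]])
       (auto simp: norm_mult intro!: AE_I2 mult_left_le K1)
  from lborel_pair.Fubini_integral[OF this]
  have "(\<integral>y. \<integral>x. a x * b y * K (x, y) \<partial>lborel \<partial>lborel) = (\<integral>x. \<integral>y. a x * b y * K (x, y) \<partial>lborel \<partial>lborel)" .
  moreover have "(\<integral>y. a x * b y * K (x, y) \<partial>lborel) = a x * (\<integral>y. b y * K (x, y) \<partial>lborel)" for x
    by (simp add: mult.assoc)
  moreover have "(\<integral>x. a x * b y * K (x, y) \<partial>lborel) = b y * (\<integral>x. a x * K (x, y) \<partial>lborel)" for y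
    by (simp only: mult.commute[of "a _" "b y"] mult.assoc integral_mult_right_zero)
  ultimately show ?thesis by simp
qed

section \<open>Gaussian integrals and Fourier inversion\<close>

text \<open>Up to the factor sqrt(2 pi) this is the characteristic function of the standard normal
  distribution.\<close>

lemma gauss_integral_1d:
  "integrable lborel (\<lambda>x::real. exp (of_real (- x\<^sup>2 / 2)) * exp (\<i> * of_real (t * x)) :: complex)"
  "(\<integral>x. exp (of_real (- x\<^sup>2 / 2)) * exp (\<i> * of_real (t * x)) \<partial>lborel) = complex_of_real (sqrt (2 * pi) * exp (- t\<^sup>2 / 2))"
proof -
  have dens: "complex_of_real (exp (- x\<^sup>2 / 2)) = of_real (sqrt (2 * pi)) * of_real (std_normal_density x)" for x
    by (simp add: std_normal_density_def)
  have i: "integrable lborel (\<lambda>x. complex_of_real (std_normal_density x) * exp (\<i> * of_real (t * x)))"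
  proof (rule Bochner_Integration.integrable_bound[of _ std_normal_density])
    show "integrable lborel std_normal_density" by (rule integrable_normal_density) simp
    show "(\<lambda>x. complex_of_real (std_normal_density x) * exp (\<i> * of_real (t * x))) \<in> borel_measurable lborel"
      by measurable
    show "AE x in lborel. cmod (complex_of_real (std_normal_density x) * exp (\<i> * of_real (t * x))) \<le> norm (std_normal_density x)"
      by (simp add: norm_mult norm_exp_eq_Re)
  qed
  have "(\<integral>x. complex_of_real (std_normal_density x) * exp (\<i> * of_real (t * x)) \<partial>lborel) = char std_normal_distribution t"
    unfolding char_def by (subst integral_density) (auto simp: scaleR_conv_of_real)
  also have "\<dots> = complex_of_real (exp (- t\<^sup>2 / 2))" by (simp add: char_std_normal_distribution)
  finally have v: "(\<integral>x. complex_of_real (std_normal_density x) * exp (\<i> * of_real (t * x)) \<partial>lborel) = complex_of_real (exp (- t\<^sup>2 / 2))" .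
  have e: "exp (of_real (- x\<^sup>2 / 2)) * exp (\<i> * of_real (t * x)) = of_real (sqrt (2 * pi)) * (complex_of_real (std_normal_density x) * exp (\<i> * of_real (t * x)))" for x :: real
    unfolding exp_of_real dens by (simp add: mult.assoc)
  show "integrable lborel (\<lambda>x::real. exp (of_real (- x\<^sup>2 / 2)) * exp (\<i> * of_real (t * x)) :: complex)"
    unfolding e using i by simp
  show "(\<integral>x. exp (of_real (- x\<^sup>2 / 2)) * exp (\<i> * of_real (t * x)) \<partial>lborel) = complex_of_real (sqrt (2 * pi) * exp (- t\<^sup>2 / 2))"
    unfolding e integral_mult_right_zero v by simp
qed

lemma integral_lborel_product:
  fixes a :: "'a::euclidean_space \<Rightarrow> complex" and b :: "'b::euclidean_space \<Rightarrow> complex"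
  assumes a: "integrable lborel a" and b: "integrable lborel b"
  shows "integrable lborel (\<lambda>z. a (fst z) * b (snd z))" "(\<integral>z. a (fst z) * b (snd z) \<partial>lborel) = (\<integral>x. a x \<partial>lborel) * (\<integral>y. b y \<partial>lborel)"
proof -
  have i: "integrable (lborel \<Otimes>\<^sub>M lborel) (\<lambda>(x, y). a x * b y)" by (rule integrable_lborel_product[OF a b])
  then show "integrable lborel (\<lambda>z. a (fst z) * b (snd z))" by (simp add: lborel_prod case_prod_beta')
  have "(\<integral>x. (\<integral>y. a x * b y \<partial>lborel) \<partial>lborel) = (\<integral>z. (case z of (x, y) \<Rightarrow> a x * b y) \<partial>(lborel \<Otimes>\<^sub>M lborel))"
    using lborel_pair.integral_fst[OF i] by simp
  then show "(\<integral>z. a (fst z) * b (snd z) \<partial>lborel) = (\<integral>x. a x \<partial>lborel) * (\<integral>y. b y \<partial>lborel)"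
    by (simp add: lborel_prod case_prod_beta')
qed

abbreviation gau :: "R3 \<Rightarrow> complex" where "gau \<equiv> gauss 0 0"

lemma gau_eq: "gau p = of_real (exp (- (p \<bullet> p) / 2))"
  by (simp add: gauss_def exp_of_real[symmetric])

lemma gauss_0: "gauss 0 v p = gau p * ech v p"
  by (simp add: gauss_def ech_def exp_add[symmetric] algebra_simps)

text \<open>The total mass (2 pi)^(3/2) of the Gaussian. As \<open>fourier\<close> is not
  normalised, the square \<open>gconst * gconst\<close> = (2 pi)^3 appears in inversion, in the
  convolution theorem and in Plancherel.\<close>

definition gconst :: complex where "gconst = of_real (sqrt (2 * pi) ^ 3)"

lemma gconst_neq_0: "gconst \<noteq> 0" by (simp add: gconst_def)

lemma gau_integrable: "integrable lborel gau" by (intro schwartz_integrable schwartz_gauss)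

lemma integral_gauss: "(\<integral>p. gau p * ech c p \<partial>lborel) = gconst * gau c"
proof -
  obtain c1 c2 c3 where c: "c = (c1, c2, c3)" by (cases c)
  let ?g = "\<lambda>t x::real. exp (of_real (- x\<^sup>2 / 2)) * exp (\<i> * of_real (t * x)) :: complex"
  have e: "gau p * ech c p = ?g c1 (fst p) * (?g c2 (fst (snd p)) * ?g c3 (snd (snd p)))" for p
  proof -
    have "gau p = exp (of_real (- (fst p)\<^sup>2 / 2)) * (exp (of_real (- (fst (snd p))\<^sup>2 / 2)) * exp (of_real (- (snd (snd p))\<^sup>2 / 2)))"
      unfolding gau_eq exp_of_real[symmetric] exp_add[symmetric]
      by (cases p) (simp add: power2_eq_square add_divide_distrib diff_divide_distrib)
    moreover have "ech c p = exp (\<i> * of_real (c1 * fst p)) * (exp (\<i> * of_real (c2 * fst (snd p))) * exp (\<i> * of_real (c3 * snd (snd p))))"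
      unfolding ech_def exp_add[symmetric] by (cases p) (simp add: c algebra_simps)
    ultimately show ?thesis by (simp only: mult_ac)
  qed
  have i23: "integrable lborel (\<lambda>q::real\<times>real. ?g c2 (fst q) * ?g c3 (snd q))"
    "(\<integral>q. ?g c2 (fst q) * ?g c3 (snd q) \<partial>lborel) = complex_of_real (sqrt (2 * pi) * exp (- c2\<^sup>2 / 2)) * complex_of_real (sqrt (2 * pi) * exp (- c3\<^sup>2 / 2))"
    using integral_lborel_product[OF gauss_integral_1d(1)[of c2] gauss_integral_1d(1)[of c3]]
    unfolding gauss_integral_1d(2) by simp_all
  have "(\<integral>p. gau p * ech c p \<partial>lborel) = complex_of_real (sqrt (2 * pi) * exp (- c1\<^sup>2 / 2)) * (complex_of_real (sqrt (2 * pi) * exp (- c2\<^sup>2 / 2)) * complex_of_real (sqrt (2 * pi) * exp (- c3\<^sup>2 / 2)))"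
    unfolding e using integral_lborel_product(2)[OF gauss_integral_1d(1)[of c1] i23(1)]
    unfolding gauss_integral_1d(2) i23(2) by simp
  also have "\<dots> = complex_of_real (sqrt (2 * pi) ^ 3 * (exp (- c1\<^sup>2 / 2) * (exp (- c2\<^sup>2 / 2) * exp (- c3\<^sup>2 / 2))))"
    by (simp only: of_real_mult of_real_power power3_eq_cube mult_ac)
  also have "exp (- c1\<^sup>2 / 2) * (exp (- c2\<^sup>2 / 2) * exp (- c3\<^sup>2 / 2)) = exp (- (c \<bullet> c) / 2)"
    unfolding exp_add[symmetric] by (simp add: c power2_eq_square add_divide_distrib diff_divide_distrib)
  finally show ?thesis by (simp add: gconst_def gau_eq)
qed

lemma integral_gau: "(\<integral>p. gau p \<partial>lborel) = gconst"
  using integral_gauss[of 0] by (simp add: ech_def gau_eq)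

lemma gau_bound: "cmod (gau p) \<le> 1" by (simp add: gau_eq)

lemma gau_measurable [measurable]: "gau \<in> borel_measurable borel"
  by (intro schwartz_measurable schwartz_gauss)

lemma gau_continuous: "continuous_on A gau"
  by (intro schwartz_continuous schwartz_gauss)

text \<open>The Gaussian is written as a Fourier integral and the integrals are exchanged. The
  average of \<open>h\<close> around \<open>c\<close> at scale 1 / \<open>T\<close> becomes an
  inversion integral damped by a Gaussian factor.\<close>

lemma gaussian_mollifier:
  assumes h: "integrable lborel h"
  shows "gconst * (\<integral>\<zeta>. h \<zeta> * gau (T *\<^sub>R (c - \<zeta>)) \<partial>lborel) = (\<integral>\<eta>. gau \<eta> * (ech c (T *\<^sub>R \<eta>) * fourier h (T *\<^sub>R \<eta>)) \<partial>lborel)"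
proof -
  let ?K = "\<lambda>z::R3\<times>R3. ech (T *\<^sub>R (c - fst z)) (snd z)"
  have K: "?K \<in> borel_measurable borel" by (intro borel_measurable_continuous_onI ech_continuous continuous_intros)
  have "gconst * (\<integral>\<zeta>. h \<zeta> * gau (T *\<^sub>R (c - \<zeta>)) \<partial>lborel) = (\<integral>\<zeta>. h \<zeta> * (gconst * gau (T *\<^sub>R (c - \<zeta>))) \<partial>lborel)"
    by (simp add: mult.left_commute)
  also have "\<dots> = (\<integral>\<zeta>. h \<zeta> * (\<integral>\<eta>. gau \<eta> * ?K (\<zeta>, \<eta>) \<partial>lborel) \<partial>lborel)" by (simp add: integral_gauss)
  also have "\<dots> = (\<integral>\<eta>. gau \<eta> * (\<integral>\<zeta>. h \<zeta> * ?K (\<zeta>, \<eta>) \<partial>lborel) \<partial>lborel)"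
    by (rule fubini_kernel[OF h gau_integrable K]) simp
  also have "\<dots> = (\<integral>\<eta>. gau \<eta> * (ech c (T *\<^sub>R \<eta>) * fourier h (T *\<^sub>R \<eta>)) \<partial>lborel)"
  proof (intro Bochner_Integration.integral_cong refl)
    fix \<eta>
    have k: "?K (\<zeta>, \<eta>) = ech c (T *\<^sub>R \<eta>) * ech (- (T *\<^sub>R \<eta>)) \<zeta>" for \<zeta>
    proof -
      have "?K (\<zeta>, \<eta>) = ech (T *\<^sub>R \<eta>) (c - \<zeta>)" by (simp add: ech_def inner_commute)
      also have "\<dots> = ech (T *\<^sub>R \<eta>) c * ech (- \<zeta>) (T *\<^sub>R \<eta>)" by (rule ech_diff)
      also have "ech (- \<zeta>) (T *\<^sub>R \<eta>) = ech (- (T *\<^sub>R \<eta>)) \<zeta>" by (simp add: ech_def inner_commute)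
      finally show ?thesis by (simp add: ech_commute)
    qed
    have "(\<integral>\<zeta>. h \<zeta> * ?K (\<zeta>, \<eta>) \<partial>lborel) = ech c (T *\<^sub>R \<eta>) * fourier h (T *\<^sub>R \<eta>)"
      unfolding k fourier_ech by (simp only: mult.left_commute[of "h _"] integral_mult_right_zero)
    then show "gau \<eta> * (\<integral>\<zeta>. h \<zeta> * ?K (\<zeta>, \<eta>) \<partial>lborel) = gau \<eta> * (ech c (T *\<^sub>R \<eta>) * fourier h (T *\<^sub>R \<eta>))" by simp
  qed
  finally show ?thesis .
qed

lemma tendsto_inverse_Suc_scaleR: "(\<lambda>n. c + (a / real (Suc n)) *\<^sub>R (q::R3)) \<longlonglongrightarrow> c"
proof -
  have "(\<lambda>n. a / real (Suc n)) \<longlonglongrightarrow> 0"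
    using tendsto_mult[OF tendsto_const[of a] LIMSEQ_inverse_real_of_nat] by (simp add: divide_inverse)
  from tendsto_add[OF tendsto_const tendsto_scaleR[OF this tendsto_const]] show ?thesis by simp
qed

lemma mollify_tendsto:
  assumes cont: "continuous_on UNIV k" and bd: "\<And>x. cmod (k x) \<le> B"
  shows "(\<lambda>n. \<integral>q. k (c + (a / real (Suc n)) *\<^sub>R q) * gau q \<partial>lborel) \<longlonglongrightarrow> k c * gconst"
proof -
  have [measurable]: "k \<in> borel_measurable borel" by (intro borel_measurable_continuous_onI cont)
  have "(\<lambda>n. \<integral>q. k (c + (a / real (Suc n)) *\<^sub>R q) * gau q \<partial>lborel) \<longlonglongrightarrow> (\<integral>q. k c * gau q \<partial>lborel)"
  proof (rule integral_dominated_convergence[where w = "\<lambda>q. B * cmod (gau q)"])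
    show "integrable lborel (\<lambda>q. B * cmod (gau q))" using gau_integrable by simp
    show "(\<lambda>q. k (c + (a / real (Suc n)) *\<^sub>R q) * gau q) \<in> borel_measurable lborel" for n by measurable
    show "AE q in lborel. (\<lambda>n. k (c + (a / real (Suc n)) *\<^sub>R q) * gau q) \<longlonglongrightarrow> k c * gau q"
    proof (intro AE_I2 tendsto_mult tendsto_const)
      fix q
      have "isCont k c" using cont continuous_on_eq_continuous_at[OF open_UNIV] by blast
      then show "(\<lambda>n. k (c + (a / real (Suc n)) *\<^sub>R q)) \<longlonglongrightarrow> k c"
        using isCont_tendsto_compose tendsto_inverse_Suc_scaleR by blast
    qed
    show "AE q in lborel. cmod (k (c + (a / real (Suc n)) *\<^sub>R q) * gau q) \<le> B * cmod (gau q)" for n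
      using bd by (intro AE_I2) (simp add: norm_mult mult_right_mono del: of_nat_Suc)
  qed simp
  then show ?thesis by (simp add: integral_gau)
qed

text \<open>The mollifier identity is rescaled on both sides and the scale tends to infinity. The
  left side is an approximate identity at \<open>c\<close>; on the right the damping factor tends to
  \<open>gau 0\<close> = 1, with the integrable transform as majorant.\<close>

lemma fourier_inversion:
  assumes f: "schwartz f"
  shows "gconst * gconst * f c = (\<integral>\<eta>. fourier f \<eta> * ech c \<eta> \<partial>lborel)"
proof -
  note [measurable] = schwartz_measurable[OF f] fourier_measurable[OF schwartz_measurable[OF f]]
  have [measurable]: "ech c \<in> borel_measurable borel" by (intro borel_measurable_continuous_onI ech_continuous continuous_intros)
  obtain B where B: "\<And>x. cmod (f x) \<le> B" using schwartz_decay[OF f, of 0] by auto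
  have eq: "gconst * (\<integral>q. f (c + (-1 / real (Suc n)) *\<^sub>R q) * gau q \<partial>lborel) = (\<integral>\<eta>. gau (0 + (1 / real (Suc n)) *\<^sub>R \<eta>) * (ech c \<eta> * fourier f \<eta>) \<partial>lborel)" for n
  proof -
    let ?T = "real (Suc n)"
    have T: "?T > 0" by simp
    \<comment> \<open>The two changes of variables produce the same Jacobian, the cube of 1 /
      \<open>?T\<close>, which is cancelled at the end.\<close>
    have "(\<integral>\<zeta>. f \<zeta> * gau (?T *\<^sub>R (c - \<zeta>)) \<partial>lborel) = of_real (\<bar>-1 / ?T\<bar> ^ 3) * (\<integral>q. f (c + (-1 / ?T) *\<^sub>R q) * gau (?T *\<^sub>R (c - (c + (-1 / ?T) *\<^sub>R q))) \<partial>lborel)"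
      by (rule lborel_integral_affine) (use T in auto)
    also have "(\<lambda>q. gau (?T *\<^sub>R (c - (c + (-1 / ?T) *\<^sub>R q)))) = gau" using T by (simp add: fun_eq_iff del: of_nat_Suc split_paired_All)
    then have "(\<integral>q. f (c + (-1 / ?T) *\<^sub>R q) * gau (?T *\<^sub>R (c - (c + (-1 / ?T) *\<^sub>R q))) \<partial>lborel) = (\<integral>q. f (c + (-1 / ?T) *\<^sub>R q) * gau q \<partial>lborel)"
      by metis
    finally have 1: "(\<integral>\<zeta>. f \<zeta> * gau (?T *\<^sub>R (c - \<zeta>)) \<partial>lborel) = of_real (\<bar>-1 / ?T\<bar> ^ 3) * (\<integral>q. f (c + (-1 / ?T) *\<^sub>R q) * gau q \<partial>lborel)" .
    have "(\<integral>\<eta>. gau \<eta> * (ech c (?T *\<^sub>R \<eta>) * fourier f (?T *\<^sub>R \<eta>)) \<partial>lborel) = of_real (\<bar>1 / ?T\<bar> ^ 3) *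
       (\<integral>\<eta>. gau (0 + (1 / ?T) *\<^sub>R \<eta>) * (ech c (?T *\<^sub>R (0 + (1 / ?T) *\<^sub>R \<eta>)) * fourier f (?T *\<^sub>R (0 + (1 / ?T) *\<^sub>R \<eta>))) \<partial>lborel)"
      by (rule lborel_integral_affine) (use T in auto)
    also have "(\<lambda>\<eta>. (?T *\<^sub>R (0 + (1 / ?T) *\<^sub>R \<eta>))) = (\<lambda>\<eta>::R3. \<eta>)" using T by (simp add: fun_eq_iff del: of_nat_Suc split_paired_All)
    then have "(\<integral>\<eta>. gau (0 + (1 / ?T) *\<^sub>R \<eta>) * (ech c (?T *\<^sub>R (0 + (1 / ?T) *\<^sub>R \<eta>)) * fourier f (?T *\<^sub>R (0 + (1 / ?T) *\<^sub>R \<eta>))) \<partial>lborel)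
       = (\<integral>\<eta>. gau (0 + (1 / ?T) *\<^sub>R \<eta>) * (ech c \<eta> * fourier f \<eta>) \<partial>lborel)" by metis
    finally have 2: "(\<integral>\<eta>. gau \<eta> * (ech c (?T *\<^sub>R \<eta>) * fourier f (?T *\<^sub>R \<eta>)) \<partial>lborel) = of_real (\<bar>1 / ?T\<bar> ^ 3) * (\<integral>\<eta>. gau (0 + (1 / ?T) *\<^sub>R \<eta>) * (ech c \<eta> * fourier f \<eta>) \<partial>lborel)" .
    have e: "\<bar>-1 / ?T\<bar> = \<bar>1 / ?T\<bar>" by simp
    have nz: "complex_of_real (\<bar>1 / ?T\<bar> ^ 3) \<noteq> 0" using T by (simp del: of_nat_Suc)
    have "complex_of_real (\<bar>1 / ?T\<bar> ^ 3) * (gconst * (\<integral>q. f (c + (-1 / ?T) *\<^sub>R q) * gau q \<partial>lborel))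
       = complex_of_real (\<bar>1 / ?T\<bar> ^ 3) * (\<integral>\<eta>. gau (0 + (1 / ?T) *\<^sub>R \<eta>) * (ech c \<eta> * fourier f \<eta>) \<partial>lborel)"
      using gaussian_mollifier[OF schwartz_integrable[OF f], of ?T c] unfolding 1 2 e by (simp only: mult.left_commute[of gconst])
    then show ?thesis by (rule mult_left_cancel[OF nz, THEN iffD1])
  qed
  have L: "(\<lambda>n. gconst * (\<integral>q. f (c + (-1 / real (Suc n)) *\<^sub>R q) * gau q \<partial>lborel)) \<longlonglongrightarrow> gconst * (f c * gconst)"
    by (intro tendsto_mult tendsto_const mollify_tendsto[OF schwartz_continuous[OF f] B])
  have R: "(\<lambda>n. \<integral>\<eta>. gau (0 + (1 / real (Suc n)) *\<^sub>R \<eta>) * (ech c \<eta> * fourier f \<eta>) \<partial>lborel) \<longlonglongrightarrow> (\<integral>\<eta>. gau 0 * (ech c \<eta> * fourier f \<eta>) \<partial>lborel)"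
  proof (rule integral_dominated_convergence[where w = "\<lambda>\<eta>. cmod (fourier f \<eta>)"])
    show "integrable lborel (\<lambda>\<eta>. cmod (fourier f \<eta>))" using rapid_integrable[OF fourier_rapid[OF f]] by simp
    show "(\<lambda>\<eta>. gau (0 + (1 / real (Suc n)) *\<^sub>R \<eta>) * (ech c \<eta> * fourier f \<eta>)) \<in> borel_measurable lborel" for n by measurable
    show "AE \<eta> in lborel. (\<lambda>n. gau (0 + (1 / real (Suc n)) *\<^sub>R \<eta>) * (ech c \<eta> * fourier f \<eta>)) \<longlonglongrightarrow> gau 0 * (ech c \<eta> * fourier f \<eta>)"
    proof (intro AE_I2 tendsto_mult tendsto_const)
      fix \<eta>
      have "isCont gau 0" using gau_continuous continuous_on_eq_continuous_at[OF open_UNIV] by blast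
      then show "(\<lambda>n. gau (0 + (1 / real (Suc n)) *\<^sub>R \<eta>)) \<longlonglongrightarrow> gau 0"
        using isCont_tendsto_compose tendsto_inverse_Suc_scaleR by blast
    qed
    show "AE \<eta> in lborel. cmod (gau (0 + (1 / real (Suc n)) *\<^sub>R \<eta>) * (ech c \<eta> * fourier f \<eta>)) \<le> cmod (fourier f \<eta>)" for n
      by (intro AE_I2) (simp add: norm_mult mult_left_le_one_le gau_bound del: of_nat_Suc)
  qed measurable
  have "gconst * (f c * gconst) = (\<integral>\<eta>. gau 0 * (ech c \<eta> * fourier f \<eta>) \<partial>lborel)"
    using LIMSEQ_unique[OF L] R unfolding eq by blast
  then show ?thesis by (simp add: gau_eq mult_ac)
qed

text \<open>Only the first factor is recovered by inversion: inserting the integral that defines the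
  transform of \<open>g\<close> and exchanging integrals makes the inversion integral of
  \<open>f\<close> appear at each point.\<close>

lemma fourier_mult:
  assumes f: "schwartz f" and g: "schwartz g"
  shows "gconst * gconst * fourier (\<lambda>p. f p * g p) \<zeta> = (\<integral>\<eta>. fourier f \<eta> * fourier g (\<zeta> - \<eta>) \<partial>lborel)"
proof -
  let ?K = "\<lambda>z::R3\<times>R3. ech (fst z - \<zeta>) (snd z)"
  have K: "?K \<in> borel_measurable borel" by (intro borel_measurable_continuous_onI ech_continuous continuous_intros)
  have "(\<integral>\<eta>. fourier f \<eta> * fourier g (\<zeta> - \<eta>) \<partial>lborel) = (\<integral>\<eta>. fourier f \<eta> * (\<integral>p. g p * ?K (\<eta>, p) \<partial>lborel) \<partial>lborel)"
    by (simp add: fourier_ech)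
  also have "\<dots> = (\<integral>p. g p * (\<integral>\<eta>. fourier f \<eta> * ?K (\<eta>, p) \<partial>lborel) \<partial>lborel)"
    by (rule fubini_kernel[OF rapid_integrable[OF fourier_rapid[OF f]] schwartz_integrable[OF g] K]) simp
  also have "\<dots> = (\<integral>p. gconst * gconst * (f p * g p * ech (- \<zeta>) p) \<partial>lborel)"
  proof (intro Bochner_Integration.integral_cong refl)
    fix p
    have "?K (\<eta>, p) = ech p \<eta> * ech (- \<zeta>) p" for \<eta>
      by (simp add: ech_def exp_add[symmetric] inner_diff_right inner_commute algebra_simps)
    then have "(\<integral>\<eta>. fourier f \<eta> * ?K (\<eta>, p) \<partial>lborel) = (\<integral>\<eta>. fourier f \<eta> * ech p \<eta> \<partial>lborel) * ech (- \<zeta>) p"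
      by (simp add: mult.assoc[symmetric])
    also have "\<dots> = gconst * gconst * f p * ech (- \<zeta>) p" by (simp add: fourier_inversion[OF f])
    finally show "g p * (\<integral>\<eta>. fourier f \<eta> * ?K (\<eta>, p) \<partial>lborel) = gconst * gconst * (f p * g p * ech (- \<zeta>) p)" by simp
  qed
  also have "\<dots> = gconst * gconst * fourier (\<lambda>p. f p * g p) \<zeta>" by (simp add: fourier_ech)
  finally show ?thesis ..
qed

lemma fourier_transpose:
  assumes f: "integrable lborel f" and g: "integrable lborel g"
  shows "(\<integral>p. f p * fourier g p \<partial>lborel) = (\<integral>\<zeta>. g \<zeta> * fourier f \<zeta> \<partial>lborel)"
proof -
  let ?K = "\<lambda>z::R3\<times>R3. ech (- fst z) (snd z)"
  have K: "?K \<in> borel_measurable borel" by (intro borel_measurable_continuous_onI ech_continuous continuous_intros)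
  have c: "ech (- x) y = ech (- y) x" for x y by (simp add: ech_def inner_commute)
  show ?thesis using fubini_kernel[OF f g K] by (simp add: fourier_ech c[of _ "_"] c)
qed

lemma plancherel:
  assumes f: "schwartz f"
  shows "gconst * gconst * of_real (\<integral>p. (cmod (f p))\<^sup>2 \<partial>lborel) = of_real (\<integral>\<zeta>. (cmod (fourier f \<zeta>))\<^sup>2 \<partial>lborel)"
proof -
  let ?K = "\<lambda>z::R3\<times>R3. ech (fst z) (snd z)"
  have K: "?K \<in> borel_measurable borel" by (intro borel_measurable_continuous_onI ech_continuous continuous_intros)
  have ci: "integrable lborel (\<lambda>p. cnj (f p))" using schwartz_integrable[OF f] by simp
  have "gconst * gconst * of_real (\<integral>p. (cmod (f p))\<^sup>2 \<partial>lborel) = (\<integral>p. cnj (f p) * (gconst * gconst * f p) \<partial>lborel)"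
    by (simp add: complex_norm_square integral_complex_of_real[symmetric] mult_ac del: of_real_power)
  also have "\<dots> = (\<integral>p. cnj (f p) * (\<integral>\<eta>. fourier f \<eta> * ?K (p, \<eta>) \<partial>lborel) \<partial>lborel)"
    by (simp add: fourier_inversion[OF f])
  also have "\<dots> = (\<integral>\<eta>. fourier f \<eta> * (\<integral>p. cnj (f p) * ?K (p, \<eta>) \<partial>lborel) \<partial>lborel)"
    by (rule fubini_kernel[OF ci rapid_integrable[OF fourier_rapid[OF f]] K]) simp
  also have "\<dots> = (\<integral>\<eta>. fourier f \<eta> * cnj (fourier f \<eta>) \<partial>lborel)"
  proof (intro Bochner_Integration.integral_cong refl)
    fix \<eta>
    have "cnj (fourier f \<eta>) = (\<integral>p. cnj (f p * ech (- \<eta>) p) \<partial>lborel)"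
      unfolding fourier_ech by (rule Bochner_Integration.integral_cnj[symmetric])
    also have "\<dots> = (\<integral>p. cnj (f p) * ?K (p, \<eta>) \<partial>lborel)" by (simp add: ech_minus ech_commute)
    finally show "fourier f \<eta> * (\<integral>p. cnj (f p) * ?K (p, \<eta>) \<partial>lborel) = fourier f \<eta> * cnj (fourier f \<eta>)" by simp
  qed
  also have "\<dots> = of_real (\<integral>\<zeta>. (cmod (fourier f \<zeta>))\<^sup>2 \<partial>lborel)"
    by (simp add: complex_norm_square integral_complex_of_real[symmetric] del: of_real_power)
  finally show ?thesis .
qed

section \<open>Injectivity of the Fourier transform on integrable functions\<close>

text \<open>By \<open>gaussian_mollifier\<close> all Gaussian averages of \<open>h\<close> vanish.
  Fubini moves the averaging onto \<open>k\<close>, and as its width shrinks the averages of the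
  bounded continuous \<open>k\<close> tend to \<open>k\<close> itself, up to
  \<open>gconst\<close>.\<close>

lemma fourier_eq_0_imp_integral_eq_0:
  assumes h: "integrable lborel h" and 0: "\<And>\<zeta>. fourier h \<zeta> = 0"
    and k: "continuous_on UNIV k" "integrable lborel k" and B: "\<And>x. cmod (k x) \<le> B"
  shows "(\<integral>\<zeta>. h \<zeta> * k \<zeta> \<partial>lborel) = 0"
proof -
  have [measurable]: "h \<in> borel_measurable borel" "k \<in> borel_measurable borel" using h k by auto
  have m0: "(\<integral>\<zeta>. h \<zeta> * gau (T *\<^sub>R (c - \<zeta>)) \<partial>lborel) = 0" for T c
    using gaussian_mollifier[OF h, of T c] gconst_neq_0 by (simp add: 0)
  have z: "(\<integral>\<zeta>. h \<zeta> * (\<integral>q. k (\<zeta> + (1 / real (Suc n)) *\<^sub>R q) * gau q \<partial>lborel) \<partial>lborel) = 0" for n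
  proof -
    let ?T = "real (Suc n)"
    have T: "?T > 0" by simp
    let ?K = "\<lambda>z::R3\<times>R3. gau (?T *\<^sub>R (fst z - snd z))"
    have K: "?K \<in> borel_measurable borel"
      by (intro borel_measurable_continuous_onI continuous_on_compose2[OF gau_continuous[of UNIV]] continuous_intros) auto
    have "0 = (\<integral>c. k c * (\<integral>\<zeta>. h \<zeta> * ?K (c, \<zeta>) \<partial>lborel) \<partial>lborel)" by (simp add: m0 del: of_nat_Suc)
    also have "\<dots> = (\<integral>\<zeta>. h \<zeta> * (\<integral>c. k c * ?K (c, \<zeta>) \<partial>lborel) \<partial>lborel)"
      by (rule fubini_kernel[OF k(2) h K]) (rule gau_bound)
    also have "\<dots> = (\<integral>\<zeta>. of_real (\<bar>1 / ?T\<bar> ^ 3) * (h \<zeta> * (\<integral>q. k (\<zeta> + (1 / ?T) *\<^sub>R q) * gau q \<partial>lborel)) \<partial>lborel)"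
    proof (intro Bochner_Integration.integral_cong refl)
      fix \<zeta>
      have "(\<integral>c. k c * ?K (c, \<zeta>) \<partial>lborel) = of_real (\<bar>1 / ?T\<bar> ^ 3) * (\<integral>q. k (\<zeta> + (1 / ?T) *\<^sub>R q) * ?K (\<zeta> + (1 / ?T) *\<^sub>R q, \<zeta>) \<partial>lborel)"
        by (rule lborel_integral_affine) (use T in auto)
      also have "(\<lambda>q. ?K (\<zeta> + (1 / ?T) *\<^sub>R q, \<zeta>)) = gau" using T by (simp add: fun_eq_iff del: of_nat_Suc split_paired_All)
      then have "(\<integral>q. k (\<zeta> + (1 / ?T) *\<^sub>R q) * ?K (\<zeta> + (1 / ?T) *\<^sub>R q, \<zeta>) \<partial>lborel) = (\<integral>q. k (\<zeta> + (1 / ?T) *\<^sub>R q) * gau q \<partial>lborel)"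
        by metis
      finally show "h \<zeta> * (\<integral>c. k c * ?K (c, \<zeta>) \<partial>lborel) = of_real (\<bar>1 / ?T\<bar> ^ 3) * (h \<zeta> * (\<integral>q. k (\<zeta> + (1 / ?T) *\<^sub>R q) * gau q \<partial>lborel))"
        by (simp add: mult.left_commute)
    qed
    also have "\<dots> = of_real (\<bar>1 / ?T\<bar> ^ 3) * (\<integral>\<zeta>. h \<zeta> * (\<integral>q. k (\<zeta> + (1 / ?T) *\<^sub>R q) * gau q \<partial>lborel) \<partial>lborel)" by simp
    finally have "of_real (\<bar>1 / ?T\<bar> ^ 3) * (\<integral>\<zeta>. h \<zeta> * (\<integral>q. k (\<zeta> + (1 / ?T) *\<^sub>R q) * gau q \<partial>lborel) \<partial>lborel) = 0" by (rule sym)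
    moreover have "complex_of_real (\<bar>1 / ?T\<bar> ^ 3) \<noteq> 0" using T by (simp del: of_nat_Suc)
    ultimately show ?thesis using mult_eq_0_iff[THEN iffD1] by blast
  qed
  have B0: "B \<ge> 0" using order_trans[OF norm_ge_zero B[of 0]] .
  have inner: "cmod (\<integral>q. k (\<zeta> + (1 / real (Suc n)) *\<^sub>R q) * gau q \<partial>lborel) \<le> B * (\<integral>q. cmod (gau q) \<partial>lborel)" for \<zeta> n
  proof -
    have "cmod (\<integral>q. k (\<zeta> + (1 / real (Suc n)) *\<^sub>R q) * gau q \<partial>lborel) \<le> (\<integral>q. B * cmod (gau q) \<partial>lborel)"
    proof (rule Bochner_Integration.integral_norm_bound_integral)
      show "integrable lborel (\<lambda>q. k (\<zeta> + (1 / real (Suc n)) *\<^sub>R q) * gau q)"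
        by (rule Bochner_Integration.integrable_bound[of _ "\<lambda>q. B * cmod (gau q)"])
          (use gau_integrable B B0 in \<open>auto simp: norm_mult mult_right_mono simp del: of_nat_Suc\<close>)
    qed (use gau_integrable B in \<open>auto simp: norm_mult mult_right_mono simp del: of_nat_Suc\<close>)
    then show ?thesis by simp
  qed
  have "(\<lambda>n. \<integral>\<zeta>. h \<zeta> * (\<integral>q. k (\<zeta> + (1 / real (Suc n)) *\<^sub>R q) * gau q \<partial>lborel) \<partial>lborel) \<longlonglongrightarrow> (\<integral>\<zeta>. h \<zeta> * (k \<zeta> * gconst) \<partial>lborel)"
  proof (rule integral_dominated_convergence[where w = "\<lambda>\<zeta>. cmod (h \<zeta>) * (B * (\<integral>q. cmod (gau q) \<partial>lborel))"])
    show "integrable lborel (\<lambda>\<zeta>. cmod (h \<zeta>) * (B * (\<integral>q. cmod (gau q) \<partial>lborel)))" using h by simp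
    show "(\<lambda>\<zeta>. h \<zeta> * (\<integral>q. k (\<zeta> + (1 / real (Suc n)) *\<^sub>R q) * gau q \<partial>lborel)) \<in> borel_measurable lborel" for n by measurable
    show "AE \<zeta> in lborel. (\<lambda>n. h \<zeta> * (\<integral>q. k (\<zeta> + (1 / real (Suc n)) *\<^sub>R q) * gau q \<partial>lborel)) \<longlonglongrightarrow> h \<zeta> * (k \<zeta> * gconst)"
      by (intro AE_I2 tendsto_mult tendsto_const mollify_tendsto[OF k(1) B])
    show "AE \<zeta> in lborel. cmod (h \<zeta> * (\<integral>q. k (\<zeta> + (1 / real (Suc n)) *\<^sub>R q) * gau q \<partial>lborel)) \<le> cmod (h \<zeta>) * (B * (\<integral>q. cmod (gau q) \<partial>lborel))" for n
      unfolding norm_mult by (intro AE_I2 mult_left_mono inner) simp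
  qed measurable
  then have "(\<integral>\<zeta>. h \<zeta> * (k \<zeta> * gconst) \<partial>lborel) = 0" unfolding z by (simp add: LIMSEQ_const_iff)
  then show ?thesis using gconst_neq_0 by (simp add: mult.assoc[symmetric])
qed

text \<open>The integrals of \<open>h\<close> over all Borel sets vanish: over open boxes because
  their indicators are limits of continuous functions, and over the others by the pi-lambda
  argument, boxes being stable under intersection.\<close>

lemma fourier_eq_0_imp_AE_eq_0:
  assumes h: "integrable lborel h" and 0: "\<And>\<zeta>. fourier h \<zeta> = 0"
  shows "AE x in lborel. h x = 0"
proof (rule sigma_finite_measure.density_zero[OF lborel.sigma_finite_measure_axioms h])
  have [measurable]: "h \<in> borel_measurable borel" using h by simp
  have total: "(\<integral>x. h x \<partial>lborel) = 0" using 0[of 0] by (simp add: fourier_ech ech_def)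
  have si: "set_integrable lborel A h" if "A \<in> sets borel" for A
    using integrable_mult_indicator[OF _ h, of A] that by (simp add: set_integrable_def)
  have box0: "set_lebesgue_integral lborel (box a b) h = 0" for a b :: R3
  proof (cases "box a b = {}")
    case False
    \<comment> \<open>Truncated multiples of the distance to the complement: continuous, zero
      outside the box, and eventually 1 at each point of the open box.\<close>
    define k where "k n x = complex_of_real (min 1 (real n * infdist x (- box a b)))" for n x
    have ne: "- box a b \<noteq> {}" 
    proof
      assume "- box a b = {}"
      then have "- (- box a b) = UNIV" by simp
      then have "box a b = UNIV" by (simp only: double_complement)
      then have "bounded (UNIV :: R3 set)" using bounded_box[of a b] by simp
      then show False using not_bounded_UNIV by blast
    qed
    have kbox: "k n x = 0" if "x \<notin> box a b" for n x using that by (simp add: k_def)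
    have kbd: "cmod (k n x) \<le> 1" for n x by (simp add: k_def infdist_nonneg)
    have kc: "continuous_on UNIV (k n)" for n unfolding k_def[abs_def] by (intro continuous_intros)
    have ki: "integrable lborel (k n)" for n
    proof (rule Bochner_Integration.integrable_bound[of _ "indicator (box a b) :: R3 \<Rightarrow> real"])
      show "integrable lborel (indicator (box a b) :: R3 \<Rightarrow> real)"
        using emeasure_lborel_box_finite[of a b] by (simp add: integrable_indicator_iff)
      show "k n \<in> borel_measurable lborel" using borel_measurable_continuous_onI[OF kc] by simp
      show "AE x in lborel. norm (k n x) \<le> norm (indicator (box a b) x :: real)"
        using kbox kbd by (auto simp: indicator_def)
    qed
    have z: "(\<integral>x. h x * k n x \<partial>lborel) = 0" for n
      by (rule fourier_eq_0_imp_integral_eq_0[OF h 0 kc ki kbd])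
    have "(\<lambda>n. \<integral>x. h x * k n x \<partial>lborel) \<longlonglongrightarrow> (\<integral>x. indicator (box a b) x *\<^sub>R h x \<partial>lborel)"
    proof (rule integral_dominated_convergence[where w = "\<lambda>x. cmod (h x)"])
      show "(\<lambda>x. h x * k n x) \<in> borel_measurable lborel" for n
        using borel_measurable_continuous_onI[OF kc[of n]] by simp
      show "AE x in lborel. (\<lambda>n. h x * k n x) \<longlonglongrightarrow> indicator (box a b) x *\<^sub>R h x"
      proof (rule AE_I2)
        fix x
        show "(\<lambda>n. h x * k n x) \<longlonglongrightarrow> indicator (box a b) x *\<^sub>R h x"
        proof (cases "x \<in> box a b")
          case True
          have cl: "closed (- box a b)" by (simp add: closed_Compl open_box)
          have pos: "infdist x (- box a b) > 0"
            using in_closed_iff_infdist_zero[OF cl ne, of x] True infdist_nonneg[of x "- box a b"] by auto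
          obtain N :: nat where N: "1 < real N * infdist x (- box a b)" using reals_Archimedean3[OF pos] by blast
          have "k n x = 1" if "n \<ge> N" for n
          proof -
            have "real N * infdist x (- box a b) \<le> real n * infdist x (- box a b)"
              using that pos by (intro mult_right_mono) auto
            then show ?thesis using N by (simp add: k_def)
          qed
          then have "eventually (\<lambda>n. h x * k n x = h x) sequentially"
            unfolding eventually_sequentially by (intro exI[of _ N]) simp
          then show ?thesis using True by (simp add: tendsto_eventually)
        qed (simp add: kbox)
      qed
      show "AE x in lborel. cmod (h x * k n x) \<le> cmod (h x)" for n
        using kbd by (intro AE_I2) (simp add: norm_mult mult_left_le)
    qed (use h in auto)
    then show ?thesis unfolding z by (simp add: LIMSEQ_const_iff set_lebesgue_integral_def)
  qed (simp add: set_lebesgue_integral_def)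
  fix A assume "A \<in> sets (lborel :: R3 measure)"
  have sb: "sigma_sets UNIV (range (\<lambda>(a, b). box a b :: R3 set)) = sets borel"
    by (subst borel_eq_box) simp
  have stable: "Int_stable (range (\<lambda>(a, b). box a b :: R3 set))"
    by (auto simp: Int_stable_def box_Int_box)
  have sub: "range (\<lambda>(a, b). box a b :: R3 set) \<subseteq> Pow UNIV" by simp
  have "A \<in> sigma_sets UNIV (range (\<lambda>(a, b). box a b :: R3 set))" using \<open>A \<in> sets lborel\<close> by (simp add: sb)
  with stable sub show "set_lebesgue_integral lborel A h = 0"
  proof (induction rule: sigma_sets_induct_disjoint)
    case (basic A) then show ?case using box0 by auto
  next
    case empty then show ?case by (simp add: set_lebesgue_integral_def)
  next
    case (compl A)
    have "set_lebesgue_integral lborel (UNIV - A) h = (\<integral>x. h x - indicator A x *\<^sub>R h x \<partial>lborel)"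
      unfolding set_lebesgue_integral_def by (intro Bochner_Integration.integral_cong) (auto simp: indicator_def)
    also have "\<dots> = (\<integral>x. h x \<partial>lborel) - set_lebesgue_integral lborel A h"
      unfolding set_lebesgue_integral_def using h si[of A] compl sb by (intro Bochner_Integration.integral_diff) (auto simp: set_integrable_def)
    finally show ?case using compl total by simp
  next
    case (union A)
    have "set_lebesgue_integral lborel (\<Union>i. A i) h = (\<Sum>i. set_lebesgue_integral lborel (A i) h)"
      using union sb by (intro lebesgue_integral_countable_add si) (auto simp: disjoint_family_on_def)
    then show ?case using union by simp
  qed
qed

section \<open>Weighted square-integrable limits and the Bourgain norms\<close>

lemma tendsto_ennreal_0I:
  fixes u :: "nat \<Rightarrow> ennreal"
  assumes "\<And>\<epsilon>. \<epsilon> > 0 \<Longrightarrow> \<exists>N. \<forall>n\<ge>N. u n \<le> ennreal \<epsilon>"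
  shows "u \<longlonglongrightarrow> 0"
proof (rule order_tendstoI)
  fix y :: ennreal assume "0 < y"
  then obtain z where z: "0 < z" "z < y" using dense by blast
  then have "z < top" by (metis top.not_eq_extremum top.extremum_strict)
  then obtain e where e: "z = ennreal e" "e > 0" using z(1) by (cases z) auto
  with assms[of e] z(2) show "eventually (\<lambda>n. u n < y) sequentially"
    unfolding eventually_sequentially by (meson le_less_trans)
qed simp

section \<open>Completeness and pairings of square-integrable functions\<close>

abbreviation L2sq :: "'a measure \<Rightarrow> ('a \<Rightarrow> complex) \<Rightarrow> ennreal" where
  "L2sq M f \<equiv> (\<integral>\<^sup>+x. ennreal ((cmod (f x))\<^sup>2) \<partial>M)"

text \<open>The Riesz-Fischer argument. Along a subsequence whose increments have squared norm at
  most 8^(-k), the sum of 4^k |d_k|^2 is finite almost everywhere; so |d_k| is at most a multiple of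
  2^(-k) and the subsequence converges pointwise. Fatou's lemma then yields convergence of the full
  sequence in norm.\<close>

lemma L2_complete:
  fixes f :: "nat \<Rightarrow> 'a \<Rightarrow> complex"
  assumes [measurable]: "\<And>n. f n \<in> borel_measurable M"
    and cauchy: "\<And>\<epsilon>. \<epsilon> > 0 \<Longrightarrow> \<exists>N. \<forall>m\<ge>N. \<forall>n\<ge>N. L2sq M (\<lambda>x. f m x - f n x) \<le> ennreal \<epsilon>"
  obtains g where "g \<in> borel_measurable M" "(\<lambda>n. L2sq M (\<lambda>x. f n x - g x)) \<longlonglongrightarrow> 0"
proof -
  have "\<forall>k. \<exists>N. \<forall>m\<ge>N. \<forall>n\<ge>N. L2sq M (\<lambda>x. f m x - f n x) \<le> ennreal ((1/8) ^ k)"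
    using cauchy by simp
  then obtain N where N: "\<And>k m n. m \<ge> N k \<Longrightarrow> n \<ge> N k \<Longrightarrow> L2sq M (\<lambda>x. f m x - f n x) \<le> ennreal ((1/8) ^ k)"
    by metis
  \<comment> \<open>Summing the thresholds and adding \<open>k\<close> makes the indices
    nondecreasing, at least \<open>N k\<close> and unbounded.\<close>
  define r where "r k = k + sum N {..k}" for k
  have rN: "r k \<ge> N k" for k unfolding r_def by (intro trans_le_add2 member_le_sum) auto
  have rS: "r k \<le> r (Suc k)" for k by (simp add: r_def)
  define d where "d k x = f (r (Suc k)) x - f (r k) x" for k x
  have [measurable]: "d k \<in> borel_measurable M" for k unfolding d_def[abs_def] by measurable
  have dk: "L2sq M (d k) \<le> ennreal ((1/8) ^ k)" for k
    unfolding d_def using rN rS by (intro N) (auto intro: order_trans)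
  have "(\<integral>\<^sup>+x. (\<Sum>k. ennreal (4 ^ k * (cmod (d k x))\<^sup>2)) \<partial>M) = (\<Sum>k. \<integral>\<^sup>+x. ennreal (4 ^ k * (cmod (d k x))\<^sup>2) \<partial>M)"
    by (rule nn_integral_suminf) measurable
  also have "\<dots> \<le> (\<Sum>k. ennreal ((1/2) ^ k))"
  proof (intro suminf_le summableI)
    fix k
    have "(\<integral>\<^sup>+x. ennreal (4 ^ k * (cmod (d k x))\<^sup>2) \<partial>M) = ennreal (4 ^ k) * L2sq M (d k)"
      by (simp add: ennreal_mult nn_integral_cmult)
    also have "\<dots> \<le> ennreal (4 ^ k) * ennreal ((1/8) ^ k)" by (intro mult_left_mono dk) simp
    also have "\<dots> = ennreal ((1/2) ^ k)" by (simp add: ennreal_mult[symmetric] power_mult_distrib[symmetric])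
    finally show "(\<integral>\<^sup>+x. ennreal (4 ^ k * (cmod (d k x))\<^sup>2) \<partial>M) \<le> ennreal ((1/2) ^ k)" .
  qed
  also have "\<dots> = ennreal 2"
    using geometric_sums[of "1/2 :: real"] by (intro suminf_ennreal_eq) simp_all
  also have "\<dots> < \<infinity>" by simp
  finally have fin: "(\<integral>\<^sup>+x. (\<Sum>k. ennreal (4 ^ k * (cmod (d k x))\<^sup>2)) \<partial>M) < \<infinity>" .
  have "AE x in M. (\<Sum>k. ennreal (4 ^ k * (cmod (d k x))\<^sup>2)) \<noteq> \<infinity>"
    using fin by (intro nn_integral_PInf_AE) auto
  then have AEc: "AE x in M. convergent (\<lambda>k. f (r k) x)"
  proof eventually_elim
    fix x assume fin: "(\<Sum>k. ennreal (4 ^ k * (cmod (d k x))\<^sup>2)) \<noteq> \<infinity>"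
    define K where "K = enn2real (\<Sum>k. ennreal (4 ^ k * (cmod (d k x))\<^sup>2))"
    have K: "(\<Sum>k. ennreal (4 ^ k * (cmod (d k x))\<^sup>2)) = ennreal K" "K \<ge> 0" using fin by (auto simp: K_def less_top)
    have le: "cmod (d k x) \<le> sqrt K * (1/2) ^ k" for k
    proof -
      have "ennreal (4 ^ k * (cmod (d k x))\<^sup>2) \<le> (\<Sum>k. ennreal (4 ^ k * (cmod (d k x))\<^sup>2))"
      proof -
        define F where "F k = ennreal (4 ^ k * (cmod (d k x))\<^sup>2)" for k
        have "F k \<le> sum F {k}" by simp
        also have "\<dots> \<le> suminf F" by (rule sum_le_suminf[OF summableI]) auto
        finally show ?thesis unfolding F_def .
      qed
      then have "4 ^ k * (cmod (d k x))\<^sup>2 \<le> K" unfolding K(1) using K(2) by (simp only: ennreal_le_iff)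
      moreover have "(2 ^ k * cmod (d k x))\<^sup>2 = 4 ^ k * (cmod (d k x))\<^sup>2"
      proof -
        have "(2::real) ^ k * 2 ^ k = 4 ^ k" by (simp add: power_mult_distrib[symmetric])
        then show ?thesis unfolding power_mult_distrib by (simp add: power2_eq_square)
      qed
      ultimately have "(2 ^ k * cmod (d k x))\<^sup>2 \<le> K" by simp
      then have "2 ^ k * cmod (d k x) \<le> sqrt K" by (rule real_le_rsqrt)
      then show ?thesis by (simp add: field_simps power_one_over)
    qed
    have "summable (\<lambda>k. d k x)"
      by (rule summable_comparison_test'[of "\<lambda>k. sqrt K * (1/2) ^ k" 0]) (auto intro!: summable_mult summable_geometric le)
    then have "(\<lambda>n. \<Sum>k<n. d k x) \<longlonglongrightarrow> (\<Sum>k. d k x)" by (rule summable_LIMSEQ)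
    moreover have "(\<Sum>k<n. d k x) = f (r n) x - f (r 0) x" for n
      unfolding d_def by (rule sum_lessThan_telescope)
    ultimately have "(\<lambda>n. f (r n) x - f (r 0) x) \<longlonglongrightarrow> (\<Sum>k. d k x)" by simp
    from tendsto_add[OF this tendsto_const[of "f (r 0) x"]] show "convergent (\<lambda>k. f (r k) x)"
      by (auto simp: convergent_def)
  qed
  define g where "g x = lim (\<lambda>k. f (r k) x)" for x
  have gm [measurable]: "g \<in> borel_measurable M" unfolding g_def[abs_def] by (rule borel_measurable_lim_metric) simp
  have AEg: "AE x in M. (\<lambda>k. f (r k) x) \<longlonglongrightarrow> g x"
    using AEc by eventually_elim (simp add: g_def convergent_LIMSEQ_iff)
  have "(\<lambda>n. L2sq M (\<lambda>x. f n x - g x)) \<longlonglongrightarrow> 0"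
  proof (rule tendsto_ennreal_0I)
    show "\<exists>N. \<forall>n\<ge>N. L2sq M (\<lambda>x. f n x - g x) \<le> ennreal \<epsilon>" if "\<epsilon> > 0" for \<epsilon>
    proof -
      obtain N0 where N0: "\<And>m n. m \<ge> N0 \<Longrightarrow> n \<ge> N0 \<Longrightarrow> L2sq M (\<lambda>x. f m x - f n x) \<le> ennreal \<epsilon>"
        using cauchy[OF \<open>\<epsilon> > 0\<close>] by blast
      have "L2sq M (\<lambda>x. f n x - g x) \<le> ennreal \<epsilon>" if n: "n \<ge> N0" for n
      proof -
        \<comment> \<open>Fatou's lemma along the subsequence, with \<open>n\<close> held
          fixed.\<close>
        have "L2sq M (\<lambda>x. f n x - g x) = (\<integral>\<^sup>+x. liminf (\<lambda>k. ennreal ((cmod (f n x - f (r k) x))\<^sup>2)) \<partial>M)"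
        proof (rule nn_integral_cong_AE)
          show "AE x in M. ennreal ((cmod (f n x - g x))\<^sup>2) = liminf (\<lambda>k. ennreal ((cmod (f n x - f (r k) x))\<^sup>2))"
            using AEg
          proof eventually_elim
            fix x assume "(\<lambda>k. f (r k) x) \<longlonglongrightarrow> g x"
            then have "(\<lambda>k. ennreal ((cmod (f n x - f (r k) x))\<^sup>2)) \<longlonglongrightarrow> ennreal ((cmod (f n x - g x))\<^sup>2)"
              by (intro tendsto_intros)
            then show "ennreal ((cmod (f n x - g x))\<^sup>2) = liminf (\<lambda>k. ennreal ((cmod (f n x - f (r k) x))\<^sup>2))"
              by (rule lim_imp_Liminf[OF trivial_limit_sequentially, symmetric])
          qed
        qed
        also have "\<dots> \<le> liminf (\<lambda>k. L2sq M (\<lambda>x. f n x - f (r k) x))"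
          by (rule nn_integral_liminf) measurable
        also have "\<dots> \<le> ennreal \<epsilon>"
        proof (rule Liminf_le)
          show "eventually (\<lambda>k. L2sq M (\<lambda>x. f n x - f (r k) x) \<le> ennreal \<epsilon>) sequentially"
            unfolding eventually_sequentially
          proof (intro exI[of _ N0] allI impI)
            fix k assume "N0 \<le> k"
            then have "N0 \<le> r k" by (simp add: r_def)
            then show "L2sq M (\<lambda>x. f n x - f (r k) x) \<le> ennreal \<epsilon>" using n by (intro N0)
          qed
        qed simp
        finally show ?thesis .
      qed
      then show ?thesis by blast
    qed
  qed
  with gm that show ?thesis by blast
qed

lemma L2_pairing:
  fixes g \<kappa> :: "'a \<Rightarrow> complex"
  assumes [measurable]: "g \<in> borel_measurable M" "\<kappa> \<in> borel_measurable M"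
    and "L2sq M g < \<infinity>" "L2sq M \<kappa> < \<infinity>"
  shows "integrable M (\<lambda>x. g x * \<kappa> x)"
    "ennreal ((cmod (\<integral>x. g x * \<kappa> x \<partial>M))\<^sup>2) \<le> L2sq M g * L2sq M \<kappa>"
proof -
  have "(\<integral>\<^sup>+x. ennreal (cmod (g x)) * ennreal (cmod (\<kappa> x)) \<partial>M)\<^sup>2 \<le> (\<integral>\<^sup>+x. (ennreal (cmod (g x)))\<^sup>2 \<partial>M) * (\<integral>\<^sup>+x. (ennreal (cmod (\<kappa> x)))\<^sup>2 \<partial>M)"
    by (rule Cauchy_Schwarz_nn_integral) measurable
  then have cs: "(\<integral>\<^sup>+x. ennreal (cmod (g x * \<kappa> x)) \<partial>M)\<^sup>2 \<le> L2sq M g * L2sq M \<kappa>"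
    by (simp add: ennreal_power norm_mult ennreal_mult)
  also have "\<dots> < \<infinity>" using assms by (simp add: ennreal_mult_less_top)
  finally have "(\<integral>\<^sup>+x. ennreal (cmod (g x * \<kappa> x)) \<partial>M) < \<infinity>" by (simp add: power_less_top_ennreal)
  then show i: "integrable M (\<lambda>x. g x * \<kappa> x)" by (intro integrableI_bounded) auto
  have "ennreal (cmod (\<integral>x. g x * \<kappa> x \<partial>M)) \<le> (\<integral>\<^sup>+x. ennreal (cmod (g x * \<kappa> x)) \<partial>M)"
    using i by (rule integral_norm_bound_ennreal)
  then have "(ennreal (cmod (\<integral>x. g x * \<kappa> x \<partial>M)))\<^sup>2 \<le> (\<integral>\<^sup>+x. ennreal (cmod (g x * \<kappa> x)) \<partial>M)\<^sup>2" by (rule power_mono) simp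
  also note cs
  finally show "ennreal ((cmod (\<integral>x. g x * \<kappa> x \<partial>M))\<^sup>2) \<le> L2sq M g * L2sq M \<kappa>"
    by (simp add: ennreal_power)
qed

lemma L2_add_less_top:
  fixes f g :: "'a \<Rightarrow> complex"
  assumes [measurable]: "f \<in> borel_measurable M" "g \<in> borel_measurable M"
    and "L2sq M (\<lambda>x. f x - g x) < \<infinity>" "L2sq M f < \<infinity>"
  shows "L2sq M g < \<infinity>"
proof -
  have "L2sq M g \<le> (\<integral>\<^sup>+x. 2 * ennreal ((cmod (f x - g x))\<^sup>2) + 2 * ennreal ((cmod (f x))\<^sup>2) \<partial>M)"
  proof (rule nn_integral_mono)
    fix x
    have "cmod (g x) \<le> cmod (f x) + cmod (f x - g x)" using norm_triangle_sub[of "g x" "f x"] by (simp add: norm_minus_commute)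
    then have "(cmod (g x))\<^sup>2 \<le> (cmod (f x) + cmod (f x - g x))\<^sup>2" by (rule power_mono) simp
    also have "\<dots> \<le> 2 * (cmod (f x - g x))\<^sup>2 + 2 * (cmod (f x))\<^sup>2"
      using sum_squares_bound[of "cmod (f x)" "cmod (f x - g x)"] by (simp add: power2_sum)
    finally show "ennreal ((cmod (g x))\<^sup>2) \<le> 2 * ennreal ((cmod (f x - g x))\<^sup>2) + 2 * ennreal ((cmod (f x))\<^sup>2)"
      by (simp add: ennreal_plus[symmetric] ennreal_mult[symmetric] ennreal_numeral[symmetric] ennreal_leI del: ennreal_plus ennreal_numeral)
  qed
  also have "\<dots> = 2 * L2sq M (\<lambda>x. f x - g x) + 2 * L2sq M f"
    by (simp add: nn_integral_add nn_integral_cmult)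
  also have "\<dots> < \<infinity>" using assms by (simp add: ennreal_mult_less_top)
  finally show ?thesis .
qed

lemma tendsto_0_of_square:
  fixes u :: "nat \<Rightarrow> complex"
  assumes "(\<lambda>n. ennreal ((cmod (u n))\<^sup>2)) \<longlonglongrightarrow> 0"
  shows "u \<longlonglongrightarrow> 0"
proof -
  have "(\<lambda>n. (cmod (u n))\<^sup>2) \<longlonglongrightarrow> 0" using assms by (subst (asm) ennreal_0[symmetric], subst (asm) tendsto_ennreal_iff) auto
  then have "(\<lambda>n. sqrt ((cmod (u n))\<^sup>2)) \<longlonglongrightarrow> sqrt 0" by (rule tendsto_real_sqrt)
  then show ?thesis by (simp add: tendsto_norm_zero_iff)
qed

lemma tendsto_ennreal_mult_0:
  fixes u v :: "nat \<Rightarrow> ennreal"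
  assumes u: "u \<longlonglongrightarrow> 0" and v: "\<And>n. v n \<le> K" "K < \<infinity>"
  shows "(\<lambda>n. u n * v n) \<longlonglongrightarrow> 0"
proof -
  have "(\<lambda>n. u n * K) \<longlonglongrightarrow> 0 * K" using v(2) by (intro tendsto_mult_ennreal u tendsto_const) auto
  then have "(\<lambda>n. u n * K) \<longlonglongrightarrow> 0" by simp
  then show ?thesis
    by (rule tendsto_sandwich[OF _ _ tendsto_const, rotated 2]) (auto intro!: always_eventually mult_left_mono v)
qed

lemma L2_pairing_tendsto:
  fixes f :: "nat \<Rightarrow> 'a \<Rightarrow> complex"
  assumes [measurable]: "\<And>n. f n \<in> borel_measurable M" "g \<in> borel_measurable M" "\<kappa> \<in> borel_measurable M"
    and lim: "(\<lambda>n. L2sq M (\<lambda>x. f n x - g x)) \<longlonglongrightarrow> 0"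
    and fin: "\<And>n. L2sq M (f n) < \<infinity>" and g: "L2sq M g < \<infinity>"
    and \<kappa>: "L2sq M \<kappa> < \<infinity>"
  shows "(\<lambda>n. \<integral>x. f n x * \<kappa> x \<partial>M) \<longlonglongrightarrow> (\<integral>x. g x * \<kappa> x \<partial>M)"
proof -
  have "(\<lambda>n. L2sq M (\<lambda>x. f n x - g x) * L2sq M \<kappa>) \<longlonglongrightarrow> 0"
    by (rule tendsto_ennreal_mult_0[OF lim order_refl \<kappa>])
  note A = this
  have B: "eventually (\<lambda>n. ennreal ((cmod ((\<integral>x. f n x * \<kappa> x \<partial>M) - (\<integral>x. g x * \<kappa> x \<partial>M)))\<^sup>2)
     \<le> L2sq M (\<lambda>x. f n x - g x) * L2sq M \<kappa>) sequentially"
  proof -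
    have "eventually (\<lambda>n. L2sq M (\<lambda>x. f n x - g x) < \<infinity>) sequentially"
      using order_tendstoD(2)[OF lim, of \<infinity>] by simp
    then show ?thesis
    proof eventually_elim
      fix n assume "L2sq M (\<lambda>x. f n x - g x) < \<infinity>"
      then have "ennreal ((cmod (\<integral>x. (f n x - g x) * \<kappa> x \<partial>M))\<^sup>2) \<le> L2sq M (\<lambda>x. f n x - g x) * L2sq M \<kappa>"
        using \<kappa> by (intro L2_pairing(2)) auto
      moreover have "(\<integral>x. (f n x - g x) * \<kappa> x \<partial>M) = (\<integral>x. f n x * \<kappa> x \<partial>M) - (\<integral>x. g x * \<kappa> x \<partial>M)"
        unfolding left_diff_distrib by (intro Bochner_Integration.integral_diff L2_pairing(1) fin g \<kappa>) measurable
      ultimately show "ennreal ((cmod ((\<integral>x. f n x * \<kappa> x \<partial>M) - (\<integral>x. g x * \<kappa> x \<partial>M)))\<^sup>2)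
        \<le> L2sq M (\<lambda>x. f n x - g x) * L2sq M \<kappa>" by simp
    qed
  qed
  have "(\<lambda>n. ennreal ((cmod ((\<integral>x. f n x * \<kappa> x \<partial>M) - (\<integral>x. g x * \<kappa> x \<partial>M)))\<^sup>2)) \<longlonglongrightarrow> 0"
    by (rule tendsto_sandwich[OF _ B tendsto_const A]) simp
  then have "(\<lambda>n. (\<integral>x. f n x * \<kappa> x \<partial>M) - (\<integral>x. g x * \<kappa> x \<partial>M)) \<longlonglongrightarrow> 0" by (rule tendsto_0_of_square)
  then show ?thesis by (simp add: LIM_zero_iff)
qed

section \<open>Weights and the norm of Schwartz functions\<close>

lemma wt_inverse: "wt (- s) (- b) z = 1 / wt s b z"
  by (simp add: wt_def powr_minus divide_inverse)

text \<open>Exponents of either sign are covered, so the bound also applies to reciprocal weights;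
  multiplying by a weight or its reciprocal therefore preserves rapid decay.\<close>

lemma wt_poly:
  obtains C N where "C \<ge> 0" "\<And>z. wt s b z \<le> C * (1 + norm z) ^ N"
proof -
  define K where "K = nat \<lceil>\<bar>2 * b\<bar>\<rceil>"
  define L where "L = nat \<lceil>\<bar>2 * s\<bar>\<rceil>"
  have pw: "jbr x powr a \<le> y ^ nat \<lceil>\<bar>a\<bar>\<rceil>" if "jbr x \<le> y" for x a y
  proof -
    have y: "y \<ge> 1" using that jbr_ge_1[of x] by simp
    have "jbr x powr a \<le> jbr x powr \<bar>a\<bar>" using jbr_ge_1 by (intro powr_mono) auto
    also have "\<dots> \<le> y powr \<bar>a\<bar>" using that jbr_pos[of x] by (intro powr_mono2) auto
    also have "\<dots> \<le> y powr real (nat \<lceil>\<bar>a\<bar>\<rceil>)" using y by (intro powr_mono) (auto simp: real_nat_ceiling_ge)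
    also have "\<dots> = y ^ nat \<lceil>\<bar>a\<bar>\<rceil>" using y by (subst powr_realpow) auto
    finally show ?thesis .
  qed
  \<comment> \<open>The dispersion relation is cubic, so each power of the modulation costs three
    powers of the norm and each power of the frequency size one.\<close>
  have "wt s b z \<le> 2 ^ K * 2 ^ L * (1 + norm z) ^ (3 * K + L)" for z
  proof -
    obtain x m t where z: "z = (x, m, t)" by (cases z)
    let ?n = "norm z"
    have n: "\<bar>x\<bar> \<le> ?n" "\<bar>m\<bar> \<le> ?n" "\<bar>t\<bar> \<le> ?n"
      using norm_fst_le[of x "(m, t)"] norm_snd_le[of "(m, t)" x] norm_fst_le[of m t] norm_snd_le[of t m] by (auto simp: z)
    have "\<bar>w x m\<bar> \<le> \<bar>x\<bar> ^ 3 + \<bar>x\<bar> * \<bar>m\<bar>\<^sup>2"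
      unfolding w_def using abs_triangle_ineq[of "x ^ 3" "x * m\<^sup>2"] by (simp add: abs_mult power_abs)
    also have "\<dots> \<le> ?n ^ 3 + ?n * ?n\<^sup>2" using n by (intro add_mono mult_mono power_mono) auto
    finally have wle: "\<bar>w x m\<bar> \<le> 2 * ?n ^ 3" by (simp add: power3_eq_cube power2_eq_square)
    have "\<bar>t - w x m\<bar> \<le> \<bar>t\<bar> + \<bar>w x m\<bar>" by (rule abs_triangle_ineq4)
    then have "jbr (sg z) \<le> 1 + ?n + 2 * ?n ^ 3" using wle n by (simp add: jbr_def sg_def z)
    also have "\<dots> \<le> 2 * (1 + ?n) ^ 3" by (simp add: power3_eq_cube algebra_simps)
    finally have 1: "jbr (sg z) powr (2 * b) \<le> (2 * (1 + ?n) ^ 3) ^ K" unfolding K_def by (rule pw)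
    have "x\<^sup>2 \<le> ?n\<^sup>2" "m\<^sup>2 \<le> ?n\<^sup>2" using n by (metis abs_ge_zero power_mono power2_abs)+
    then have "freq_norm x m \<le> sqrt ((2 * ?n)\<^sup>2)" unfolding freq_norm_def by (intro real_sqrt_le_mono) (simp add: power_mult_distrib)
    then have "freq_norm x m \<le> 2 * ?n" by (simp only: real_sqrt_abs abs_mult) simp
    then have "jbr (rr z) \<le> 2 * (1 + ?n)" using freq_norm_nonneg[of x m] by (simp add: jbr_def rr_def z)
    then have 2: "jbr (rr z) powr (2 * s) \<le> (2 * (1 + ?n)) ^ L" unfolding L_def by (rule pw)
    have "wt s b z \<le> (2 * (1 + ?n) ^ 3) ^ K * (2 * (1 + ?n)) ^ L" unfolding wt_def by (intro mult_mono 1 2) auto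
    also have "\<dots> = 2 ^ K * 2 ^ L * (1 + ?n) ^ (3 * K + L)"
    proof -
      have e: "((1 + ?n) ^ 3) ^ K = (1 + ?n) ^ (3 * K)" by (rule power_mult[symmetric])
      show ?thesis unfolding power_mult_distrib e power_add by (simp only: mult_ac)
    qed
    finally show ?thesis .
  qed
  then show ?thesis by (intro that[of "2 ^ K * 2 ^ L" "3 * K + L"]) auto
qed

lemma rapid_wt:
  assumes f: "rapid f" shows "rapid (\<lambda>z. of_real (wt s b z) * f z)"
proof -
  have [measurable]: "f \<in> borel_measurable borel" using f by (simp add: rapid_def)
  obtain C M where C: "C \<ge> 0" "\<And>z. wt s b z \<le> C * (1 + norm z) ^ M" using wt_poly by blast
  have "\<exists>B. \<forall>z. norm z ^ N * cmod (of_real (wt s b z) * f z) \<le> B" for N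
  proof -
    obtain B where B: "B \<ge> 0" "\<And>p. (1 + norm p) ^ (N + M) * cmod (f p) \<le> B" using rapid_bound[OF f] by blast
    have "norm z ^ N * cmod (of_real (wt s b z) * f z) \<le> C * B" for z
    proof -
      have "norm z ^ N * cmod (of_real (wt s b z) * f z) = (norm z ^ N * wt s b z) * cmod (f z)"
        using wt_pos[of s b z] by (simp add: norm_mult)
      also have "\<dots> \<le> ((1 + norm z) ^ N * (C * (1 + norm z) ^ M)) * cmod (f z)"
        using C wt_pos[of s b z] by (intro mult_right_mono mult_mono power_mono) auto
      also have "\<dots> = C * ((1 + norm z) ^ (N + M) * cmod (f z))" by (simp add: power_add mult_ac)
      also have "\<dots> \<le> C * B" using C(1) by (intro mult_left_mono B) auto
      finally show ?thesis .
    qed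
    then show ?thesis by blast
  qed
  then show ?thesis unfolding rapid_def by simp
qed

lemma rapid_wt_L2:
  assumes f: "rapid f"
  shows "integrable lborel (\<lambda>z. wt s b z * (cmod (f z))\<^sup>2)"
proof -
  have [measurable]: "f \<in> borel_measurable borel" using f by (simp add: rapid_def)
  obtain B where B: "B \<ge> 0" "\<And>p. (1 + norm p) ^ 0 * cmod (f p) \<le> B" using rapid_bound[OF f] by blast
  have "integrable lborel (\<lambda>z. B * cmod (of_real (wt s b z) * f z))"
    using rapid_integrable[OF rapid_wt[OF f]] by simp
  then show ?thesis
  proof (rule Bochner_Integration.integrable_bound)
    show "AE z in lborel. norm (wt s b z * (cmod (f z))\<^sup>2) \<le> norm (B * cmod (of_real (wt s b z) * f z))"
    proof (rule AE_I2)
      fix z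
      have "wt s b z * (cmod (f z) * cmod (f z)) \<le> wt s b z * (B * cmod (f z))"
        using B wt_pos[of s b z] by (intro mult_left_mono mult_right_mono) auto
      then show "norm (wt s b z * (cmod (f z))\<^sup>2) \<le> norm (B * cmod (of_real (wt s b z) * f z))"
        using B(1) wt_pos[of s b z] by (simp add: norm_mult abs_mult power2_eq_square mult_ac)
    qed
  qed measurable
qed

text \<open>The squared norm as an extended nonnegative integral, the form in which the convolution
  bounds are stated; \<open>xsq_eq\<close> identifies it with the real-valued norm.\<close>

definition xsq :: "real \<Rightarrow> real \<Rightarrow> (R3 \<Rightarrow> complex) \<Rightarrow> ennreal" where
  "xsq s b f = (\<integral>\<^sup>+z. ennreal (wt s b z * (cmod (fourier f z))\<^sup>2) \<partial>lborel)"

lemma schwartz_X_norm_eq: "schwartz_X_norm s b f = sqrt (\<integral>z. wt s b z * (cmod (fourier f z))\<^sup>2 \<partial>lborel)"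
  unfolding schwartz_X_norm_def by (simp add: case_prod_beta' wt_def rr_def sg_def)

lemma schwartz_X_norm_nonneg: "schwartz_X_norm s b f \<ge> 0"
  unfolding schwartz_X_norm_eq by (intro real_sqrt_ge_zero integral_nonneg_AE AE_I2) (simp add: wt_pos less_imp_le)

lemma xsq_eq:
  assumes "schwartz f" shows "xsq s b f = ennreal ((schwartz_X_norm s b f)\<^sup>2)"
proof -
  have "(\<integral>z. wt s b z * (cmod (fourier f z))\<^sup>2 \<partial>lborel) \<ge> 0"
    by (intro integral_nonneg_AE AE_I2) (simp add: wt_pos less_imp_le)
  then show ?thesis unfolding xsq_def schwartz_X_norm_eq
    using rapid_wt_L2[OF fourier_rapid[OF assms], of s b]
    by (subst nn_integral_eq_integral) (auto simp: wt_pos less_imp_le)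
qed

lemma fourier_linear:
  assumes "schwartz f" "schwartz g"
  shows "fourier (\<lambda>p. a * f p + b * g p) \<zeta> = a * fourier f \<zeta> + b * fourier g \<zeta>"
proof -
  have i: "integrable lborel (\<lambda>p. h p * ech (- \<zeta>) p)" if "schwartz h" for h
  proof (rule Bochner_Integration.integrable_bound[OF schwartz_integrable[OF that]])
    have [measurable]: "ech (- \<zeta>) \<in> borel_measurable borel" by (intro borel_measurable_continuous_onI ech_continuous continuous_intros)
    note [measurable] = schwartz_measurable[OF that]
    show "(\<lambda>p. h p * ech (- \<zeta>) p) \<in> borel_measurable lborel" by measurable
  qed (simp add: norm_mult)
  have "(\<lambda>p. (a * f p + b * g p) * ech (- \<zeta>) p) = (\<lambda>p. a * (f p * ech (- \<zeta>) p) + b * (g p * ech (- \<zeta>) p))"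
    by (simp add: algebra_simps)
  then show ?thesis unfolding fourier_ech using i[OF assms(1)] i[OF assms(2)] by simp
qed

lemma fourier_diff: "schwartz f \<Longrightarrow> schwartz g \<Longrightarrow> fourier (\<lambda>p. f p - g p) \<zeta> = fourier f \<zeta> - fourier g \<zeta>"
  using fourier_linear[of f g 1 "-1"] by simp

lemma fourier_add: "schwartz f \<Longrightarrow> schwartz g \<Longrightarrow> fourier (\<lambda>p. f p + g p) \<zeta> = fourier f \<zeta> + fourier g \<zeta>"
  using fourier_linear[of f g 1 1] by simp

text \<open>Equality holds when x and y are in the ratio of \<open>A\<close> to \<open>B\<close>. If
  x and y have norms \<open>A\<close> and \<open>B\<close>, the right side adds up to (A + B)^2,
  which is how the triangle inequality arises from a pointwise bound.\<close>

lemma square_add_le: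
  fixes x y A B :: real
  assumes "A > 0" "B > 0" "x \<ge> 0" "y \<ge> 0"
  shows "(x + y)\<^sup>2 \<le> (1 + B / A) * x\<^sup>2 + (1 + A / B) * y\<^sup>2"
proof -
  have "0 \<le> (B * x - A * y)\<^sup>2 / (A * B)" using assms by simp
  also have "\<dots> = (B / A) * x\<^sup>2 + (A / B) * y\<^sup>2 - 2 * x * y"
    using assms by (simp add: power2_eq_square field_simps)
  finally show ?thesis by (simp add: power2_sum algebra_simps)
qed

lemma schwartz_X_norm_triangle:
  assumes f: "schwartz f" and g: "schwartz g"
  shows "schwartz_X_norm s b (\<lambda>p. f p + g p) \<le> schwartz_X_norm s b f + schwartz_X_norm s b g"
proof (rule field_le_epsilon)
  fix e :: real assume e: "e > 0"
  let ?I = "\<lambda>f. \<integral>z. wt s b z * (cmod (fourier f z))\<^sup>2 \<partial>lborel"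
  \<comment> \<open>The added e / 2 keeps the ratios \<open>B / A\<close> and \<open>A / B\<close>
    meaningful when a norm vanishes.\<close>
  define A where "A = schwartz_X_norm s b f + e / 2"
  define B where "B = schwartz_X_norm s b g + e / 2"
  have AB: "A > 0" "B > 0" using e schwartz_X_norm_nonneg[of s b f] schwartz_X_norm_nonneg[of s b g] by (auto simp: A_def B_def)
  have nn: "?I h \<ge> 0" for h by (intro integral_nonneg_AE AE_I2) (simp add: wt_pos less_imp_le)
  have IA: "?I f \<le> A\<^sup>2" 
  proof -
    have "?I f = (schwartz_X_norm s b f)\<^sup>2" using nn[of f] by (simp add: schwartz_X_norm_eq)
    also have "\<dots> \<le> A\<^sup>2" using e schwartz_X_norm_nonneg[of s b f] by (intro power_mono) (auto simp: A_def)
    finally show ?thesis .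
  qed
  have IB: "?I g \<le> B\<^sup>2" 
  proof -
    have "?I g = (schwartz_X_norm s b g)\<^sup>2" using nn[of g] by (simp add: schwartz_X_norm_eq)
    also have "\<dots> \<le> B\<^sup>2" using e schwartz_X_norm_nonneg[of s b g] by (intro power_mono) (auto simp: B_def)
    finally show ?thesis .
  qed
  note i = rapid_wt_L2[OF fourier_rapid[OF f], of s b] rapid_wt_L2[OF fourier_rapid[OF g], of s b]
  have "?I (\<lambda>p. f p + g p) \<le> (\<integral>z. (1 + B / A) * (wt s b z * (cmod (fourier f z))\<^sup>2) + (1 + A / B) * (wt s b z * (cmod (fourier g z))\<^sup>2) \<partial>lborel)"
  proof (rule integral_mono)
    show "integrable lborel (\<lambda>z. wt s b z * (cmod (fourier (\<lambda>p. f p + g p) z))\<^sup>2)"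
      by (rule rapid_wt_L2[OF fourier_rapid[OF schwartz_add[OF f g]]])
    show "integrable lborel (\<lambda>z. (1 + B / A) * (wt s b z * (cmod (fourier f z))\<^sup>2) + (1 + A / B) * (wt s b z * (cmod (fourier g z))\<^sup>2))"
      using i by simp
    fix z
    have "(cmod (fourier (\<lambda>p. f p + g p) z))\<^sup>2 \<le> (cmod (fourier f z) + cmod (fourier g z))\<^sup>2"
      unfolding fourier_add[OF f g] by (intro power_mono norm_triangle_ineq) simp
    also have "\<dots> \<le> (1 + B / A) * (cmod (fourier f z))\<^sup>2 + (1 + A / B) * (cmod (fourier g z))\<^sup>2"
      using AB by (intro square_add_le) auto
    finally have "wt s b z * (cmod (fourier (\<lambda>p. f p + g p) z))\<^sup>2 \<le> wt s b z * ((1 + B / A) * (cmod (fourier f z))\<^sup>2 + (1 + A / B) * (cmod (fourier g z))\<^sup>2)"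
      using wt_pos[of s b z] by (intro mult_left_mono) auto
    then show "wt s b z * (cmod (fourier (\<lambda>p. f p + g p) z))\<^sup>2 \<le> (1 + B / A) * (wt s b z * (cmod (fourier f z))\<^sup>2) + (1 + A / B) * (wt s b z * (cmod (fourier g z))\<^sup>2)"
      by (simp add: distrib_left mult_ac)
  qed
  also have "\<dots> = (1 + B / A) * ?I f + (1 + A / B) * ?I g" using i by simp
  also have "\<dots> \<le> (1 + B / A) * A\<^sup>2 + (1 + A / B) * B\<^sup>2" using AB by (intro add_mono mult_left_mono IA IB) auto
  also have "\<dots> = (A + B)\<^sup>2" using AB by (simp add: power2_eq_square field_simps)
  finally have "sqrt (?I (\<lambda>p. f p + g p)) \<le> A + B" using AB by (intro real_le_lsqrt) auto
  then show "schwartz_X_norm s b (\<lambda>p. f p + g p) \<le> schwartz_X_norm s b f + schwartz_X_norm s b g + e"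
    by (simp add: schwartz_X_norm_eq[of s b "\<lambda>p. f p + g p"] A_def B_def)
qed

lemma schwartz_X_norm_minus_commute:
  assumes "schwartz f" "schwartz g"
  shows "schwartz_X_norm s b (\<lambda>p. f p - g p) = schwartz_X_norm s b (\<lambda>p. g p - f p)"
  unfolding schwartz_X_norm_eq fourier_diff[OF assms] fourier_diff[OF assms(2,1)] by (simp add: norm_minus_commute)

lemma schwartz_X_norm_diff_le:
  assumes f: "schwartz f" and g: "schwartz g"
  shows "\<bar>schwartz_X_norm s b f - schwartz_X_norm s b g\<bar> \<le> schwartz_X_norm s b (\<lambda>p. f p - g p)"
proof -
  have "schwartz_X_norm s b (\<lambda>p. (f p - g p) + g p) \<le> schwartz_X_norm s b (\<lambda>p. f p - g p) + schwartz_X_norm s b g"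
    by (intro schwartz_X_norm_triangle schwartz_diff f g)
  moreover have "schwartz_X_norm s b (\<lambda>p. (g p - f p) + f p) \<le> schwartz_X_norm s b (\<lambda>p. g p - f p) + schwartz_X_norm s b f"
    by (intro schwartz_X_norm_triangle schwartz_diff f g)
  ultimately show ?thesis using schwartz_X_norm_minus_commute[OF f g, of s b] by simp
qed

lemma distr_of_schwartz:
  assumes "schwartz f" "schwartz \<psi>"
  shows "distr_of f \<psi> = (\<integral>p. f p * \<psi> p \<partial>lborel)"
proof -
  have "(\<lambda>p. f p * \<psi> p) \<in> borel_measurable lborel" using schwartz_measurable[OF schwartz_product[OF assms]] by simp
  then show ?thesis unfolding distr_of_def by (rule integral_completion)
qed

lemma fourier_gauss: "fourier (gauss 0 c) p = gconst * gau (c - p)"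
proof -
  have "ech c z * ech (- p) z = ech (c - p) z" for z
    by (simp add: ech_def exp_add[symmetric] inner_diff_right algebra_simps)
  then have "gauss 0 c z * ech (- p) z = gau z * ech (c - p) z" for z unfolding gauss_0[of c] by (simp only: mult.assoc)
  then show ?thesis unfolding fourier_ech by (simp only: integral_gauss)
qed

text \<open>Expanding the square shows that the translated Gaussian is a multiple of
  \<open>gauss c 0\<close>. It is thus an admissible test function, and pairing a distribution with
  it amounts to pairing the transform with a modulated Gaussian.\<close>

lemma schwartz_fourier_gauss: "schwartz (fourier (gauss 0 c))"
proof -
  have "fourier (gauss 0 c) = (\<lambda>p. (gconst * of_real (exp (- (c \<bullet> c) / 2))) * gauss c 0 p)"
  proof (rule ext)
    fix p
    have "exp (- ((c - p) \<bullet> (c - p)) / 2) = exp (- (c \<bullet> c) / 2) * exp (- (p \<bullet> p) / 2 + p \<bullet> c)"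
      unfolding exp_add[symmetric] by (simp add: inner_diff_left inner_diff_right inner_commute field_simps)
    moreover have "gauss c 0 p = of_real (exp (- (p \<bullet> p) / 2 + p \<bullet> c))" by (simp add: gauss_def exp_of_real[symmetric])
    ultimately show "fourier (gauss 0 c) p = (gconst * of_real (exp (- (c \<bullet> c) / 2))) * gauss c 0 p"
      unfolding fourier_gauss gau_eq by simp
  qed
  then show ?thesis using schwartz_scale[OF schwartz_gauss] by simp
qed

lemma fourier_eq_0_of_modulations:
  assumes h: "integrable lborel h" and 0: "\<And>c. (\<integral>z. h z * ech c z \<partial>lborel) = 0"
  shows "AE z in lborel. h z = 0"
  by (rule fourier_eq_0_imp_AE_eq_0[OF h]) (simp only: fourier_ech 0)

lemma gau_neq_0: "gau p \<noteq> 0" by (simp add: gau_eq)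

lemma rapid_L2: "rapid f \<Longrightarrow> L2sq lborel f < \<infinity>"
proof -
  assume f: "rapid f"
  have "wt 0 0 z = 1" for z by (simp add: wt_def jbr_neq_0)
  then have "integrable lborel (\<lambda>z. (cmod (f z))\<^sup>2)" using rapid_wt_L2[OF f, of 0 0] by simp
  then show ?thesis by (simp add: integrable_iff_bounded)
qed

text \<open>A Cauchy sequence whose distributional limit vanishes is a null sequence: its Fourier transforms
  converge in the weighted \<^term>\<open>L2\<close> space, and testing with modulated Gaussians shows that the limit has
  vanishing Fourier transform.\<close>

lemma schwartz_X_norm_tendsto_0:
  assumes sch: "\<And>n. schwartz (\<phi> n)"
    and cauchy: "\<And>\<epsilon>. \<epsilon> > 0 \<Longrightarrow> \<exists>N. \<forall>m\<ge>N. \<forall>n\<ge>N. schwartz_X_norm s b (\<lambda>p. \<phi> m p - \<phi> n p) < \<epsilon>"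
    and lim: "\<And>\<psi>. schwartz \<psi> \<Longrightarrow> (\<lambda>n. distr_of (\<phi> n) \<psi>) \<longlonglongrightarrow> 0"
  shows "(\<lambda>n. schwartz_X_norm s b (\<phi> n)) \<longlonglongrightarrow> 0"
proof -
  \<comment> \<open>Multiplication by the root of the weight turns the Bourgain norm into the norm
    of L2.\<close>
  define G where "G n z = of_real (sqrt (wt s b z)) * fourier (\<phi> n) z" for n z
  have [measurable]: "fourier (\<phi> n) \<in> borel_measurable borel" for n by (intro fourier_measurable schwartz_measurable sch)
  have Gm [measurable]: "G n \<in> borel_measurable lborel" for n unfolding G_def[abs_def] by measurable
  have sq: "(cmod (of_real (sqrt (wt s b z)) * y))\<^sup>2 = wt s b z * (cmod y)\<^sup>2" for z y
    using wt_pos[of s b z] by (simp add: norm_mult power_mult_distrib)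
  have Gn: "L2sq lborel (G n) = ennreal ((schwartz_X_norm s b (\<phi> n))\<^sup>2)" for n
    unfolding G_def sq xsq_eq[OF sch, symmetric] xsq_def by simp
  have Gd: "L2sq lborel (\<lambda>z. G m z - G n z) = ennreal ((schwartz_X_norm s b (\<lambda>p. \<phi> m p - \<phi> n p))\<^sup>2)" for m n
  proof -
    have "G m z - G n z = of_real (sqrt (wt s b z)) * fourier (\<lambda>p. \<phi> m p - \<phi> n p) z" for z
      by (simp add: G_def fourier_diff[OF sch sch] right_diff_distrib)
    then show ?thesis by (simp only: sq xsq_eq[OF schwartz_diff[OF sch sch], symmetric] xsq_def)
  qed
  have "\<exists>N. \<forall>m\<ge>N. \<forall>n\<ge>N. L2sq lborel (\<lambda>z. G m z - G n z) \<le> ennreal \<epsilon>" if "\<epsilon> > 0" for \<epsilon>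
  proof -
    obtain N where N: "\<And>m n. m \<ge> N \<Longrightarrow> n \<ge> N \<Longrightarrow> schwartz_X_norm s b (\<lambda>p. \<phi> m p - \<phi> n p) < sqrt \<epsilon>"
      using cauchy[of "sqrt \<epsilon>"] \<open>\<epsilon> > 0\<close> by auto
    have "(schwartz_X_norm s b (\<lambda>p. \<phi> m p - \<phi> n p))\<^sup>2 \<le> \<epsilon>" if "m \<ge> N" "n \<ge> N" for m n
      using power_mono[OF less_imp_le[OF N[OF that]] schwartz_X_norm_nonneg, of 2] \<open>\<epsilon> > 0\<close> by simp
    then show ?thesis unfolding Gd by (auto intro!: exI[of _ N] ennreal_leI)
  qed
  note cau = this
  obtain g where g [measurable]: "g \<in> borel_measurable lborel" and lg: "(\<lambda>n. L2sq lborel (\<lambda>z. G n z - g z)) \<longlonglongrightarrow> 0"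
    by (rule L2_complete[of G lborel, OF Gm cau])
  have Gfin: "L2sq lborel (G n) < \<infinity>" for n unfolding Gn by simp
  have gfin: "L2sq lborel g < \<infinity>"
  proof -
    have "eventually (\<lambda>n. L2sq lborel (\<lambda>z. G n z - g z) < \<infinity>) sequentially"
      by (rule order_tendstoD(2)[OF lg]) simp
    then obtain n where "L2sq lborel (\<lambda>z. G n z - g z) < \<infinity>"
      unfolding eventually_sequentially by blast
    then show ?thesis by (rule L2_add_less_top[OF Gm g _ Gfin])
  qed
  \<comment> \<open>The reciprocal root cancels the one in \<open>G\<close>. It grows at most
    polynomially, so the product with a Gaussian is square integrable.\<close>
  let ?k = "\<lambda>c z. of_real (1 / sqrt (wt s b z)) * gauss 0 c z"
  have [measurable]: "gauss 0 c \<in> borel_measurable borel" for c by (intro schwartz_measurable schwartz_gauss)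
  have km [measurable]: "?k c \<in> borel_measurable lborel" for c by measurable
  have kfin: "L2sq lborel (?k c) < \<infinity>" for c
  proof -
    have "(cmod (?k c z))\<^sup>2 = wt (-s) (-b) z * (cmod (gauss 0 c z))\<^sup>2" for z
      using wt_pos[of s b z] by (simp add: norm_mult power_mult_distrib norm_divide power_divide wt_inverse)
    then show ?thesis using rapid_wt_L2[OF schwartz_rapid[OF schwartz_gauss], of "-s" "-b" 0 c]
      by (simp add: integrable_iff_bounded wt_pos less_imp_le abs_mult)
  qed
  have zero: "(\<integral>z. g z * ?k c z \<partial>lborel) = 0" for c
  proof -
    have "(\<lambda>n. \<integral>z. G n z * ?k c z \<partial>lborel) \<longlonglongrightarrow> (\<integral>z. g z * ?k c z \<partial>lborel)"
      by (rule L2_pairing_tendsto[OF _ g km lg Gfin gfin kfin]) measurable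
    moreover have "(\<integral>z. G n z * ?k c z \<partial>lborel) = distr_of (\<phi> n) (fourier (gauss 0 c))" for n
    proof -
      have "G n z * ?k c z = gauss 0 c z * fourier (\<phi> n) z" for z
      proof -
        have cancel: "a * x * (1 / a * y) = y * x" if "a \<noteq> 0" for a x y :: complex using that by simp
        show ?thesis using wt_pos[of s b z] unfolding G_def of_real_divide of_real_1 by (intro cancel) simp
      qed
      then have "(\<integral>z. G n z * ?k c z \<partial>lborel) = (\<integral>z. gauss 0 c z * fourier (\<phi> n) z \<partial>lborel)" by simp
      also have "\<dots> = (\<integral>p. \<phi> n p * fourier (gauss 0 c) p \<partial>lborel)"
        by (rule fourier_transpose[symmetric]) (intro schwartz_integrable sch schwartz_gauss)+
      finally show ?thesis by (simp add: distr_of_schwartz[OF sch schwartz_fourier_gauss])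
    qed
    ultimately have "(\<lambda>n. distr_of (\<phi> n) (fourier (gauss 0 c))) \<longlonglongrightarrow> (\<integral>z. g z * ?k c z \<partial>lborel)" by simp
    then show ?thesis using lim[OF schwartz_fourier_gauss] by (rule LIMSEQ_unique)
  qed
  \<comment> \<open>\<open>?k c\<close> is \<open>?k 0\<close> times a character, so the vanishing
    pairings say that the Fourier transform of \<open>g\<close> times \<open>?k 0\<close> is zero;
    neither factor of \<open>?k 0\<close> has a zero.\<close>
  have "AE z in lborel. g z * ?k 0 z = 0"
  proof (rule fourier_eq_0_of_modulations)
    show "integrable lborel (\<lambda>z. g z * ?k 0 z)" by (rule L2_pairing(1)[OF g km gfin kfin])
    fix c
    have "g z * ?k 0 z * ech c z = g z * ?k c z" for z
      unfolding gauss_0[of c] by (simp add: mult_ac)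
    then show "(\<integral>z. g z * ?k 0 z * ech c z \<partial>lborel) = 0" using zero[of c] by (simp only:)
  qed
  then have AEg: "AE z in lborel. g z = 0"
  proof eventually_elim
    fix z assume "g z * ?k 0 z = 0"
    then show "g z = 0" using gau_neq_0[of z] wt_pos[of s b z] by simp
  qed
  have "(\<lambda>n. ennreal ((cmod (of_real (schwartz_X_norm s b (\<phi> n)) :: complex))\<^sup>2)) \<longlonglongrightarrow> 0"
  proof -
    have "L2sq lborel (\<lambda>z. G n z - g z) = L2sq lborel (G n)" for n
      using AEg by (intro nn_integral_cong_AE) auto
    then show ?thesis using lg by (simp add: Gn)
  qed
  then have "(\<lambda>n. of_real (schwartz_X_norm s b (\<phi> n)) :: complex) \<longlonglongrightarrow> 0" by (rule tendsto_0_of_square)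
  then show ?thesis using tendsto_of_real_iff[of "\<lambda>n. schwartz_X_norm s b (\<phi> n)" 0, where 'a = complex] by simp
qed

section \<open>The Bourgain norm of a distribution\<close>

lemma X_approx_norm_convergent:
  assumes "X_approx s b \<phi> T"
  shows "convergent (\<lambda>n. schwartz_X_norm s b (\<phi> n))"
proof (rule Cauchy_convergent, rule metric_CauchyI)
  fix e :: real assume "e > 0"
  then obtain N where N: "\<And>m n. m \<ge> N \<Longrightarrow> n \<ge> N \<Longrightarrow> schwartz_X_norm s b (\<lambda>p. \<phi> m p - \<phi> n p) < e"
    using assms unfolding X_approx_def by blast
  have "schwartz (\<phi> n)" for n using assms by (simp add: X_approx_def)
  then have "dist (schwartz_X_norm s b (\<phi> m)) (schwartz_X_norm s b (\<phi> n)) < e" if "m \<ge> N" "n \<ge> N" for m n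
    using schwartz_X_norm_diff_le[of "\<phi> m" "\<phi> n" s b] N[OF that] by (simp add: dist_real_def)
  then show "\<exists>M. \<forall>m\<ge>M. \<forall>n\<ge>M. dist (schwartz_X_norm s b (\<phi> m)) (schwartz_X_norm s b (\<phi> n)) < e" by blast
qed

text \<open>The differences of the two approximations form a Cauchy sequence whose distributional
  limit is 0, hence a null sequence in the norm.\<close>

lemma X_approx_unique:
  assumes 1: "X_approx s b \<phi> T" and 2: "X_approx s b \<eta> T"
  shows "(\<lambda>n. schwartz_X_norm s b (\<lambda>p. \<phi> n p - \<eta> n p)) \<longlonglongrightarrow> 0"
proof (rule schwartz_X_norm_tendsto_0)
  have sch: "schwartz (\<phi> n)" "schwartz (\<eta> n)" for n using 1 2 by (simp_all add: X_approx_def)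
  show "schwartz (\<lambda>p. \<phi> n p - \<eta> n p)" for n by (intro schwartz_diff sch)
  show "(\<lambda>n. distr_of (\<lambda>p. \<phi> n p - \<eta> n p) \<psi>) \<longlonglongrightarrow> 0" if "schwartz \<psi>" for \<psi>
  proof -
    have "distr_of (\<lambda>p. \<phi> n p - \<eta> n p) \<psi> = distr_of (\<phi> n) \<psi> - distr_of (\<eta> n) \<psi>" for n
      unfolding distr_of_schwartz[OF schwartz_diff[OF sch] that] distr_of_schwartz[OF sch(1) that] distr_of_schwartz[OF sch(2) that]
        left_diff_distrib
      by (intro Bochner_Integration.integral_diff schwartz_integrable schwartz_product sch that)
    moreover have "(\<lambda>n. distr_of (\<phi> n) \<psi> - distr_of (\<eta> n) \<psi>) \<longlonglongrightarrow> T \<psi> - T \<psi>"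
      using 1 2 that by (intro tendsto_diff) (auto simp: X_approx_def)
    ultimately show ?thesis by simp
  qed
  fix e :: real assume e: "e > 0"
  obtain N where N: "\<And>m n. m \<ge> N \<Longrightarrow> n \<ge> N \<Longrightarrow> schwartz_X_norm s b (\<lambda>p. \<phi> m p - \<phi> n p) < e / 2"
    using 1 e unfolding X_approx_def by (meson half_gt_zero)
  obtain M where M: "\<And>m n. m \<ge> M \<Longrightarrow> n \<ge> M \<Longrightarrow> schwartz_X_norm s b (\<lambda>p. \<eta> m p - \<eta> n p) < e / 2"
    using 2 e unfolding X_approx_def by (meson half_gt_zero)
  have "schwartz_X_norm s b (\<lambda>p. (\<phi> m p - \<eta> m p) - (\<phi> n p - \<eta> n p)) < e" if "m \<ge> max N M" "n \<ge> max N M" for m n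
  proof -
    have "(\<lambda>p. (\<phi> m p - \<eta> m p) - (\<phi> n p - \<eta> n p)) = (\<lambda>p. (\<phi> m p - \<phi> n p) + (\<eta> n p - \<eta> m p))" by (rule ext) simp
    then have "schwartz_X_norm s b (\<lambda>p. (\<phi> m p - \<eta> m p) - (\<phi> n p - \<eta> n p)) \<le> schwartz_X_norm s b (\<lambda>p. \<phi> m p - \<phi> n p) + schwartz_X_norm s b (\<lambda>p. \<eta> n p - \<eta> m p)"
      using schwartz_X_norm_triangle[OF schwartz_diff[OF sch(1) sch(1)] schwartz_diff[OF sch(2) sch(2)], of s b m n n m] by simp
    then show ?thesis using N[of m n] M[of n m] that by simp
  qed
  then show "\<exists>N. \<forall>m\<ge>N. \<forall>n\<ge>N. schwartz_X_norm s b (\<lambda>p. (\<phi> m p - \<eta> m p) - (\<phi> n p - \<eta> n p)) < e" by blast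
qed

text \<open>This justifies the definite description in \<open>X_norm\<close>: norms converge along
  every approximating sequence, and by \<open>X_approx_unique\<close> to the same limit.
  Inequalities between norms can then be proved on any sequence at hand.\<close>

lemma X_norm_tendsto:
  assumes 1: "X_approx s b \<phi> T"
  shows "(\<lambda>n. schwartz_X_norm s b (\<phi> n)) \<longlonglongrightarrow> X_norm s b T"
proof -
  obtain r where r: "(\<lambda>n. schwartz_X_norm s b (\<phi> n)) \<longlonglongrightarrow> r" using X_approx_norm_convergent[OF 1] by (auto simp: convergent_def)
  have "X_norm s b T = r" unfolding X_norm_def
  proof (rule the_equality)
    show "\<exists>\<phi>. X_approx s b \<phi> T \<and> (\<lambda>n. schwartz_X_norm s b (\<phi> n)) \<longlonglongrightarrow> r" using 1 r by blast
    fix r' assume "\<exists>\<phi>. X_approx s b \<phi> T \<and> (\<lambda>n. schwartz_X_norm s b (\<phi> n)) \<longlonglongrightarrow> r'"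
    then obtain \<eta> where 2: "X_approx s b \<eta> T" and r': "(\<lambda>n. schwartz_X_norm s b (\<eta> n)) \<longlonglongrightarrow> r'" by blast
    have sch: "schwartz (\<phi> n)" "schwartz (\<eta> n)" for n using 1 2 by (simp_all add: X_approx_def)
    have "(\<lambda>n. schwartz_X_norm s b (\<phi> n) - schwartz_X_norm s b (\<eta> n)) \<longlonglongrightarrow> 0"
      by (rule Lim_null_comparison[OF _ X_approx_unique[OF 1 2]]) (simp add: schwartz_X_norm_diff_le sch)
    moreover have "(\<lambda>n. schwartz_X_norm s b (\<phi> n) - schwartz_X_norm s b (\<eta> n)) \<longlonglongrightarrow> r - r'" by (intro tendsto_diff r r')
    ultimately show "r' = r" using LIMSEQ_unique by fastforce
  qed
  with r show ?thesis by simp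
qed

lemma L2_le_xsq:
  assumes f: "schwartz f" and "s \<ge> 0" "b \<ge> 0"
  shows "L2sq lborel f \<le> ennreal (schwartz_X_norm s b f ^ 2)"
proof -
  let ?K = "(sqrt (2 * pi) ^ 3)\<^sup>2"
  have w1: "wt s b z \<ge> 1" for z
  proof -
    have "1 * 1 \<le> jbr (sg z) powr (2 * b) * jbr (rr z) powr (2 * s)"
      using assms jbr_ge_1 by (intro mult_mono ge_one_powr_ge_zero) auto
    then show ?thesis by (simp add: wt_def)
  qed
  have i: "integrable lborel (\<lambda>p. (cmod (f p))\<^sup>2)"
    using rapid_L2[OF schwartz_rapid[OF f]] schwartz_measurable[OF f] by (simp add: integrable_iff_bounded)
  have "of_real (?K * (\<integral>p. (cmod (f p))\<^sup>2 \<partial>lborel)) = complex_of_real (\<integral>\<zeta>. (cmod (fourier f \<zeta>))\<^sup>2 \<partial>lborel)"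
    using plancherel[OF f] by (simp add: gconst_def power2_eq_square)
  then have pl: "?K * (\<integral>p. (cmod (f p))\<^sup>2 \<partial>lborel) = (\<integral>\<zeta>. (cmod (fourier f \<zeta>))\<^sup>2 \<partial>lborel)" by (simp only: of_real_eq_iff)
  have "?K \<ge> 1"
  proof -
    have "sqrt (2 * pi) \<ge> 1" using pi_gt3 by simp
    then show ?thesis by (intro one_le_power)
  qed
  then have "(\<integral>p. (cmod (f p))\<^sup>2 \<partial>lborel) \<le> ?K * (\<integral>p. (cmod (f p))\<^sup>2 \<partial>lborel)"
    using mult_right_mono[of 1 ?K "\<integral>p. (cmod (f p))\<^sup>2 \<partial>lborel"] by simp
  then have "(\<integral>p. (cmod (f p))\<^sup>2 \<partial>lborel) \<le> (\<integral>\<zeta>. (cmod (fourier f \<zeta>))\<^sup>2 \<partial>lborel)" unfolding pl .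
  also have "\<dots> \<le> (\<integral>z. wt s b z * (cmod (fourier f z))\<^sup>2 \<partial>lborel)"
  proof (rule integral_mono)
    have [measurable]: "fourier f \<in> borel_measurable borel" by (intro fourier_measurable schwartz_measurable f)
    show "integrable lborel (\<lambda>\<zeta>. (cmod (fourier f \<zeta>))\<^sup>2)"
      using rapid_L2[OF fourier_rapid[OF f]] by (simp add: integrable_iff_bounded)
    show "integrable lborel (\<lambda>z. wt s b z * (cmod (fourier f z))\<^sup>2)" by (rule rapid_wt_L2[OF fourier_rapid[OF f]])
    show "(cmod (fourier f z))\<^sup>2 \<le> wt s b z * (cmod (fourier f z))\<^sup>2" for z
      using mult_right_mono[OF w1, of "(cmod (fourier f z))\<^sup>2"] by simp
  qed
  also have "\<dots> = (schwartz_X_norm s b f)\<^sup>2"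
    unfolding schwartz_X_norm_eq
    by (intro real_sqrt_pow2[symmetric] integral_nonneg_AE AE_I2) (simp add: wt_pos less_imp_le)
  finally show ?thesis using i by (subst nn_integral_eq_integral) (auto intro: ennreal_leI)
qed

text \<open>The approximating sequence has a limit \<open>g\<close> in L2. It agrees with
  \<open>u\<close> almost everywhere because both have the same pairings with all modulated
  Gaussians. The distribution is thereby tied to an actual square-integrable function, as forming a
  product with another one requires.\<close>

lemma X_function_L2:
  fixes u :: "R3 \<Rightarrow> real"
  assumes sb: "s \<ge> 0" "b \<ge> 0" and u: "distr_function (\<lambda>p. complex_of_real (u p))"
    and X: "X_approx s b \<phi> (distr_of (\<lambda>p. complex_of_real (u p)))"
  obtains g where "g \<in> borel_measurable borel" "AE p in lborel. complex_of_real (u p) = g p"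
    "L2sq lborel g < \<infinity>"
    "(\<lambda>n. L2sq lborel (\<lambda>p. \<phi> n p - g p)) \<longlonglongrightarrow> 0"
proof -
  have sch: "schwartz (\<phi> n)" for n using X by (simp add: X_approx_def)
  have pm [measurable]: "\<phi> n \<in> borel_measurable lborel" for n using schwartz_measurable[OF sch] by simp
  have "\<exists>N. \<forall>m\<ge>N. \<forall>n\<ge>N. L2sq lborel (\<lambda>z. \<phi> m z - \<phi> n z) \<le> ennreal \<epsilon>" if "\<epsilon> > 0" for \<epsilon>
  proof -
    obtain N where N: "\<And>m n. m \<ge> N \<Longrightarrow> n \<ge> N \<Longrightarrow> schwartz_X_norm s b (\<lambda>p. \<phi> m p - \<phi> n p) < sqrt \<epsilon>"
      using X \<open>\<epsilon> > 0\<close> unfolding X_approx_def by (meson real_sqrt_gt_zero)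
    have "L2sq lborel (\<lambda>z. \<phi> m z - \<phi> n z) \<le> ennreal \<epsilon>" if "m \<ge> N" "n \<ge> N" for m n
    proof -
      have "L2sq lborel (\<lambda>z. \<phi> m z - \<phi> n z) \<le> ennreal (schwartz_X_norm s b (\<lambda>p. \<phi> m p - \<phi> n p) ^ 2)"
        by (rule L2_le_xsq[OF schwartz_diff[OF sch sch] sb])
      also have "\<dots> \<le> ennreal \<epsilon>"
        using power_mono[OF less_imp_le[OF N[OF that]] schwartz_X_norm_nonneg, of 2] \<open>\<epsilon> > 0\<close> by (intro ennreal_leI) simp
      finally show ?thesis .
    qed
    then show ?thesis by blast
  qed
  note cau = this
  obtain g where g [measurable]: "g \<in> borel_measurable lborel" and lg: "(\<lambda>n. L2sq lborel (\<lambda>z. \<phi> n z - g z)) \<longlonglongrightarrow> 0"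
    by (rule L2_complete[of \<phi> lborel, OF pm cau])
  have pfin: "L2sq lborel (\<phi> n) < \<infinity>" for n by (intro rapid_L2 schwartz_rapid sch)
  have gfin: "L2sq lborel g < \<infinity>"
  proof -
    have "eventually (\<lambda>n. L2sq lborel (\<lambda>z. \<phi> n z - g z) < \<infinity>) sequentially"
      by (rule order_tendstoD(2)[OF lg]) simp
    then obtain n where "L2sq lborel (\<lambda>z. \<phi> n z - g z) < \<infinity>"
      unfolding eventually_sequentially by blast
    then show ?thesis by (rule L2_add_less_top[OF pm g _ pfin])
  qed
  have kfin: "L2sq lborel (gauss 0 c) < \<infinity>" for c by (intro rapid_L2 schwartz_rapid schwartz_gauss)
  have km [measurable]: "gauss 0 c \<in> borel_measurable borel" for c by (intro schwartz_measurable schwartz_gauss)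
  \<comment> \<open>Measurability of \<open>u\<close> is read off from its product with the
    Gaussian, which has no zeros.\<close>
  have um: "u \<in> borel_measurable lebesgue"
  proof -
    have "integrable lebesgue (\<lambda>p. complex_of_real (u p) * gau p)" using u schwartz_gauss by (simp add: distr_function_def)
    then have "(\<lambda>p. Re (complex_of_real (u p) * gau p)) \<in> borel_measurable lebesgue" by measurable
    moreover have "(\<lambda>p::R3. exp ((p \<bullet> p) / 2)) \<in> borel_measurable lebesgue"
      by (intro borel_measurable_if_lebesgue_on[of _ UNIV, THEN iffD1] measurable_completion) (auto intro!: borel_measurable_continuous_onI continuous_intros)
    ultimately have "(\<lambda>p. Re (complex_of_real (u p) * gau p) * exp ((p \<bullet> p) / 2)) \<in> borel_measurable lebesgue" by (rule borel_measurable_times)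
    moreover have "(\<lambda>p. Re (complex_of_real (u p) * gau p) * exp ((p \<bullet> p) / 2)) = u"
      by (rule ext) (simp add: gau_eq exp_minus power2_eq_square)
    ultimately show ?thesis by (simp only:)
  qed
  \<comment> \<open>\<open>u\<close> is known only to be Lebesgue measurable; a Borel version allows
    the Fourier arguments over \<open>lborel\<close>.\<close>
  obtain u' where u' [measurable]: "u' \<in> borel_measurable lborel" and uu: "AE p in lborel. u p = u' p"
    using completion_ex_borel_measurable_real[OF um] by blast
  have ui: "integrable lborel (\<lambda>p. complex_of_real (u' p) * gauss 0 c p)"
    and ue: "distr_of (\<lambda>p. complex_of_real (u p)) (gauss 0 c) = (\<integral>p. complex_of_real (u' p) * gauss 0 c p \<partial>lborel)" for c
  proof -
    have "integrable lebesgue (\<lambda>p. complex_of_real (u p) * gauss 0 c p)" using u schwartz_gauss by (simp add: distr_function_def)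
    moreover have ae: "AE p in lebesgue. complex_of_real (u p) * gauss 0 c p = complex_of_real (u' p) * gauss 0 c p"
      using AE_completion[OF uu] by eventually_elim simp
    moreover have m: "(\<lambda>p. complex_of_real (u' p) * gauss 0 c p) \<in> borel_measurable lborel" by measurable
    ultimately have "integrable lebesgue (\<lambda>p. complex_of_real (u' p) * gauss 0 c p)"
      using integrable_cong_AE_imp[OF _ measurable_completion[OF m]] by fastforce
    then show "integrable lborel (\<lambda>p. complex_of_real (u' p) * gauss 0 c p)" using integrable_completion[OF m] by simp
    have "distr_of (\<lambda>p. complex_of_real (u p)) (gauss 0 c) = (\<integral>p. complex_of_real (u' p) * gauss 0 c p \<partial>lebesgue)"
      unfolding distr_of_def using ae \<open>integrable lebesgue (\<lambda>p. complex_of_real (u p) * gauss 0 c p)\<close>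
      by (intro integral_cong_AE measurable_completion[OF m]) auto
    then show "distr_of (\<lambda>p. complex_of_real (u p)) (gauss 0 c) = (\<integral>p. complex_of_real (u' p) * gauss 0 c p \<partial>lborel)"
      using integral_completion[OF m] by simp
  qed
  have gi: "integrable lborel (\<lambda>p. g p * gauss 0 c p)" for c by (rule L2_pairing(1)[OF g _ gfin kfin]) measurable
  have eq: "(\<integral>p. g p * gauss 0 c p \<partial>lborel) = (\<integral>p. complex_of_real (u' p) * gauss 0 c p \<partial>lborel)" for c
  proof -
    have "(\<lambda>n. \<integral>p. \<phi> n p * gauss 0 c p \<partial>lborel) \<longlonglongrightarrow> (\<integral>p. g p * gauss 0 c p \<partial>lborel)"
      by (rule L2_pairing_tendsto[OF _ g _ lg pfin gfin kfin]) measurable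
    moreover have "(\<lambda>n. \<integral>p. \<phi> n p * gauss 0 c p \<partial>lborel) \<longlonglongrightarrow> distr_of (\<lambda>p. complex_of_real (u p)) (gauss 0 c)"
      using X schwartz_gauss[of 0 c] unfolding X_approx_def distr_of_schwartz[OF sch schwartz_gauss, symmetric] by blast
    ultimately show ?thesis unfolding ue by (rule LIMSEQ_unique)
  qed
  have "AE p in lborel. (g p - complex_of_real (u' p)) * gau p = 0"
  proof (rule fourier_eq_0_of_modulations)
    show "integrable lborel (\<lambda>p. (g p - complex_of_real (u' p)) * gau p)"
      unfolding left_diff_distrib by (intro Bochner_Integration.integrable_diff gi ui)
    fix c
    have "(g p - complex_of_real (u' p)) * gau p * ech c p = g p * gauss 0 c p - complex_of_real (u' p) * gauss 0 c p" for p
      unfolding gauss_0[of c] by (simp add: algebra_simps)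
    then show "(\<integral>p. (g p - complex_of_real (u' p)) * gau p * ech c p \<partial>lborel) = 0"
      using gi[of c] ui[of c] eq[of c] by simp
  qed
  then have ae: "AE p in lborel. complex_of_real (u p) = g p"
    using uu
  proof eventually_elim
    fix p assume "(g p - complex_of_real (u' p)) * gau p = 0" "u p = u' p"
    then show "complex_of_real (u p) = g p" using gau_neq_0[of p] by simp
  qed
  have "g \<in> borel_measurable borel" using g by simp
  then show ?thesis by (rule that[OF _ ae gfin lg])
qed

section \<open>The product of two elements of the Bourgain space\<close>

lemma e1_Basis: "((1, 0, 0) :: R3) \<in> Basis" by (simp add: Basis_prod_def zero_prod_def)

lemma fourier_mult_le_bilin:
  assumes f: "schwartz f" and g: "schwartz g"
  shows "ennreal (cmod (fourier (\<lambda>p. f p * g p) \<zeta>)) \<le> bilin UNIV (\<lambda>z. ennreal (cmod (fourier f z))) (\<lambda>z. ennreal (cmod (fourier g z))) \<zeta>"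
proof -
  have "1 \<le> cmod gconst"
  proof -
    have "sqrt (2 * pi) \<ge> 1" using pi_gt3 by simp
    then show ?thesis unfolding gconst_def by (simp add: norm_power one_le_power)
  qed
  then have "1 * 1 \<le> cmod gconst * cmod gconst" by (intro mult_mono) auto
  then have "1 * cmod (fourier (\<lambda>p. f p * g p) \<zeta>) \<le> cmod (gconst * gconst) * cmod (fourier (\<lambda>p. f p * g p) \<zeta>)"
    by (intro mult_right_mono) (simp_all add: norm_mult)
  also have "\<dots> = cmod (\<integral>\<eta>. fourier f \<eta> * fourier g (\<zeta> - \<eta>) \<partial>lborel)"
    unfolding fourier_mult[OF f g, symmetric] by (simp only: norm_mult)
  finally have "ennreal (cmod (fourier (\<lambda>p. f p * g p) \<zeta>)) \<le> ennreal (cmod (\<integral>\<eta>. fourier f \<eta> * fourier g (\<zeta> - \<eta>) \<partial>lborel))"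
    by (intro ennreal_leI) simp
  also have "\<dots> \<le> (\<integral>\<^sup>+\<eta>. ennreal (cmod (fourier f \<eta> * fourier g (\<zeta> - \<eta>))) \<partial>lborel)"
  proof (cases "integrable lborel (\<lambda>\<eta>. fourier f \<eta> * fourier g (\<zeta> - \<eta>))")
    case True
    then show ?thesis by (rule integral_norm_bound_ennreal)
  next
    \<comment> \<open>For a non-integrable integrand the Bochner integral takes the default value
      0.\<close>
    case False
    then show ?thesis by (simp add: not_integrable_integral_eq)
  qed
  also have "\<dots> = bilin UNIV (\<lambda>z. ennreal (cmod (fourier f z))) (\<lambda>z. ennreal (cmod (fourier g z))) \<zeta>"
    unfolding bilin_def by (simp add: norm_mult ennreal_mult)
  finally show ?thesis .
qed

text \<open>The convolution bound is applied to the moduli of the two transforms, the x-derivative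
  being the factor \<open>fst z\<close> on the Fourier side. The constant is a square root because
  \<open>bilin_bounded\<close> compares squares of norms.\<close>

lemma schwartz_bilinear_estimate:
  assumes zk: "zk_bounded s \<beta> \<gamma> UNIV"
  obtains C where "C \<ge> 0" "\<And>f g. schwartz f \<Longrightarrow> schwartz g \<Longrightarrow>
    schwartz_X_norm s (- \<gamma> / 2) (dir_deriv (1, 0, 0) (\<lambda>p. f p * g p)) \<le> C * schwartz_X_norm s (\<beta> / 2) f * schwartz_X_norm s (\<beta> / 2) g"
proof -
  obtain C where C: "C \<ge> 0" and le: "\<And>F G. F \<in> borel_measurable borel \<Longrightarrow> G \<in> borel_measurable borel \<Longrightarrow>
     (\<integral>\<^sup>+z. ennreal (mult_weight s \<gamma> z) * (bilin UNIV F G z)\<^sup>2 \<partial>lborel)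
      \<le> ennreal C * (\<integral>\<^sup>+z. ennreal (wt s (\<beta> / 2) z) * (F z)\<^sup>2 \<partial>lborel) * (\<integral>\<^sup>+z. ennreal (wt s (\<beta> / 2) z) * (G z)\<^sup>2 \<partial>lborel)"
    using zk unfolding zk_bounded_def bilin_bounded_def by blast
  have est: "schwartz_X_norm s (- \<gamma> / 2) (dir_deriv (1, 0, 0) (\<lambda>p. f p * g p)) \<le> sqrt C * schwartz_X_norm s (\<beta> / 2) f * schwartz_X_norm s (\<beta> / 2) g"
    if f: "schwartz f" and g: "schwartz g" for f g
  proof -
    let ?F = "\<lambda>z. ennreal (cmod (fourier f z))" and ?G = "\<lambda>z. ennreal (cmod (fourier g z))"
    let ?D = "dir_deriv (1, 0, 0) (\<lambda>p. f p * g p)"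
    let ?N = "schwartz_X_norm s (- \<gamma> / 2) ?D" and ?a = "schwartz_X_norm s (\<beta> / 2) f" and ?b = "schwartz_X_norm s (\<beta> / 2) g"
    have fg: "schwartz (\<lambda>p. f p * g p)" by (rule schwartz_product[OF f g])
    have D: "schwartz ?D" by (rule schwartz_dir_deriv[OF fg e1_Basis])
    have [measurable]: "fourier f \<in> borel_measurable borel" "fourier g \<in> borel_measurable borel"
      by (intro fourier_measurable schwartz_measurable f g)+
    have X: "(\<integral>\<^sup>+z. ennreal (wt s (\<beta> / 2) z) * (ennreal (cmod (fourier h z)))\<^sup>2 \<partial>lborel) = ennreal ((schwartz_X_norm s (\<beta> / 2) h)\<^sup>2)" if "schwartz h" for h
      unfolding xsq_eq[OF that, symmetric] xsq_def by (simp add: ennreal_mult wt_pos less_imp_le ennreal_power)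
    have "ennreal (?N\<^sup>2) = (\<integral>\<^sup>+z. ennreal (wt s (- \<gamma> / 2) z * (cmod (fourier ?D z))\<^sup>2) \<partial>lborel)"
      unfolding xsq_eq[OF D, symmetric] xsq_def ..
    also have "\<dots> \<le> (\<integral>\<^sup>+z. ennreal (mult_weight s \<gamma> z) * (bilin UNIV ?F ?G z)\<^sup>2 \<partial>lborel)"
    proof (rule nn_integral_mono)
      fix z :: R3
      have "cmod (fourier ?D z) = \<bar>fst z\<bar> * cmod (fourier (\<lambda>p. f p * g p) z)"
        unfolding fourier_dir_deriv[OF fg e1_Basis] by (cases z) (simp add: norm_mult)
      then have "wt s (- \<gamma> / 2) z * (cmod (fourier ?D z))\<^sup>2 = mult_weight s \<gamma> z * (cmod (fourier (\<lambda>p. f p * g p) z))\<^sup>2"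
        unfolding mult_weight_def by (simp add: power_mult_distrib)
      moreover have "mult_weight s \<gamma> z \<ge> 0" unfolding mult_weight_def by (simp add: wt_pos less_imp_le)
      ultimately have "ennreal (wt s (- \<gamma> / 2) z * (cmod (fourier ?D z))\<^sup>2) = ennreal (mult_weight s \<gamma> z) * (ennreal (cmod (fourier (\<lambda>p. f p * g p) z)))\<^sup>2"
        by (simp only: ennreal_mult zero_le_power2 ennreal_power norm_ge_zero)
      also have "\<dots> \<le> ennreal (mult_weight s \<gamma> z) * (bilin UNIV ?F ?G z)\<^sup>2"
        by (intro mult_left_mono power_mono fourier_mult_le_bilin f g) auto
      finally show "ennreal (wt s (- \<gamma> / 2) z * (cmod (fourier ?D z))\<^sup>2) \<le> ennreal (mult_weight s \<gamma> z) * (bilin UNIV ?F ?G z)\<^sup>2" .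
    qed
    also have "\<dots> \<le> ennreal C * ennreal (?a\<^sup>2) * ennreal (?b\<^sup>2)"
      unfolding X[OF f, symmetric] X[OF g, symmetric] by (rule le) measurable
    also have "\<dots> = ennreal (C * ?a\<^sup>2 * ?b\<^sup>2)" using C by (simp add: ennreal_mult)
    finally have "?N\<^sup>2 \<le> C * ?a\<^sup>2 * ?b\<^sup>2" using C by (subst (asm) ennreal_le_iff) auto
    then have "?N\<^sup>2 \<le> (sqrt C * ?a * ?b)\<^sup>2" using C by (simp add: power_mult_distrib)
    then show ?thesis by (rule power2_le_imp_le) (use C schwartz_X_norm_nonneg in simp)
  qed
  show ?thesis by (rule that[of "sqrt C"]) (use C est in auto)
qed

text \<open>In \<phi> \<eta> - g h = (\<phi> - g) \<eta> + g (\<eta> - h), the first term tends to 0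
  because the \<eta> are bounded in L2, and the second because it is a pairing with the fixed
  square-integrable function g \<kappa>.\<close>

lemma L2_product_tendsto:
  fixes \<phi> \<eta> :: "nat \<Rightarrow> 'a \<Rightarrow> complex"
  assumes m: "\<And>n. \<phi> n \<in> borel_measurable M" "\<And>n. \<eta> n \<in> borel_measurable M" and gm: "g \<in> borel_measurable M" and hm: "h \<in> borel_measurable M"
    and km: "\<kappa> \<in> borel_measurable M"
    and \<phi>: "(\<lambda>n. L2sq M (\<lambda>x. \<phi> n x - g x)) \<longlonglongrightarrow> 0" and \<eta>: "(\<lambda>n. L2sq M (\<lambda>x. \<eta> n x - h x)) \<longlonglongrightarrow> 0"
    and \<phi>f: "\<And>n. L2sq M (\<phi> n) < \<infinity>" and \<eta>K: "\<And>n. L2sq M (\<eta> n) \<le> K" "K < \<infinity>"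
    and gf: "L2sq M g < \<infinity>" and hf: "L2sq M h < \<infinity>"
    and B: "\<And>x. cmod (\<kappa> x) \<le> B"
  shows "(\<lambda>n. \<integral>x. \<phi> n x * \<eta> n x * \<kappa> x \<partial>M) \<longlonglongrightarrow> (\<integral>x. g x * h x * \<kappa> x \<partial>M)" "integrable M (\<lambda>x. g x * h x * \<kappa> x)"
proof -
  note [measurable] = m gm hm km
  have k: "L2sq M (\<lambda>x. f x * \<kappa> x) \<le> ennreal (B\<^sup>2) * L2sq M f"
    if [measurable]: "f \<in> borel_measurable M" for f
  proof -
    have "L2sq M (\<lambda>x. f x * \<kappa> x) \<le> (\<integral>\<^sup>+x. ennreal (B\<^sup>2) * ennreal ((cmod (f x))\<^sup>2) \<partial>M)"
    proof (rule nn_integral_mono)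
      fix x
      have "(cmod (\<kappa> x))\<^sup>2 * (cmod (f x))\<^sup>2 \<le> B\<^sup>2 * (cmod (f x))\<^sup>2" by (intro mult_right_mono power_mono B) auto
      then show "ennreal ((cmod (f x * \<kappa> x))\<^sup>2) \<le> ennreal (B\<^sup>2) * ennreal ((cmod (f x))\<^sup>2)"
        by (simp add: norm_mult power_mult_distrib ennreal_mult[symmetric] mult.commute ennreal_leI)
    qed
    then show ?thesis by (simp add: nn_integral_cmult)
  qed
  have kf: "L2sq M (\<lambda>x. f x * \<kappa> x) < \<infinity>"
    if "f \<in> borel_measurable M" "L2sq M f < \<infinity>" for f
    using le_less_trans[OF k[OF that(1)]] that(2) by (simp add: ennreal_mult_less_top)
  have \<eta>f: "L2sq M (\<eta> n) < \<infinity>" for n using \<eta>K le_less_trans by blast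
  have \<eta>km: "(\<lambda>x. \<eta> n x * \<kappa> x) \<in> borel_measurable M" for n by measurable
  have gkm: "(\<lambda>x. g x * \<kappa> x) \<in> borel_measurable M" by measurable
  have hkm: "(\<lambda>x. h x * \<kappa> x) \<in> borel_measurable M" by measurable
  show i: "integrable M (\<lambda>x. g x * h x * \<kappa> x)"
    using L2_pairing(1)[OF gm hkm gf kf[OF hm hf]] by (simp only: mult.assoc)
  have A: "(\<lambda>n. \<integral>x. \<eta> n x * (g x * \<kappa> x) \<partial>M) \<longlonglongrightarrow> (\<integral>x. h x * (g x * \<kappa> x) \<partial>M)"
    by (rule L2_pairing_tendsto[OF m(2) hm gkm \<eta> \<eta>f hf kf[OF gm gf]])
  have dm: "(\<lambda>x. \<phi> n x - g x) \<in> borel_measurable M" for n by measurable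
  have df: "L2sq M (\<lambda>x. \<phi> n x - g x) < \<infinity>" for n
  proof (rule L2_add_less_top[OF m(1)[of n] dm _ \<phi>f])
    have "\<phi> n x - (\<phi> n x - g x) = g x" for x by simp
    then show "L2sq M (\<lambda>x. \<phi> n x - (\<phi> n x - g x)) < \<infinity>" using gf by (simp only:)
  qed
  have "(\<lambda>n. L2sq M (\<lambda>x. \<phi> n x - g x) * L2sq M (\<lambda>x. \<eta> n x * \<kappa> x)) \<longlonglongrightarrow> 0"
  proof (rule tendsto_ennreal_mult_0[OF \<phi>])
    show "L2sq M (\<lambda>x. \<eta> n x * \<kappa> x) \<le> ennreal (B\<^sup>2) * K" for n
      by (rule order_trans[OF k[OF m(2)]]) (intro mult_left_mono \<eta>K zero_le)
    show "ennreal (B\<^sup>2) * K < \<infinity>" using \<eta>K(2) by (simp add: ennreal_mult_less_top)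
  qed
  then have "(\<lambda>n. ennreal ((cmod (\<integral>x. (\<phi> n x - g x) * (\<eta> n x * \<kappa> x) \<partial>M))\<^sup>2)) \<longlonglongrightarrow> 0"
    by (rule tendsto_sandwich[OF _ _ tendsto_const, rotated 2])
      (intro always_eventually allI zero_le L2_pairing(2)[OF dm \<eta>km df kf[OF m(2) \<eta>f]])+
  then have Z: "(\<lambda>n. \<integral>x. (\<phi> n x - g x) * (\<eta> n x * \<kappa> x) \<partial>M) \<longlonglongrightarrow> 0" by (rule tendsto_0_of_square)
  have "(\<integral>x. \<phi> n x * \<eta> n x * \<kappa> x \<partial>M) = (\<integral>x. (\<phi> n x - g x) * (\<eta> n x * \<kappa> x) \<partial>M) + (\<integral>x. \<eta> n x * (g x * \<kappa> x) \<partial>M)" for n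
  proof -
    have "(\<phi> n x - g x) * (\<eta> n x * \<kappa> x) + \<eta> n x * (g x * \<kappa> x) = \<phi> n x * \<eta> n x * \<kappa> x" for x by (simp add: algebra_simps)
    moreover have "(\<integral>x. (\<phi> n x - g x) * (\<eta> n x * \<kappa> x) + \<eta> n x * (g x * \<kappa> x) \<partial>M) = (\<integral>x. (\<phi> n x - g x) * (\<eta> n x * \<kappa> x) \<partial>M) + (\<integral>x. \<eta> n x * (g x * \<kappa> x) \<partial>M)"
      by (rule Bochner_Integration.integral_add[OF L2_pairing(1)[OF dm \<eta>km df kf[OF m(2) \<eta>f]] L2_pairing(1)[OF m(2) gkm \<eta>f kf[OF gm gf]]])
    ultimately show ?thesis by (simp only:)
  qed
  moreover have "(\<integral>x. h x * (g x * \<kappa> x) \<partial>M) = (\<integral>x. g x * h x * \<kappa> x \<partial>M)" by (intro Bochner_Integration.integral_cong) (simp_all add: mult_ac)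
  ultimately show "(\<lambda>n. \<integral>x. \<phi> n x * \<eta> n x * \<kappa> x \<partial>M) \<longlonglongrightarrow> (\<integral>x. g x * h x * \<kappa> x \<partial>M)"
    using tendsto_add[OF Z A] by (simp only: add_0_left)
qed

text \<open>Bilinearity and the estimate for Schwartz functions make the derivatives of the products
  a Cauchy sequence in the output norm. Its distributional limit is found by moving the derivative
  onto the test function, where L2 convergence of both factors suffices; the output norm itself,
  with a possibly negative exponent, gives no such pointwise access to the product.\<close>

lemma X_product_approx:
  fixes u v :: "R3 \<Rightarrow> real"
  assumes sb: "s \<ge> 0" "b \<ge> 0" and C: "C \<ge> 0"
    and est: "\<And>f g. schwartz f \<Longrightarrow> schwartz g \<Longrightarrow>
      schwartz_X_norm s b' (dir_deriv (1, 0, 0) (\<lambda>p. f p * g p)) \<le> C * schwartz_X_norm s b f * schwartz_X_norm s b g"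
    and u: "distr_function (\<lambda>p. complex_of_real (u p))" and v: "distr_function (\<lambda>p. complex_of_real (v p))"
    and \<phi>: "X_approx s b \<phi> (distr_of (\<lambda>p. complex_of_real (u p)))" and \<eta>: "X_approx s b \<eta> (distr_of (\<lambda>p. complex_of_real (v p)))"
  shows "distr_function (\<lambda>p. complex_of_real (u p * v p))"
    "X_approx s b' (\<lambda>n. dir_deriv (1, 0, 0) (\<lambda>p. \<phi> n p * \<eta> n p)) (distr_dx (distr_of (\<lambda>p. complex_of_real (u p * v p))))"
proof -
  obtain g where g: "g \<in> borel_measurable borel" and ug: "AE p in lborel. complex_of_real (u p) = g p"
    and gf: "L2sq lborel g < \<infinity>" and \<phi>g: "(\<lambda>n. L2sq lborel (\<lambda>p. \<phi> n p - g p)) \<longlonglongrightarrow> 0"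
    by (rule X_function_L2[OF sb u \<phi>])
  obtain h where h: "h \<in> borel_measurable borel" and vh: "AE p in lborel. complex_of_real (v p) = h p"
    and hf: "L2sq lborel h < \<infinity>" and \<eta>h: "(\<lambda>n. L2sq lborel (\<lambda>p. \<eta> n p - h p)) \<longlonglongrightarrow> 0"
    by (rule X_function_L2[OF sb v \<eta>])
  let ?N = "schwartz_X_norm s b" and ?N' = "schwartz_X_norm s b'"
  let ?\<Phi> = "\<lambda>n. dir_deriv (1, 0, 0) (\<lambda>p. \<phi> n p * \<eta> n p)"
  have sch: "schwartz (\<phi> n)" "schwartz (\<eta> n)" for n using \<phi> \<eta> by (simp_all add: X_approx_def)
  have schm: "schwartz f \<Longrightarrow> f \<in> borel_measurable lborel" for f using schwartz_measurable by simp
  have gl: "g \<in> borel_measurable lborel" and hl: "h \<in> borel_measurable lborel" using g h by simp_all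
  have bound: "\<exists>M>0. \<forall>n. ?N (f n) \<le> M" if "X_approx s b f T" for f T
  proof -
    have "Bseq (\<lambda>n. ?N (f n))" by (rule convergent_imp_Bseq[OF X_approx_norm_convergent[OF that]])
    then obtain M where "M > 0" "\<And>n. norm (?N (f n)) \<le> M" by (auto elim: BseqE)
    then show ?thesis using schwartz_X_norm_nonneg by auto
  qed
  obtain M1 where M1: "M1 > 0" "\<And>n. ?N (\<phi> n) \<le> M1" using bound[OF \<phi>] by blast
  obtain M2 where M2: "M2 > 0" "\<And>n. ?N (\<eta> n) \<le> M2" using bound[OF \<eta>] by blast
  have \<eta>K: "L2sq lborel (\<eta> n) \<le> ennreal (M2\<^sup>2)" for n
    by (rule order_trans[OF L2_le_xsq[OF sch(2) sb]]) (intro ennreal_leI power_mono M2 schwartz_X_norm_nonneg)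
  have \<phi>f: "L2sq lborel (\<phi> n) < \<infinity>" for n by (intro rapid_L2 schwartz_rapid sch)
  have lim: "(\<lambda>n. \<integral>p. \<phi> n p * \<eta> n p * \<psi> p \<partial>lborel) \<longlonglongrightarrow> (\<integral>p. g p * h p * \<psi> p \<partial>lborel)"
    and int: "integrable lborel (\<lambda>p. g p * h p * \<psi> p)" if \<psi>: "schwartz \<psi>" for \<psi>
  proof -
    obtain B where B: "\<And>p. (1 + norm p) ^ 0 * cmod (\<psi> p) \<le> B" using rapid_bound[OF schwartz_rapid[OF \<psi>]] by metis
    have B': "cmod (\<psi> p) \<le> B" for p using B[of p] by simp
    show "(\<lambda>n. \<integral>p. \<phi> n p * \<eta> n p * \<psi> p \<partial>lborel) \<longlonglongrightarrow> (\<integral>p. g p * h p * \<psi> p \<partial>lborel)"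
      by (rule L2_product_tendsto(1)[OF schm[OF sch(1)] schm[OF sch(2)] gl hl schm[OF \<psi>] \<phi>g \<eta>h \<phi>f \<eta>K _ gf hf B']) simp
    show "integrable lborel (\<lambda>p. g p * h p * \<psi> p)"
      by (rule L2_product_tendsto(2)[OF schm[OF sch(1)] schm[OF sch(2)] gl hl schm[OF \<psi>] \<phi>g \<eta>h \<phi>f \<eta>K _ gf hf B']) simp
  qed
  have uv: "integrable lebesgue (\<lambda>p. complex_of_real (u p * v p) * \<psi> p)"
    and uve: "distr_of (\<lambda>p. complex_of_real (u p * v p)) \<psi> = (\<integral>p. g p * h p * \<psi> p \<partial>lborel)" if \<psi>: "schwartz \<psi>" for \<psi>
  proof -
    have m: "(\<lambda>p. g p * h p * \<psi> p) \<in> borel_measurable lborel" using int[OF \<psi>] by (rule borel_measurable_integrable)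
    have i: "integrable lebesgue (\<lambda>p. g p * h p * \<psi> p)" using int[OF \<psi>] integrable_completion[OF m] by simp
    have "AE p in lborel. g p * h p * \<psi> p = complex_of_real (u p * v p) * \<psi> p"
      using ug vh by eventually_elim simp
    then have ae: "AE p in lebesgue. g p * h p * \<psi> p = complex_of_real (u p * v p) * \<psi> p" by (rule AE_completion)
    have m': "(\<lambda>p. complex_of_real (u p * v p) * \<psi> p) \<in> borel_measurable lebesgue"
      by (rule borel_measurable_AE[OF measurable_completion[OF m] ae])
    show "integrable lebesgue (\<lambda>p. complex_of_real (u p * v p) * \<psi> p)" by (rule integrable_cong_AE_imp[OF i m' ae])
    have "(\<integral>p. g p * h p * \<psi> p \<partial>lebesgue) = distr_of (\<lambda>p. complex_of_real (u p * v p)) \<psi>"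
      unfolding distr_of_def by (rule integral_cong_AE[OF measurable_completion[OF m] m' ae])
    then show "distr_of (\<lambda>p. complex_of_real (u p * v p)) \<psi> = (\<integral>p. g p * h p * \<psi> p \<partial>lborel)"
      unfolding integral_completion[OF m] by (rule sym)
  qed
  show "distr_function (\<lambda>p. complex_of_real (u p * v p))" unfolding distr_function_def using uv by blast
  have schp: "schwartz (\<lambda>p. \<phi> m p * \<eta> n p)" for m n by (intro schwartz_product sch)
  have sch\<Phi>: "schwartz (?\<Phi> n)" for n by (intro schwartz_dir_deriv schp e1_Basis)
  have diff: "?N' (\<lambda>p. ?\<Phi> m p - ?\<Phi> n p) \<le> C * (M2 * ?N (\<lambda>p. \<phi> m p - \<phi> n p) + M1 * ?N (\<lambda>p. \<eta> m p - \<eta> n p))" for m n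
  proof -
    \<comment> \<open>The difference of two products is split so that each part contains one
      difference, and the estimate is applied to each part.\<close>
    let ?A = "\<lambda>p. (\<phi> m p - \<phi> n p) * \<eta> m p" and ?B = "\<lambda>p. \<phi> n p * (\<eta> m p - \<eta> n p)"
    have d\<phi>: "schwartz (\<lambda>p. \<phi> m p - \<phi> n p)" and d\<eta>: "schwartz (\<lambda>p. \<eta> m p - \<eta> n p)" by (intro schwartz_diff sch)+
    have A: "schwartz ?A" and B: "schwartz ?B" by (intro schwartz_product d\<phi> d\<eta> sch)+
    have "(\<lambda>p. ?\<Phi> m p - ?\<Phi> n p) = dir_deriv (1, 0, 0) (\<lambda>p. \<phi> m p * \<eta> m p - \<phi> n p * \<eta> n p)"
      using dir_deriv_linear[OF schp[of m m] schp[of n n], of "(1, 0, 0)" 1 "-1"] by simp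
    also have "(\<lambda>p. \<phi> m p * \<eta> m p - \<phi> n p * \<eta> n p) = (\<lambda>p. ?A p + ?B p)" by (simp add: algebra_simps)
    also have "dir_deriv (1, 0, 0) (\<lambda>p. ?A p + ?B p) = (\<lambda>p. dir_deriv (1, 0, 0) ?A p + dir_deriv (1, 0, 0) ?B p)"
      using dir_deriv_linear[OF A B, of "(1, 0, 0)" 1 1] by simp
    finally have "?N' (\<lambda>p. ?\<Phi> m p - ?\<Phi> n p) \<le> ?N' (dir_deriv (1, 0, 0) ?A) + ?N' (dir_deriv (1, 0, 0) ?B)"
      using schwartz_X_norm_triangle[OF schwartz_dir_deriv[OF A e1_Basis] schwartz_dir_deriv[OF B e1_Basis]] by (simp only:)
    also have "\<dots> \<le> C * ?N (\<lambda>p. \<phi> m p - \<phi> n p) * ?N (\<eta> m) + C * ?N (\<phi> n) * ?N (\<lambda>p. \<eta> m p - \<eta> n p)"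
      by (intro add_mono est d\<phi> d\<eta> sch)
    also have "\<dots> \<le> C * ?N (\<lambda>p. \<phi> m p - \<phi> n p) * M2 + C * M1 * ?N (\<lambda>p. \<eta> m p - \<eta> n p)"
      by (intro add_mono mult_left_mono mult_right_mono M1 M2 mult_nonneg_nonneg C schwartz_X_norm_nonneg)
    finally show ?thesis by (simp add: algebra_simps)
  qed
  show "X_approx s b' ?\<Phi> (distr_dx (distr_of (\<lambda>p. complex_of_real (u p * v p))))"
    unfolding X_approx_def
  proof (intro conjI allI impI)
    show "schwartz (?\<Phi> n)" for n by (rule sch\<Phi>)
  next
    fix e :: real assume e: "e > 0"
    \<comment> \<open>With C + 1 in place of C the denominator is positive and the final inequality
      strict even for C = 0.\<close>
    define d where "d = e / ((C + 1) * (M1 + M2))"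
    have d: "d > 0" unfolding d_def using e C M1 M2 by (intro divide_pos_pos mult_pos_pos) auto
    obtain N1 where N1: "\<And>m n. m \<ge> N1 \<Longrightarrow> n \<ge> N1 \<Longrightarrow> ?N (\<lambda>p. \<phi> m p - \<phi> n p) < d" using \<phi> d unfolding X_approx_def by meson
    obtain N2 where N2: "\<And>m n. m \<ge> N2 \<Longrightarrow> n \<ge> N2 \<Longrightarrow> ?N (\<lambda>p. \<eta> m p - \<eta> n p) < d" using \<eta> d unfolding X_approx_def by meson
    have "?N' (\<lambda>p. ?\<Phi> m p - ?\<Phi> n p) < e" if "m \<ge> max N1 N2" "n \<ge> max N1 N2" for m n
    proof -
      have "?N' (\<lambda>p. ?\<Phi> m p - ?\<Phi> n p) \<le> C * (M2 * ?N (\<lambda>p. \<phi> m p - \<phi> n p) + M1 * ?N (\<lambda>p. \<eta> m p - \<eta> n p))" by (rule diff)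
      also have "\<dots> \<le> C * (M2 * d + M1 * d)"
        using that N1[of m n] N2[of m n] M1(1) M2(1) C by (intro mult_left_mono add_mono) auto
      also have "\<dots> < (C + 1) * (M1 + M2) * d" using d M1(1) M2(1) by (simp add: algebra_simps add_pos_pos)
      also have "\<dots> = e" unfolding d_def using C M1(1) M2(1) by simp
      finally show ?thesis .
    qed
    then show "\<exists>N. \<forall>m\<ge>N. \<forall>n\<ge>N. ?N' (\<lambda>p. ?\<Phi> m p - ?\<Phi> n p) < e" by blast
  next
    fix \<psi> assume \<psi>: "schwartz \<psi>"
    have d\<psi>: "schwartz (dir_deriv (1, 0, 0) \<psi>)" by (rule schwartz_dir_deriv[OF \<psi> e1_Basis])
    have "distr_of (?\<Phi> n) \<psi> = - (\<integral>p. \<phi> n p * \<eta> n p * dir_deriv (1, 0, 0) \<psi> p \<partial>lborel)" for n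
      unfolding distr_of_schwartz[OF sch\<Phi> \<psi>] integration_by_parts[OF schp \<psi> e1_Basis] by simp
    moreover have "(\<lambda>n. - (\<integral>p. \<phi> n p * \<eta> n p * dir_deriv (1, 0, 0) \<psi> p \<partial>lborel)) \<longlonglongrightarrow> - (\<integral>p. g p * h p * dir_deriv (1, 0, 0) \<psi> p \<partial>lborel)"
      by (intro tendsto_minus lim d\<psi>)
    ultimately show "(\<lambda>n. distr_of (?\<Phi> n) \<psi>) \<longlonglongrightarrow> distr_dx (distr_of (\<lambda>p. complex_of_real (u p * v p))) \<psi>"
      unfolding distr_dx_def uve[OF d\<psi>] by (simp only:)
  qed
qed

text \<open>Membership in \<open>X_space\<close> is part of the conclusion because
  \<open>X_norm\<close> is a definite description, whose value is determined by approximating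
  sequences. Likewise \<open>distr_function\<close> for the product guarantees that the integrals
  defining its distribution are not default values.\<close>

theorem proposition4p1:
  fixes s :: real
  assumes "s > 1 / 2"
  shows "\<exists>\<delta>>0. \<exists>C>0. \<forall>u v :: R3 \<Rightarrow> real.
    (\<lambda>p. complex_of_real (u p)) \<in> X_functions s (1 / 2 + \<delta>) \<and>
    (\<lambda>p. complex_of_real (v p)) \<in> X_functions s (1 / 2 + \<delta>) \<longrightarrow>
      distr_function (\<lambda>p. complex_of_real (u p * v p)) \<and>
      distr_dx (distr_of (\<lambda>p. complex_of_real (u p * v p))) \<in> X_space s (- (1 / 2) + 2 * \<delta>) \<and>
      X_norm s (- (1 / 2) + 2 * \<delta>) (distr_dx (distr_of (\<lambda>p. complex_of_real (u p * v p))))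
        \<le> C * X_norm s (1 / 2 + \<delta>) (distr_of (\<lambda>p. complex_of_real (u p)))
            * X_norm s (1 / 2 + \<delta>) (distr_of (\<lambda>p. complex_of_real (v p)))"
proof -
  \<comment> \<open>The first bound leaves room for the total loss 1 + 21 \<delta> <= 2 s; the
    second keeps the output exponent 1 - 4 \<delta> at least 1/2.\<close>
  define \<delta> where "\<delta> = min ((2 * s - 1) / 21) (1 / 8)"
  have \<delta>: "\<delta> > 0" "21 * \<delta> \<le> 2 * s - 1" "8 * \<delta> \<le> 1" using assms by (auto simp: \<delta>_def min_def)
  have zk: "zk_bounded s (1 + 2 * \<delta>) (1 - 4 * \<delta>) UNIV" by (rule zk_bounded_UNIV[OF assms \<delta> refl refl])
  let ?b = "1 / 2 + \<delta>" and ?b' = "- (1 / 2) + 2 * \<delta>"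
  have b: "(1 + 2 * \<delta>) / 2 = ?b" "- (1 - 4 * \<delta>) / 2 = ?b'" by (simp_all add: field_simps)
  obtain C where C: "C \<ge> 0" and est: "\<And>f g. schwartz f \<Longrightarrow> schwartz g \<Longrightarrow>
    schwartz_X_norm s ?b' (dir_deriv (1, 0, 0) (\<lambda>p. f p * g p)) \<le> C * schwartz_X_norm s ?b f * schwartz_X_norm s ?b g"
    using schwartz_bilinear_estimate[OF zk] unfolding b by blast
  have sb: "s \<ge> 0" "?b \<ge> 0" using assms \<delta> by auto
  show ?thesis
  \<comment> \<open>The Schwartz estimate may come with C = 0, whereas a positive constant is asked
    for.\<close>
  proof (rule exI[of _ \<delta>], rule conjI[OF \<delta>(1)], rule exI[of _ "C + 1"], intro conjI allI impI)
    show "C + 1 > 0" using C by simp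
    fix u v :: "R3 \<Rightarrow> real"
    let ?u = "\<lambda>p. complex_of_real (u p)" and ?v = "\<lambda>p. complex_of_real (v p)"
    let ?T = "distr_dx (distr_of (\<lambda>p. complex_of_real (u p * v p)))"
    assume uv: "?u \<in> X_functions s ?b \<and> ?v \<in> X_functions s ?b"
    obtain \<phi> where \<phi>: "X_approx s ?b \<phi> (distr_of ?u)" using uv unfolding X_functions_def X_space_def by blast
    obtain \<eta> where \<eta>: "X_approx s ?b \<eta> (distr_of ?v)" using uv unfolding X_functions_def X_space_def by blast
    have u: "distr_function ?u" and v: "distr_function ?v" using uv unfolding X_functions_def by blast+
    let ?\<Phi> = "\<lambda>n. dir_deriv (1, 0, 0) (\<lambda>p. \<phi> n p * \<eta> n p)"
    show "distr_function (\<lambda>p. complex_of_real (u p * v p))" by (rule X_product_approx(1)[OF sb C est u v \<phi> \<eta>])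
    have T: "X_approx s ?b' ?\<Phi> ?T" by (rule X_product_approx(2)[OF sb C est u v \<phi> \<eta>])
    then show "?T \<in> X_space s ?b'" unfolding X_space_def by blast
    have sch: "schwartz (\<phi> n)" "schwartz (\<eta> n)" for n using \<phi> \<eta> by (simp_all add: X_approx_def)
    have "X_norm s ?b' ?T \<le> (C + 1) * X_norm s ?b (distr_of ?u) * X_norm s ?b (distr_of ?v)"
    proof (rule LIMSEQ_le[OF X_norm_tendsto[OF T]])
      show "(\<lambda>n. (C + 1) * schwartz_X_norm s ?b (\<phi> n) * schwartz_X_norm s ?b (\<eta> n)) \<longlonglongrightarrow> (C + 1) * X_norm s ?b (distr_of ?u) * X_norm s ?b (distr_of ?v)"
        by (intro tendsto_mult tendsto_const X_norm_tendsto \<phi> \<eta>)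
      have "schwartz_X_norm s ?b' (?\<Phi> n) \<le> (C + 1) * schwartz_X_norm s ?b (\<phi> n) * schwartz_X_norm s ?b (\<eta> n)" for n
        by (rule order_trans[OF est[OF sch]]) (intro mult_right_mono schwartz_X_norm_nonneg, simp)
      then show "\<exists>N. \<forall>n\<ge>N. schwartz_X_norm s ?b' (?\<Phi> n) \<le> (C + 1) * schwartz_X_norm s ?b (\<phi> n) * schwartz_X_norm s ?b (\<eta> n)" by blast
    qed
    then show "X_norm s ?b' ?T \<le> (C + 1) * X_norm s ?b (distr_of ?u) * X_norm s ?b (distr_of ?v)" .
  qed
qed

end
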